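(* Let $\Omega\subset\mathbb{R}^3$ be a bounded regular domain, $a>0$, $\gamma\in(2,4)$. For $\lambda\in(0,\lambda_0^* )$ let $u_\lambda$ be the positive global minimizer of $\Phi_\lambda$ and $w_\lambda$ the positive mountain pass critical point of $\Phi_\lambda$ (as specified in the context). Then: i) $\Phi_\lambda(u_\lambda)\to-\infty$ and $\|u_\lambda\|\to\infty$ as $\lambda\downarrow0$. ii) $w_\lambda\to w_0$ in $H_0^1(\Omega)$ as $\lambda\downarrow 0$, where $w_0\in H_0^1(\Omega)$ is a mountain pass critical point associated to the equation $-a\Delta w=|w|^{\gamma-2}w$.
   Context: $\|u\|=(\int_\Omega|\nabla u|^2)^{1/2}$ is the norm on $H_0^1(\Omega)$ and $\|u\|_\gamma$ the $L^\gamma(\Omega)$ norm. For $\lambda\ge0$, $\Phi_\lambda(u)=\frac a2\|u\|^2+\frac\lambda4\|u\|^4-\frac1\gamma\|u\|_\gamma^\gamma$ on $H_0^1(\Omega)$. Critical points of $\Phi_\lambda$ ($\lambda>0$) are the solutions of $-(a+\lambda\|u\|^2)\Delta u=|u|^{\gamma-2}u$ in $\Omega$, $u=0$ on $\partial\Omega$. The number $\lambda_0^*$ is $\lambda_0^*=\sup_{u\in H_0^1(\Omega)\setminus\{0\}}\lambda_0(u)$, where $\lambda_0(u)=2\left(\frac2\gamma\right)^{\frac{2}{\gamma-2}}\lambda(u)$ and $\lambda(u)=a\,\frac{\gamma-2}{4-\gamma}\left(\frac{4-\gamma}{2a}\right)^{\frac{2}{\gamma-2}}\left(\frac{\|u\|_\gamma}{\|u\|}\right)^{\frac{2\gamma}{\gamma-2}}$.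 For $\lambda\in(0,\lambda_0^*]$, $u_\lambda$ denotes a positive global minimizer of $\Phi_\lambda$; it satisfies $\Phi_\lambda(u_\lambda)<0$ for $\lambda<\lambda_0^*$ and $\Phi_{\lambda_0^*}(u_{\lambda_0^*})=0$, $u_{\lambda_0^*}\ne0$. With $u_{\lambda_0^*}$ fixed, for $\lambda\in[0,\lambda_0^* )$ put $$c_\lambda=\inf_{\varphi\in\Gamma}\max_{t\in[0,1]}\Phi_\lambda(\varphi(t)),\qquad\Gamma=\{\varphi\in C([0,1],H_0^1(\Omega)):\varphi(0)=0,\ \varphi(1)=u_{\lambda_0^*}\}.$$ For $\lambda\in(0,\lambda_0^* )$, $w_\lambda$ denotes a positive mountain pass critical point of $\Phi_\lambda$, i.e. $\Phi_\lambda'(w_\lambda)=0$ and $\Phi_\lambda(w_\lambda)=c_\lambda>0$. A mountain pass critical point associated to $-a\Delta w=|w|^{\gamma-2}w$ means $w_0\in H_0^1(\Omega)$ with $\Phi_0'(w_0)=0$ and $\Phi_0(w_0)=c_0$.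
   Formalization: For arbitrary w_λ, ii) can fail if mountain pass critical points are not unique (large annulus: alternate rotated copies). Proved instead: every sequence λ_n↓0 has a subsequence along which w_{λ_n} converges in H_0^1(Ω) to a mountain pass critical point w_0, which may depend on it. *)

theory Defs
  imports "HOL-Analysis.Analysis"
begin

text \<open>
  Elements of the Sobolev spaces over an open set \<open>\<Omega>\<close> are represented by functions on the whole
  Euclidean space; only their restriction to \<open>\<Omega>\<close>, up to almost everywhere equality, matters.
\<close>

subsection \<open>Functions and boundaries of class \<open>C\<^sup>k\<close>\<close>

primrec Ck :: "nat \<Rightarrow> ('a::euclidean_space \<Rightarrow> real) \<Rightarrow> bool" where
  "Ck 0 f \<longleftrightarrow> continuous_on UNIV f"
| "Ck (Suc k) f \<longleftrightarrow> (\<forall>x. f differentiable at x) \<and>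
     (\<forall>b\<in>Basis. Ck k (\<lambda>x. frechet_derivative f (at x) b))"

text \<open>Near each boundary point, and in suitably rotated or reflected coordinates, the set is the
  part of a ball lying above the graph of a \<open>C\<^sup>k\<close> function of two variables.\<close>

definition Ck_boundary :: "nat \<Rightarrow> (real^3) set \<Rightarrow> bool" where
  "Ck_boundary k \<Omega> \<longleftrightarrow>
     (\<forall>p\<in>frontier \<Omega>. \<exists>r>0. \<exists>(T :: real^3 \<Rightarrow> real^3) h. orthogonal_transformation T \<and> Ck k h \<and>
        \<Omega> \<inter> ball p r = {x \<in> ball p r. T x $ 3 > h (T x $ 1, T x $ 2)})"

text \<open>``Regular'' is read as: boundary of class \<open>C\<^sup>2\<close>; this includes all smooth domains.\<close>

definition bounded_regular_domain :: "(real^3) set \<Rightarrow> bool" where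
  "bounded_regular_domain \<Omega> \<longleftrightarrow>
     \<Omega> \<noteq> {} \<and> open \<Omega> \<and> connected \<Omega> \<and> bounded \<Omega> \<and> Ck_boundary 2 \<Omega>"

subsection \<open>The space \<open>H\<^sub>0\<^sup>1\<close>\<close>

definition test_functions :: "'a::euclidean_space set \<Rightarrow> ('a \<Rightarrow> real) set" where
  "test_functions \<Omega> = {\<phi>. (\<forall>k. Ck k \<phi>) \<and>
     compact (closure {x. \<phi> x \<noteq> 0}) \<and> closure {x. \<phi> x \<noteq> 0} \<subseteq> \<Omega>}"

definition square_integrable ::
    "'a::euclidean_space set \<Rightarrow> ('a \<Rightarrow> 'b::euclidean_space) \<Rightarrow> bool" where
  "square_integrable \<Omega> f \<longleftrightarrow> f \<in> borel_measurable (lebesgue_on \<Omega>) \<and>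
     integrable (lebesgue_on \<Omega>) (\<lambda>x. (norm (f x))\<^sup>2)"

definition is_weak_gradient ::
    "'a::euclidean_space set \<Rightarrow> ('a \<Rightarrow> real) \<Rightarrow> ('a \<Rightarrow> 'a) \<Rightarrow> bool" where
  "is_weak_gradient \<Omega> u g \<longleftrightarrow> square_integrable \<Omega> g \<and>
     (\<forall>\<phi>\<in>test_functions \<Omega>. \<forall>b\<in>Basis.
        (LINT x|lebesgue_on \<Omega>. u x * frechet_derivative \<phi> (at x) b) =
        - (LINT x|lebesgue_on \<Omega>. (g x \<bullet> b) * \<phi> x))"

definition H1 :: "'a::euclidean_space set \<Rightarrow> ('a \<Rightarrow> real) set" where
  "H1 \<Omega> = {u. square_integrable \<Omega> u \<and> (\<exists>g. is_weak_gradient \<Omega> u g)}"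

text \<open>The weak gradient is unique almost everywhere in \<open>\<Omega>\<close>, so the choice made here does not
  affect the integrals below. For \<open>u \<notin> H1 \<Omega>\<close> the value is meaningless.\<close>

definition weak_grad :: "'a::euclidean_space set \<Rightarrow> ('a \<Rightarrow> real) \<Rightarrow> ('a \<Rightarrow> 'a)" where
  "weak_grad \<Omega> u = (SOME g. is_weak_gradient \<Omega> u g)"

definition H1_norm :: "'a::euclidean_space set \<Rightarrow> ('a \<Rightarrow> real) \<Rightarrow> real" where
  "H1_norm \<Omega> u = sqrt ((LINT x|lebesgue_on \<Omega>. (u x)\<^sup>2) +
     (LINT x|lebesgue_on \<Omega>. (norm (weak_grad \<Omega> u x))\<^sup>2))"

definition H01 :: "'a::euclidean_space set \<Rightarrow> ('a \<Rightarrow> real) set" where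
  "H01 \<Omega> = {u \<in> H1 \<Omega>. \<forall>e>0. \<exists>\<phi>\<in>test_functions \<Omega>. H1_norm \<Omega> (\<lambda>x. u x - \<phi> x) < e}"

definition H01_norm :: "'a::euclidean_space set \<Rightarrow> ('a \<Rightarrow> real) \<Rightarrow> real" where
  "H01_norm \<Omega> u = sqrt (LINT x|lebesgue_on \<Omega>. (norm (weak_grad \<Omega> u x))\<^sup>2)"

definition Lp_norm :: "real \<Rightarrow> 'a::euclidean_space set \<Rightarrow> ('a \<Rightarrow> real) \<Rightarrow> real" where
  "Lp_norm p \<Omega> u = (LINT x|lebesgue_on \<Omega>. \<bar>u x\<bar> powr p) powr (1 / p)"

definition ae_eq :: "'a::euclidean_space set \<Rightarrow> ('a \<Rightarrow> real) \<Rightarrow> ('a \<Rightarrow> real) \<Rightarrow> bool" where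
  "ae_eq \<Omega> u v \<longleftrightarrow> (AE x in lebesgue_on \<Omega>. u x = v x)"

definition ae_positive :: "'a::euclidean_space set \<Rightarrow> ('a \<Rightarrow> real) \<Rightarrow> bool" where
  "ae_positive \<Omega> u \<longleftrightarrow> (AE x in lebesgue_on \<Omega>. u x > 0)"

text \<open>\<open>F\<close> is Frechet differentiable at \<open>u\<close>, as a functional on the normed space \<open>H01 \<Omega>\<close>, and its
  derivative is the bounded linear functional \<open>L\<close>.\<close>

definition H01_has_derivative ::
    "'a::euclidean_space set \<Rightarrow> (('a \<Rightarrow> real) \<Rightarrow> real) \<Rightarrow> (('a \<Rightarrow> real) \<Rightarrow> real) \<Rightarrow> ('a \<Rightarrow> real) \<Rightarrow> bool"
  where
  "H01_has_derivative \<Omega> F L u \<longleftrightarrow>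
     (\<forall>v\<in>H01 \<Omega>. \<forall>w\<in>H01 \<Omega>. L (\<lambda>x. v x + w x) = L v + L w) \<and>
     (\<forall>v\<in>H01 \<Omega>. \<forall>c. L (\<lambda>x. c * v x) = c * L v) \<and>
     (\<exists>K. \<forall>v\<in>H01 \<Omega>. \<bar>L v\<bar> \<le> K * H01_norm \<Omega> v) \<and>
     (\<forall>e>0. \<exists>d>0. \<forall>v\<in>H01 \<Omega>. H01_norm \<Omega> v < d \<longrightarrow>
        \<bar>F (\<lambda>x. u x + v x) - F u - L v\<bar> \<le> e * H01_norm \<Omega> v)"

definition critical_point ::
    "'a::euclidean_space set \<Rightarrow> (('a \<Rightarrow> real) \<Rightarrow> real) \<Rightarrow> ('a \<Rightarrow> real) \<Rightarrow> bool" where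
  "critical_point \<Omega> F u \<longleftrightarrow> u \<in> H01 \<Omega> \<and> H01_has_derivative \<Omega> F (\<lambda>_. 0) u"

subsection \<open>The Kirchhoff energy and the extremal parameter\<close>

text \<open>The stiffness parameter is called \<open>\<mu>\<close>, since the usual letter is taken by abstraction.\<close>

definition Phi ::
    "'a::euclidean_space set \<Rightarrow> real \<Rightarrow> real \<Rightarrow> real \<Rightarrow> ('a \<Rightarrow> real) \<Rightarrow> real" where
  "Phi \<Omega> a \<gamma> \<mu> u = a / 2 * (H01_norm \<Omega> u)\<^sup>2 + \<mu> / 4 * (H01_norm \<Omega> u) ^ 4
     - 1 / \<gamma> * (Lp_norm \<gamma> \<Omega> u) powr \<gamma>"

definition lam ::
    "'a::euclidean_space set \<Rightarrow> real \<Rightarrow> real \<Rightarrow> ('a \<Rightarrow> real) \<Rightarrow> real" where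
  "lam \<Omega> a \<gamma> u = a * ((\<gamma> - 2) / (4 - \<gamma>)) * ((4 - \<gamma>) / (2 * a)) powr (2 / (\<gamma> - 2))
     * (Lp_norm \<gamma> \<Omega> u / H01_norm \<Omega> u) powr (2 * \<gamma> / (\<gamma> - 2))"

definition lam0 ::
    "'a::euclidean_space set \<Rightarrow> real \<Rightarrow> real \<Rightarrow> ('a \<Rightarrow> real) \<Rightarrow> real" where
  "lam0 \<Omega> a \<gamma> u = 2 * (2 / \<gamma>) powr (2 / (\<gamma> - 2)) * lam \<Omega> a \<gamma> u"

text \<open>The supremum is finite by the Sobolev embedding, so the real-valued supremum is adequate.\<close>

definition lam0_star :: "'a::euclidean_space set \<Rightarrow> real \<Rightarrow> real \<Rightarrow> real" where
  "lam0_star \<Omega> a \<gamma> = (SUP u \<in> {u \<in> H01 \<Omega>. \<not> ae_eq \<Omega> u (\<lambda>_. 0)}. lam0 \<Omega> a \<gamma> u)"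

subsection \<open>Global minimizers and mountain pass critical points\<close>

definition positive_global_minimizer ::
    "'a::euclidean_space set \<Rightarrow> (('a \<Rightarrow> real) \<Rightarrow> real) \<Rightarrow> ('a \<Rightarrow> real) \<Rightarrow> bool" where
  "positive_global_minimizer \<Omega> F u \<longleftrightarrow>
     u \<in> H01 \<Omega> \<and> ae_positive \<Omega> u \<and> (\<forall>v\<in>H01 \<Omega>. F u \<le> F v)"

definition paths ::
    "'a::euclidean_space set \<Rightarrow> ('a \<Rightarrow> real) \<Rightarrow> (real \<Rightarrow> 'a \<Rightarrow> real) set" where
  "paths \<Omega> e = {\<phi>. (\<forall>t\<in>{0..1}. \<phi> t \<in> H01 \<Omega>) \<and>
     (\<forall>t\<in>{0..1}. ((\<lambda>s. H01_norm \<Omega> (\<lambda>x. \<phi> s x - \<phi> t x)) \<longlongrightarrow> 0) (at t within {0..1})) \<and>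
     ae_eq \<Omega> (\<phi> 0) (\<lambda>_. 0) \<and> ae_eq \<Omega> (\<phi> 1) e}"

text \<open>The argument \<open>e\<close> is the common endpoint of the admissible paths. The inner supremum is a
  maximum, \<open>Phi\<close> being continuous along paths; the outer infimum is over values \<open>\<ge> 0\<close>.\<close>

definition mp_level ::
    "'a::euclidean_space set \<Rightarrow> real \<Rightarrow> real \<Rightarrow> ('a \<Rightarrow> real) \<Rightarrow> real \<Rightarrow> real" where
  "mp_level \<Omega> a \<gamma> e \<mu> = (INF \<phi> \<in> paths \<Omega> e. SUP t \<in> {0..1}. Phi \<Omega> a \<gamma> \<mu> (\<phi> t))"

definition mp_critical_point ::
    "'a::euclidean_space set \<Rightarrow> real \<Rightarrow> real \<Rightarrow> ('a \<Rightarrow> real) \<Rightarrow> real \<Rightarrow> ('a \<Rightarrow> real) \<Rightarrow> bool" where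
  "mp_critical_point \<Omega> a \<gamma> e \<mu> w \<longleftrightarrow>
     critical_point \<Omega> (Phi \<Omega> a \<gamma> \<mu>) w \<and> Phi \<Omega> a \<gamma> \<mu> w = mp_level \<Omega> a \<gamma> e \<mu>"

end

theory Submission
  imports Defs "HOL-Complex_Analysis.Great_Picard" "HOL-Computational_Algebra.Polynomial" "HOL-Real_Asymp.Real_Asymp"
begin

text \<open>
 Part i): \<open>u \<mu>\<close> has at most the energy of \<open>t * u L\<close>, which is as negative as desired for large fixed \<open>t\<close> and small \<open>\<mu>\<close>;
 by the Sobolev inequality an energy tending to \<open>- \<infinity>\<close> forces the norm to infinity.

 Part ii): a positive critical point of \<open>Phi \<Omega> a \<gamma> \<mu>\<close> is a multiple of a positive weak solution of \<open>- \<Delta> z = z powr p\<close>,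
 \<open>p = \<gamma> - 1\<close>, and positivity of the level bounds the factor. Mountain pass levels are continuous at \<open>\<mu> = 0\<close>, so by
 Rellich compactness it suffices to bound the Dirichlet norm of all positive solutions. Splitting
 \<open>\<integral> z powr (p + 1) <= K * \<integral> z powr p + K powr (p - 5) * \<integral> z ^ 6\<close> and the Sobolev inequality reduce this, because
 \<open>p < 3\<close>, to a bound on \<open>\<integral> z powr p\<close>. On compact subsets it follows by testing with a power of a cutoff function. Near a
 boundary point take a sphere touching the domain from outside there. The equation being subcritical, the method of moving
 spheres shows that \<open>z\<close> is dominated by its Kelvin transform in a slightly larger sphere, and inversion in that sphere
 maps a neighbourhood of the boundary point into a compact subset of the domain. As no regularity of \<open>z\<close> is available,
 both maximum principles are obtained by testing the weak equation with smooth approximations.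
\<close>

subsection \<open>Smooth functions\<close>

text \<open>Testing the equation with a critical point \<open>w\<close> of squared norm
  \<open>A\<close> gives \<open>Phi = A * (a * (1/2 - 1/\<gamma>) - \<mu> * A * (1/\<gamma> -
  1/4))\<close>. As \<open>\<gamma> < 4\<close>, the Kirchhoff term enters with the wrong sign: a
  positive level bounds \<open>\<mu> * A\<close> but not \<open>A\<close>, so the energy alone gives
  no compactness when \<open>\<mu>\<close> tends to 0. This is why a bound for all positive
  solutions of the limiting equation is required. Blow-up arguments for such bounds rest on
  regularity and a Liouville theorem; comparison under inversion works with weak solutions, and an
  integral bound is enough here. Inversions are used because the domain need not be convex: exterior
  balls exist at every boundary point. The Kelvin transform preserves the Dirichlet integral, so the
  transformed solution satisfies the same weak equation up to the weight
  \<open>(\<rho> / norm (x - y)) powr (5 - p)\<close>, where 5 is the critical exponent in dimension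
  three. For the comparison \<open>p < 5\<close> would do; \<open>p < 3\<close> is what closes the
  final estimate, where the norm \<open>g\<close> satisfies
  \<open>g^2 <= const * g powr (4 / (5 - p))\<close>.\<close>

text \<open>The unqualified names refer to the Henstock-Kurzweil integral.\<close>

lemmas integrable_bound' = Bochner_Integration.integrable_bound
 and integrable_add' = Bochner_Integration.integrable_add
 and integrable_diff' = Bochner_Integration.integrable_diff
 and integrable_minus' = Bochner_Integration.integrable_minus
 and integrable_sum' = Bochner_Integration.integrable_sum
 and integral_nonneg' = Bochner_Integration.integral_nonneg
 and integral_sum' = Bochner_Integration.integral_sum
 and integral_add' = Bochner_Integration.integral_add
 and integral_diff' = Bochner_Integration.integral_diff
 and integral_cong' = Bochner_Integration.integral_cong

abbreviation nnint :: "('a::euclidean_space \<Rightarrow> ennreal) \<Rightarrow> ennreal" (binder "NI " 10)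
 where "nnint f \<equiv> nn_integral lborel f"

text \<open>A version of \<open>Ck\<close> localised to a set, because Kelvin transforms are smooth
  only away from the centre of the inversion. Derivatives are taken \<open>at x\<close>, so the
  notion is meant for open sets.\<close>

primrec Ck_on :: "nat \<Rightarrow> 'a::euclidean_space set \<Rightarrow> ('a \<Rightarrow> real) \<Rightarrow> bool" where
 "Ck_on 0 S f \<longleftrightarrow> continuous_on S f"
| "Ck_on (Suc k) S f \<longleftrightarrow> (\<forall>x\<in>S. f differentiable at x) \<and>
   (\<forall>b\<in>Basis. Ck_on k S (%x. frechet_derivative f (at x) b))"

lemma Ck_iff_on: "Ck k f \<longleftrightarrow> Ck_on k UNIV f"
 by (induction k arbitrary: f) auto

lemma frechet_derivative_eq_on:
 assumes "open S" "x \<in> S" "!!y. y \<in> S ==> f y = g y"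
 shows "f differentiable at x \<longleftrightarrow> g differentiable at x"
  and "frechet_derivative f (at x) = frechet_derivative g (at x)"
proof -
 have *: "(f has_derivative D) (at x) \<longleftrightarrow> (g has_derivative D) (at x)" for D
  using has_derivative_transform_within_open[OF _ assms(1,2), of f D UNIV g]
   has_derivative_transform_within_open[OF _ assms(1,2), of g D UNIV f] assms(3) by auto
 show "f differentiable at x \<longleftrightarrow> g differentiable at x"
  unfolding differentiable_def using * by auto
 show "frechet_derivative f (at x) = frechet_derivative g (at x)"
  unfolding frechet_derivative_def using * by auto
qed

lemma Ck_on_cong:
 assumes "open S" "!!x. x \<in> S ==> f x = g x" "Ck_on k S f"
 shows "Ck_on k S g"
 using assms(2,3)
proof (induction k arbitrary: f g)
 case 0
 then show ?case using continuous_on_cong by force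
next
 case (Suc k)
 have eq: "g differentiable at x" "frechet_derivative f (at x) = frechet_derivative g (at x)"
  if "x \<in> S" for x
  using frechet_derivative_eq_on[OF assms(1) that, of f g] Suc.prems that by auto
 have "Ck_on k S (%x. frechet_derivative g (at x) b)" if "b \<in> Basis" for b
  by (rule Suc.IH[of "%x. frechet_derivative f (at x) b"]) (use eq Suc.prems that in auto)
 then show ?case using eq by auto
qed

lemma Ck_on_SucI:
 assumes "open S" "!!x. x \<in> S ==> (f has_derivative f' x) (at x)"
  "!!b. b \<in> Basis ==> Ck_on k S (%x. f' x b)"
 shows "Ck_on (Suc k) S f"
proof -
 have eq: "f' x = frechet_derivative f (at x)" if "x \<in> S" for x
  using frechet_derivative_at assms(2) that by blast
 have "Ck_on k S (%x. frechet_derivative f (at x) b)" if "b \<in> Basis" for b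
  by (rule Ck_on_cong[OF assms(1) _ assms(3)[OF that]]) (use eq in auto)
 then show ?thesis using assms(2) by (auto simp: differentiable_def)
qed

lemma Ck_on_SucD:
 assumes "Ck_on (Suc k) S f" "x \<in> S"
 shows "(f has_derivative frechet_derivative f (at x)) (at x)"
 using assms by (auto simp: frechet_derivative_works)

lemma Ck_on_Suc_imp: "Ck_on (Suc k) S f ==> Ck_on k S f"
proof (induction k arbitrary: f)
 case 0
 then show ?case
  by (auto intro!: continuous_at_imp_continuous_on differentiable_imp_continuous_within)
next
 case (Suc k)
 then show ?case by (metis Ck_on.simps(2))
qed

lemma Ck_on_subset: "Ck_on k S f ==> T \<subseteq> S ==> Ck_on k T f"
 by (induction k arbitrary: f) (auto intro: continuous_on_subset)

lemma Ck_on_Un: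
 assumes "open S" "open T"
 shows "Ck_on k S f ==> Ck_on k T f ==> Ck_on k (S \<union> T) f"
 by (induction k arbitrary: f) (auto intro: continuous_on_open_Un assms)

lemma Ck_on_const: "open S ==> Ck_on k S (%x. c)"
proof (induction k arbitrary: c)
 case (Suc k)
 show ?case
  by (rule Ck_on_SucI[where f' = "%x h. 0"]) (use Suc in \<open>auto intro!: derivative_eq_intros\<close>)
qed auto

lemma Ck_on_inner: "open S ==> Ck_on k S (%x. x \<bullet> c)"
proof (cases k)
 case (Suc k)
 assume "open S"
 then show ?thesis unfolding Suc
  by (intro Ck_on_SucI[where f' = "%x h. h \<bullet> c"])
    (auto intro!: derivative_eq_intros Ck_on_const)
qed (auto intro!: continuous_intros)

lemma Ck_on_add: "open S ==> Ck_on k S f ==> Ck_on k S g ==> Ck_on k S (%x. f x + g x)"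
proof (induction k arbitrary: f g)
 case (Suc k)
 show ?case
  by (rule Ck_on_SucI[where f' = "%x h. frechet_derivative f (at x) h + frechet_derivative g (at x) h"])
    (use Suc in \<open>auto intro!: derivative_eq_intros simp: frechet_derivative_works[symmetric]\<close>)
qed (auto intro!: continuous_intros)

lemma Ck_on_mult: "open S ==> Ck_on k S f ==> Ck_on k S g ==> Ck_on k S (%x. f x * g x)"
proof (induction k arbitrary: f g)
 case (Suc k)
 show ?case
 proof (rule Ck_on_SucI[where f' = "%x h. f x * frechet_derivative g (at x) h + frechet_derivative f (at x) h * g x"])
  fix b :: 'a assume b: "b \<in> Basis"
  show "Ck_on k S (%x. f x * frechet_derivative g (at x) b + frechet_derivative f (at x) b * g x)"
   using Suc b Ck_on_Suc_imp[OF Suc.prems(2)] Ck_on_Suc_imp[OF Suc.prems(3)]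
   by (intro Ck_on_add Suc.IH) auto
 qed (use Suc in \<open>auto intro!: derivative_eq_intros simp: frechet_derivative_works[symmetric]\<close>)
qed (auto intro!: continuous_intros)

lemma Ck_on_sum: "open S ==> (!!i. i \<in> I ==> Ck_on k S (f i)) ==> Ck_on k S (%x. \<Sum>i\<in>I. f i x)"
 by (induction I rule: infinite_finite_induct) (auto intro!: Ck_on_const Ck_on_add)

text \<open>The outer function is given together with all its derivatives as a sequence
  \<open>G\<close>, and the claim is made for every \<open>j\<close>: the derivative of
  \<open>G j (f x)\<close> involves \<open>G (Suc j)\<close>, to which the induction hypothesis then
  applies.\<close>

lemma Ck_on_compose_real:
 assumes "open S" and G: "!!j t. t \<in> T ==> (G j has_real_derivative G (Suc j) t) (at t)"
  and "Ck_on k S f" "f ` S \<subseteq> T"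
 shows "Ck_on k S (%x. G j (f x))"
 using assms(3)
proof (induction k arbitrary: j)
 case 0
 have "isCont (G j) t" if "t \<in> T" for t using G[OF that] DERIV_isCont by blast
 then have "continuous_on T (G j)" by (simp add: continuous_at_imp_continuous_on)
 then show ?case using 0 assms(4) continuous_on_compose2 by auto
next
 case (Suc k)
 show ?case
 proof (rule Ck_on_SucI[where f' = "%x h. G (Suc j) (f x) * frechet_derivative f (at x) h"])
  fix x assume x: "x \<in> S"
  show "((%x. G j (f x)) has_derivative (%h. G (Suc j) (f x) * frechet_derivative f (at x) h)) (at x)"
   using has_derivative_compose[OF Ck_on_SucD[OF Suc.prems x], of "G j" "(*) (G (Suc j) (f x))"]
    G[of "f x" j] assms(4) x by (auto simp: has_field_derivative_def)
 next
  fix b :: 'a assume b: "b \<in> Basis"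
  show "Ck_on k S (%x. G (Suc j) (f x) * frechet_derivative f (at x) b)"
   using Suc b Ck_on_Suc_imp[OF Suc.prems] by (intro Ck_on_mult assms(1)) auto
 qed (rule assms)
qed

lemma Ck_on_compose:
 fixes \<kappa> :: "'a::euclidean_space \<Rightarrow> 'b::euclidean_space"
 assumes "open S" "open T" "\<kappa> ` S \<subseteq> T"
 shows "Ck_on k T \<phi> ==> (!!c. c \<in> Basis ==> Ck_on k S (%x. \<kappa> x \<bullet> c)) ==> Ck_on k S (%x. \<phi> (\<kappa> x))"
proof (induction k arbitrary: \<phi>)
 case 0
 have "continuous_on S \<kappa>" using 0(2) continuous_on_componentwise by auto
 then show ?case using 0 assms(3) continuous_on_compose2 by auto
next
 case (Suc k)
 define D where "D x h = (\<Sum>c\<in>Basis. frechet_derivative (%x. \<kappa> x \<bullet> c) (at x) h *\<^sub>R c)" for x h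
 have D: "(\<kappa> has_derivative D x) (at x)" if "x \<in> S" for x
 proof -
  have "((%x. \<kappa> x \<bullet> c) has_derivative (%h. D x h \<bullet> c)) (at x)" if c: "c \<in> Basis" for c
   using Ck_on_SucD[OF Suc.prems(2)[OF c] \<open>x \<in> S\<close>] c by (simp add: D_def inner_sum_left inner_Basis if_distrib cong: if_cong)
  then show ?thesis using has_derivative_componentwise_within by blast
 qed
 show ?case
 proof (rule Ck_on_SucI[where f' = "%x h. \<Sum>c\<in>Basis. frechet_derivative (%x. \<kappa> x \<bullet> c) (at x) h * frechet_derivative \<phi> (at (\<kappa> x)) c"])
  fix x assume x: "x \<in> S"
  have \<phi>: "(\<phi> has_derivative frechet_derivative \<phi> (at (\<kappa> x))) (at (\<kappa> x))"
   using Ck_on_SucD[OF Suc.prems(1)] x assms(3) by auto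
  have "((%x. \<phi> (\<kappa> x)) has_derivative (%h. frechet_derivative \<phi> (at (\<kappa> x)) (D x h))) (at x)"
   by (rule has_derivative_compose[OF D[OF x] \<phi>])
  moreover have "linear (frechet_derivative \<phi> (at (\<kappa> x)))"
   using \<phi> has_derivative_linear by blast
  ultimately show "((%x. \<phi> (\<kappa> x)) has_derivative (%h. \<Sum>c\<in>Basis. frechet_derivative (%x. \<kappa> x \<bullet> c) (at x) h * frechet_derivative \<phi> (at (\<kappa> x)) c)) (at x)"
   by (simp add: D_def linear_sum linear_scale)
 next
  fix b :: 'a assume b: "b \<in> Basis"
  have "Ck_on k S (%x. frechet_derivative \<phi> (at (\<kappa> x)) c)" if "c \<in> Basis" for c
  proof (rule Suc.IH)
   show "Ck_on k T (%x. frechet_derivative \<phi> (at x) c)"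
    using Suc.prems(1) that unfolding Ck_on.simps by blast
   show "Ck_on k S (%x. \<kappa> x \<bullet> c)" if "c \<in> Basis" for c
    by (rule Ck_on_Suc_imp[OF Suc.prems(2)[OF that]])
  qed
  moreover have "Ck_on k S (%x. frechet_derivative (%x. \<kappa> x \<bullet> c) (at x) b)" if "c \<in> Basis" for c
   using Suc.prems(2)[OF that] b unfolding Ck_on.simps by blast
  ultimately show "Ck_on k S (%x. \<Sum>c\<in>Basis. frechet_derivative (%x. \<kappa> x \<bullet> c) (at x) b * frechet_derivative \<phi> (at (\<kappa> x)) c)"
   by (intro Ck_on_sum Ck_on_mult assms(1))
 qed (rule assms)
qed

definition smooth_on :: "'a::euclidean_space set \<Rightarrow> ('a \<Rightarrow> real) \<Rightarrow> bool" where
 "smooth_on S f \<longleftrightarrow> (\<forall>k. Ck_on k S f)"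

lemma smooth_on_cong: "open S ==> (!!x. x \<in> S ==> f x = g x) ==> smooth_on S f ==> smooth_on S g"
 unfolding smooth_on_def by (blast intro: Ck_on_cong)

lemma smooth_on_subset: "smooth_on S f ==> T \<subseteq> S ==> smooth_on T f"
 unfolding smooth_on_def by (blast intro: Ck_on_subset)

lemma smooth_on_Un: "open S ==> open T ==> smooth_on S f ==> smooth_on T f ==> smooth_on (S \<union> T) f"
 unfolding smooth_on_def by (blast intro: Ck_on_Un)

lemma smooth_on_const: "open S ==> smooth_on S (%x. c)"
 by (simp add: smooth_on_def Ck_on_const)

lemma smooth_on_inner: "open S ==> smooth_on S (%x. x \<bullet> c)"
 by (simp add: smooth_on_def Ck_on_inner)

lemma smooth_on_add: "open S ==> smooth_on S f ==> smooth_on S g ==> smooth_on S (%x. f x + g x)"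
 by (simp add: smooth_on_def Ck_on_add)

lemma smooth_on_mult: "open S ==> smooth_on S f ==> smooth_on S g ==> smooth_on S (%x. f x * g x)"
 by (simp add: smooth_on_def Ck_on_mult)

lemma smooth_on_cmult: "open S ==> smooth_on S f ==> smooth_on S (%x. c * f x)"
 by (intro smooth_on_mult smooth_on_const)

lemma smooth_on_minus: "open S ==> smooth_on S f ==> smooth_on S (%x. - f x)"
 using smooth_on_cmult[of S f "-1"] by simp

lemma smooth_on_diff: "open S ==> smooth_on S f ==> smooth_on S g ==> smooth_on S (%x. f x - g x)"
 using smooth_on_add[of S f "%x. - g x"] smooth_on_minus[of S g] by simp

lemma smooth_on_sum: "open S ==> (!!i. i \<in> I ==> smooth_on S (f i)) ==> smooth_on S (%x. \<Sum>i\<in>I. f i x)"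
 by (simp add: smooth_on_def Ck_on_sum)

lemma smooth_on_power: "open S ==> smooth_on S f ==> smooth_on S (%x. f x ^ n)"
 by (induction n) (auto intro: smooth_on_const smooth_on_mult)

lemma smooth_on_compose_real:
 assumes "open S" "!!j t. t \<in> T ==> (G j has_real_derivative G (Suc j) t) (at t)" "smooth_on S f" "f ` S \<subseteq> T"
 shows "smooth_on S (%x. G j (f x))"
 unfolding smooth_on_def
proof
 show "Ck_on k S (%x. G j (f x))" for k
  by (rule Ck_on_compose_real[where T = T]) (use assms in \<open>auto simp: smooth_on_def\<close>)
qed

lemma smooth_on_compose:
 fixes \<kappa> :: "'a::euclidean_space \<Rightarrow> 'b::euclidean_space"
 assumes "open S" "open T" "\<kappa> ` S \<subseteq> T" "smooth_on T \<phi>" "!!c. c \<in> Basis ==> smooth_on S (%x. \<kappa> x \<bullet> c)"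
 shows "smooth_on S (%x. \<phi> (\<kappa> x))"
 unfolding smooth_on_def
proof
 show "Ck_on k S (%x. \<phi> (\<kappa> x))" for k
  by (rule Ck_on_compose[where T = T]) (use assms in \<open>auto simp: smooth_on_def\<close>)
qed

lemma smooth_on_exp: "open S ==> smooth_on S f ==> smooth_on S (%x. exp (f x))"
 by (rule smooth_on_compose_real[where T = UNIV and G = "%_. exp"]) (auto intro!: derivative_eq_intros)

lemma smooth_on_powr:
 assumes "open S" "smooth_on S f" "!!x. x \<in> S ==> f x > 0"
 shows "smooth_on S (%x. f x powr c)"
proof -
 \<comment> \<open>The \<open>j\<close>-th derivative of \<open>t powr c\<close>, with the falling
   factorial as its coefficient.\<close>
 define G where "G j t = (\<Prod>i<j. c - real i) * t powr (c - real j)" for j and t :: real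
 have "(G j has_real_derivative G (Suc j) t) (at t)" if "t > 0" for j t
  unfolding G_def using DERIV_cmult[OF has_real_derivative_powr[OF that, of "c - real j"], of "\<Prod>i<j. c - real i"]
  by (simp add: diff_diff_eq add.commute mult.assoc)
 then have "smooth_on S (%x. G 0 (f x))"
  by (intro smooth_on_compose_real[where T = "{0<..}" and G = G and j = 0 and f = f]) (use assms in auto)
 then show ?thesis by (simp add: G_def)
qed

lemma smooth_on_inverse:
 assumes "open S" "smooth_on S f" "!!x. x \<in> S ==> f x > 0"
 shows "smooth_on S (%x. inverse (f x))"
 by (rule smooth_on_cong[OF assms(1) _ smooth_on_powr[OF assms, of "-1"]])
   (use assms(3) in \<open>force simp: powr_minus\<close>)

lemma smooth_on_norm_sq: "open S ==> smooth_on S (%x. (norm (x - y))^2)"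
proof -
 assume S: "open S"
 have eq: "(norm (x - y))^2 = (\<Sum>b\<in>Basis. (x \<bullet> b - y \<bullet> b) ^ 2)" for x
  by (subst power2_norm_eq_inner, subst euclidean_inner) (simp add: inner_diff_left power2_eq_square)
 show ?thesis unfolding eq
  by (intro smooth_on_sum smooth_on_power smooth_on_diff smooth_on_inner smooth_on_const S)
qed

lemma smooth_on_norm: "open S ==> y \<notin> S ==> smooth_on S (%x. norm (x - y))"
 by (rule smooth_on_cong[OF _ _ smooth_on_powr[OF _ smooth_on_norm_sq[of S y], of "1/2"]])
   (auto simp: powr_half_sqrt)

lemma smooth_on_continuous: "smooth_on S f ==> continuous_on S f"
 using smooth_on_def Ck_on.simps(1) by metis

lemma smooth_on_has_derivative:
 "smooth_on S f ==> x \<in> S ==> (f has_derivative frechet_derivative f (at x)) (at x)"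
 using smooth_on_def Ck_on_SucD by metis

lemma smooth_on_frechet_derivative:
 "smooth_on S f ==> b \<in> Basis ==> smooth_on S (%x. frechet_derivative f (at x) b)"
 unfolding smooth_on_def using Ck_on.simps(2) by metis

subsection \<open>Auxiliary smooth functions of one variable\<close>

text \<open>The flat function \<open>exp (- 1 / t)\<close> with a polynomial factor in
  \<open>1 / t\<close>. The family is closed under differentiation, so smoothness of all its members
  follows in one induction.\<close>

definition exp_inv :: "real poly \<Rightarrow> real \<Rightarrow> real" where
 "exp_inv p t = (if t > 0 then poly p (1 / t) * exp (- 1 / t) else 0)"

lemma tendsto_poly_exp_at_top: "((%x::real. poly p x * exp (- x)) \<longlongrightarrow> 0) at_top"
proof -
 have "((%x::real. \<Sum>i\<le>degree p. coeff p i * (x ^ i / exp x)) \<longlongrightarrow> (\<Sum>i\<le>degree p. coeff p i * 0)) at_top"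
  by (intro tendsto_intros tendsto_power_div_exp_0)
 then show ?thesis by (simp add: poly_altdef exp_minus divide_inverse sum_distrib_right mult.assoc)
qed

text \<open>The factor \<open>[:0,0,1:]\<close> is the square of \<open>1 / t\<close> coming from
  the inner derivative. At 0 the difference quotient is again of the same kind, and the exponential
  beats every polynomial in \<open>1 / t\<close>.\<close>

lemma DERIV_exp_inv:
 "(exp_inv p has_real_derivative exp_inv ([:0,0,1:] * (p - pderiv p)) t) (at t)"
proof -
 consider "t > 0" | "t < 0" | "t = 0" by linarith
 then show ?thesis
 proof cases
  case 1
  have "((%t. poly p (1 / t) * exp (- 1 / t)) has_real_derivative exp_inv ([:0,0,1:] * (p - pderiv p)) t) (at t)"
   using 1 by (auto intro!: derivative_eq_intros DERIV_chain2[OF poly_DERIV] simp: exp_inv_def field_simps power2_eq_square)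
  then show ?thesis
   by (rule has_field_derivative_transform_within_open[where S = "{0<..}"]) (use 1 in \<open>auto simp: exp_inv_def\<close>)
 next
  case 2
  have "((%t. 0) has_real_derivative exp_inv ([:0,0,1:] * (p - pderiv p)) t) (at t)"
   using 2 by (auto simp: exp_inv_def)
  then show ?thesis
   by (rule has_field_derivative_transform_within_open[where S = "{..<0}"]) (use 2 in \<open>auto simp: exp_inv_def\<close>)
 next
  case 3
  have "((%t. poly (pCons 0 p) (inverse t) * exp (- inverse t)) \<longlongrightarrow> 0) (at_right (0::real))"
   by (rule filterlim_compose[OF tendsto_poly_exp_at_top filterlim_inverse_at_top_right])
  then have "((%t. exp_inv p t / t) \<longlongrightarrow> 0) (at_right 0)"
   by (rule Lim_transform_eventually)
     (auto simp: exp_inv_def field_simps eventually_at_right_field intro!: exI[of _ 1])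
  moreover have "((%t. exp_inv p t / t) \<longlongrightarrow> 0) (at_left 0)"
   by (rule Lim_transform_eventually[OF tendsto_const])
     (auto simp: exp_inv_def eventually_at_left_field intro!: exI[of _ "-1"])
  ultimately have "((%t. exp_inv p t / t) \<longlongrightarrow> 0) (at 0)"
   by (simp add: filterlim_at_split)
  then show ?thesis using 3 by (simp add: has_field_derivative_iff exp_inv_def)
 qed
qed

lemma smooth_on_exp_inv:
 assumes "open S" "smooth_on S f"
 shows "smooth_on S (%x. exp_inv p (f x))"
proof -
 define G where "G j = exp_inv (((%p. [:0,0,1:] * (p - pderiv p)) ^^ j) p)" for j
 have "(G j has_real_derivative G (Suc j) t) (at t)" for j t
  unfolding G_def using DERIV_exp_inv by simp
 then have "smooth_on S (%x. G 0 (f x))"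
  by (intro smooth_on_compose_real[where T = UNIV and G = G and j = 0 and f = f]) (use assms in auto)
 then show ?thesis by (simp add: G_def)
qed

text \<open>A smooth approximation of the positive part that vanishes near \<open>0\<close>.\<close>

definition spos :: "real \<Rightarrow> real \<Rightarrow> real" where
 "spos e t = (t - e) * exp_inv 1 ((t - e) / e)"

definition spos' :: "real \<Rightarrow> real \<Rightarrow> real" where
 "spos' e t = (if t > e then exp (- e / (t - e)) * (1 + e / (t - e)) else 0)"

lemma spos_eq: "e > 0 ==> spos e t = (if t > e then (t - e) * exp (- e / (t - e)) else 0)"
 by (auto simp: spos_def exp_inv_def zero_less_divide_iff)

lemma smooth_on_spos: "open S ==> smooth_on S f ==> smooth_on S (%x. spos e (f x))"
 unfolding spos_def divide_inverse
 by (intro smooth_on_mult smooth_on_diff smooth_on_const smooth_on_exp_inv)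

lemma DERIV_spos:
 assumes "e > 0"
 shows "(spos e has_real_derivative spos' e t) (at t)"
proof -
 have "((%t. exp_inv 1 ((t - e) / e)) has_real_derivative exp_inv ([:0,0,1:] * (1 - pderiv 1)) ((t - e) / e) * (1/e)) (at t)"
  by (rule DERIV_chain2[OF DERIV_exp_inv]) (use assms in \<open>auto intro!: derivative_eq_intros\<close>)
 then have "(spos e has_real_derivative 1 * exp_inv 1 ((t - e) / e) + (t - e) * (exp_inv ([:0,0,1:] * (1 - pderiv 1)) ((t - e) / e) * (1/e))) (at t)"
  unfolding spos_def by (auto intro!: derivative_eq_intros)
 moreover have "1 * exp_inv 1 ((t - e) / e) + (t - e) * (exp_inv ([:0,0,1:] * (1 - pderiv 1)) ((t - e) / e) * (1/e)) = spos' e t"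
 proof (cases "t > e")
  case True
  define s where "s = t - e"
  have s: "s > 0" "t - e = s" using True by (auto simp: s_def)
  show ?thesis
   unfolding spos'_def s(2) using s(1) assms True
   by (simp add: exp_inv_def field_simps power2_eq_square)
 qed (use assms in \<open>auto simp: exp_inv_def spos'_def zero_less_divide_iff\<close>)
 ultimately show ?thesis by simp
qed

text \<open>The inequality \<open>1 + x <= exp x\<close> keeps the slope below 1, so that truncation
  with \<open>spos\<close> never increases a Dirichlet norm.\<close>

lemma spos'_bounds: "e > 0 ==> 0 <= spos' e t \<and> spos' e t <= 1"
proof -
 assume e: "e > 0"
 have "exp (- x) * (1 + x) <= 1" for x :: real
  using exp_ge_add_one_self[of x] by (simp add: exp_minus field_simps)
 from this[of "e / (t - e)"] show ?thesis using e by (auto simp: spos'_def)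
qed

text \<open>In the last bound the shift by \<open>e\<close> and the exponential factor each cost at
  most \<open>e\<close>.\<close>

lemma spos_bounds:
 assumes "e > 0"
 shows "0 <= spos e t" "spos e t <= max t 0" "\<bar>spos e t - max t 0\<bar> <= 2 * e"
proof -
 have *: "s * exp (- e / s) <= s" "s - s * exp (- e / s) <= e" if "s > 0" for s
 proof -
  show "s * exp (- e / s) <= s" using that assms by (simp add: mult_left_le)
  have "1 - e / s <= exp (- e / s)" using exp_ge_add_one_self[of "- e / s"] by simp
  then have "s * (1 - e / s) <= s * exp (- e / s)" using that by simp
  moreover have "s * (1 - e / s) = s - e" using that by (simp add: field_simps)
  ultimately show "s - s * exp (- e / s) <= e" by linarith
 qed
 have "0 <= spos e t \<and> spos e t <= max t 0 \<and> \<bar>spos e t - max t 0\<bar> <= 2 * e"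
 proof (cases "t > e")
  case True
  then have "0 < t - e" by simp
  from *[OF this] True assms show ?thesis
   unfolding spos_eq[OF assms] max_def abs_if by (smt (verit) exp_gt_zero mult_pos_pos)
 qed (use assms in \<open>auto simp: spos_eq\<close>)
 then show "0 <= spos e t" "spos e t <= max t 0" "\<bar>spos e t - max t 0\<bar> <= 2 * e" by auto
qed

subsection \<open>Test functions\<close>

lemma test_functionsI:
 assumes "smooth_on UNIV \<phi>" "compact K" "K \<subseteq> \<Omega>" "!!x. x \<notin> K ==> \<phi> x = 0"
 shows "\<phi> \<in> test_functions \<Omega>"
proof -
 have "closure {x. \<phi> x \<noteq> 0} \<subseteq> K"
  using assms by (intro closure_minimal) (auto simp: compact_imp_closed)
 then show ?thesis using assms
  unfolding test_functions_def smooth_on_def Ck_iff_on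
  using compact_Int_closed[of K "closure {x. \<phi> x \<noteq> 0}"] by (auto simp: inf.absorb2)
qed

lemma test_functionsE:
 assumes "\<phi> \<in> test_functions \<Omega>"
 obtains K where "smooth_on UNIV \<phi>" "compact K" "K \<subseteq> \<Omega>" "!!x. x \<notin> K ==> \<phi> x = 0"
proof
 show "smooth_on UNIV \<phi>" "compact (closure {x. \<phi> x \<noteq> 0})" "closure {x. \<phi> x \<noteq> 0} \<subseteq> \<Omega>"
  using assms unfolding test_functions_def smooth_on_def Ck_iff_on[symmetric] by blast+
 show "\<phi> x = 0" if "x \<notin> closure {x. \<phi> x \<noteq> 0}" for x
  using that closure_subset[of "{x. \<phi> x \<noteq> 0}"] by auto
qed

lemma tf_smooth: "\<phi> \<in> test_functions \<Omega> ==> smooth_on UNIV \<phi>"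
 by (erule test_functionsE)

lemma tf_mono: "\<phi> \<in> test_functions U ==> U \<subseteq> V ==> \<phi> \<in> test_functions V"
 by (auto simp: test_functions_def)

lemma tf_UNIV: "\<phi> \<in> test_functions U ==> \<phi> \<in> test_functions UNIV"
 by (auto simp: test_functions_def)

lemma tf_outside: "\<phi> \<in> test_functions \<Omega> ==> x \<notin> \<Omega> ==> \<phi> x = 0"
 by (erule test_functionsE) blast

lemma tf_0: "(%x. 0) \<in> test_functions \<Omega>"
 by (rule test_functionsI[of _ "{}"]) (auto intro: smooth_on_const)

lemma tf_add:
 assumes "\<phi> \<in> test_functions \<Omega>" "\<psi> \<in> test_functions \<Omega>"
 shows "(%x. \<phi> x + \<psi> x) \<in> test_functions \<Omega>"
proof -
 obtain K L where "smooth_on UNIV \<phi>" "compact K" "K \<subseteq> \<Omega>" "!!x. x \<notin> K ==> \<phi> x = 0"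
  "smooth_on UNIV \<psi>" "compact L" "L \<subseteq> \<Omega>" "!!x. x \<notin> L ==> \<psi> x = 0"
  by (rule test_functionsE[OF assms(1)], rule test_functionsE[OF assms(2)], rule that)
 then show ?thesis by (intro test_functionsI[where K = "K \<union> L"]) (auto intro: smooth_on_add)
qed

lemma tf_mult:
 assumes "\<phi> \<in> test_functions \<Omega>" "smooth_on UNIV \<psi>"
 shows "(%x. \<psi> x * \<phi> x) \<in> test_functions \<Omega>"
proof -
 obtain K where "smooth_on UNIV \<phi>" "compact K" "K \<subseteq> \<Omega>" "!!x. x \<notin> K ==> \<phi> x = 0"
  by (rule test_functionsE[OF assms(1)], rule that)
 then show ?thesis using assms(2) by (intro test_functionsI[where K = "K"]) (auto intro: smooth_on_mult)
qed

lemma tf_cmult: "\<phi> \<in> test_functions \<Omega> ==> (%x. c * \<phi> x) \<in> test_functions \<Omega>"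
 by (intro tf_mult smooth_on_const) auto

lemma tf_minus: "\<phi> \<in> test_functions \<Omega> ==> (%x. - \<phi> x) \<in> test_functions \<Omega>"
 using tf_cmult[of \<phi> \<Omega> "-1"] by simp

lemma tf_diff:
 "\<phi> \<in> test_functions \<Omega> ==> \<psi> \<in> test_functions \<Omega> ==> (%x. \<phi> x - \<psi> x) \<in> test_functions \<Omega>"
 using tf_add[of \<phi> \<Omega> "%x. - \<psi> x"] tf_minus[of \<psi> \<Omega>] by simp

lemma tf_sum:
 "(!!i. i \<in> I ==> \<phi> i \<in> test_functions \<Omega>) ==> (%x. \<Sum>i\<in>I. \<phi> i x) \<in> test_functions \<Omega>"
 by (induction I rule: infinite_finite_induct) (auto intro: tf_0 tf_add)

lemma tf_frechet_derivative:
 assumes "\<phi> \<in> test_functions \<Omega>" "b \<in> Basis"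
 shows "(%x. frechet_derivative \<phi> (at x) b) \<in> test_functions \<Omega>"
proof -
 obtain K where K: "smooth_on UNIV \<phi>" "compact K" "K \<subseteq> \<Omega>" "!!x. x \<notin> K ==> \<phi> x = 0"
  by (rule test_functionsE[OF assms(1)], rule that)
 show ?thesis
 proof (rule test_functionsI[where K = K])
  fix x assume "x \<notin> K"
  then have "frechet_derivative \<phi> (at x) = frechet_derivative (%x. 0) (at x)"
   using K by (intro frechet_derivative_eq_on(2)[of "- K"]) (auto simp: compact_imp_closed)
  then show "frechet_derivative \<phi> (at x) b = 0" by simp
 qed (use K assms smooth_on_frechet_derivative in auto)
qed

lemma tf_spos:
 assumes "\<phi> \<in> test_functions \<Omega>" "e > 0"
 shows "(%x. spos e (\<phi> x)) \<in> test_functions \<Omega>"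
proof -
 obtain K where "smooth_on UNIV \<phi>" "compact K" "K \<subseteq> \<Omega>" "!!x. x \<notin> K ==> \<phi> x = 0"
  by (rule test_functionsE[OF assms(1)], rule that)
 then show ?thesis using assms(2) using smooth_on_spos[OF open_UNIV, of \<phi> e] spos_eq[OF assms(2), of 0]
  by (intro test_functionsI[where K = "K"]) auto
qed

lemma tf_bump:
 assumes "cball x r \<subseteq> \<Omega>" "r > 0"
 shows "(%y. exp_inv 1 (r^2 - (norm (y - x))^2)) \<in> test_functions \<Omega>"
proof (rule test_functionsI[where K = "cball x r"])
 fix y assume "y \<notin> cball x r"
 then have "r^2 < (norm (y - x))^2"
  using assms by (intro power_strict_mono) (auto simp: dist_norm norm_minus_commute)
 then show "exp_inv 1 (r^2 - (norm (y - x))^2) = 0" by (auto simp: exp_inv_def)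
qed (use assms in \<open>auto intro!: smooth_on_exp_inv smooth_on_diff smooth_on_const smooth_on_norm_sq\<close>)

text \<open>A finite sum of bumps on balls covering \<open>K\<close>. No plateau is built in: where
  a lower bound on \<open>K\<close> is wanted, it is taken from compactness.\<close>

lemma tf_positive_on_compact:
 assumes "compact K" "K \<subseteq> U" "open U"
 obtains \<eta> where "\<eta> \<in> test_functions U" "!!x. 0 <= \<eta> x" "!!x. x \<in> K ==> 0 < \<eta> x"
proof -
 have "\<exists>r>0. cball x r \<subseteq> U" if "x \<in> K" for x
  using assms that open_contains_cball by blast
 then obtain r where r: "!!x. x \<in> K ==> 0 < r x \<and> cball x (r x) \<subseteq> U" by metis
 have "K \<subseteq> (\<Union>x\<in>K. ball x (r x))" using r by force
 then obtain F where F: "F \<subseteq> K" "finite F" "K \<subseteq> (\<Union>x\<in>F. ball x (r x))"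
  using compactE_image[OF assms(1), of K "%x. ball x (r x)"] by auto
 define \<eta> where "\<eta> y = (\<Sum>x\<in>F. exp_inv 1 ((r x)^2 - (norm (y - x))^2))" for y
 have nn: "0 <= exp_inv 1 t" for t by (auto simp: exp_inv_def)
 show thesis
 proof (rule that[of \<eta>])
  show "\<eta> \<in> test_functions U" unfolding \<eta>_def
   using r F by (intro tf_sum tf_bump) auto
  show "0 <= \<eta> x" for x unfolding \<eta>_def by (intro sum_nonneg nn)
  show "0 < \<eta> y" if y: "y \<in> K" for y
  proof -
   obtain x where x: "x \<in> F" "y \<in> ball x (r x)" using F y by auto
   then have "(norm (y - x))^2 < (r x)^2"
    by (intro power_strict_mono) (auto simp: dist_norm norm_minus_commute)
   then have "0 < exp_inv 1 ((r x)^2 - (norm (y - x))^2)" by (auto simp: exp_inv_def)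
   then show ?thesis unfolding \<eta>_def using F x nn by (intro sum_pos2[of F x]) auto
  qed
 qed
qed

subsection \<open>Square integrable functions\<close>

text \<open>Square integrability stays a predicate on functions, with almost everywhere equality
  treated by hand, because the elements of \<open>H01\<close> are functions and not classes.\<close>

definition L2 :: "'a measure \<Rightarrow> ('a \<Rightarrow> 'b::euclidean_space) \<Rightarrow> bool" where
 "L2 M f \<longleftrightarrow> f \<in> borel_measurable M \<and> integrable M (%x. (norm (f x))^2)"

definition n2 :: "'a measure \<Rightarrow> ('a \<Rightarrow> 'b::euclidean_space) \<Rightarrow> real" where
 "n2 M f = sqrt (LINT x|M. (norm (f x))^2)"

lemma L2_measurable[measurable_dest]: "L2 M f ==> f \<in> borel_measurable M"
 by (simp add: L2_def)

lemma L2_integrable: "L2 M f ==> integrable M (%x. (norm (f x))^2)"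
 by (simp add: L2_def)

lemma L2_integrable_real: "L2 M f ==> integrable M (%x. (f x :: real)^2)"
 using L2_integrable[of M f] by simp

lemma n2_nonneg[simp]: "n2 M f \<ge> 0"
 by (simp add: n2_def)

lemma n2_sq: "(n2 M f)^2 = (LINT x|M. (norm (f x))^2)"
 by (simp add: n2_def)

lemma n2_sq_real: "(n2 M f)^2 = (LINT x|M. (f x :: real)^2)"
 by (simp add: n2_def)

lemma L2_cong_AE:
 assumes "AE x in M. f x = g x" "f \<in> borel_measurable M" "g \<in> borel_measurable M"
 shows "L2 M f \<longleftrightarrow> L2 M g" and "n2 M f = n2 M g"
proof -
 note [measurable] = assms(2,3)
 have "AE x in M. (norm (f x))^2 = (norm (g x))^2" using assms(1) by auto
 then show "L2 M f \<longleftrightarrow> L2 M g" "n2 M f = n2 M g"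
  unfolding L2_def n2_def using assms(2,3) integrable_cong_AE[of "%x. (norm (f x))^2" M "%x. (norm (g x))^2"]
   integral_cong_AE[of "%x. (norm (f x))^2" M "%x. (norm (g x))^2"] by auto
qed

lemma L2_bound:
 assumes "L2 M f" "g \<in> borel_measurable M" "AE x in M. norm (g x) <= norm (f x)"
 shows "L2 M g" "n2 M g <= n2 M f"
proof -
 note [measurable] = assms(2)
 have ae: "AE x in M. norm ((norm (g x))^2) <= norm ((norm (f x))^2)"
  using assms(3) by eventually_elim (simp add: power_mono)
 show 1: "L2 M g" unfolding L2_def
  using integrable_bound'[OF L2_integrable[OF assms(1)] _ ae] assms(2) by simp
 show "n2 M g <= n2 M f" unfolding n2_def
  by (intro real_sqrt_le_mono integral_mono_AE L2_integrable 1 assms(1)) (use ae in auto)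
qed

lemma L2_scaleR: "L2 M f ==> L2 M (%x. c *\<^sub>R f x)"
 by (auto simp: L2_def power_mult_distrib)

lemma n2_scaleR: "n2 M (%x. c *\<^sub>R f x) = \<bar>c\<bar> * n2 M f"
 by (simp add: n2_def power_mult_distrib real_sqrt_mult)

lemma norm_add_sq_le: "(norm (a + b :: 'b::real_normed_vector))^2 <= 2 * (norm a)^2 + 2 * (norm b)^2"
proof -
 have "(norm (a + b))^2 <= (norm a + norm b)^2" by (intro power_mono norm_triangle_ineq) auto
 also have "\<dots> <= 2 * (norm a)^2 + 2 * (norm b)^2"
  using sum_squares_bound[of "norm a" "norm b"] by (simp add: power2_sum)
 finally show ?thesis .
qed

lemma L2_add:
 assumes "L2 M f" "L2 M g" shows "L2 M (%x. f x + g x)"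
proof -
 note [measurable] = assms[THEN L2_measurable]
 have "integrable M (%x. 2 * (norm (f x))^2 + 2 * (norm (g x))^2)"
  using assms by (auto simp: L2_def)
 then have "integrable M (%x. (norm (f x + g x))^2)"
  by (rule integrable_bound') (use norm_add_sq_le in auto)
 then show ?thesis by (simp add: L2_def)
qed

lemma L2_minus: "L2 M f ==> L2 M (%x. - f x)"
 by (auto simp: L2_def)

lemma L2_diff: "L2 M f ==> L2 M g ==> L2 M (%x. f x - g x)"
 using L2_add[of M f "%x. - g x"] L2_minus[of M g] by simp

lemma L2_cmult: "L2 M (f :: 'a \<Rightarrow> real) ==> L2 M (%x. c * f x)"
 using L2_scaleR[of M f c] by simp

lemma n2_cmult: "n2 M (%x. c * f x :: real) = \<bar>c\<bar> * n2 M f"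
 using n2_scaleR[of M c f] by simp

lemma n2_commute: "n2 M (%x. f x - g x) = n2 M (%x. g x - f x)"
 by (simp add: n2_def norm_minus_commute)

lemma integrable_inner_L2:
 assumes "L2 M f" "L2 M g" shows "integrable M (%x. f x \<bullet> g x)"
proof -
 note [measurable] = assms[THEN L2_measurable]
 have "\<bar>a \<bullet> b\<bar> <= (norm a)^2 + (norm b)^2" for a b :: 'b
  using Cauchy_Schwarz_ineq2[of a b] sum_squares_bound[of "norm a" "norm b"]
   zero_le_power2[of "norm a"] zero_le_power2[of "norm b"] by linarith
 then show ?thesis
  by (intro integrable_bound'[OF integrable_add'[OF L2_integrable[OF assms(1)] L2_integrable[OF assms(2)]]]) simp_all
qed

lemma integrable_mult_L2:
 "L2 M f ==> L2 M g ==> integrable M (%x. f x * g x :: real)"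
 using integrable_inner_L2[of M f g] by simp

lemma n2_add_sq:
 assumes "L2 M f" "L2 M g"
 shows "(n2 M (%x. f x + g x))^2 = (n2 M f)^2 + 2 * (LINT x|M. f x \<bullet> g x) + (n2 M g)^2"
proof -
 have "(norm (f x + g x))^2 = (norm (f x))^2 + 2 * (f x \<bullet> g x) + (norm (g x))^2" for x
  by (simp add: power2_norm_eq_inner inner_add inner_commute)
 then show ?thesis
  unfolding n2_sq using assms[THEN L2_integrable] integrable_inner_L2[OF assms] by simp
qed

text \<open>The quadratic form of \<open>s * f + t * g\<close> is nonnegative; it is evaluated at
  \<open>s = n2 M g\<close> and \<open>t\<close> equal to plus or minus \<open>n2 M f\<close>.
  Cancelling the product of the norms requires it to be nonzero, hence the case distinction.\<close>

lemma L2_Cauchy_Schwarz: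
 assumes "L2 M f" "L2 M g"
 shows "\<bar>LINT x|M. f x \<bullet> g x\<bar> <= n2 M f * n2 M g"
proof -
 define C where "C = (LINT x|M. f x \<bullet> g x)"
 have *: "0 <= s^2 * (n2 M f)^2 + 2 * (s * t * C) + t^2 * (n2 M g)^2" for s t
 proof -
  have "(n2 M (%x. s *\<^sub>R f x + t *\<^sub>R g x))^2 = s^2 * (n2 M f)^2 + 2 * (s * t * C) + t^2 * (n2 M g)^2"
   by (subst n2_add_sq) (use assms in \<open>auto intro: L2_scaleR simp: n2_scaleR power_mult_distrib C_def\<close>)
  then show ?thesis by (metis zero_le_power2)
 qed
 show ?thesis
 proof (cases "n2 M f * n2 M g = 0")
  case True
  have "C = 0"
  proof (rule ccontr)
   assume C: "C \<noteq> 0"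
   consider "n2 M f = 0" | "n2 M g = 0" using True by auto
   then show False
   proof cases
    case 1
    \<comment> \<open>With \<open>n2 M f = 0\<close> the form is affine in \<open>s\<close>, and
      this \<open>s\<close> makes it negative.\<close>
    have "- ((n2 M g)^2 + 1) / C * 1 * C = - ((n2 M g)^2 + 1)" using C by simp
    with *[of "- ((n2 M g)^2 + 1) / C" 1] 1 have "0 <= 2 * (- ((n2 M g)^2 + 1)) + (n2 M g)^2"
     by (simp only: power2_eq_square mult_zero_right add_0 mult_1)
    then have "(n2 M g)^2 <= -2" by simp
    from order_trans[OF zero_le_power2 this] show False by simp
   next
    case 2
    have "1 * (- ((n2 M f)^2 + 1) / C) * C = - ((n2 M f)^2 + 1)" using C by simp
    with *[of 1 "- ((n2 M f)^2 + 1) / C"] 2 have "0 <= (n2 M f)^2 + 2 * (- ((n2 M f)^2 + 1))"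
     by (simp only: power2_eq_square mult_zero_right add_0_right mult_1)
    then have "(n2 M f)^2 <= -2" by simp
    from order_trans[OF zero_le_power2 this] show False by simp
   qed
  qed
  then show ?thesis by (simp add: C_def)
 next
  case False
  then have pos: "n2 M f > 0" "n2 M g > 0"
   by (metis mult_zero_left n2_nonneg order_le_less, metis mult_zero_right n2_nonneg order_le_less)
  have e1: "0 <= 2 * (n2 M f * n2 M g) * (n2 M f * n2 M g + C)"
   using *[of "n2 M g" "n2 M f"] by (simp add: power2_eq_square algebra_simps)
  have e2: "0 <= 2 * (n2 M f * n2 M g) * (n2 M f * n2 M g - C)"
   using *[of "n2 M g" "- n2 M f"] by (simp add: power2_eq_square algebra_simps)
  have P: "n2 M f * n2 M g > 0" using pos by simp
  have "0 <= n2 M f * n2 M g + C" "0 <= n2 M f * n2 M g - C"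
   using e1 e2 P by (simp_all add: zero_le_mult_iff)
  then show ?thesis by (simp add: C_def)
 qed
qed

lemma L2_Cauchy_Schwarz_real:
 "L2 M f ==> L2 M g ==> \<bar>LINT x|M. f x * g x :: real\<bar> <= n2 M f * n2 M g"
 using L2_Cauchy_Schwarz[of M f g] by simp

lemma n2_triangle:
 assumes "L2 M f" "L2 M g"
 shows "n2 M (%x. f x + g x) <= n2 M f + n2 M g"
proof -
 have "(n2 M (%x. f x + g x))^2 <= (n2 M f + n2 M g)^2"
  unfolding n2_add_sq[OF assms] using L2_Cauchy_Schwarz[OF assms] by (simp add: power2_sum)
 then show ?thesis by (rule power2_le_imp_le) simp
qed

lemma n2_minus: "n2 M (%x. - f x) = n2 M f"
 by (simp add: n2_def)

lemma n2_triangle_diff: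
 assumes "L2 M f" "L2 M g"
 shows "n2 M (%x. f x - g x) <= n2 M f + n2 M g"
 using n2_triangle[OF assms(1) L2_minus[OF assms(2)]] n2_minus[of M g] by simp

lemma n2_triangle3:
 assumes "L2 M f" "L2 M g" "L2 M h"
 shows "n2 M (%x. f x - h x) <= n2 M (%x. f x - g x) + n2 M (%x. g x - h x)"
 using n2_triangle[OF L2_diff[OF assms(1,2)] L2_diff[OF assms(2,3)]] by simp

lemma n2_diff_abs:
 assumes "L2 M f" "L2 M g"
 shows "\<bar>n2 M f - n2 M g\<bar> <= n2 M (%x. f x - g x)"
 using n2_triangle[OF assms(2) L2_diff[OF assms]] n2_triangle[OF assms(1) L2_diff[OF assms(2,1)]]
  n2_commute[of M f g] by auto

text \<open>Fatou's lemma with integrability of the limit included. It carries norm bounds from test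
  functions to limits that are known only almost everywhere.\<close>

lemma Fatou_bound:
 fixes u :: "nat \<Rightarrow> 'a \<Rightarrow> real"
 assumes u: "!!k. integrable M (u k)" "!!k x. 0 <= u k x" and v: "v \<in> borel_measurable M"
  and ae: "AE x in M. (%k. u k x) \<longlonglongrightarrow> v x"
  and c: "!!k. (LINT x|M. u k x) <= c k" "c \<longlonglongrightarrow> C"
 shows "integrable M v" "(LINT x|M. v x) <= C"
proof -
 have v0: "AE x in M. 0 <= v x"
  using ae by eventually_elim (rule LIMSEQ_le_const, auto intro: u(2))
 have "(\<integral>\<^sup>+x. ennreal (v x) \<partial>M) = (\<integral>\<^sup>+x. liminf (%k. ennreal (u k x)) \<partial>M)"
 proof (rule nn_integral_cong_AE, use ae in eventually_elim)
  fix x assume "(%k. u k x) \<longlonglongrightarrow> v x"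
  then have "(%k. ennreal (u k x)) \<longlonglongrightarrow> ennreal (v x)" by (rule tendsto_ennrealI)
  then show "ennreal (v x) = liminf (%k. ennreal (u k x))"
   by (simp add: lim_imp_Liminf)
 qed
 also have "\<dots> <= liminf (%k. \<integral>\<^sup>+x. ennreal (u k x) \<partial>M)"
  using u(1) by (intro nn_integral_liminf) auto
 also have "\<dots> <= liminf (%k. ennreal (c k))"
 proof (rule Liminf_mono)
  show "\<forall>\<^sub>F k in sequentially. (\<integral>\<^sup>+x. ennreal (u k x) \<partial>M) <= ennreal (c k)"
   using c(1) u by (intro always_eventually) (auto simp: nn_integral_eq_integral intro!: ennreal_leI)
 qed
 also have "\<dots> = ennreal C"
  using tendsto_ennrealI[OF c(2)] by (simp add: lim_imp_Liminf)
 finally have *: "(\<integral>\<^sup>+x. ennreal (v x) \<partial>M) <= ennreal C" .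
 have "0 <= (LINT x|M. u k x)" for k by (rule integral_nonneg') (rule u)
 then have "0 <= c k" for k using c(1)[of k] order_trans by blast
 then have "C \<ge> 0" using LIMSEQ_le_const[OF c(2)] by blast
 have eq: "(\<integral>\<^sup>+x. ennreal (norm (v x)) \<partial>M) = (\<integral>\<^sup>+x. ennreal (v x) \<partial>M)"
  by (rule nn_integral_cong_AE) (use v0 in auto)
 show int: "integrable M v"
  by (rule integrableI_bounded[OF v]) (use eq * in \<open>simp add: le_less_trans[OF _ ennreal_less_top]\<close>)
 show "(LINT x|M. v x) <= C"
  using * int v0 \<open>C \<ge> 0\<close> by (simp add: nn_integral_eq_integral)
qed

lemma L2_convergence_AE_subseq:
 assumes "!!n. L2 M (f n)" "L2 M g" "(%n. n2 M (%x. f n x - g x)) \<longlonglongrightarrow> 0"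
 obtains r where "strict_mono (r :: nat \<Rightarrow> nat)" "AE x in M. (%n. f (r n) x) \<longlonglongrightarrow> g x"
proof -
 have "(%n. (n2 M (%x. f n x - g x))^2) \<longlonglongrightarrow> 0^2"
  by (intro tendsto_intros assms)
 then have "(%n. (LINT x|M. norm ((norm (f n x - g x))^2))) \<longlonglongrightarrow> 0"
  by (simp add: n2_sq)
 from tendsto_L1_AE_subseq[OF L2_integrable[OF L2_diff[OF assms(1,2)]] this]
 obtain r where r: "strict_mono (r :: nat \<Rightarrow> nat)" "AE x in M. (%n. (norm (f (r n) x - g x))^2) \<longlonglongrightarrow> 0"
  by blast
 have "AE x in M. (%n. f (r n) x) \<longlonglongrightarrow> g x"
  using r(2)
 proof eventually_elim
  fix x assume "(%n. (norm (f (r n) x - g x))^2) \<longlonglongrightarrow> 0"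
  then have "(%n. sqrt ((norm (f (r n) x - g x))^2)) \<longlonglongrightarrow> sqrt 0" by (intro tendsto_intros)
  then show "(%n. f (r n) x) \<longlonglongrightarrow> g x" by (simp add: tendsto_norm_zero_iff LIM_zero_iff)
 qed
 then show thesis using that r(1) by blast
qed

text \<open>The Riesz-Fischer argument: along a subsequence with differences below
  \<open>(1/2)^k\<close> the increments are absolutely summable almost everywhere. Finiteness of the
  measure allows the \<open>L1\<close> norms of the increments to be estimated by pairing with the
  constant 1.\<close>

lemma L2_complete:
 fixes f :: "nat \<Rightarrow> 'a \<Rightarrow> 'b::euclidean_space"
 assumes fin: "finite_measure M" and f: "!!n. L2 M (f n)"
  and Cauchy: "!!e. e > 0 ==> \<exists>N. \<forall>m\<ge>N. \<forall>n\<ge>N. n2 M (%x. f m x - f n x) < e"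
 obtains g where "L2 M g" "(%n. n2 M (%x. f n x - g x)) \<longlonglongrightarrow> 0"
proof -
 interpret finite_measure M by fact
 note [measurable] = f[THEN L2_measurable]
 obtain N where N: "!!k m n. m \<ge> N k ==> n \<ge> N k ==> n2 M (%x. f m x - f n x) < (1/2)^k"
  using Cauchy[of "(1/2)^k" for k] by (metis zero_less_divide_1_iff zero_less_numeral zero_less_power)
 \<comment> \<open>The sum dominates \<open>N k\<close>, and the extra summand \<open>k\<close>
   makes the sequence strictly increasing.\<close>
 define r where "r k = (\<Sum>i\<le>k. N i) + k" for k
 have r: "strict_mono r" by (rule strict_mono_Suc_iff[THEN iffD2]) (auto simp: r_def)
 have rN: "r k \<ge> N k" for k unfolding r_def by (rule trans_le_add1) (auto intro: member_le_sum)
 define c where "c = n2 M (%x. 1 :: real)"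
 have L1: "L2 M (%x. 1 :: real)" by (auto simp: L2_def)
 have diff: "(\<integral>\<^sup>+x. ennreal (norm (f (r (Suc k)) x - f (r k) x)) \<partial>M) <= ennreal (c * (1/2)^k)" for k
 proof -
  have L: "L2 M (%x. norm (f (r (Suc k)) x - f (r k) x))"
   using L2_diff[OF f f] by (auto simp: L2_def)
  have i: "integrable M (%x. norm (f (r (Suc k)) x - f (r k) x))"
   using integrable_mult_L2[OF L L1] by simp
  have "(LINT x|M. norm (f (r (Suc k)) x - f (r k) x) * 1) <= n2 M (%x. norm (f (r (Suc k)) x - f (r k) x)) * c"
   using L2_Cauchy_Schwarz_real[OF L L1] unfolding c_def by linarith
  also have "n2 M (%x. norm (f (r (Suc k)) x - f (r k) x)) = n2 M (%x. f (r (Suc k)) x - f (r k) x)"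
   by (simp add: n2_def)
  also have "\<dots> * c <= (1/2)^k * c"
  proof (rule mult_right_mono)
   have "r (Suc k) \<ge> N k" using rN[of k] r by (meson le_trans lessI less_imp_le strict_mono_less)
   then show "n2 M (%x. f (r (Suc k)) x - f (r k) x) <= (1/2)^k" using N[of k] rN by (meson less_imp_le)
  qed (simp add: c_def n2_nonneg)
  finally show ?thesis using i by (simp add: nn_integral_eq_integral ennreal_leI mult.commute)
 qed
 have "(\<integral>\<^sup>+x. (\<Sum>k. ennreal (norm (f (r (Suc k)) x - f (r k) x))) \<partial>M) = (\<Sum>k. \<integral>\<^sup>+x. ennreal (norm (f (r (Suc k)) x - f (r k) x)) \<partial>M)"
  by (rule nn_integral_suminf) measurable
 also have "\<dots> <= (\<Sum>k. ennreal (c * (1/2)^k))"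
  by (intro suminf_le diff) auto
 also have "\<dots> = ennreal (\<Sum>k. c * (1/2)^k)"
  by (rule suminf_ennreal2) (auto simp: c_def n2_nonneg intro!: summable_mult summable_geometric)
 also have "\<dots> < \<infinity>" by simp
 finally have "AE x in M. (\<Sum>k. ennreal (norm (f (r (Suc k)) x - f (r k) x))) \<noteq> \<infinity>"
  by (intro nn_integral_PInf_AE) auto
 then have conv: "AE x in M. convergent (%k. f (r k) x)"
 proof eventually_elim
  fix x assume "(\<Sum>k. ennreal (norm (f (r (Suc k)) x - f (r k) x))) \<noteq> \<infinity>"
  then have "summable (%k. norm (f (r (Suc k)) x - f (r k) x))"
   by (intro summable_suminf_not_top) (auto simp: infinity_ennreal_def)
  then have "summable (%k. f (r (Suc k)) x - f (r k) x)" by (rule summable_norm_cancel)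
  then have "convergent (%n. \<Sum>k<n. f (r (Suc k)) x - f (r k) x)" by (simp add: summable_iff_convergent)
  then have "convergent (%n. f (r n) x - f (r 0) x)" 
   by (simp add: sum_lessThan_telescope[of "%k. f (r k) x"])
  then show "convergent (%k. f (r k) x)"
   using convergent_add[OF _ convergent_const[of "f (r 0) x"]] by force
 qed
 define g where "g x = lim (%k. f (r k) x)" for x
 have g[measurable]: "g \<in> borel_measurable M" unfolding g_def by (rule borel_measurable_lim_metric) measurable
 have lim: "AE x in M. (%k. f (r k) x) \<longlonglongrightarrow> g x"
  using conv unfolding g_def by eventually_elim (simp add: convergent_LIMSEQ_iff)
 \<comment> \<open>Fatou along the subsequence with \<open>n\<close> fixed; the shift by
   \<open>K\<close> places every index in the range where the Cauchy bound holds.\<close>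
 have key: "integrable M (%x. (norm (f n x - g x))^2) \<and> (LINT x|M. (norm (f n x - g x))^2) <= e^2"
  if e: "!!m. m \<ge> K ==> n2 M (%x. f n x - f m x) <= e" for n K e
 proof -
  have A: "AE x in M. (%k. (norm (f n x - f (r (k + K)) x))^2) \<longlonglongrightarrow> (norm (f n x - g x))^2"
   using lim
  proof eventually_elim
   fix x assume "(%k. f (r k) x) \<longlonglongrightarrow> g x"
   then have "(%k. f (r (k + K)) x) \<longlonglongrightarrow> g x" by (rule LIMSEQ_ignore_initial_segment)
   then show "(%k. (norm (f n x - f (r (k + K)) x))^2) \<longlonglongrightarrow> (norm (f n x - g x))^2"
    by (intro tendsto_intros)
  qed
  have B: "(LINT x|M. (norm (f n x - f (r (k + K)) x))^2) <= e^2" for k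
  proof -
   have "r (k + K) \<ge> K" using seq_suble[OF r, of "k + K"] by linarith
   then show ?thesis using e[of "r (k + K)"] unfolding n2_sq[symmetric] by (intro power_mono) auto
  qed
  show ?thesis
   using Fatou_bound[of M "%k x. (norm (f n x - f (r (k + K)) x))^2", OF _ _ _ A B tendsto_const]
    L2_integrable[OF L2_diff[OF f f]] by auto
 qed
 have Lfg: "L2 M (%x. f n x - g x) \<and> n2 M (%x. f n x - g x) <= e"
  if "!!m. m \<ge> K ==> n2 M (%x. f n x - f m x) <= e" "e \<ge> 0" for n K e
  using key[of K n e, OF that(1)] that(2) by (auto simp: L2_def n2_def real_le_lsqrt intro: real_le_lsqrt)
 have "L2 M (%x. f (N 0) x - g x)"
  using Lfg[of "N 0" "N 0" 1] N[where k = 0] by (force intro: less_imp_le)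
 from L2_diff[OF f[of "N 0"] this] have "L2 M g" by simp
 moreover have "(%n. n2 M (%x. f n x - g x)) \<longlonglongrightarrow> 0"
 proof (rule LIMSEQ_I)
  fix e :: real assume "0 < e"
  then obtain K where K: "!!m n. m \<ge> K ==> n \<ge> K ==> n2 M (%x. f m x - f n x) < e/2"
   using Cauchy[of "e/2"] by auto
  have "n2 M (%x. f n x - g x) <= e/2" if "n \<ge> K" for n
   using Lfg[of K n "e/2"] K that \<open>0 < e\<close> by (force intro: less_imp_le)
  then show "\<exists>no. \<forall>n\<ge>no. norm (n2 M (%x. f n x - g x) - 0) < e"
   using \<open>0 < e\<close> by (intro exI[of _ K]) fastforce
 qed
 ultimately show thesis using that by blast
qed

lemma L2_integrable_finite:
 assumes "finite_measure M" "L2 M f" shows "integrable M f"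
proof -
 interpret finite_measure M by fact
 have b: "norm y <= 1 + (norm y)^2" for y :: 'b
  using zero_le_power2[of "norm y - 1/2"] by (simp add: power2_eq_square algebra_simps)
 have "integrable M (%x. 1 + (norm (f x))^2)" using L2_integrable[OF assms(2)] by simp
 then show ?thesis
  by (rule integrable_bound') (use L2_measurable[OF assms(2)] b in auto)
qed

subsection \<open>Gradients of test functions\<close>

definition grad :: "('a::euclidean_space \<Rightarrow> real) \<Rightarrow> 'a \<Rightarrow> 'a" where
 "grad \<phi> x = (\<Sum>b\<in>Basis. frechet_derivative \<phi> (at x) b *\<^sub>R b)"

lemma grad_inner_Basis: "b \<in> Basis ==> grad \<phi> x \<bullet> b = frechet_derivative \<phi> (at x) b"
 by (simp add: grad_def inner_sum_left inner_Basis if_distrib cong: if_cong)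

lemma grad_eqI:
 assumes "(\<phi> has_derivative (%h. v \<bullet> h)) (at x)" shows "grad \<phi> x = v"
proof (rule euclidean_eqI)
 fix b :: 'a assume "b \<in> Basis"
 then show "grad \<phi> x \<bullet> b = v \<bullet> b"
  using frechet_derivative_at[OF assms] by (metis grad_inner_Basis)
qed

lemma has_derivative_grad:
 assumes "\<phi> differentiable at x"
 shows "(\<phi> has_derivative (%h. grad \<phi> x \<bullet> h)) (at x)"
proof -
 have D: "(\<phi> has_derivative frechet_derivative \<phi> (at x)) (at x)"
  using assms frechet_derivative_works by blast
 then have lin: "linear (frechet_derivative \<phi> (at x))" using has_derivative_linear by blast
 have "frechet_derivative \<phi> (at x) h = grad \<phi> x \<bullet> h" for h
 proof -
  have "frechet_derivative \<phi> (at x) h = frechet_derivative \<phi> (at x) (\<Sum>b\<in>Basis. (h \<bullet> b) *\<^sub>R b)"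
   by (simp add: euclidean_representation)
  also have "\<dots> = (\<Sum>b\<in>Basis. (h \<bullet> b) * frechet_derivative \<phi> (at x) b)"
   by (simp add: linear_sum[OF lin] linear_scale[OF lin])
  also have "\<dots> = grad \<phi> x \<bullet> h"
   unfolding grad_def inner_sum_left inner_scaleR_left
   by (intro sum.cong refl) (simp add: inner_commute mult.commute)
  finally show ?thesis .
 qed
 then have "frechet_derivative \<phi> (at x) = (%h. grad \<phi> x \<bullet> h)" by blast
 then show ?thesis using D by metis
qed

lemma smooth_on_differentiable: "smooth_on S f ==> x \<in> S ==> f differentiable at x"
 using smooth_on_has_derivative differentiable_def by blast

lemma smooth_on_has_derivative_grad:
 "smooth_on S f ==> x \<in> S ==> (f has_derivative (%h. grad f x \<bullet> h)) (at x)"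
 by (intro has_derivative_grad smooth_on_differentiable)

lemma grad_add:
 assumes "f differentiable at x" "g differentiable at x"
 shows "grad (%x. f x + g x) x = grad f x + grad g x"
 by (rule grad_eqI) (use has_derivative_add[OF has_derivative_grad[OF assms(1)] has_derivative_grad[OF assms(2)]] in \<open>simp add: inner_add_left\<close>)

lemma grad_diff:
 assumes "f differentiable at x" "g differentiable at x"
 shows "grad (%x. f x - g x) x = grad f x - grad g x"
 by (rule grad_eqI) (use has_derivative_diff[OF has_derivative_grad[OF assms(1)] has_derivative_grad[OF assms(2)]] in \<open>simp add: inner_diff_left\<close>)

lemma grad_mult:
 assumes "f differentiable at x" "g differentiable at x"
 shows "grad (%x. f x * g x) x = f x *\<^sub>R grad g x + g x *\<^sub>R grad f x"
 by (rule grad_eqI) (use has_derivative_mult[OF has_derivative_grad[OF assms(1)] has_derivative_grad[OF assms(2)]] in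
  \<open>simp add: inner_add_left mult.commute\<close>)

lemma grad_cmult:
 assumes "f differentiable at x" shows "grad (%x. c * f x) x = c *\<^sub>R grad f x"
 by (rule grad_eqI) (use has_derivative_mult_right[OF has_derivative_grad[OF assms]] in simp)

lemma grad_compose:
 assumes "f differentiable at x" "(g has_real_derivative g') (at (f x))"
 shows "grad (%x. g (f x)) x = g' *\<^sub>R grad f x"
 by (rule grad_eqI) (use has_derivative_compose[OF has_derivative_grad[OF assms(1)], of g "(*) g'"] assms(2) in
  \<open>simp add: has_field_derivative_def\<close>)

lemma smooth_on_continuous_grad: "smooth_on S f ==> continuous_on S (grad f)"
 unfolding grad_def
 by (intro continuous_on_sum continuous_on_scaleR continuous_on_const smooth_on_continuous smooth_on_frechet_derivative)

lemma integrable_compact_support: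
 fixes f :: "'a::euclidean_space \<Rightarrow> 'b::{banach, second_countable_topology}"
 assumes "continuous_on UNIV f" "compact K" "!!x. x \<notin> K ==> f x = 0"
 shows "integrable lborel f"
proof -
 have "(%x. indicator K x *\<^sub>R f x) = f" using assms(3) by (auto simp: indicator_def)
 then show ?thesis
  using borel_integrable_compact[OF assms(2), of f] continuous_on_subset[OF assms(1)] by auto
qed

lemma L2_compact_support:
 fixes f :: "'a::euclidean_space \<Rightarrow> 'b::euclidean_space"
 assumes "continuous_on UNIV f" "compact K" "!!x. x \<notin> K ==> f x = 0"
 shows "L2 lborel f"
 unfolding L2_def
proof
 show "f \<in> borel_measurable lborel" using assms(1) by (simp add: borel_measurable_continuous_onI)
 show "integrable lborel (%x. (norm (f x))^2)"
  by (rule integrable_compact_support[OF _ assms(2)]) (use assms in \<open>auto intro!: continuous_intros\<close>)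
qed

lemma tf_grad_outside:
 assumes "\<phi> \<in> test_functions \<Omega>" "x \<notin> \<Omega>" shows "grad \<phi> x = 0"
 unfolding grad_def
 using tf_outside[OF tf_frechet_derivative[OF assms(1)] assms(2)] by simp

lemma tf_continuous: "\<phi> \<in> test_functions \<Omega> ==> continuous_on UNIV \<phi>"
 by (intro smooth_on_continuous tf_smooth)

lemma tf_measurable[measurable_dest]: "\<phi> \<in> test_functions \<Omega> ==> \<phi> \<in> borel_measurable borel"
 by (intro borel_measurable_continuous_onI tf_continuous)

lemma tf_differentiable: "\<phi> \<in> test_functions \<Omega> ==> \<phi> differentiable at x"
 by (meson UNIV_I smooth_on_differentiable tf_smooth)

lemma tf_continuous_grad: "\<phi> \<in> test_functions \<Omega> ==> continuous_on UNIV (grad \<phi>)"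
 by (intro smooth_on_continuous_grad tf_smooth)

lemma tf_measurable_grad[measurable (raw)]: "\<phi> \<in> test_functions \<Omega> ==> grad \<phi> \<in> borel_measurable borel"
 by (intro borel_measurable_continuous_onI tf_continuous_grad)

lemma tf_integrable: "\<phi> \<in> test_functions \<Omega> ==> integrable lborel \<phi>"
 by (erule test_functionsE) (rule integrable_compact_support, auto intro: smooth_on_continuous)

lemma tf_L2: "\<phi> \<in> test_functions \<Omega> ==> L2 lborel \<phi>"
 by (erule test_functionsE) (rule L2_compact_support, auto intro: smooth_on_continuous)

lemma tf_grad_support:
 assumes "\<phi> \<in> test_functions \<Omega>"
 obtains K where "compact K" "K \<subseteq> \<Omega>" "!!x. x \<notin> K ==> \<phi> x = 0" "!!x. x \<notin> K ==> grad \<phi> x = 0"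
proof -
 obtain K where K: "smooth_on UNIV \<phi>" "compact K" "K \<subseteq> \<Omega>" "!!x. x \<notin> K ==> \<phi> x = 0"
  by (rule test_functionsE[OF assms(1)], rule that)
 have "\<phi> \<in> test_functions K" using K by (intro test_functionsI) auto
 then show thesis using that[of K] K tf_grad_outside[of \<phi> K] by blast
qed

lemma tf_grad_L2:
 assumes "\<phi> \<in> test_functions \<Omega>" shows "L2 lborel (grad \<phi>)"
proof -
 obtain K where K: "compact K" "K \<subseteq> \<Omega>" "!!x. x \<notin> K ==> \<phi> x = 0" "!!x. x \<notin> K ==> grad \<phi> x = 0"
  by (rule tf_grad_support[OF assms(1)], rule that)
 show ?thesis
  by (rule L2_compact_support[OF tf_continuous_grad[OF assms] K(1) K(4)])
qed

lemma tf_grad_add: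
 "\<phi> \<in> test_functions U ==> \<psi> \<in> test_functions V ==> grad (%x. \<phi> x + \<psi> x) = (%x. grad \<phi> x + grad \<psi> x)"
 by (rule ext, rule grad_add) (auto intro: tf_differentiable)

lemma tf_grad_diff:
 "\<phi> \<in> test_functions U ==> \<psi> \<in> test_functions V ==> grad (%x. \<phi> x - \<psi> x) = (%x. grad \<phi> x - grad \<psi> x)"
 by (rule ext, rule grad_diff) (auto intro: tf_differentiable)

lemma tf_grad_cmult:
 "\<phi> \<in> test_functions U ==> grad (%x. c * \<phi> x) = (%x. c *\<^sub>R grad \<phi> x)"
 by (rule ext, rule grad_cmult) (auto intro: tf_differentiable)

subsection \<open>Integration along lines\<close>

lemma nn_integral_shift:
 fixes f :: "'a::euclidean_space \<Rightarrow> ennreal"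
 assumes "f \<in> borel_measurable borel"
 shows "(NI x. f (x + c)) = (NI x. f x)"
 using nn_integral_distr[of "(+) c" lborel borel f] assms
 by (simp add: lborel_distr_plus add.commute[of _ c])

lemma integral_shift:
 fixes f :: "'a::euclidean_space \<Rightarrow> real"
 assumes "f \<in> borel_measurable borel"
 shows "(LBINT x. f (x + c)) = (LBINT x. f x)"
 using integral_distr[of "(+) c" lborel borel f] assms
 by (simp add: lborel_distr_plus add.commute[of _ c])

lemma integrable_shift:
 fixes f :: "'a::euclidean_space \<Rightarrow> real"
 assumes "integrable lborel f"
 shows "integrable lborel (%x. f (x + c))"
proof -
 have "f \<in> borel_measurable borel" using borel_measurable_integrable[OF assms] by simp
 then show ?thesis
  using integrable_distr_eq[of "(+) c" lborel borel f] assms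
  by (simp add: lborel_distr_plus add.commute[of _ c])
qed

lemma line_derivative:
 assumes "smooth_on UNIV \<phi>"
 shows "((%s. \<phi> (x + s *\<^sub>R h)) has_real_derivative grad \<phi> (x + s *\<^sub>R h) \<bullet> h) (at s)"
proof -
 have "((%s. x + s *\<^sub>R h) has_derivative (%s. s *\<^sub>R h)) (at s)"
  by (auto intro!: derivative_eq_intros)
 from has_derivative_compose[OF this smooth_on_has_derivative_grad[OF assms UNIV_I]]
 show ?thesis by (simp add: has_field_derivative_def mult_commute_abs)
qed

lemma line_continuous:
 assumes "smooth_on UNIV \<phi>"
 shows "continuous_on UNIV (%s. grad \<phi> (x + s *\<^sub>R h) \<bullet> h)"
 by (intro continuous_intros continuous_on_compose2[OF smooth_on_continuous_grad[OF assms]]) auto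

lemma line_integral:
 assumes "smooth_on UNIV \<phi>" "0 <= L"
 shows "(LINT s|lborel. (grad \<phi> (x + s *\<^sub>R h) \<bullet> h) * indicator {0..L} s) = \<phi> (x + L *\<^sub>R h) - \<phi> x"
 using integral_FTC_Icc_real[OF assms(2) line_derivative[OF assms(1), of x h]]
  line_continuous[OF assms(1), of x h] by (simp add: continuous_on_eq_continuous_at)

lemma line_Cauchy_Schwarz:
 assumes "smooth_on UNIV \<phi>" "0 <= L"
 shows "ennreal ((\<phi> (x + L *\<^sub>R h) - \<phi> x)^2) <=
  ennreal L * (NI s. ennreal ((grad \<phi> (x + s *\<^sub>R h) \<bullet> h)^2) * indicator {0..L} s)"
proof -
 define u where "u s = (grad \<phi> (x + s *\<^sub>R h) \<bullet> h) * indicator {0..L} s" for s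
 have c: "continuous_on UNIV (%s. grad \<phi> (x + s *\<^sub>R h) \<bullet> h)" by (rule line_continuous[OF assms(1)])
 have [measurable]: "(%s. grad \<phi> (x + s *\<^sub>R h) \<bullet> h) \<in> borel_measurable borel"
  by (rule borel_measurable_continuous_onI[OF c])
 have sq: "(u s)^2 = indicator {0..L} s *\<^sub>R (grad \<phi> (x + s *\<^sub>R h) \<bullet> h)^2" for s
  by (auto simp: u_def indicator_def)
 have "integrable lborel (%s. indicator {0..L} s *\<^sub>R (grad \<phi> (x + s *\<^sub>R h) \<bullet> h)^2)"
  by (rule borel_integrable_compact) (auto intro!: continuous_intros continuous_on_subset[OF c])
 then have int: "integrable lborel (%s. (u s)^2)" by (simp add: sq)
 have [measurable]: "u \<in> borel_measurable borel" unfolding u_def by measurable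
 from int have L2u: "L2 lborel u" by (auto simp: L2_def)
 have ip: "(indicator {0..L} s :: real)^2 = indicator {0..L} s" for s by (auto simp: indicator_def)
 have L2i: "L2 lborel (indicator {0..L} :: real \<Rightarrow> real)" using assms(2) by (auto simp: L2_def ip)
 have n2i: "n2 lborel (indicator {0..L} :: real \<Rightarrow> real) = sqrt L" using assms(2) by (simp add: n2_def ip)
 have "\<bar>LINT s|lborel. u s * indicator {0..L} s\<bar> <= n2 lborel u * sqrt L"
  using L2_Cauchy_Schwarz_real[OF L2u L2i] by (simp add: n2i)
 moreover have "(%s. u s * indicator {0..L} s) = u" by (auto simp: u_def indicator_def)
 ultimately have "\<bar>\<phi> (x + L *\<^sub>R h) - \<phi> x\<bar> <= n2 lborel u * sqrt L"
  using line_integral[OF assms, of x h] by (simp add: u_def[symmetric])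
 then have "\<bar>\<phi> (x + L *\<^sub>R h) - \<phi> x\<bar>^2 <= (n2 lborel u * sqrt L)^2" by (intro power_mono) auto
 then have "(\<phi> (x + L *\<^sub>R h) - \<phi> x)^2 <= L * (LINT s|lborel. (u s)^2)"
  using assms(2) by (simp add: power_mult_distrib n2_sq_real mult.commute)
 then have "ennreal ((\<phi> (x + L *\<^sub>R h) - \<phi> x)^2) <= ennreal L * ennreal (LINT s|lborel. (u s)^2)"
  using assms(2) by (simp add: ennreal_mult[symmetric] ennreal_leI)
 also have "ennreal (LINT s|lborel. (u s)^2) = (NI s. ennreal ((u s)^2))"
  using int by (simp add: nn_integral_eq_integral)
 also have "\<dots> = (NI s. ennreal ((grad \<phi> (x + s *\<^sub>R h) \<bullet> h)^2) * indicator {0..L} s)"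
  by (intro nn_integral_cong) (auto simp: sq indicator_def)
 finally show ?thesis .
qed

text \<open>The derivative is integrated over all unit segments in direction \<open>b\<close>. By
  Fubini and translation invariance the result is the integral in question; by the fundamental
  theorem it is the integral of \<open>f (x + b) - f x\<close>, which vanishes by translation
  invariance again.\<close>

lemma integral_derivative_test_function:
 assumes f: "f \<in> test_functions UNIV" and b: "b \<in> Basis"
 shows "(LBINT x. frechet_derivative f (at x) b) = 0"
proof -
 define F where "F x = frechet_derivative f (at x) b" for x
 have Ft: "F \<in> test_functions UNIV" unfolding F_def by (rule tf_frechet_derivative[OF f b])
 have Fm[measurable]: "F \<in> borel_measurable borel" by (rule tf_measurable[OF Ft])
 obtain K where K: "compact K" "!!x. x \<notin> K ==> F x = 0" by (metis test_functionsE[OF Ft])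
 obtain B where B: "!!x. x \<in> K ==> norm x <= B" using compact_imp_bounded[OF K(1)] bounded_iff by blast
 have F0: "F x = 0" if "norm x > B" for x using that B[of x] K(2)[of x] by force
 \<comment> \<open>The cutoff makes Fubini applicable. Radius \<open>B + 1\<close> loses nothing,
   since shifts have length at most 1 and \<open>F\<close> vanishes outside radius
   \<open>B\<close>.\<close>
 define h where "h p = indicator (cball 0 (B + 1) \<times> {0..1}) p *\<^sub>R F (fst p + snd p *\<^sub>R b)" for p :: "'a \<times> real"
 have "integrable lborel h" unfolding h_def
  by (intro borel_integrable_compact compact_Times continuous_on_compose2[OF tf_continuous[OF Ft]] continuous_intros) auto
 then have int: "integrable (lborel \<Otimes>\<^sub>M lborel) (%(x, s). h (x, s))" by (simp add: lborel_prod case_prod_unfold)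
 have h_eq: "h (x, s) = indicator {0..1} s * F (x + s *\<^sub>R b)" for x s
 proof (cases "s \<in> {0..1} \<and> norm x > B + 1")
  case True
  have "norm x <= norm (x + s *\<^sub>R b) + norm (s *\<^sub>R b)" using norm_triangle_ineq4[of "x + s *\<^sub>R b" "s *\<^sub>R b"] by simp
  moreover have "norm (s *\<^sub>R b) <= 1" using True b by (auto simp: norm_Basis)
  ultimately have "F (x + s *\<^sub>R b) = 0" using True by (intro F0) auto
  then show ?thesis by (simp add: h_def)
 qed (auto simp: h_def indicator_def)
 have "(LINT x|lborel. LINT s|lborel. h (x, s)) = (LINT s|lborel. LINT x|lborel. h (x, s))"
  using lborel_pair.Fubini_integral[OF int] by simp
 also have "\<dots> = (LINT s|lborel. indicator {0..1::real} s * (LBINT x. F x))"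
  by (rule integral_cong'[OF refl]) (simp add: h_eq integral_shift[OF Fm])
 also have "\<dots> = (LBINT x. F x)" by (simp add: content_real)
 also have "(LINT x|lborel. LINT s|lborel. h (x, s)) = (LINT x|lborel. f (x + b) - f x)"
 proof (rule integral_cong'[OF refl])
  fix x
  show "(LINT s|lborel. h (x, s)) = f (x + b) - f x"
   using line_integral[OF tf_smooth[OF f], of 1 x b] b
   by (simp add: h_eq F_def grad_inner_Basis mult.commute)
 qed
 also have "\<dots> = (LBINT x. f (x + b)) - (LBINT x. f x)"
  by (intro integral_diff' integrable_shift tf_integrable[OF f])
 also have "\<dots> = 0" using integral_shift[OF tf_measurable[OF f], of b] by simp
 finally show ?thesis by (simp add: F_def)
qed

lemma tf_by_parts:
 assumes f: "f \<in> test_functions UNIV" and g: "smooth_on UNIV g" and b: "b \<in> Basis"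
 shows "(LBINT x. g x * frechet_derivative f (at x) b) = - (LBINT x. frechet_derivative g (at x) b * f x)"
proof -
 have t: "(%x. g x * f x) \<in> test_functions UNIV" by (rule tf_mult[OF f g])
 have eq: "frechet_derivative (%x. g x * f x) (at x) b = g x * frechet_derivative f (at x) b + frechet_derivative g (at x) b * f x" for x
  using grad_mult[OF smooth_on_differentiable[OF g UNIV_I] tf_differentiable[OF f], of x]
  by (simp add: grad_inner_Basis[OF b, symmetric] inner_add_left mult.commute)
 have "integrable lborel (%x. g x * frechet_derivative f (at x) b)"
  by (rule tf_integrable[OF tf_mult[OF tf_frechet_derivative[OF f b] g]])
 moreover have "integrable lborel (%x. frechet_derivative g (at x) b * f x)"
  by (rule tf_integrable[OF tf_mult[OF f smooth_on_frechet_derivative[OF g b]]])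
 ultimately show ?thesis
  using integral_derivative_test_function[OF t b] unfolding eq by simp
qed

text \<open>The length \<open>2 * D + 1\<close> exceeds the diameter of the ball, so every segment
  of that length starting in \<Omega> ends outside, where \<phi> vanishes. Cauchy-Schwarz along the
  segment and translation invariance give one factor of the length each.\<close>

lemma tf_Poincare:
 assumes \<phi>: "\<phi> \<in> test_functions \<Omega>" and \<Omega>: "\<Omega> \<subseteq> cball 0 D" and D: "D \<ge> 0"
 shows "n2 lborel \<phi> <= (2 * D + 1) * n2 lborel (grad \<phi>)"
proof -
 define L where "L = 2 * D + 1"
 have L: "L > 0" using D by (simp add: L_def)
 obtain b :: 'a where b: "b \<in> Basis" using nonempty_Basis by blast
 have [measurable]: "\<phi> \<in> borel_measurable borel" "grad \<phi> \<in> borel_measurable borel"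
  using tf_measurable[OF \<phi>] tf_measurable_grad[OF \<phi>] by auto
 have pt: "ennreal ((\<phi> x)^2) <= ennreal L * (NI s. ennreal ((norm (grad \<phi> (x + s *\<^sub>R - b)))^2) * indicator {0..L} s)" for x
 proof (cases "x \<in> \<Omega>")
  case True
  have "norm (L *\<^sub>R b) <= norm (x + L *\<^sub>R - b) + norm x"
   using norm_triangle_ineq4[of x "x + L *\<^sub>R - b"] by simp
  moreover have "norm y <= D" if "y \<in> \<Omega>" for y using \<Omega> that by auto
  moreover have "norm (L *\<^sub>R b) = L" using L b by simp
  ultimately have "x + L *\<^sub>R - b \<notin> \<Omega>" using True by (smt (verit, ccfv_threshold) L_def)
  then have "\<phi> (x + L *\<^sub>R - b) = 0" by (rule tf_outside[OF \<phi>])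
  then have "ennreal ((\<phi> x)^2) <= ennreal L * (NI s. ennreal ((grad \<phi> (x + s *\<^sub>R - b) \<bullet> - b)^2) * indicator {0..L} s)"
   using line_Cauchy_Schwarz[OF tf_smooth[OF \<phi>], of L x "-b"] L by simp
  also have "\<dots> <= ennreal L * (NI s. ennreal ((norm (grad \<phi> (x + s *\<^sub>R - b)))^2) * indicator {0..L} s)"
  proof (intro mult_left_mono nn_integral_mono mult_right_mono ennreal_leI)
   fix s
   have "\<bar>grad \<phi> (x + s *\<^sub>R - b) \<bullet> - b\<bar> <= norm (grad \<phi> (x + s *\<^sub>R - b))"
    using Cauchy_Schwarz_ineq2[of "grad \<phi> (x + s *\<^sub>R - b)" "-b"] b by simp
   from power_mono[OF this, of 2] show "(grad \<phi> (x + s *\<^sub>R - b) \<bullet> - b)^2 <= (norm (grad \<phi> (x + s *\<^sub>R - b)))^2" by simp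
  qed auto
  finally show ?thesis .
 qed (simp add: tf_outside[OF \<phi>])
 define G where "G x = ennreal ((norm (grad \<phi> x))^2)" for x
 have Gm[measurable]: "G \<in> borel_measurable borel" unfolding G_def by measurable
 have "(NI x. ennreal ((\<phi> x)^2)) <= (NI x. ennreal L * (NI s. G (x + s *\<^sub>R - b) * indicator {0..L} s))"
  unfolding G_def by (intro nn_integral_mono pt)
 also have "\<dots> = ennreal L * (NI x. (NI s. G (x + s *\<^sub>R - b) * indicator {0..L} s))"
  by (rule nn_integral_cmult) measurable
 also have "(NI x. (NI s. G (x + s *\<^sub>R - b) * indicator {0..L} s))
  = (NI s. (NI x. G (x + s *\<^sub>R - b) * indicator {0..L} s))"
  by (rule lborel_pair.Fubini'[symmetric]) measurable
 also have "\<dots> = (NI s. (NI x. G x) * indicator {0..L} s)"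
 proof -
  have "(NI x. G (x - s *\<^sub>R b)) = (NI x. G x)" for s
   using nn_integral_shift[OF Gm, of "- (s *\<^sub>R b)"] by simp
  then show ?thesis by (subst nn_integral_multc) auto
 qed
 also have "\<dots> = (NI x. G x) * ennreal L"
  using L by (simp add: nn_integral_cmult_indicator)
 finally have "(NI x. ennreal ((\<phi> x)^2)) <= ennreal L * ((NI x. G x) * ennreal L)" .
 moreover have "(NI x. ennreal ((\<phi> x)^2)) = ennreal ((n2 lborel \<phi>)^2)"
  unfolding n2_sq_real by (rule nn_integral_eq_integral) (use L2_integrable[OF tf_L2[OF \<phi>]] in auto)
 moreover have "(NI x. G x) = ennreal ((n2 lborel (grad \<phi>))^2)"
  unfolding n2_sq G_def by (rule nn_integral_eq_integral) (use L2_integrable[OF tf_grad_L2[OF \<phi>]] in auto)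
 ultimately have "ennreal ((n2 lborel \<phi>)^2) <= ennreal (L * ((n2 lborel (grad \<phi>))^2 * L))"
  using L by (simp add: ennreal_mult[symmetric])
 then have "(n2 lborel \<phi>)^2 <= (L * n2 lborel (grad \<phi>))^2"
  using L by (simp add: power_mult_distrib power2_eq_square mult_ac)
 then show ?thesis unfolding L_def[symmetric] by (rule power2_le_imp_le) (use L in simp)
qed

subsection \<open>The fundamental lemma of the calculus of variations\<close>

text \<open>\<open>\<eta> n\<close> lives in a neighbourhood of \<open>T\<close> of width
  \<open>1 / (n + 1)\<close> and is at least \<open>c n\<close> on \<open>T\<close>. In
  \<open>1 - exp (- (n / c n * \<eta> n))\<close> the values on \<open>T\<close> are at least
  \<open>1 - exp (- n)\<close>, while a point off \<open>T\<close> is eventually outside the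
  support.\<close>

lemma tf_indicator_approx:
 assumes T: "compact T" "T \<subseteq> \<Omega>" "open \<Omega>"
 obtains \<phi> where "!!n. \<phi> n \<in> test_functions \<Omega>" "!!n x. 0 <= \<phi> n x \<and> \<phi> n x <= 1"
  "!!x. (%n. \<phi> n x) \<longlonglongrightarrow> indicator T x"
proof (cases "T = {}")
 case True
 show thesis by (rule that[of "%n x. 0"]) (auto simp: tf_0 True)
next
 case False
 define U where "U n = \<Omega> \<inter> {x. infdist x T < 1 / real (Suc n)}" for n
 have U: "open (U n)" "T \<subseteq> U n" for n
  using T unfolding U_def by (auto intro!: open_Int open_Collect_less continuous_intros)
 have "\<exists>\<eta>. \<eta> \<in> test_functions (U n) \<and> (\<forall>x. 0 <= \<eta> x) \<and> (\<forall>x\<in>T. 0 < \<eta> x)" for n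
  using tf_positive_on_compact[OF T(1) U(2) U(1)] by metis
 then obtain \<eta> where \<eta>: "!!n. \<eta> n \<in> test_functions (U n)" "!!n x. 0 <= \<eta> n x" "!!n x. x \<in> T ==> 0 < \<eta> n x"
  by metis
 have "\<exists>c>0. \<forall>x\<in>T. c <= \<eta> n x" for n
 proof -
  obtain x where x: "x \<in> T" "!!y. y \<in> T ==> \<eta> n x <= \<eta> n y"
   using continuous_attains_inf[OF T(1) False continuous_on_subset[OF tf_continuous[OF \<eta>(1)] subset_UNIV]] by blast
  then show ?thesis using \<eta>(3) by blast
 qed
 then obtain c where c: "!!n. c n > 0" "!!n x. x \<in> T ==> c n <= \<eta> n x" by metis
 define \<phi> where "\<phi> n x = 1 - exp (- (real n / c n * \<eta> n x))" for n x
 show thesis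
 proof (rule that[of \<phi>])
  fix n
  show "\<phi> n \<in> test_functions \<Omega>"
  proof -
   obtain K where K: "smooth_on UNIV (\<eta> n)" "compact K" "K \<subseteq> U n" "!!x. x \<notin> K ==> \<eta> n x = 0"
    by (rule test_functionsE[OF \<eta>(1)], rule that)
   have "K \<subseteq> \<Omega>" using K(3) by (auto simp: U_def)
   then show ?thesis unfolding \<phi>_def
    by (intro test_functionsI[OF _ K(2)] smooth_on_diff smooth_on_const smooth_on_exp smooth_on_minus smooth_on_cmult K(1))
      (auto simp: K(4))
  qed
  show "0 <= \<phi> n x \<and> \<phi> n x <= 1" for x
   using \<eta>(2)[of n x] c(1)[of n] by (simp add: \<phi>_def)
 next
  fix x
  show "(%n. \<phi> n x) \<longlonglongrightarrow> indicator T x"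
  proof (cases "x \<in> T")
   case True
   have "1 - exp (- real n) <= \<phi> n x" for n
   proof -
    have "real n * 1 <= real n * (\<eta> n x / c n)"
     using c(1)[of n] c(2)[OF True, of n] by (intro mult_left_mono) (auto simp: field_simps)
    then show ?thesis by (simp add: \<phi>_def)
   qed
   moreover have "\<phi> n x <= 1" for n by (simp add: \<phi>_def)
   moreover have "(%n. 1 - exp (- real n)) \<longlonglongrightarrow> 1"
    by real_asymp
   ultimately show ?thesis using True
    by (intro tendsto_sandwich[of "%n. 1 - exp (- real n)" "%n. \<phi> n x" sequentially "%n. 1"]) (simp_all add: always_eventually)
  next
   case x: False
   then have "infdist x T > 0"
    using in_closed_iff_infdist_zero[OF compact_imp_closed[OF T(1)] False] infdist_nonneg[of x T] by force
   then obtain N where N: "1 / real (Suc N) < infdist x T" using reals_Archimedean by (auto simp: inverse_eq_divide)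
   have "\<phi> n x = 0" if "n \<ge> N" for n
   proof -
    have "1 / real (Suc n) <= 1 / real (Suc N)" using that by (simp add: frac_le)
    then have "x \<notin> U n" using N by (auto simp: U_def)
    then show ?thesis using tf_outside[OF \<eta>(1)] by (simp add: \<phi>_def)
   qed
   then show ?thesis using x
    by (intro tendsto_eventually) (auto simp: eventually_sequentially intro!: exI[of _ N])
  qed
 qed
qed

text \<open>On a closed subset \<open>T\<close> of the set where \<open>g\<close> is positive, the
  indicator is a bounded limit of test functions, so \<open>g\<close> integrates to 0 over
  \<open>T\<close> and \<open>T\<close> is null. Inner regularity then makes the whole set
  null.\<close>

lemma fundamental_lemma_nonpos:
 assumes \<Omega>: "open \<Omega>" "bounded \<Omega>" and g: "integrable (lebesgue_on \<Omega>) g"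
  and 0: "!!\<phi>. \<phi> \<in> test_functions \<Omega> ==> (LINT x|lebesgue_on \<Omega>. g x * \<phi> x) = 0"
 shows "AE x in lebesgue_on \<Omega>. g x <= 0"
proof -
 have S: "\<Omega> \<in> sets lebesgue" using \<Omega>(1) by auto
 define A where "A = {x\<in>\<Omega>. 0 < g x}"
 have [measurable]: "g \<in> borel_measurable (lebesgue_on \<Omega>)" using g by simp
 have "A \<in> sets (lebesgue_on \<Omega>)"
  using measurable_sets[OF borel_measurable_integrable[OF g], of "{0<..}"] by (simp add: A_def vimage_def Int_def conj_commute)
 then have A: "A \<in> sets lebesgue" using S by (auto simp: sets_restrict_space_iff)
 have null: "T \<in> null_sets (lebesgue_on \<Omega>)" if T: "closed T" "T \<subseteq> A" for T
 proof -
  have "compact T" using T bounded_subset[OF \<Omega>(2), of T] by (auto simp: A_def compact_eq_bounded_closed)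
  then obtain \<phi> where \<phi>: "!!n. \<phi> n \<in> test_functions \<Omega>" "!!n x. 0 <= \<phi> n x \<and> \<phi> n x <= 1"
   "!!x. (%n. \<phi> n x) \<longlonglongrightarrow> indicator T x"
   by (rule tf_indicator_approx[of T \<Omega>]) (use T \<Omega> in \<open>auto simp: A_def\<close>)
  have TS: "T \<in> sets (lebesgue_on \<Omega>)" using T S by (auto simp: sets_restrict_space_iff A_def)
  have [measurable]: "\<phi> n \<in> borel_measurable (lebesgue_on \<Omega>)" for n
   using tf_measurable[OF \<phi>(1)] by (simp add: measurable_completion measurable_restrict_space1)
  have "(%n. LINT x|lebesgue_on \<Omega>. g x * \<phi> n x) \<longlonglongrightarrow> (LINT x|lebesgue_on \<Omega>. g x * indicator T x)"
  proof (rule integral_dominated_convergence[where w = "%x. norm (g x)"])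
   show "AE x in lebesgue_on \<Omega>. (%n. g x * \<phi> n x) \<longlonglongrightarrow> g x * indicator T x"
    by (intro AE_I2 tendsto_intros \<phi>(3))
   show "AE x in lebesgue_on \<Omega>. norm (g x * \<phi> n x) <= norm (g x)" for n
    using \<phi>(2)[of n] by (intro AE_I2) (simp add: abs_mult mult_left_le)
  qed (use g TS in auto)
  then have "(LINT x|lebesgue_on \<Omega>. g x * indicator T x) = 0"
   unfolding 0[OF \<phi>(1)] by (simp add: LIMSEQ_const_iff)
  moreover have "integrable (lebesgue_on \<Omega>) (%x. g x * indicator T x)"
   using g TS by (rule integrable_real_mult_indicator[rotated])
  ultimately have "AE x in lebesgue_on \<Omega>. g x * indicator T x = 0"
   using T by (subst (asm) integral_nonneg_eq_0_iff_AE) (auto simp: A_def indicator_def intro!: AE_I2 less_imp_le)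
  then have "AE x in lebesgue_on \<Omega>. x \<notin> T"
   by eventually_elim (use T in \<open>force simp: A_def indicator_def\<close>)
  then show ?thesis using TS AE_iff_null_sets by blast
 qed
 have "emeasure lebesgue A <= 0"
 proof (rule ennreal_le_epsilon)
  fix e :: real assume "0 < e"
  then obtain T where T: "closed T" "T \<subseteq> A" "A - T \<in> lmeasurable" "emeasure lebesgue (A - T) < ennreal e"
   using sets_lebesgue_inner_closed[OF A] by blast
  have "T \<in> null_sets lebesgue"
   using null[OF T(1,2)] null_sets_restrict_space[OF S] by auto
  then have "emeasure lebesgue A <= emeasure lebesgue (A - T) + 0"
   using emeasure_subadditive[of "A - T" lebesgue T] T A by (auto simp: Un_absorb2 null_sets_def)
  then show "emeasure lebesgue A <= 0 + ennreal e" using T(4) by simp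
 qed
 then have "A \<in> null_sets lebesgue" using A by auto
 then have "A \<in> null_sets (lebesgue_on \<Omega>)" using S by (auto simp: null_sets_restrict_space A_def)
 then show ?thesis by (rule AE_I') (auto simp: A_def)
qed

lemma fundamental_lemma:
 assumes \<Omega>: "open \<Omega>" "bounded \<Omega>" and g: "integrable (lebesgue_on \<Omega>) g"
  and 0: "!!\<phi>. \<phi> \<in> test_functions \<Omega> ==> (LINT x|lebesgue_on \<Omega>. g x * \<phi> x) = 0"
 shows "AE x in lebesgue_on \<Omega>. g x = 0"
proof -
 have "AE x in lebesgue_on \<Omega>. g x <= 0" by (rule fundamental_lemma_nonpos[OF assms])
 moreover have "AE x in lebesgue_on \<Omega>. - g x <= 0"
  by (rule fundamental_lemma_nonpos[OF \<Omega>]) (use g 0 in auto)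
 ultimately show ?thesis by eventually_elim simp
qed

subsection \<open>The space \<open>H01\<close> as a Hilbert space\<close>

lemma L2_inner_tendsto:
 assumes "!!n. L2 M (f n)" "L2 M g" "L2 M h" "(%n. n2 M (%x. g x - f n x)) \<longlonglongrightarrow> 0"
 shows "(%n. LINT x|M. f n x \<bullet> h x) \<longlonglongrightarrow> (LINT x|M. g x \<bullet> h x)"
proof -
 have "norm ((LINT x|M. f n x \<bullet> h x) - (LINT x|M. g x \<bullet> h x)) <= n2 M (%x. g x - f n x) * n2 M h" for n
 proof -
  have "(LINT x|M. g x \<bullet> h x) - (LINT x|M. f n x \<bullet> h x) = (LINT x|M. (g x - f n x) \<bullet> h x)"
   by (simp add: inner_diff_left integrable_inner_L2 assms)
  then show ?thesis
   using L2_Cauchy_Schwarz[OF L2_diff[OF assms(2) assms(1)[of n]] assms(3)] by (metis norm_minus_commute real_norm_def)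
 qed
 moreover have "(%n. n2 M (%x. g x - f n x) * n2 M h) \<longlonglongrightarrow> 0"
  using tendsto_mult_right[OF assms(4), of "n2 M h"] by simp
 ultimately have "(%n. (LINT x|M. f n x \<bullet> h x) - (LINT x|M. g x \<bullet> h x)) \<longlonglongrightarrow> 0"
  by (rule Lim_null_comparison[OF always_eventually[OF allI]])
 then show ?thesis by (rule LIM_zero_cancel)
qed

lemma n2_tendsto:
 assumes "!!n. L2 M (f n)" "L2 M g" "(%n. n2 M (%x. g x - f n x)) \<longlonglongrightarrow> 0"
 shows "(%n. n2 M (f n)) \<longlonglongrightarrow> n2 M g"
proof -
 have "norm (n2 M (f n) - n2 M g) <= n2 M (%x. g x - f n x)" for n
  using n2_diff_abs[OF assms(2) assms(1)[of n]] by (simp add: abs_minus_commute)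
 then have "(%n. n2 M (f n) - n2 M g) \<longlonglongrightarrow> 0"
  by (rule Lim_null_comparison[OF always_eventually[OF allI] assms(3)])
 then show ?thesis by (rule LIM_zero_cancel)
qed

locale bounded_open =
 fixes \<Omega> :: "'a::euclidean_space set"
 assumes open_dom: "open \<Omega>" and bounded_dom: "bounded \<Omega>"
begin

abbreviation "M \<equiv> lebesgue_on \<Omega>"
abbreviation "G \<equiv> weak_grad \<Omega>"
abbreviation "nrm \<equiv> H01_norm \<Omega>"

lemma sets_dom[simp]: "\<Omega> \<in> sets lebesgue"
 using open_dom by auto

lemma finite_measure_M: "finite_measure M"
 by (intro finite_measure_lebesgue_on bounded_set_imp_lmeasurable bounded_dom) simp

lemma borel_measurable_M: "f \<in> borel_measurable borel ==> f \<in> borel_measurable M"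
 by (simp add: measurable_completion measurable_restrict_space1)

lemma indicator_outside:
 fixes f :: "'a \<Rightarrow> 'b::real_vector"
 shows "(!!x. x \<notin> \<Omega> ==> f x = 0) ==> (%x. indicator \<Omega> x *\<^sub>R f x) = f"
 by (auto simp: indicator_def)

lemma integral_M:
 fixes f :: "'a \<Rightarrow> 'b::{banach, second_countable_topology}"
 assumes "f \<in> borel_measurable borel" "!!x. x \<notin> \<Omega> ==> f x = 0"
 shows "(LINT x|M. f x) = (LBINT x. f x)"
 using integral_restrict_space[of \<Omega> lebesgue f] integral_completion[of f lborel] assms
 by (simp add: indicator_outside[of f])

lemma integrable_M:
 fixes f :: "'a \<Rightarrow> 'b::{banach, second_countable_topology}"
 assumes "f \<in> borel_measurable borel" "!!x. x \<notin> \<Omega> ==> f x = 0"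
 shows "integrable M f \<longleftrightarrow> integrable lborel f"
 using integrable_restrict_space[of \<Omega> lebesgue f] integrable_completion[of f lborel] assms
 by (simp add: indicator_outside[of f])

lemma L2_M:
 assumes "f \<in> borel_measurable borel" "!!x. x \<notin> \<Omega> ==> f x = 0"
 shows "L2 M f \<longleftrightarrow> L2 lborel f"
 unfolding L2_def using integrable_M[of "%x. (norm (f x))^2"] assms borel_measurable_M by auto

lemma n2_M:
 assumes "f \<in> borel_measurable borel" "!!x. x \<notin> \<Omega> ==> f x = 0"
 shows "n2 M f = n2 lborel f"
 unfolding n2_def using integral_M[of "%x. (norm (f x))^2"] assms by auto

lemma test_L2_M: "\<phi> \<in> test_functions \<Omega> ==> L2 M \<phi>"
 by (subst L2_M) (auto intro: tf_L2 tf_measurable dest: tf_outside)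

lemma test_n2_M: "\<phi> \<in> test_functions \<Omega> ==> n2 M \<phi> = n2 lborel \<phi>"
 by (rule n2_M) (auto intro: tf_measurable dest: tf_outside)

lemma grad_L2_M: "\<phi> \<in> test_functions \<Omega> ==> L2 M (grad \<phi>)"
 by (subst L2_M) (auto intro: tf_grad_L2 tf_measurable_grad dest: tf_grad_outside)

lemma grad_n2_M: "\<phi> \<in> test_functions \<Omega> ==> n2 M (grad \<phi>) = n2 lborel (grad \<phi>)"
 by (rule n2_M) (auto intro: tf_measurable_grad dest: tf_grad_outside)

lemma square_integrable_iff: "square_integrable \<Omega> f \<longleftrightarrow> L2 M f"
 by (simp add: square_integrable_def L2_def)

lemma weak_gradientI:
 assumes "L2 M g" "!!\<phi> b. \<phi> \<in> test_functions \<Omega> ==> b \<in> Basis ==>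
  (LINT x|M. u x * frechet_derivative \<phi> (at x) b) = - (LINT x|M. (g x \<bullet> b) * \<phi> x)"
 shows "is_weak_gradient \<Omega> u g"
 using assms by (simp add: is_weak_gradient_def square_integrable_iff)

lemma weak_gradientD:
 assumes "is_weak_gradient \<Omega> u g"
 shows "L2 M g" and "\<phi> \<in> test_functions \<Omega> ==> b \<in> Basis ==>
  (LINT x|M. u x * frechet_derivative \<phi> (at x) b) = - (LINT x|M. (g x \<bullet> b) * \<phi> x)"
 using assms by (auto simp: is_weak_gradient_def square_integrable_iff)

lemma test_weak_gradient:
 assumes \<phi>: "\<phi> \<in> test_functions \<Omega>" shows "is_weak_gradient \<Omega> \<phi> (grad \<phi>)"
proof (rule weak_gradientI[OF grad_L2_M[OF \<phi>]])
 fix \<psi> and b :: 'a assume \<psi>: "\<psi> \<in> test_functions \<Omega>" and b: "b \<in> Basis"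
 note [measurable] = tf_measurable[OF \<phi>] tf_measurable[OF \<psi>]
  tf_measurable[OF tf_frechet_derivative[OF \<phi> b]]
  tf_measurable[OF tf_frechet_derivative[OF \<psi> b]]
 have "(LINT x|M. \<phi> x * frechet_derivative \<psi> (at x) b) = (LBINT x. \<phi> x * frechet_derivative \<psi> (at x) b)"
  by (rule integral_M) (auto simp: tf_outside[OF \<phi>])
 also have "\<dots> = - (LBINT x. frechet_derivative \<phi> (at x) b * \<psi> x)"
  by (rule tf_by_parts[OF tf_UNIV[OF \<psi>] tf_smooth[OF \<phi>] b])
 also have "(LBINT x. frechet_derivative \<phi> (at x) b * \<psi> x) = (LINT x|M. frechet_derivative \<phi> (at x) b * \<psi> x)"
  by (rule integral_M[symmetric]) (auto simp: tf_outside[OF \<psi>])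
 finally show "(LINT x|M. \<phi> x * frechet_derivative \<psi> (at x) b) = - (LINT x|M. (grad \<phi> x \<bullet> b) * \<psi> x)"
  by (simp add: grad_inner_Basis[OF b])
qed

lemma L2_inner_const: "L2 M f ==> L2 M (%x. f x \<bullet> b)"
proof -
 assume f: "L2 M f"
 note [measurable] = L2_measurable[OF f]
 show ?thesis
  by (rule L2_bound(1)[OF L2_scaleR[OF f, of "norm b"]])
    (auto intro!: AE_I2 simp: mult.commute[of "norm b"] Cauchy_Schwarz_ineq2)
qed

text \<open>Makes the choice in \<open>weak_grad\<close> harmless: any explicit weak gradient, such
  as the classical one of a test function, may replace it under an integral.\<close>

lemma weak_gradient_unique:
 assumes g: "is_weak_gradient \<Omega> u g" and h: "is_weak_gradient \<Omega> u h"
 shows "AE x in M. g x = h x"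
proof -
 have "AE x in M. g x \<bullet> b - h x \<bullet> b = 0" if b: "b \<in> Basis" for b
 proof (rule fundamental_lemma[OF open_dom bounded_dom])
  have L: "L2 M (%x. g x \<bullet> b)" "L2 M (%x. h x \<bullet> b)"
   using weak_gradientD(1)[OF g] weak_gradientD(1)[OF h] by (auto intro: L2_inner_const)
  then show "integrable M (%x. g x \<bullet> b - h x \<bullet> b)"
   by (intro L2_integrable_finite finite_measure_M L2_diff)
  fix \<phi> assume \<phi>: "\<phi> \<in> test_functions \<Omega>"
  have "(LINT x|M. (g x \<bullet> b) * \<phi> x) = (LINT x|M. (h x \<bullet> b) * \<phi> x)"
   using weak_gradientD(2)[OF g \<phi> b] weak_gradientD(2)[OF h \<phi> b] by simp
  then show "(LINT x|M. (g x \<bullet> b - h x \<bullet> b) * \<phi> x) = 0"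
   using integrable_mult_L2[OF L(1) test_L2_M[OF \<phi>]] integrable_mult_L2[OF L(2) test_L2_M[OF \<phi>]]
   by (simp add: left_diff_distrib)
 qed
 then have "AE x in M. \<forall>b\<in>Basis. g x \<bullet> b - h x \<bullet> b = 0"
  by (subst AE_finite_all) auto
 then show ?thesis
 proof eventually_elim
  case (elim x)
  show ?case by (rule euclidean_eqI) (use elim in auto)
 qed
qed

lemma H1_D:
 assumes "u \<in> H1 \<Omega>" shows "L2 M u" "is_weak_gradient \<Omega> u (G u)" "L2 M (G u)"
proof -
 show "L2 M u" using assms by (simp add: H1_def square_integrable_iff)
 show "is_weak_gradient \<Omega> u (G u)" using assms someI_ex[of "is_weak_gradient \<Omega> u"] unfolding weak_grad_def H1_def by auto
 then show "L2 M (G u)" by (rule weak_gradientD)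
qed

lemma H1_I: "L2 M u ==> is_weak_gradient \<Omega> u g ==> u \<in> H1 \<Omega>"
 by (auto simp: H1_def square_integrable_iff)

lemma weak_grad_AE:
 assumes "L2 M u" "is_weak_gradient \<Omega> u g" shows "AE x in M. G u x = g x"
 using weak_gradient_unique[OF H1_D(2)[OF H1_I[OF assms]] assms(2)] .

lemma weak_gradient_diff:
 assumes "L2 M u" "L2 M v" "is_weak_gradient \<Omega> u g" "is_weak_gradient \<Omega> v h"
 shows "is_weak_gradient \<Omega> (%x. u x - v x) (%x. g x - h x)"
proof (rule weak_gradientI)
 show "L2 M (%x. g x - h x)" using weak_gradientD(1) assms(3,4) by (intro L2_diff) blast+
 fix \<phi> and b :: 'a assume \<phi>: "\<phi> \<in> test_functions \<Omega>" and b: "b \<in> Basis"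
 have L: "L2 M (%x. frechet_derivative \<phi> (at x) b)" "L2 M \<phi>" "L2 M (%x. g x \<bullet> b)" "L2 M (%x. h x \<bullet> b)"
  using weak_gradientD(1)[OF assms(3)] weak_gradientD(1)[OF assms(4)]
  by (auto intro!: test_L2_M \<phi> tf_frechet_derivative b L2_inner_const)
 show "(LINT x|M. (u x - v x) * frechet_derivative \<phi> (at x) b) = - (LINT x|M. ((g x - h x) \<bullet> b) * \<phi> x)"
  using weak_gradientD(2)[OF assms(3) \<phi> b] weak_gradientD(2)[OF assms(4) \<phi> b]
  by (simp add: left_diff_distrib inner_diff_left integrable_mult_L2 assms L)
qed

lemma H1_norm_eq: "H1_norm \<Omega> u = sqrt ((n2 M u)^2 + (n2 M (G u))^2)"
 by (simp add: H1_norm_def n2_sq n2_sq_real)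

lemma H01_norm_eq: "nrm u = n2 M (G u)"
 by (simp add: H01_norm_def n2_def)

lemma H01_L2:
 assumes "u \<in> H01 \<Omega>" shows "L2 M u" "L2 M (G u)" "is_weak_gradient \<Omega> u (G u)"
 using assms H1_D by (auto simp: H01_def)

lemma n2_cong_AE:
 assumes "AE x in N. f x = g x" "f \<in> borel_measurable N" "g \<in> borel_measurable N"
 shows "n2 N f = n2 N g"
 using L2_cong_AE(2)[OF assms] .

lemma H1_diff_norm:
 assumes "L2 M u" "is_weak_gradient \<Omega> u g" "\<phi> \<in> test_functions \<Omega>"
 shows "H1_norm \<Omega> (%x. u x - \<phi> x) = sqrt ((n2 M (%x. u x - \<phi> x))^2 + (n2 M (%x. g x - grad \<phi> x))^2)"
proof -
 have L: "L2 M (%x. u x - \<phi> x)" "L2 M (%x. g x - grad \<phi> x)"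
  by (intro L2_diff test_L2_M grad_L2_M assms weak_gradientD(1)[OF assms(2)])+
 have w: "is_weak_gradient \<Omega> (%x. u x - \<phi> x) (%x. g x - grad \<phi> x)"
  by (rule weak_gradient_diff[OF assms(1) test_L2_M[OF assms(3)] assms(2) test_weak_gradient[OF assms(3)]])
 have "n2 M (G (%x. u x - \<phi> x)) = n2 M (%x. g x - grad \<phi> x)"
  by (rule n2_cong_AE[OF weak_grad_AE[OF L(1) w]])
    (use H1_D(3)[OF H1_I[OF L(1) w]] L(2) L2_measurable in blast)+
 then show ?thesis by (simp add: H1_norm_eq)
qed

lemma H01_approx:
 assumes "u \<in> H01 \<Omega>"
 obtains \<phi> where "!!n. \<phi> n \<in> test_functions \<Omega>" "(%n. n2 M (%x. u x - \<phi> n x)) \<longlonglongrightarrow> 0"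
  "(%n. n2 M (%x. G u x - grad (\<phi> n) x)) \<longlonglongrightarrow> 0"
proof -
 have "\<exists>\<phi>\<in>test_functions \<Omega>. H1_norm \<Omega> (%x. u x - \<phi> x) < 1 / real (Suc n)" for n
  using assms unfolding H01_def by auto
 then obtain \<phi> where \<phi>: "!!n. \<phi> n \<in> test_functions \<Omega>" "!!n. H1_norm \<Omega> (%x. u x - \<phi> n x) < 1 / real (Suc n)"
  by metis
 have le: "n2 M (%x. u x - \<phi> n x) <= 1 / real (Suc n)" "n2 M (%x. G u x - grad (\<phi> n) x) <= 1 / real (Suc n)" for n
 proof -
  have *: "a <= c" "b <= c" if "sqrt (a^2 + b^2) < c" for a b c :: real
   using that real_sqrt_sum_squares_ge1[of a b] real_sqrt_sum_squares_ge2[of b a] by linarith+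
  show "n2 M (%x. u x - \<phi> n x) <= 1 / real (Suc n)" "n2 M (%x. G u x - grad (\<phi> n) x) <= 1 / real (Suc n)"
   using \<phi>(2)[of n] unfolding H1_diff_norm[OF H01_L2(1,3)[OF assms] \<phi>(1)] by (auto dest: *)
 qed
 have lim: "(%n. 1 / real (Suc n)) \<longlonglongrightarrow> 0"
  using LIMSEQ_inverse_real_of_nat by (simp add: inverse_eq_divide)
 show thesis
  by (rule that[OF \<phi>(1)]; rule Lim_null_comparison[OF always_eventually[OF allI] lim]) (use le in simp_all)
qed

text \<open>Integration by parts passes to the \<open>L2\<close> limit, so a common approximation by
  test functions yields the weak gradient as well as membership. This is the way elements of
  \<open>H01\<close> are produced below.\<close>

lemma H01_I_approx:
 assumes u: "L2 M u" and g: "L2 M g" and \<phi>: "!!n. \<phi> n \<in> test_functions \<Omega>"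
  and lim: "(%n. n2 M (%x. u x - \<phi> n x)) \<longlonglongrightarrow> 0" "(%n. n2 M (%x. g x - grad (\<phi> n) x)) \<longlonglongrightarrow> 0"
 shows "u \<in> H01 \<Omega>" "AE x in M. G u x = g x"
proof -
 have w: "is_weak_gradient \<Omega> u g"
 proof (rule weak_gradientI[OF g])
  fix \<psi> and b :: 'a assume \<psi>: "\<psi> \<in> test_functions \<Omega>" and b: "b \<in> Basis"
  have L: "L2 M (%x. frechet_derivative \<psi> (at x) b)" "L2 M (%x. \<psi> x *\<^sub>R b)"
   using test_L2_M[OF tf_frechet_derivative[OF \<psi> b]] test_L2_M[OF \<psi>] b by (auto simp: L2_def)
  have l1: "(%n. LINT x|M. \<phi> n x * frechet_derivative \<psi> (at x) b) \<longlonglongrightarrow> (LINT x|M. u x * frechet_derivative \<psi> (at x) b)"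
   using L2_inner_tendsto[OF test_L2_M[OF \<phi>] u L(1) lim(1)] by simp
  have l2: "(%n. LINT x|M. grad (\<phi> n) x \<bullet> (\<psi> x *\<^sub>R b)) \<longlonglongrightarrow> (LINT x|M. g x \<bullet> (\<psi> x *\<^sub>R b))"
   by (rule L2_inner_tendsto[OF grad_L2_M[OF \<phi>] g L(2) lim(2)])
  have eq: "(LINT x|M. \<phi> n x * frechet_derivative \<psi> (at x) b) = - (LINT x|M. grad (\<phi> n) x \<bullet> (\<psi> x *\<^sub>R b))" for n
   using weak_gradientD(2)[OF test_weak_gradient[OF \<phi>] \<psi> b] by (simp add: mult.commute)
  have "(LINT x|M. u x * frechet_derivative \<psi> (at x) b) = - (LINT x|M. g x \<bullet> (\<psi> x *\<^sub>R b))"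
   by (rule LIMSEQ_unique[OF l1[unfolded eq] tendsto_minus[OF l2]])
  then show "(LINT x|M. u x * frechet_derivative \<psi> (at x) b) = - (LINT x|M. (g x \<bullet> b) * \<psi> x)"
   by (simp add: mult.commute)
 qed
 show "AE x in M. G u x = g x" by (rule weak_grad_AE[OF u w])
 have "(%n. sqrt ((n2 M (%x. u x - \<phi> n x))^2 + (n2 M (%x. g x - grad (\<phi> n) x))^2)) \<longlonglongrightarrow> sqrt (0^2 + 0^2)"
  by (intro tendsto_intros lim)
 then have l: "(%n. H1_norm \<Omega> (%x. u x - \<phi> n x)) \<longlonglongrightarrow> 0"
  using H1_diff_norm[OF u w \<phi>] by simp
 have "\<exists>\<phi>\<in>test_functions \<Omega>. H1_norm \<Omega> (%x. u x - \<phi> x) < e" if e: "e > 0" for e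
 proof -
  obtain n where "H1_norm \<Omega> (%x. u x - \<phi> n x) < e"
   using order_tendstoD(2)[OF l e] by (auto simp: eventually_sequentially)
  then show ?thesis using \<phi> by blast
 qed
 then show "u \<in> H01 \<Omega>" using H1_I[OF u w] by (simp add: H01_def)
qed

lemma test_H01:
 assumes "\<phi> \<in> test_functions \<Omega>" shows "\<phi> \<in> H01 \<Omega>" "AE x in M. G \<phi> x = grad \<phi> x"
 by (rule H01_I_approx[where \<phi> = "%n. \<phi>", OF test_L2_M[OF assms] grad_L2_M[OF assms] assms]; simp add: n2_def)+

text \<open>Since \<open>weak_grad\<close> is a choice, linearity of the gradient can only be
  asserted almost everywhere; it is inherited from approximating test functions.\<close>

lemma H01_lincomb:
 assumes u: "u \<in> H01 \<Omega>" and v: "v \<in> H01 \<Omega>"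
 shows "(%x. c * u x + d * v x) \<in> H01 \<Omega>" "AE x in M. G (%x. c * u x + d * v x) x = c *\<^sub>R G u x + d *\<^sub>R G v x"
proof -
 obtain \<phi> where \<phi>: "!!n. \<phi> n \<in> test_functions \<Omega>" "(%n. n2 M (%x. u x - \<phi> n x)) \<longlonglongrightarrow> 0"
  "(%n. n2 M (%x. G u x - grad (\<phi> n) x)) \<longlonglongrightarrow> 0" by (rule H01_approx[OF u], rule that)
 obtain \<psi> where \<psi>: "!!n. \<psi> n \<in> test_functions \<Omega>" "(%n. n2 M (%x. v x - \<psi> n x)) \<longlonglongrightarrow> 0"
  "(%n. n2 M (%x. G v x - grad (\<psi> n) x)) \<longlonglongrightarrow> 0" by (rule H01_approx[OF v], rule that)
 define \<xi> where "\<xi> n x = c * \<phi> n x + d * \<psi> n x" for n x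
 have \<xi>: "\<xi> n \<in> test_functions \<Omega>" for n unfolding \<xi>_def
  by (intro tf_add tf_cmult \<phi> \<psi>)
 have gr: "grad (\<xi> n) x = c *\<^sub>R grad (\<phi> n) x + d *\<^sub>R grad (\<psi> n) x" for n x unfolding \<xi>_def
  by (simp add: tf_grad_add[OF tf_cmult[OF \<phi>(1)] tf_cmult[OF \<psi>(1)]]
   tf_grad_cmult[OF \<phi>(1)] tf_grad_cmult[OF \<psi>(1)])
 have L: "L2 M (%x. c * u x + d * v x)" "L2 M (%x. c *\<^sub>R G u x + d *\<^sub>R G v x)"
  using H01_L2[OF u] H01_L2[OF v] by (auto intro!: L2_add L2_scaleR L2_cmult)
 have lim0: "(%n. \<bar>c\<bar> * f n + \<bar>d\<bar> * g n) \<longlonglongrightarrow> 0" if "f \<longlonglongrightarrow> 0" "g \<longlonglongrightarrow> 0" for f g :: "nat \<Rightarrow> real"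
  using tendsto_add[OF tendsto_mult_left[OF that(1), of "\<bar>c\<bar>"] tendsto_mult_left[OF that(2), of "\<bar>d\<bar>"]] by simp
 have b1: "norm (n2 M (%x. c * u x + d * v x - \<xi> n x)) <= \<bar>c\<bar> * n2 M (%x. u x - \<phi> n x) + \<bar>d\<bar> * n2 M (%x. v x - \<psi> n x)" for n
 proof -
  have "n2 M (%x. c * (u x - \<phi> n x) + d * (v x - \<psi> n x)) <= n2 M (%x. c * (u x - \<phi> n x)) + n2 M (%x. d * (v x - \<psi> n x))"
   by (intro n2_triangle L2_cmult L2_diff test_L2_M \<phi> \<psi> H01_L2 u v)
  moreover have "(%x. c * (u x - \<phi> n x) + d * (v x - \<psi> n x)) = (%x. c * u x + d * v x - \<xi> n x)"
   by (auto simp: \<xi>_def algebra_simps)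
  ultimately show ?thesis by (simp add: n2_cmult)
 qed
 have b2: "norm (n2 M (%x. c *\<^sub>R G u x + d *\<^sub>R G v x - grad (\<xi> n) x)) <= \<bar>c\<bar> * n2 M (%x. G u x - grad (\<phi> n) x) + \<bar>d\<bar> * n2 M (%x. G v x - grad (\<psi> n) x)" for n
 proof -
  have "n2 M (%x. c *\<^sub>R (G u x - grad (\<phi> n) x) + d *\<^sub>R (G v x - grad (\<psi> n) x)) <= n2 M (%x. c *\<^sub>R (G u x - grad (\<phi> n) x)) + n2 M (%x. d *\<^sub>R (G v x - grad (\<psi> n) x))"
   by (intro n2_triangle L2_scaleR L2_diff grad_L2_M \<phi> \<psi> H01_L2 u v)
  moreover have "(%x. c *\<^sub>R (G u x - grad (\<phi> n) x) + d *\<^sub>R (G v x - grad (\<psi> n) x)) = (%x. c *\<^sub>R G u x + d *\<^sub>R G v x - grad (\<xi> n) x)"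
   by (auto simp: gr algebra_simps)
  ultimately show ?thesis by (simp add: n2_scaleR)
 qed
 show "(%x. c * u x + d * v x) \<in> H01 \<Omega>" "AE x in M. G (%x. c * u x + d * v x) x = c *\<^sub>R G u x + d *\<^sub>R G v x"
  by (rule H01_I_approx[OF L \<xi> Lim_null_comparison[OF always_eventually[OF allI[OF b1]] lim0[OF \<phi>(2) \<psi>(2)]]
   Lim_null_comparison[OF always_eventually[OF allI[OF b2]] lim0[OF \<phi>(3) \<psi>(3)]]])+
qed

lemma H01_add: "u \<in> H01 \<Omega> ==> v \<in> H01 \<Omega> ==> (%x. u x + v x) \<in> H01 \<Omega>"
 using H01_lincomb(1)[of u v 1 1] by simp

lemma H01_diff: "u \<in> H01 \<Omega> ==> v \<in> H01 \<Omega> ==> (%x. u x - v x) \<in> H01 \<Omega>"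
 using H01_lincomb(1)[of u v 1 "-1"] by simp

lemma H01_cmult: "u \<in> H01 \<Omega> ==> (%x. c * u x) \<in> H01 \<Omega>"
 using H01_lincomb(1)[of u u c 0] by simp

definition B :: "('a \<Rightarrow> real) \<Rightarrow> ('a \<Rightarrow> real) \<Rightarrow> real" where
 "B u v = (LINT x|M. G u x \<bullet> G v x)"

lemma B_commute: "B u v = B v u"
 by (simp add: B_def inner_commute)

lemma H01_norm_sq: "(nrm u)^2 = B u u"
 unfolding H01_norm_eq n2_sq B_def by (simp add: power2_norm_eq_inner)

lemma H01_norm_nonneg[simp]: "0 <= nrm u"
 by (simp add: H01_norm_eq)

lemma B_lincomb_left:
 assumes "u \<in> H01 \<Omega>" "v \<in> H01 \<Omega>" "w \<in> H01 \<Omega>"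
 shows "B (%x. c * u x + d * v x) w = c * B u w + d * B v w"
proof -
 note L = H01_L2(2)[OF assms(1)] H01_L2(2)[OF assms(2)] H01_L2(2)[OF assms(3)]
 note [measurable] = L[THEN L2_measurable] H01_L2(2)[OF H01_lincomb(1)[OF assms(1,2)], THEN L2_measurable]
 have "B (%x. c * u x + d * v x) w = (LINT x|M. (c *\<^sub>R G u x + d *\<^sub>R G v x) \<bullet> G w x)"
  unfolding B_def by (rule integral_cong_AE) (use H01_lincomb(2)[OF assms(1,2), of c d] in \<open>auto elim!: eventually_mono\<close>)
 also have "\<dots> = c * B u w + d * B v w"
  unfolding B_def using L by (simp add: inner_add_left integrable_inner_L2)
 finally show ?thesis .
qed

lemma B_add_left: "u \<in> H01 \<Omega> ==> v \<in> H01 \<Omega> ==> w \<in> H01 \<Omega> ==> B (%x. u x + v x) w = B u w + B v w"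
 using B_lincomb_left[of u v w 1 1] by simp

lemma B_diff_left: "u \<in> H01 \<Omega> ==> v \<in> H01 \<Omega> ==> w \<in> H01 \<Omega> ==> B (%x. u x - v x) w = B u w - B v w"
 using B_lincomb_left[of u v w 1 "-1"] by simp

lemma B_cmult_left: "u \<in> H01 \<Omega> ==> w \<in> H01 \<Omega> ==> B (%x. c * u x) w = c * B u w"
 using B_lincomb_left[of u u w c 0] by simp

lemma B_Cauchy_Schwarz:
 "u \<in> H01 \<Omega> ==> v \<in> H01 \<Omega> ==> \<bar>B u v\<bar> <= nrm u * nrm v"
 unfolding B_def H01_norm_eq by (intro L2_Cauchy_Schwarz H01_L2)

lemma H01_norm_cmult: "u \<in> H01 \<Omega> ==> nrm (%x. c * u x) = \<bar>c\<bar> * nrm u"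
proof -
 assume u: "u \<in> H01 \<Omega>"
 have "(nrm (%x. c * u x))^2 = (\<bar>c\<bar> * nrm u)^2"
  unfolding H01_norm_sq power_mult_distrib
  using B_cmult_left[OF u H01_cmult[OF u, of c], of c] B_cmult_left[OF u u, of c] B_commute[of u "%x. c * u x"]
  by (simp add: power2_eq_square)
 then show ?thesis by simp
qed

lemma H01_norm_add_sq:
 assumes u: "u \<in> H01 \<Omega>" and v: "v \<in> H01 \<Omega>"
 shows "(nrm (%x. u x + v x))^2 = (nrm u)^2 + 2 * B u v + (nrm v)^2"
 unfolding H01_norm_sq
 using B_add_left[OF u v H01_add[OF u v]] B_add_left[OF u v u] B_add_left[OF u v v] B_commute[of u "%x. u x + v x"]
  B_commute[of v "%x. u x + v x"] B_commute[of u v] by simp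

lemma H01_norm_triangle:
 assumes u: "u \<in> H01 \<Omega>" and v: "v \<in> H01 \<Omega>"
 shows "nrm (%x. u x + v x) <= nrm u + nrm v"
proof -
 have "(nrm (%x. u x + v x))^2 <= (nrm u + nrm v)^2"
  unfolding H01_norm_add_sq[OF u v] using B_Cauchy_Schwarz[OF u v] by (simp add: power2_sum)
 then show ?thesis by (rule power2_le_imp_le) simp
qed

lemma H01_norm_commute:
 "u \<in> H01 \<Omega> ==> v \<in> H01 \<Omega> ==> nrm (%x. u x - v x) = nrm (%x. v x - u x)"
 using H01_norm_cmult[OF H01_diff[of u v], of "-1"] by simp

lemma H01_norm_triangle_diff:
 assumes "u \<in> H01 \<Omega>" "v \<in> H01 \<Omega>"
 shows "\<bar>nrm u - nrm v\<bar> <= nrm (%x. u x - v x)"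
 using H01_norm_triangle[OF H01_diff[OF assms] assms(2)] H01_norm_triangle[OF H01_diff[OF assms(2,1)] assms(1)]
  H01_norm_commute[OF assms] by simp

lemma H01_cong:
 assumes u: "u \<in> H01 \<Omega>" and v: "v \<in> borel_measurable M" and ae: "AE x in M. u x = v x"
 shows "v \<in> H01 \<Omega>" "AE x in M. G v x = G u x"
proof -
 obtain \<phi> where \<phi>: "!!n. \<phi> n \<in> test_functions \<Omega>" "(%n. n2 M (%x. u x - \<phi> n x)) \<longlonglongrightarrow> 0"
  "(%n. n2 M (%x. G u x - grad (\<phi> n) x)) \<longlonglongrightarrow> 0" by (rule H01_approx[OF u], rule that)
 note L = H01_L2[OF u]
 have Lv: "L2 M v" using L2_cong_AE(1)[OF ae L2_measurable[OF L(1)] v] L(1) by simp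
 have "n2 M (%x. v x - \<phi> n x) = n2 M (%x. u x - \<phi> n x)" for n
  by (rule n2_cong_AE) (use ae v L2_measurable[OF L(1)] L2_measurable[OF test_L2_M[OF \<phi>(1)]] in \<open>auto elim!: eventually_mono\<close>)
 then show "v \<in> H01 \<Omega>" "AE x in M. G v x = G u x"
  using H01_I_approx[OF Lv L(2) \<phi>(1) _ \<phi>(3)] \<phi>(2) by auto
qed

lemma H01_cong_norm:
 assumes u: "u \<in> H01 \<Omega>" and v: "v \<in> borel_measurable M" and ae: "AE x in M. u x = v x"
 shows "nrm v = nrm u"
 unfolding H01_norm_eq
 by (rule n2_cong_AE[OF H01_cong(2)[OF assms]]) (auto intro: L2_measurable H01_L2 u H01_cong(1)[OF assms])

lemma B_test:
 assumes u: "u \<in> H01 \<Omega>" and v: "v \<in> test_functions \<Omega>"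
 shows "B u v = (LINT x|M. G u x \<bullet> grad v x)"
proof -
 note [measurable] = H01_L2(2)[OF u, THEN L2_measurable] H01_L2(2)[OF test_H01(1)[OF v], THEN L2_measurable]
  grad_L2_M[OF v, THEN L2_measurable]
 show ?thesis
  unfolding B_def by (rule integral_cong_AE) (use test_H01(2)[OF v] in \<open>auto elim!: eventually_mono\<close>)
qed

lemma B_test_test:
 assumes u: "u \<in> test_functions \<Omega>" and v: "v \<in> test_functions \<Omega>"
 shows "B u v = (LBINT x. grad u x \<bullet> grad v x)"
proof -
 note [measurable] = H01_L2(2)[OF test_H01(1)[OF u], THEN L2_measurable] grad_L2_M[OF u, THEN L2_measurable]
  grad_L2_M[OF v, THEN L2_measurable]
 have "B u v = (LINT x|M. grad u x \<bullet> grad v x)"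
  unfolding B_test[OF test_H01(1)[OF u] v]
  by (rule integral_cong_AE) (use test_H01(2)[OF u] in \<open>auto elim!: eventually_mono\<close>)
 also have "\<dots> = (LBINT x. grad u x \<bullet> grad v x)"
  using tf_measurable_grad[OF u] tf_measurable_grad[OF v]
  by (intro integral_M) (auto simp: tf_grad_outside[OF u])
 finally show ?thesis .
qed

lemma H01_norm_test: "\<phi> \<in> test_functions \<Omega> ==> nrm \<phi> = n2 lborel (grad \<phi>)"
proof -
 assume \<phi>: "\<phi> \<in> test_functions \<Omega>"
 have "(nrm \<phi>)^2 = (n2 lborel (grad \<phi>))^2"
  unfolding H01_norm_sq B_test_test[OF \<phi> \<phi>] n2_sq by (simp add: power2_norm_eq_inner)
 then show ?thesis by (simp add: power2_eq_iff_nonneg)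
qed

lemma H01_norm_diff_test:
 assumes u: "u \<in> H01 \<Omega>" and \<phi>: "\<phi> \<in> test_functions \<Omega>"
 shows "nrm (%x. u x - \<phi> x) = n2 M (%x. G u x - grad \<phi> x)"
 unfolding H01_norm_eq
proof (rule n2_cong_AE)
 show "AE x in M. G (%x. u x - \<phi> x) x = G u x - grad \<phi> x"
  using H01_lincomb(2)[OF u test_H01(1)[OF \<phi>], of 1 "-1"] test_H01(2)[OF \<phi>] by eventually_elim simp
qed (use H01_L2(2)[OF H01_diff[OF u test_H01(1)[OF \<phi>]]] L2_diff[OF H01_L2(2)[OF u] grad_L2_M[OF \<phi>]] L2_measurable in blast)+

lemma H01_dense:
 assumes "u \<in> H01 \<Omega>"
 obtains \<phi> where "!!n. \<phi> n \<in> test_functions \<Omega>" "(%n. n2 M (%x. u x - \<phi> n x)) \<longlonglongrightarrow> 0"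
  "(%n. nrm (%x. u x - \<phi> n x)) \<longlonglongrightarrow> 0"
proof -
 obtain \<phi> where \<phi>: "!!n. \<phi> n \<in> test_functions \<Omega>" "(%n. n2 M (%x. u x - \<phi> n x)) \<longlonglongrightarrow> 0"
  "(%n. n2 M (%x. G u x - grad (\<phi> n) x)) \<longlonglongrightarrow> 0" by (rule H01_approx[OF assms], rule that)
 then show thesis using that[of \<phi>] H01_norm_diff_test[OF assms \<phi>(1)] by simp
qed

lemma B_tendsto:
 assumes "!!n. u n \<in> H01 \<Omega>" "v \<in> H01 \<Omega>" "w \<in> H01 \<Omega>" "(%n. nrm (%x. v x - u n x)) \<longlonglongrightarrow> 0"
 shows "(%n. B (u n) w) \<longlonglongrightarrow> B v w"
proof -
 have "norm (B v w - B (u n) w) <= nrm (%x. v x - u n x) * nrm w" for n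
  using B_Cauchy_Schwarz[OF H01_diff[OF assms(2) assms(1)] assms(3)] B_diff_left[OF assms(2) assms(1) assms(3)] by simp
 moreover have "(%n. nrm (%x. v x - u n x) * nrm w) \<longlonglongrightarrow> 0"
  using tendsto_mult_right[OF assms(4), of "nrm w"] by simp
 ultimately have "(%n. B v w - B (u n) w) \<longlonglongrightarrow> 0"
  by (rule Lim_null_comparison[OF always_eventually[OF allI]])
 from tendsto_diff[OF tendsto_const[of "B v w"] this] show ?thesis by simp
qed

lemma H01_norm_tendsto:
 assumes "!!n. u n \<in> H01 \<Omega>" "v \<in> H01 \<Omega>" "(%n. nrm (%x. v x - u n x)) \<longlonglongrightarrow> 0"
 shows "(%n. nrm (u n)) \<longlonglongrightarrow> nrm v"
proof -
 have "norm (nrm (u n) - nrm v) <= nrm (%x. v x - u n x)" for n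
  using H01_norm_triangle_diff[OF assms(2) assms(1)[of n]] by (simp add: abs_minus_commute)
 then have "(%n. nrm (u n) - nrm v) \<longlonglongrightarrow> 0"
  by (rule Lim_null_comparison[OF always_eventually[OF allI] assms(3)])
 then show ?thesis by (rule LIM_zero_cancel)
qed

lemma Poincare: "\<exists>C>0. \<forall>u\<in>H01 \<Omega>. n2 M u <= C * nrm u"
proof -
 obtain D where D: "D > 0" "\<Omega> \<subseteq> cball 0 D" using bounded_dom unfolding bounded_pos by (auto simp: subset_iff)
 have "n2 M u <= (2 * D + 1) * nrm u" if u: "u \<in> H01 \<Omega>" for u
 proof -
  obtain \<phi> where \<phi>: "!!n. \<phi> n \<in> test_functions \<Omega>" "(%n. n2 M (%x. u x - \<phi> n x)) \<longlonglongrightarrow> 0"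
   "(%n. nrm (%x. u x - \<phi> n x)) \<longlonglongrightarrow> 0" by (rule H01_dense[OF u], rule that)
  have "(%n. n2 M (\<phi> n)) \<longlonglongrightarrow> n2 M u"
   by (rule n2_tendsto[OF test_L2_M[OF \<phi>(1)] H01_L2(1)[OF u] \<phi>(2)])
  moreover have "(%n. (2 * D + 1) * nrm (\<phi> n)) \<longlonglongrightarrow> (2 * D + 1) * nrm u"
   by (intro tendsto_mult_left H01_norm_tendsto[OF test_H01(1)[OF \<phi>(1)] u \<phi>(3)])
  moreover have "n2 M (\<phi> n) <= (2 * D + 1) * nrm (\<phi> n)" for n
   using tf_Poincare[OF \<phi>(1) D(2)] D(1) by (simp add: test_n2_M[OF \<phi>(1)] H01_norm_test[OF \<phi>(1)])
  ultimately show ?thesis by (intro LIMSEQ_le[of "%n. n2 M (\<phi> n)" _ "%n. (2 * D + 1) * nrm (\<phi> n)"]) auto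
 qed
 then show ?thesis using D(1) by (intro exI[of _ "2 * D + 1"]) auto
qed

lemma H01_norm_tendsto_n2:
 assumes "!!n. u n \<in> H01 \<Omega>" "v \<in> H01 \<Omega>" "(%n. nrm (%x. v x - u n x)) \<longlonglongrightarrow> 0"
 shows "(%n. n2 M (%x. v x - u n x)) \<longlonglongrightarrow> 0"
proof -
 obtain C where C: "!!u. u \<in> H01 \<Omega> ==> n2 M u <= C * nrm u" using Poincare by blast
 have "norm (n2 M (%x. v x - u n x)) <= C * nrm (%x. v x - u n x)" for n
  using C[OF H01_diff[OF assms(2,1)]] by simp
 moreover have "(%n. C * nrm (%x. v x - u n x)) \<longlonglongrightarrow> 0"
  using tendsto_mult_left[OF assms(3), of C] by simp
 ultimately show ?thesis by (rule Lim_null_comparison[OF always_eventually[OF allI]])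
qed

text \<open>Each \<open>u n\<close> is replaced by a test function at distance below
  \<open>1 / (n + 1)\<close>, whose gradient is classical. Completeness of \<open>L2\<close> then
  applies to the gradients and, by the Poincare inequality, to the functions themselves.\<close>

lemma H01_complete:
 assumes u: "!!n. u n \<in> H01 \<Omega>"
  and Cauchy: "!!e. e > 0 ==> \<exists>N. \<forall>m\<ge>N. \<forall>n\<ge>N. nrm (%x. u m x - u n x) < e"
 obtains v where "v \<in> H01 \<Omega>" "(%n. nrm (%x. u n x - v x)) \<longlonglongrightarrow> 0"
proof -
 obtain C where C: "C > 0" "!!u. u \<in> H01 \<Omega> ==> n2 M u <= C * nrm u" using Poincare by blast
 have "\<exists>\<phi>\<in>test_functions \<Omega>. nrm (%x. u n x - \<phi> x) < 1 / real (Suc n)" for n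
 proof -
  obtain \<phi> where \<phi>: "!!n. \<phi> n \<in> test_functions \<Omega>" "(%k. n2 M (%x. u n x - \<phi> k x)) \<longlonglongrightarrow> 0"
   "(%k. nrm (%x. u n x - \<phi> k x)) \<longlonglongrightarrow> 0" by (rule H01_dense[OF u], rule that)
  have "\<forall>\<^sub>F k in sequentially. nrm (%x. u n x - \<phi> k x) < 1 / real (Suc n)"
   by (rule order_tendstoD(2)[OF \<phi>(3)]) simp
  then show ?thesis using \<phi>(1) by (auto simp: eventually_sequentially)
 qed
 then obtain \<phi> where \<phi>: "!!n. \<phi> n \<in> test_functions \<Omega>" "!!n. nrm (%x. u n x - \<phi> n x) < 1 / real (Suc n)"
  by metis
 note t = test_H01(1)[OF \<phi>(1)]
 have C\<phi>: "\<exists>N. \<forall>m\<ge>N. \<forall>n\<ge>N. nrm (%x. \<phi> m x - \<phi> n x) < e" if e: "e > 0" for e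
 proof -
  obtain N1 where N1: "!!m n. m \<ge> N1 ==> n \<ge> N1 ==> nrm (%x. u m x - u n x) < e/3"
   using Cauchy[of "e/3"] e by auto
  obtain N2 where N2: "1 / real (Suc N2) < e/3" using reals_Archimedean[of "e/3"] e by (auto simp: inverse_eq_divide)
  have small: "nrm (%x. u n x - \<phi> n x) < e/3" if "n \<ge> N2" for n
  proof -
   have "1 / real (Suc n) <= 1 / real (Suc N2)" using that by (simp add: frac_le)
   then show ?thesis using \<phi>(2)[of n] N2 by linarith
  qed
  have "nrm (%x. \<phi> m x - \<phi> n x) < e" if "m \<ge> max N1 N2" "n \<ge> max N1 N2" for m n
  proof -
   have "nrm (%x. (\<phi> m x - u m x) + ((u m x - u n x) + (u n x - \<phi> n x))) <=
    nrm (%x. \<phi> m x - u m x) + nrm (%x. (u m x - u n x) + (u n x - \<phi> n x))"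
    by (intro H01_norm_triangle H01_add H01_diff t u)
   also have "nrm (%x. (u m x - u n x) + (u n x - \<phi> n x)) <=
    nrm (%x. u m x - u n x) + nrm (%x. u n x - \<phi> n x)"
    by (intro H01_norm_triangle H01_diff t u)
   finally show ?thesis
    using small[of m] small[of n] N1[of m n] H01_norm_commute[OF t u, of m m] that by simp
  qed
  then show ?thesis by blast
 qed
 have gr: "n2 M (%x. grad (\<phi> m) x - grad (\<phi> n) x) = nrm (%x. \<phi> m x - \<phi> n x)" for m n
 proof -
  have "grad (%x. \<phi> m x - \<phi> n x) = (%x. grad (\<phi> m) x - grad (\<phi> n) x)"
   by (rule tf_grad_diff[OF \<phi>(1) \<phi>(1)])
  then show ?thesis
   using H01_norm_test[OF tf_diff[OF \<phi>(1) \<phi>(1)], of m n] grad_n2_M[OF tf_diff[OF \<phi>(1) \<phi>(1)], of m n] by simp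
 qed
 obtain g where g: "L2 M g" "(%n. n2 M (%x. grad (\<phi> n) x - g x)) \<longlonglongrightarrow> 0"
  by (rule L2_complete[OF finite_measure_M, of "%n. grad (\<phi> n)", OF grad_L2_M[OF \<phi>(1)]])
    (use C\<phi> in \<open>simp_all add: gr\<close>)
 have C\<phi>2: "\<exists>N. \<forall>m\<ge>N. \<forall>n\<ge>N. n2 M (%x. \<phi> m x - \<phi> n x) < e" if e: "e > 0" for e
 proof -
  obtain N where N: "!!m n. m \<ge> N ==> n \<ge> N ==> nrm (%x. \<phi> m x - \<phi> n x) < e / C"
   using C\<phi>[of "e / C"] e C(1) by auto
  have "n2 M (%x. \<phi> m x - \<phi> n x) < e" if "m \<ge> N" "n \<ge> N" for m n
   using C(2)[OF H01_diff[OF t t], of m n] N[OF that] C(1) by (simp add: pos_less_divide_eq mult.commute)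
  then show ?thesis by blast
 qed
 obtain v where v: "L2 M v" "(%n. n2 M (%x. \<phi> n x - v x)) \<longlonglongrightarrow> 0"
  by (rule L2_complete[OF finite_measure_M, of \<phi>, OF test_L2_M[OF \<phi>(1)]]) (use C\<phi>2 in simp_all)
 have vH: "v \<in> H01 \<Omega>" "AE x in M. G v x = g x"
  using H01_I_approx[OF v(1) g(1) \<phi>(1)] v(2) g(2) n2_commute[of M v] n2_commute[of M g] by auto
 have "nrm (%x. v x - \<phi> n x) = n2 M (%x. grad (\<phi> n) x - g x)" for n
  unfolding H01_norm_diff_test[OF vH(1) \<phi>(1)] n2_commute[of M "grad (\<phi> n)"]
  by (rule n2_cong_AE)
    (use vH(2) g(1) grad_L2_M[OF \<phi>(1)] H01_L2(2)[OF vH(1)] in \<open>auto dest!: L2_measurable elim!: eventually_mono\<close>)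
 then have l1: "(%n. nrm (%x. v x - \<phi> n x)) \<longlonglongrightarrow> 0" using g(2) by simp
 have "norm (nrm (%x. u n x - v x)) <= 1 / real (Suc n) + nrm (%x. v x - \<phi> n x)" for n
  using H01_norm_triangle[OF H01_diff[OF u t] H01_diff[OF t vH(1)], of n n n] \<phi>(2)[of n] H01_norm_commute[OF vH(1) t, of n] by simp
 moreover have "(%n. 1 / real (Suc n) + nrm (%x. v x - \<phi> n x)) \<longlonglongrightarrow> 0"
  using tendsto_add[OF LIMSEQ_inverse_real_of_nat l1] by (simp add: inverse_eq_divide)
 ultimately have "(%n. nrm (%x. u n x - v x)) \<longlonglongrightarrow> 0"
  by (rule Lim_null_comparison[OF always_eventually[OF allI]])
 then show thesis using that vH(1) by blast
qed

end

subsection \<open>The Sobolev inequality in three dimensions\<close>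

text \<open>Coordinates as nested pairs, so that Fubini on product spaces yields iterated integrals
  over \<open>real^3\<close>.\<close>

definition vec3 :: "real \<times> real \<times> real \<Rightarrow> real^3" where
 "vec3 p = fst p *\<^sub>R axis 1 1 + fst (snd p) *\<^sub>R axis 2 1 + snd (snd p) *\<^sub>R axis 3 1"

lemma vec3_nth: "vec3 (x, y, z) $ 1 = x" "vec3 (x, y, z) $ 2 = y" "vec3 (x, y, z) $ 3 = z"
 by (simp_all add: vec3_def axis_def)

lemma continuous_vec3: "continuous_on UNIV vec3"
 unfolding vec3_def by (intro continuous_intros)

lemma measurable_vec3[measurable]: "vec3 \<in> borel_measurable borel"
 by (rule borel_measurable_continuous_onI[OF continuous_vec3])

lemma Basis_vec3: "(Basis :: (real^3) set) = (%i. axis i 1) ` UNIV"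
 by (auto simp: Basis_vec_def)

lemma distr_vec3: "distr lborel borel vec3 = lborel"
proof (rule lborel_eqI[symmetric])
 fix l u :: "real^3" assume lu: "!!b. b \<in> Basis ==> l \<bullet> b <= u \<bullet> b"
 have le: "l $ i <= u $ i" for i using lu[of "axis i 1"] by (auto simp: Basis_vec3 inner_axis)
 have pre: "vec3 -` box l u = {l $ 1<..<u $ 1} \<times> {l $ 2<..<u $ 2} \<times> {l $ 3<..<u $ 3}"
  by (auto simp: mem_box_cart forall_3 vec3_nth)
 have times: "emeasure lborel (A \<times> D) = emeasure lborel A * emeasure lborel D"
  if "A \<in> sets borel" "D \<in> sets borel" for A :: "real set" and D :: "'b::euclidean_space set"
  using lborel.emeasure_pair_measure_Times[of A lborel D] that by (simp add: lborel_prod)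
 have "emeasure (distr lborel borel vec3) (box l u) = emeasure lborel ({l $ 1<..<u $ 1} \<times> {l $ 2<..<u $ 2} \<times> {l $ 3<..<u $ 3})"
  by (subst emeasure_distr) (auto simp: pre)
 also have "\<dots> = ennreal (u $ 1 - l $ 1) * (ennreal (u $ 2 - l $ 2) * ennreal (u $ 3 - l $ 3))"
  using le by (simp add: times borel_Times)
 also have "\<dots> = ennreal (\<Prod>b\<in>Basis. (u - l) \<bullet> b)"
 proof -
  have "(\<Prod>b\<in>Basis. (u - l) \<bullet> b) = (\<Prod>i\<in>UNIV. u $ i - l $ i)"
   unfolding Basis_vec3 by (subst prod.reindex) (simp_all add: inj_on_def axis_eq_axis inner_axis)
  also have "\<dots> = (u $ 1 - l $ 1) * ((u $ 2 - l $ 2) * (u $ 3 - l $ 3))"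
   unfolding UNIV_3 by simp
  finally show ?thesis using le[of 1] le[of 2] le[of 3] by (simp only: ennreal_mult diff_ge_0_iff_ge mult_nonneg_nonneg)
 qed
 finally show "emeasure (distr lborel borel vec3) (box l u) = ennreal (\<Prod>b\<in>Basis. (u - l) \<bullet> b)" .
qed simp

lemma nn_integral_vec3:
 assumes [measurable]: "f \<in> borel_measurable borel"
 shows "(NI x. f x) = (NI x. NI y. NI z. f (vec3 (x, y, z)))"
proof -
 have "(NI x. f x) = (NI p. f (vec3 p))"
  by (subst distr_vec3[symmetric], subst nn_integral_distr) auto
 also have "\<dots> = (NI x. NI q. f (vec3 (x, q)))"
  by (subst lborel_prod[symmetric], rule lborel.nn_integral_fst[symmetric]) (simp add: lborel_prod)
 also have "\<dots> = (NI x. NI y. NI z. f (vec3 (x, y, z)))"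
  by (intro nn_integral_cong, subst lborel_prod[symmetric], rule lborel.nn_integral_fst[symmetric]) (simp add: lborel_prod)
 finally show ?thesis .
qed

text \<open>Cauchy-Schwarz twice: first in \<open>z\<close>, where \<open>h\<close> is constant, and
  then in the pair of the remaining variables, where the squared inner integral is at most a product
  of functions of one variable each.\<close>

lemma Loomis_Whitney:
 fixes f g h :: "real \<Rightarrow> real \<Rightarrow> ennreal"
 assumes [measurable]: "case_prod f \<in> borel_measurable borel" "case_prod g \<in> borel_measurable borel" "case_prod h \<in> borel_measurable borel"
 shows "(NI x. NI y. NI z. f y z * g x z * h x y)^2 <=
  (NI y. NI z. (f y z)^2) * (NI x. NI z. (g x z)^2) * (NI x. NI y. (h x y)^2)"
proof -
 have [measurable]: "case_prod f \<in> borel_measurable (lborel \<Otimes>\<^sub>M lborel)" "case_prod g \<in> borel_measurable (lborel \<Otimes>\<^sub>M lborel)"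
  "case_prod h \<in> borel_measurable (lborel \<Otimes>\<^sub>M lborel)"
  using assms by (simp_all add: lborel_prod)
 define P where "P x y = (NI z. f y z * g x z)" for x y
 define F where "F y = (NI z. (f y z)^2)" for y
 define E where "E x = (NI z. (g x z)^2)" for x
 have P: "(P x y)^2 <= F y * E x" for x y
  unfolding P_def F_def E_def by (rule Cauchy_Schwarz_nn_integral) measurable
 have [measurable]: "case_prod P \<in> borel_measurable (lborel \<Otimes>\<^sub>M lborel)" "F \<in> borel_measurable lborel" "E \<in> borel_measurable lborel"
  unfolding P_def F_def E_def by measurable
 have "(NI x. NI y. NI z. f y z * g x z * h x y) = (NI x. NI y. case_prod P (x, y) * case_prod h (x, y))"
  by (simp add: P_def nn_integral_multc)
 also have "\<dots> = (\<integral>\<^sup>+p. case_prod P p * case_prod h p \<partial>(lborel \<Otimes>\<^sub>M lborel))"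
  by (rule lborel.nn_integral_fst) measurable
 also have "\<dots>^2 <= (\<integral>\<^sup>+p. (case_prod P p)^2 \<partial>(lborel \<Otimes>\<^sub>M lborel)) * (\<integral>\<^sup>+p. (case_prod h p)^2 \<partial>(lborel \<Otimes>\<^sub>M lborel))"
  by (rule Cauchy_Schwarz_nn_integral) measurable
 also have "\<dots> = (NI x. NI y. (P x y)^2) * (NI x. NI y. (h x y)^2)"
  by (subst (1 2) lborel.nn_integral_fst[symmetric]) simp_all
 also have "(NI x. NI y. (P x y)^2) <= (NI x. NI y. F y * E x)"
  by (intro nn_integral_mono P)
 also have "\<dots> = (NI y. F y) * (NI x. E x)"
  by (simp add: nn_integral_multc nn_integral_cmult)
 finally show ?thesis by (simp add: F_def E_def mult_right_mono)
qed

lemma line_bound: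
 assumes h: "h \<in> test_functions UNIV" and v: "norm v = 1"
 shows "ennreal \<bar>h x\<bar> <= (NI s. ennreal \<bar>grad h (x + s *\<^sub>R v) \<bullet> v\<bar>)"
proof -
 obtain K where K: "compact K" "!!x. x \<notin> K ==> h x = 0" by (metis test_functionsE[OF h])
 obtain R where R: "!!x. x \<in> K ==> norm x <= R" using compact_imp_bounded[OF K(1)] bounded_iff by blast
 define L where "L = \<bar>R\<bar> + norm x + 1"
 have "norm (L *\<^sub>R v) <= norm (x + L *\<^sub>R v) + norm x" using norm_triangle_ineq4[of "x + L *\<^sub>R v" x] by simp
 moreover have Lpos: "L > 0" unfolding L_def using norm_ge_zero[of x] by linarith
 then have "norm (L *\<^sub>R v) = L" using v by simp
 ultimately have "x + L *\<^sub>R v \<notin> K" using R[of "x + L *\<^sub>R v"] unfolding L_def by linarith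
 then have "h (x + L *\<^sub>R v) = 0" using K by blast
 then have "(LINT s|lborel. (grad h (x + s *\<^sub>R v) \<bullet> v) * indicator {0..L} s) = - h x"
  using line_integral[OF tf_smooth[OF h], of L x v] Lpos by simp
 then have "ennreal \<bar>h x\<bar> = ennreal (norm (LINT s|lborel. (grad h (x + s *\<^sub>R v) \<bullet> v) * indicator {0..L} s))" by simp
 also have "\<dots> <= (NI s. ennreal (norm ((grad h (x + s *\<^sub>R v) \<bullet> v) * indicator {0..L} s)))"
  by (rule integral_norm_bound_ennreal)
    (use borel_integrable_compact[of "{0..L}" "%s. grad h (x + s *\<^sub>R v) \<bullet> v"] continuous_on_subset[OF line_continuous[OF tf_smooth[OF h]], of "{0..L}" x v]
     in \<open>simp add: mult.commute\<close>)
 also have "\<dots> <= (NI s. ennreal \<bar>grad h (x + s *\<^sub>R v) \<bullet> v\<bar>)"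
  by (intro nn_integral_mono ennreal_leI) (auto simp: indicator_def)
 finally show ?thesis .
qed

lemma line_finite:
 assumes h: "h \<in> test_functions UNIV" and v: "norm v = 1"
 shows "(NI s. ennreal \<bar>grad h (x + s *\<^sub>R v) \<bullet> v\<bar>) < \<infinity>"
proof -
 obtain K where K: "compact K" "!!x. x \<notin> K ==> grad h x = 0" by (metis tf_grad_support[OF h])
 obtain R where R: "!!x. x \<in> K ==> norm x <= R" using compact_imp_bounded[OF K(1)] bounded_iff by blast
 have "integrable lborel (%s. grad h (x + s *\<^sub>R v) \<bullet> v)"
 proof (rule integrable_compact_support[where K = "cball 0 (\<bar>R\<bar> + norm x)"])
  fix s :: real assume "s \<notin> cball 0 (\<bar>R\<bar> + norm x)"
  moreover have "norm (s *\<^sub>R v) <= norm (x + s *\<^sub>R v) + norm x" using norm_triangle_ineq4[of "x + s *\<^sub>R v" x] by simp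
  ultimately have "x + s *\<^sub>R v \<notin> K" using R[of "x + s *\<^sub>R v"] v by auto
  then show "grad h (x + s *\<^sub>R v) \<bullet> v = 0" using K by simp
 qed (use line_continuous[OF tf_smooth[OF h]] in auto)
 then show ?thesis by (simp add: integrable_iff_bounded)
qed

text \<open>\<open>enn2real\<close> sends infinity to 0, so equality may fail. The opposite bound
  needed in \<open>Gagliardo_Nirenberg\<close> relies on finiteness of the line integrals.\<close>

lemma sqrt_enn2real_sq_le: "(ennreal (sqrt (enn2real A)))^2 <= A"
 by (cases A) (auto simp: ennreal_power)

text \<open>\<open>h\<close> is bounded by the integral of its partial derivative along each of the
  three coordinate lines through a point. Such an integral does not depend on the coordinate
  integrated out, and the sixth power of \<phi> is the cube of the square root of \<open>h\<close>,
  so \<open>Loomis_Whitney\<close> applies to the three square roots.\<close>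

lemma Gagliardo_Nirenberg:
 fixes h :: "real^3 \<Rightarrow> real"
 assumes h: "h \<in> test_functions UNIV" and \<phi>: "!!x. h x = \<phi> x ^ 4" and [measurable]: "\<phi> \<in> borel_measurable borel"
 shows "(NI x. ennreal (\<phi> x ^ 6))^2 <= (NI x. ennreal (norm (grad h x))) ^ 3"
proof -
 define e :: "3 \<Rightarrow> real^3" where "e i = axis i 1" for i
 have ne: "norm (e i) = 1" for i by (simp add: e_def)
 define a where "a i x = ennreal \<bar>grad h x \<bullet> e i\<bar>" for i x
 have [measurable]: "grad h \<in> borel_measurable borel" by (rule tf_measurable_grad[OF h])
 have am[measurable]: "a i \<in> borel_measurable borel" for i unfolding a_def by measurable
 define A1 where "A1 y z = (NI t. a 1 (vec3 (t, y, z)))" for y z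
 define A2 where "A2 x z = (NI t. a 2 (vec3 (x, t, z)))" for x z
 define A3 where "A3 x y = (NI t. a 3 (vec3 (x, y, t)))" for x y
 have [measurable]: "vec3 \<in> borel_measurable (lborel \<Otimes>\<^sub>M (lborel \<Otimes>\<^sub>M lborel))" by (simp add: lborel_prod)
 have [measurable]: "case_prod A1 \<in> borel_measurable (lborel \<Otimes>\<^sub>M lborel)" "case_prod A2 \<in> borel_measurable (lborel \<Otimes>\<^sub>M lborel)" "case_prod A3 \<in> borel_measurable (lborel \<Otimes>\<^sub>M lborel)"
  unfolding A1_def A2_def A3_def by measurable
 have line: "ennreal \<bar>h x\<bar> <= (NI t. a i (x + (t + c) *\<^sub>R e i))" "(NI t. a i (x + (t + c) *\<^sub>R e i)) < \<infinity>" for i x c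
  using line_bound[OF h ne, of x i] line_finite[OF h ne, of x i] nn_integral_shift[of "%t. a i (x + t *\<^sub>R e i)" c]
  unfolding a_def by auto
 have v1: "vec3 (x, y, z) + (t + - x) *\<^sub>R e 1 = vec3 (t, y, z)" for x y z t by (simp add: vec3_def e_def algebra_simps)
 have v2: "vec3 (x, y, z) + (t + - y) *\<^sub>R e 2 = vec3 (x, t, z)" for x y z t by (simp add: vec3_def e_def algebra_simps)
 have v3: "vec3 (x, y, z) + (t + - z) *\<^sub>R e 3 = vec3 (x, y, t)" for x y z t by (simp add: vec3_def e_def algebra_simps)
 have b: "ennreal (\<phi> (vec3 (x, y, z)) ^ 4) <= A1 y z" "A1 y z < \<infinity>" "ennreal (\<phi> (vec3 (x, y, z)) ^ 4) <= A2 x z" "A2 x z < \<infinity>"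
   "ennreal (\<phi> (vec3 (x, y, z)) ^ 4) <= A3 x y" "A3 x y < \<infinity>" for x y z
  using line[where x = "vec3 (x, y, z)" and i = 1 and c = "- x"] line[where x = "vec3 (x, y, z)" and i = 2 and c = "- y"]
   line[where x = "vec3 (x, y, z)" and i = 3 and c = "- z"]
  unfolding v1 v2 v3 A1_def A2_def A3_def \<phi> by auto
 define q where "q A = ennreal (sqrt (enn2real A))" for A
 have qm[measurable]: "q \<in> borel_measurable borel" unfolding q_def by measurable
 have q: "ennreal (t^2) <= q A" if le: "ennreal (t ^ 4) <= A" and fin: "A < \<infinity>" for t A
 proof -
  have "t ^ 4 <= enn2real A" using le fin by (cases A) auto
  then have "t^2 <= sqrt (enn2real A)" by (intro real_le_rsqrt) simp
  then show ?thesis unfolding q_def by (rule ennreal_leI)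
 qed
 have pt: "ennreal (\<phi> (vec3 (x, y, z)) ^ 6) <= q (A1 y z) * q (A2 x z) * q (A3 x y)" for x y z
 proof -
  have "ennreal (\<phi> (vec3 (x, y, z)) ^ 6) = ennreal ((\<phi> (vec3 (x, y, z)))^2) * ennreal ((\<phi> (vec3 (x, y, z)))^2) * ennreal ((\<phi> (vec3 (x, y, z)))^2)"
   by (simp add: ennreal_mult[symmetric] power_add[symmetric])
  also have "\<dots> <= q (A1 y z) * q (A2 x z) * q (A3 x y)"
   by (intro mult_mono q b) auto
  finally show ?thesis .
 qed
 have "(NI x. ennreal (\<phi> x ^ 6)) <= (NI x. NI y. NI z. q (A1 y z) * q (A2 x z) * q (A3 x y))"
  by (subst nn_integral_vec3) (auto intro!: nn_integral_mono pt)
 then have "(NI x. ennreal (\<phi> x ^ 6))^2 <= (NI x. NI y. NI z. q (A1 y z) * q (A2 x z) * q (A3 x y))^2"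
  by (rule power_mono) simp
 also have "\<dots> <= (NI y. NI z. (q (A1 y z))^2) * (NI x. NI z. (q (A2 x z))^2) * (NI x. NI y. (q (A3 x y))^2)"
  by (rule Loomis_Whitney; subst borel_prod[symmetric]; measurable)
 also have "\<dots> <= (NI y. NI z. A1 y z) * (NI x. NI z. A2 x z) * (NI x. NI y. A3 x y)"
  unfolding q_def by (intro mult_mono nn_integral_mono sqrt_enn2real_sq_le) auto
 also have "\<dots> = (NI x. a 1 x) * (NI x. a 2 x) * (NI x. a 3 x)"
 proof -
  have "(NI y. NI z. A1 y z) = (NI y. NI t. NI z. a 1 (vec3 (t, y, z)))"
   unfolding A1_def by (intro nn_integral_cong lborel_pair.Fubini') measurable
  also have "\<dots> = (NI t. NI y. NI z. a 1 (vec3 (t, y, z)))"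
   by (intro lborel_pair.Fubini') measurable
  also have "\<dots> = (NI x. a 1 x)" by (rule nn_integral_vec3[symmetric]) measurable
  finally have e1: "(NI y. NI z. A1 y z) = (NI x. a 1 x)" .
  have "(NI x. NI z. A2 x z) = (NI x. NI t. NI z. a 2 (vec3 (x, t, z)))"
   unfolding A2_def by (intro nn_integral_cong lborel_pair.Fubini') measurable
  also have "\<dots> = (NI x. a 2 x)" by (rule nn_integral_vec3[symmetric]) measurable
  finally have e2: "(NI x. NI z. A2 x z) = (NI x. a 2 x)" .
  have "(NI x. NI y. A3 x y) = (NI x. a 3 x)"
   unfolding A3_def by (rule nn_integral_vec3[symmetric]) measurable
  then show ?thesis using e1 e2 by simp
 qed
 also have "\<dots> <= (NI x. ennreal (norm (grad h x))) * (NI x. ennreal (norm (grad h x))) * (NI x. ennreal (norm (grad h x)))"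
 proof -
  have "(NI x. a i x) <= (NI x. ennreal (norm (grad h x)))" for i
   unfolding a_def using Cauchy_Schwarz_ineq2[of "grad h _" "e i"] ne by (intro nn_integral_mono ennreal_leI) simp
  then show ?thesis by (intro mult_mono) auto
 qed
 finally show ?thesis by (simp add: power3_eq_cube)
qed

lemma tf_power:
 assumes "\<phi> \<in> test_functions \<Omega>" "n > 0" shows "(%x. \<phi> x ^ n) \<in> test_functions \<Omega>"
proof -
 obtain m where n: "n = Suc m" using assms(2) gr0_implies_Suc by blast
 have "(%x. \<phi> x ^ m * \<phi> x) \<in> test_functions \<Omega>"
  by (rule tf_mult[OF assms(1) smooth_on_power[OF open_UNIV tf_smooth[OF assms(1)]]])
 then show ?thesis by (simp add: n mult.commute)
qed

text \<open>The previous inequality for the fourth power of \<phi>, with Cauchy-Schwarz on its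
  gradient, reads \<open>I^2 <= (4 * J * g)^3\<close> where \<open>I = J^2\<close>. Cancelling the
  cube of \<open>J\<close> gives \<open>J <= 64 * g^3\<close>, and
  \<open>4096 = 64^2\<close>.\<close>

lemma tf_Sobolev:
 fixes \<phi> :: "real^3 \<Rightarrow> real"
 assumes \<phi>: "\<phi> \<in> test_functions \<Omega>"
 shows "(LBINT x. \<phi> x ^ 6) <= 4096 * n2 lborel (grad \<phi>) ^ 6"
proof -
 define I where "I = (LBINT x. \<phi> x ^ 6)"
 define J where "J = n2 lborel (%x. \<phi> x ^ 3)"
 define g where "g = n2 lborel (grad \<phi>)"
 note m[measurable] = tf_measurable[OF \<phi>] tf_measurable_grad[OF \<phi>]
 have I0: "I \<ge> 0" unfolding I_def by (rule integral_nonneg') simp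
 have J: "J^2 = I" "J \<ge> 0" unfolding J_def I_def n2_sq_real by (simp_all add: power_mult[symmetric])
 have h: "(%x. \<phi> x ^ 4) \<in> test_functions UNIV" by (rule tf_UNIV[OF tf_power[OF \<phi>]]) simp
 have gh: "grad (%x. \<phi> x ^ 4) x = (4 * \<phi> x ^ 3) *\<^sub>R grad \<phi> x" for x
  by (rule grad_compose[OF tf_differentiable[OF \<phi>], of "%t. t ^ 4"]) (auto intro!: derivative_eq_intros)
 have L3: "L2 lborel (%x. \<bar>\<phi> x ^ 3\<bar>)" using tf_L2[OF tf_power[OF \<phi>, of 3]] by (auto simp: L2_def)
 have Lg: "L2 lborel (%x. norm (grad \<phi> x))" using tf_grad_L2[OF \<phi>] by (auto simp: L2_def)
 have n: "n2 lborel (%x. \<bar>\<phi> x ^ 3\<bar>) = J" "n2 lborel (%x. norm (grad \<phi> x)) = g"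
  by (simp_all add: J_def g_def n2_def)
 have "(NI x. ennreal (norm (grad (%x. \<phi> x ^ 4) x))) = (NI x. ennreal (4 * (\<bar>\<phi> x ^ 3\<bar> * norm (grad \<phi> x))))"
  by (simp add: gh abs_mult mult.assoc)
 also have "\<dots> = ennreal (4 * (LBINT x. \<bar>\<phi> x ^ 3\<bar> * norm (grad \<phi> x)))"
  using integrable_mult_L2[OF L3 Lg] by (subst nn_integral_eq_integral) auto
 also have "\<dots> <= ennreal (4 * (J * g))"
  using L2_Cauchy_Schwarz_real[OF L3 Lg] unfolding n by (intro ennreal_leI) auto
 finally have b: "(NI x. ennreal (norm (grad (%x. \<phi> x ^ 4) x))) <= ennreal (4 * (J * g))" .
 have "(NI x. ennreal (\<phi> x ^ 6)) = ennreal I"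
  unfolding I_def using tf_integrable[OF tf_power[OF \<phi>, of 6]] by (intro nn_integral_eq_integral) auto
 then have "(ennreal I)^2 <= (ennreal (4 * (J * g))) ^ 3"
  using Gagliardo_Nirenberg[OF h, of \<phi>] b m by (metis (no_types, lifting) order_trans power_mono zero_le)
 then have "I^2 <= (4 * (J * g)) ^ 3"
  using I0 J(2) by (simp add: ennreal_power g_def)
 then have "J ^ 3 * J <= J ^ 3 * (64 * g ^ 3)"
  unfolding J(1)[symmetric] by (simp add: power_mult_distrib power_mult[symmetric] power3_eq_cube power4_eq_xxxx mult_ac)
 then have "J <= 64 * g ^ 3"
  using J(2) by (cases "J = 0") (auto simp: g_def mult_le_cancel_left_pos)
 then have "J^2 <= (64 * g ^ 3)^2" using J(2) by (rule power_mono)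
 then show ?thesis unfolding J(1) by (simp add: I_def g_def power_mult_distrib power_mult[symmetric])
qed

locale bounded_open3 = bounded_open \<Omega> for \<Omega> :: "(real^3) set"
begin

lemma Sobolev:
 assumes u: "u \<in> H01 \<Omega>"
 shows "integrable M (%x. u x ^ 6)" "(LINT x|M. u x ^ 6) <= 4096 * nrm u ^ 6"
proof -
 obtain \<phi> where \<phi>: "!!n. \<phi> n \<in> test_functions \<Omega>" "(%n. n2 M (%x. u x - \<phi> n x)) \<longlonglongrightarrow> 0"
  "(%n. nrm (%x. u x - \<phi> n x)) \<longlonglongrightarrow> 0" by (rule H01_dense[OF u], rule that)
 obtain r where r: "strict_mono (r :: nat \<Rightarrow> nat)" "AE x in M. (%n. \<phi> (r n) x) \<longlonglongrightarrow> u x"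
  by (rule L2_convergence_AE_subseq[of M \<phi> u, OF test_L2_M[OF \<phi>(1)] H01_L2(1)[OF u]])
    (use \<phi>(2) in \<open>simp_all add: n2_commute[of M u]\<close>)
 have t6: "(%x. \<phi> n x ^ 6) \<in> test_functions \<Omega>" for n by (rule tf_power[OF \<phi>(1)]) simp
 have "(LINT x|M. \<phi> n x ^ 6) = (LBINT x. \<phi> n x ^ 6)" for n
  by (rule integral_M) (use tf_measurable[OF \<phi>(1)] tf_outside[OF \<phi>(1)] in auto)
 then have le: "(LINT x|M. \<phi> (r n) x ^ 6) <= 4096 * nrm (\<phi> (r n)) ^ 6" for n
  using tf_Sobolev[OF \<phi>(1)] by (simp add: H01_norm_test[OF \<phi>(1)])
 have "(%n. 4096 * nrm (\<phi> n) ^ 6) \<longlonglongrightarrow> 4096 * nrm u ^ 6"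
  by (intro tendsto_intros H01_norm_tendsto[OF test_H01(1)[OF \<phi>(1)] u \<phi>(3)])
 then have lim: "(%n. 4096 * nrm (\<phi> (r n)) ^ 6) \<longlonglongrightarrow> 4096 * nrm u ^ 6"
  using LIMSEQ_subseq_LIMSEQ[OF _ r(1)] by (auto simp: o_def)
 have int: "integrable M (%x. \<phi> (r n) x ^ 6)" for n
  using integrable_M[of "%x. \<phi> (r n) x ^ 6"] tf_integrable[OF t6] tf_measurable[OF t6] tf_outside[OF t6] by blast
 have ae: "AE x in M. (%n. \<phi> (r n) x ^ 6) \<longlonglongrightarrow> u x ^ 6"
  using r(2) by eventually_elim (intro tendsto_intros)
 have [measurable]: "u \<in> borel_measurable M" using H01_L2(1)[OF u] by (rule L2_measurable)
 show "integrable M (%x. u x ^ 6)" "(LINT x|M. u x ^ 6) <= 4096 * nrm u ^ 6"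
  by (rule Fatou_bound[OF int _ _ ae le lim]; simp)+
qed

end

subsection \<open>Rellich compactness\<close>

text \<open>The substitution costs the inverse Jacobian; for factors at least one half this is at
  most 2 to the dimension.\<close>

lemma nn_integral_affine_le:
 fixes f :: "'a::euclidean_space \<Rightarrow> ennreal"
 assumes [measurable]: "f \<in> borel_measurable borel" and c: "c \<ge> 1 / 2"
 shows "(NI x. f (t + c *\<^sub>R x)) <= 2 ^ DIM('a) * (NI x. f x)"
proof -
 have "(NI x. f x) = (\<integral>\<^sup>+x. f x \<partial>density (distr lborel borel (%x. t + c *\<^sub>R x)) (%_. \<bar>c\<bar> ^ DIM('a)))"
  using lborel_affine[of c t] c by simp
 also have "\<dots> = ennreal (\<bar>c\<bar> ^ DIM('a)) * (NI x. f (t + c *\<^sub>R x))"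
  by (simp add: nn_integral_density nn_integral_distr nn_integral_cmult)
 finally have eq: "(NI x. f x) = ennreal (\<bar>c\<bar> ^ DIM('a)) * (NI x. f (t + c *\<^sub>R x))" .
 have "1 <= (2 * \<bar>c\<bar>) ^ DIM('a)" using c by (intro one_le_power) auto
 then have "1 * (NI x. f (t + c *\<^sub>R x)) <= ennreal ((2 * \<bar>c\<bar>) ^ DIM('a)) * (NI x. f (t + c *\<^sub>R x))"
  by (intro mult_right_mono) auto
 also have "\<dots> = 2 ^ DIM('a) * (NI x. f x)"
  unfolding eq by (simp add: power_mult_distrib ennreal_mult mult.assoc ennreal_power[symmetric])
 finally show ?thesis by simp
qed

text \<open>The increment is estimated along the segment from \<open>x\<close> to \<open>y\<close>,
  which stays in \<open>Q\<close>. At parameter \<open>s\<close> the intermediate point is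
  substituted for \<open>y\<close> if \<open>s >= 1/2\<close> and for \<open>x\<close> otherwise, so
  that the scaling factor is never below one half.\<close>

lemma convex_oscillation_bound:
 fixes \<phi> :: "'a::euclidean_space \<Rightarrow> real"
 assumes \<phi>: "smooth_on UNIV \<phi>" and Q[measurable]: "Q \<in> sets borel" and conv: "convex Q"
  and diam: "!!x y. x \<in> Q ==> y \<in> Q ==> norm (y - x) <= \<delta>"
 shows "(NI x. NI y. ennreal ((\<phi> y - \<phi> x)^2) * (indicator Q x * indicator Q y))
  <= ennreal (\<delta>^2) * (emeasure lborel Q * (2 ^ DIM('a) * (NI x. ennreal ((norm (grad \<phi> x))^2) * indicator Q x)))"
proof -
 define G where "G x = ennreal ((norm (grad \<phi> x))^2)" for x
 define J where "J = (NI x. G x * indicator Q x)"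
 have [measurable]: "grad \<phi> \<in> borel_measurable borel"
  by (rule borel_measurable_continuous_onI[OF smooth_on_continuous_grad[OF \<phi>]])
 have Gm[measurable]: "G \<in> borel_measurable borel" unfolding G_def by measurable
 define K where "K x y s = G (x + s *\<^sub>R (y - x)) * (indicator Q x * indicator Q y * indicator {0..1} s)" for x y :: 'a and s :: real
 have pt: "ennreal ((\<phi> y - \<phi> x)^2) * (indicator Q x * indicator Q y) <= ennreal (\<delta>^2) * (NI s. K x y s)" for x y
 proof (cases "x \<in> Q \<and> y \<in> Q")
  case True
  have "ennreal ((\<phi> y - \<phi> x)^2) <= (NI s. ennreal ((grad \<phi> (x + s *\<^sub>R (y - x)) \<bullet> (y - x))^2) * indicator {0..1} s)"
   using line_Cauchy_Schwarz[OF \<phi>, of 1 x "y - x"] by simp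
  also have "\<dots> <= (NI s. ennreal (\<delta>^2) * K x y s)"
  proof (rule nn_integral_mono)
   fix s
   have "\<bar>grad \<phi> (x + s *\<^sub>R (y - x)) \<bullet> (y - x)\<bar> <= norm (grad \<phi> (x + s *\<^sub>R (y - x))) * \<delta>"
    using diam[of x y] True by (intro order_trans[OF Cauchy_Schwarz_ineq2] mult_left_mono) auto
   from power_mono[OF this, of 2] have "(grad \<phi> (x + s *\<^sub>R (y - x)) \<bullet> (y - x))^2 <= \<delta>^2 * (norm (grad \<phi> (x + s *\<^sub>R (y - x))))^2"
    by (simp add: power_mult_distrib mult.commute)
   then show "ennreal ((grad \<phi> (x + s *\<^sub>R (y - x)) \<bullet> (y - x))^2) * indicator {0..1} s <= ennreal (\<delta>^2) * K x y s"
    using True by (auto simp: K_def G_def indicator_def ennreal_mult[symmetric] intro!: ennreal_leI)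
  qed
  also have "\<dots> = ennreal (\<delta>^2) * (NI s. K x y s)"
   unfolding K_def by (rule nn_integral_cmult) measurable
  finally show ?thesis using True by simp
 qed auto
 have half: "(NI y. G ((1 - s) *\<^sub>R x + s *\<^sub>R y) * indicator Q y) <= 2 ^ DIM('a) * J" if s: "1 / 2 <= s" "s <= 1" and x: "x \<in> Q" for s x
 proof -
  have "(NI y. G ((1 - s) *\<^sub>R x + s *\<^sub>R y) * indicator Q y) <= (NI y. G ((1 - s) *\<^sub>R x + s *\<^sub>R y) * indicator Q ((1 - s) *\<^sub>R x + s *\<^sub>R y))"
   using convexD[OF conv x, of _ "1 - s" s] s by (intro nn_integral_mono mult_left_mono) (auto simp: indicator_def)
  also have "\<dots> <= 2 ^ DIM('a) * J" unfolding J_def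
   by (rule nn_integral_affine_le[of "%y. G y * indicator Q y"]) (use s in auto)
  finally show ?thesis .
 qed
 have Qe: "(NI x. (2 ^ DIM('a) * J) * indicator Q x) = emeasure lborel Q * (2 ^ DIM('a) * J)"
  by (subst nn_integral_cmult_indicator) (simp_all add: mult.commute)
 have s_bound: "(NI x. NI y. K x y s) <= emeasure lborel Q * (2 ^ DIM('a) * J) * indicator {0..1} s" for s
 proof (cases "s \<in> {0..1}")
  case True
  show ?thesis
  proof (cases "1 / 2 <= s")
   case s: True
   have "(NI x. NI y. K x y s) <= (NI x. (2 ^ DIM('a) * J) * indicator Q x)"
   proof (rule nn_integral_mono)
    fix x
    show "(NI y. K x y s) <= (2 ^ DIM('a) * J) * indicator Q x"
     using half[of s x] s True by (cases "x \<in> Q") (auto simp: K_def algebra_simps)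
   qed
   then show ?thesis using True unfolding Qe by simp
  next
   case s: False
   have "(NI x. NI y. K x y s) = (NI y. NI x. K x y s)"
    unfolding K_def by (rule lborel_pair.Fubini') measurable
   also have "\<dots> <= (NI y. (2 ^ DIM('a) * J) * indicator Q y)"
   proof (rule nn_integral_mono)
    fix y
    show "(NI x. K x y s) <= (2 ^ DIM('a) * J) * indicator Q y"
     using half[of "1 - s" y] s True by (cases "y \<in> Q") (auto simp: K_def algebra_simps)
   qed
   finally show ?thesis using True unfolding Qe by simp
  qed
 qed (auto simp: K_def)
 have "(NI x. NI y. ennreal ((\<phi> y - \<phi> x)^2) * (indicator Q x * indicator Q y))
  <= (NI x. NI y. ennreal (\<delta>^2) * (NI s. K x y s))"
  by (intro nn_integral_mono pt)
 also have "\<dots> = ennreal (\<delta>^2) * (NI x. NI y. NI s. K x y s)"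
  unfolding K_def by (simp add: nn_integral_cmult)
 also have "(NI x. NI y. NI s. K x y s) = (NI x. NI s. NI y. K x y s)"
  unfolding K_def by (intro nn_integral_cong lborel_pair.Fubini') measurable
 also have "\<dots> = (NI s. NI x. NI y. K x y s)"
  unfolding K_def by (rule lborel_pair.Fubini') measurable
 also have "\<dots> <= (NI s. emeasure lborel Q * (2 ^ DIM('a) * J) * indicator {0..1::real} s)"
  by (intro nn_integral_mono s_bound)
 also have "\<dots> = emeasure lborel Q * (2 ^ DIM('a) * J)"
  by (simp add: nn_integral_cmult_indicator)
 finally show ?thesis by (simp add: J_def G_def mult_left_mono)
qed

text \<open>Expanding the square in the double integral of \<open>(\<phi> y - \<phi> x)^2\<close>
  over \<open>Q\<close> gives \<open>2 * m * S - 2 * T^2\<close>, which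
  \<open>convex_oscillation_bound\<close> controls.\<close>

lemma convex_Poincare:
 fixes \<phi> :: "'a::euclidean_space \<Rightarrow> real"
 assumes \<phi>: "\<phi> \<in> test_functions \<Omega>" and Q[measurable]: "Q \<in> sets borel" and conv: "convex Q"
  and diam: "!!x y. x \<in> Q ==> y \<in> Q ==> norm (y - x) <= \<delta>"
  and fin: "emeasure lborel Q < \<infinity>" and pos: "measure lborel Q > 0"
 shows "(LBINT x. indicator Q x * (\<phi> x)^2) <= (LBINT x. indicator Q x * \<phi> x)^2 / measure lborel Q
  + \<delta>^2 * 2 ^ DIM('a) * (LBINT x. indicator Q x * (norm (grad \<phi> x))^2)"
proof -
 define S where "S = (LBINT x. indicator Q x * (\<phi> x)^2)"
 define T where "T = (LBINT x. indicator Q x * \<phi> x)"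
 define D where "D = (LBINT x. indicator Q x * (norm (grad \<phi> x))^2)"
 define m where "m = measure lborel Q"
 note [measurable] = tf_measurable[OF \<phi>] tf_measurable_grad[OF \<phi>]
 have iS: "integrable lborel (%x. indicator Q x * (\<phi> x)^2)"
  by (rule integrable_bound'[OF L2_integrable[OF tf_L2[OF \<phi>]]]) (auto simp: indicator_def)
 have iT: "integrable lborel (%x. indicator Q x * \<phi> x)"
  by (rule integrable_bound'[OF tf_integrable[OF \<phi>]]) (auto simp: indicator_def)
 have iD: "integrable lborel (%x. indicator Q x * (norm (grad \<phi> x))^2)"
  by (rule integrable_bound'[OF L2_integrable[OF tf_grad_L2[OF \<phi>]]]) (auto simp: indicator_def)
 have i1: "integrable lborel (indicator Q :: 'a \<Rightarrow> real)" using fin by simp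
 have m1: "(LBINT x. indicator Q x) = m" by (simp add: m_def)
 have eq: "indicator Q y * (\<phi> y - \<phi> x)^2 = indicator Q y * (\<phi> y)^2 - 2 * \<phi> x * (indicator Q y * \<phi> y) + (\<phi> x)^2 * indicator Q y" for x y
  by (simp add: power2_diff algebra_simps)
 have i: "integrable lborel (%y. indicator Q y * (\<phi> y - \<phi> x)^2)" for x
  unfolding eq by (intro integrable_add' integrable_diff' iS integrable_mult_right iT i1)
 have val: "(LBINT y. indicator Q y * (\<phi> y - \<phi> x)^2) = S - 2 * \<phi> x * T + (\<phi> x)^2 * m" for x
  unfolding eq S_def T_def m1[symmetric] using iS iT i1 by simp
 have nonneg: "0 <= S - 2 * \<phi> x * T + (\<phi> x)^2 * m" for x
  unfolding val[symmetric] by (intro integral_nonneg') auto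
 have inner: "(NI y. ennreal ((\<phi> y - \<phi> x)^2) * (indicator Q x * indicator Q y))
   = ennreal (indicator Q x * (S - 2 * \<phi> x * T + (\<phi> x)^2 * m))" for x
 proof -
  have "(NI y. ennreal (indicator Q y * (\<phi> y - \<phi> x)^2)) = ennreal (LBINT y. indicator Q y * (\<phi> y - \<phi> x)^2)"
   by (rule nn_integral_eq_integral[OF i]) auto
  moreover have "(NI y. ennreal ((\<phi> y - \<phi> x)^2) * (indicator Q x * indicator Q y)) =
   indicator Q x * (NI y. ennreal (indicator Q y * (\<phi> y - \<phi> x)^2))"
   by (subst nn_integral_cmult[symmetric]) (auto intro!: nn_integral_cong simp: indicator_def)
  ultimately show ?thesis unfolding val by (simp add: indicator_def)
 qed
 have eq2: "indicator Q x * (S - 2 * \<phi> x * T + (\<phi> x)^2 * m) = S * indicator Q x - 2 * T * (indicator Q x * \<phi> x) + m * (indicator Q x * (\<phi> x)^2)" for x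
  by (simp add: algebra_simps)
 have i2: "integrable lborel (%x. indicator Q x * (S - 2 * \<phi> x * T + (\<phi> x)^2 * m))"
  unfolding eq2 by (intro integrable_add' integrable_diff' iS integrable_mult_right iT i1)
 have v2: "(LBINT x. indicator Q x * (S - 2 * \<phi> x * T + (\<phi> x)^2 * m)) = 2 * m * S - 2 * T^2"
 proof -
  have "(LBINT x. S * indicator Q x - 2 * T * (indicator Q x * \<phi> x) + m * (indicator Q x * (\<phi> x)^2))
   = S * (LBINT x. indicator Q x) - 2 * T * (LBINT x. indicator Q x * \<phi> x) + m * (LBINT x. indicator Q x * (\<phi> x)^2)"
   using iS iT i1 by simp
  also have "\<dots> = 2 * m * S - 2 * T^2"
   unfolding m1 S_def[symmetric] T_def[symmetric] by (simp add: power2_eq_square)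
  finally show ?thesis unfolding eq2 .
 qed
 have D0: "D \<ge> 0" unfolding D_def by (intro integral_nonneg') auto
 have nn: "0 <= \<delta>^2 * (m * (2 ^ DIM('a) * D))" using D0 by (simp add: m_def)
 have "ennreal (LBINT x. indicator Q x * (S - 2 * \<phi> x * T + (\<phi> x)^2 * m))
   = (NI x. ennreal (indicator Q x * (S - 2 * \<phi> x * T + (\<phi> x)^2 * m)))"
  by (rule nn_integral_eq_integral[OF i2, symmetric]) (use nonneg in auto)
 also have "\<dots> = (NI x. NI y. ennreal ((\<phi> y - \<phi> x)^2) * (indicator Q x * indicator Q y))"
  by (simp add: inner)
 also have "\<dots> <= ennreal (\<delta>^2) * (emeasure lborel Q * (2 ^ DIM('a) * (NI x. ennreal ((norm (grad \<phi> x))^2) * indicator Q x)))"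
  by (rule convex_oscillation_bound[OF tf_smooth[OF \<phi>] Q conv diam])
 also have "(NI x. ennreal ((norm (grad \<phi> x))^2) * indicator Q x) = (NI x. ennreal (indicator Q x * (norm (grad \<phi> x))^2))"
  by (intro nn_integral_cong) (auto simp: indicator_def)
 also have "\<dots> = ennreal D" unfolding D_def by (rule nn_integral_eq_integral[OF iD]) auto
 also have "emeasure lborel Q = ennreal m" unfolding m_def using fin by (simp add: emeasure_eq_ennreal_measure)
 also have "ennreal (\<delta>^2) * (ennreal m * (2 ^ DIM('a) * ennreal D)) = ennreal (\<delta>^2 * (m * (2 ^ DIM('a) * D)))"
  using D0 by (simp add: ennreal_mult m_def ennreal_power[symmetric])
 finally have "2 * m * S - 2 * T^2 <= \<delta>^2 * (m * (2 ^ DIM('a) * D))"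
  unfolding v2 using nn by (simp add: ennreal_le_iff)
 with nn have "m * S <= T^2 + m * (\<delta>^2 * 2 ^ DIM('a) * D)" by (simp add: algebra_simps)
 then have "S <= T^2 / m + \<delta>^2 * 2 ^ DIM('a) * D"
  using pos unfolding m_def[symmetric] by (simp add: field_simps)
 then show ?thesis by (simp add: S_def T_def D_def m_def)
qed

text \<open>The integer point naming the cube of side \<open>h\<close> that contains
  \<open>x\<close>. Using \<open>floor\<close> makes the cubes half-open, so they partition the
  space exactly.\<close>

definition cell_label :: "real \<Rightarrow> 'a::euclidean_space \<Rightarrow> 'a" where
 "cell_label h x = (\<Sum>b\<in>Basis. of_int \<lfloor>x \<bullet> b / h\<rfloor> *\<^sub>R b)"

definition cell :: "real \<Rightarrow> 'a::euclidean_space \<Rightarrow> 'a set" where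
 "cell h l = {x. cell_label h x = l}"

lemma cell_label_inner: "b \<in> Basis ==> cell_label h x \<bullet> b = of_int \<lfloor>x \<bullet> b / h\<rfloor>"
 by (simp add: cell_label_def inner_sum_left inner_Basis if_distrib cong: if_cong)

lemma cell_eq:
 assumes "h > 0" "l \<in> range (cell_label h)"
 shows "cell h l = {x. \<forall>b\<in>Basis. h * (l \<bullet> b) <= x \<bullet> b \<and> x \<bullet> b < h * (l \<bullet> b + 1)}"
proof -
 obtain y where l: "l = cell_label h y" using assms by blast
 have "cell_label h x = l \<longleftrightarrow> (\<forall>b\<in>Basis. \<lfloor>x \<bullet> b / h\<rfloor> = \<lfloor>y \<bullet> b / h\<rfloor>)" for x
  by (auto simp: l euclidean_eq_iff[where 'a = 'a] cell_label_inner)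
 also have "\<dots> x \<longleftrightarrow> (\<forall>b\<in>Basis. h * (l \<bullet> b) <= x \<bullet> b \<and> x \<bullet> b < h * (l \<bullet> b + 1))" for x
  using assms(1) by (intro ball_cong refl) (auto simp: l cell_label_inner floor_eq_iff field_simps)
 finally show ?thesis by (auto simp: cell_def)
qed

lemma cell_props:
 assumes h: "h > 0" and l: "(l :: 'a::euclidean_space) \<in> range (cell_label h)"
 shows "cell h l \<in> sets borel" "convex (cell h l)" "emeasure lborel (cell h l) < \<infinity>" "measure lborel (cell h l) > 0"
  "!!x y. x \<in> cell h l ==> y \<in> cell h l ==> norm (y - x) <= real DIM('a) * h"
proof -
 define Q where "Q = cell h l"
 define p where "p = h *\<^sub>R l" define q where "q = h *\<^sub>R (l + One)"
 have Q: "Q = {x. \<forall>b\<in>Basis. h * (l \<bullet> b) <= x \<bullet> b \<and> x \<bullet> b < h * (l \<bullet> b + 1)}"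
  unfolding Q_def by (rule cell_eq[OF h l])
 have Q': "Q = (\<Inter>b\<in>Basis. {x. h * (l \<bullet> b) <= x \<bullet> b} \<inter> {x. x \<bullet> b < h * (l \<bullet> b + 1)})"
  unfolding Q by auto
 show m: "Q \<in> sets borel" unfolding Q' by (intro sets.finite_INT) auto
 show "convex Q" unfolding Q'
  by (intro convex_INT convex_Int) (auto simp: convex_halfspace_ge convex_halfspace_lt inner_commute[of _ "_ :: 'a"])
 have sub: "box p q \<subseteq> Q" "Q \<subseteq> cbox p q"
  unfolding Q p_def q_def by (auto simp: mem_box inner_add_left less_imp_le)
 have "emeasure lborel Q <= emeasure lborel (cbox p q)" by (rule emeasure_mono[OF sub(2)]) simp
 then show fin: "emeasure lborel Q < \<infinity>" using emeasure_lborel_cbox_finite[of p q] le_less_trans by blast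
 have "measure lborel (box p q) = (\<Prod>b\<in>(Basis :: 'a set). h)"
  using h by (subst measure_lborel_box) (auto simp: p_def q_def inner_add_left inner_diff_left algebra_simps)
 then have "0 < measure lborel (box p q)" using h by simp
 also have "\<dots> <= measure lborel Q" by (rule measure_mono_fmeasurable[OF sub(1)]) (use m fin in \<open>auto simp: fmeasurable_def\<close>)
 finally show "measure lborel Q > 0" .
 show "norm (y - x) <= real DIM('a) * h" if "x \<in> Q" "y \<in> Q" for x y
 proof -
  have "norm (y - x) <= (\<Sum>b\<in>Basis. \<bar>(y - x) \<bullet> b\<bar>)" by (rule norm_le_l1)
  also have "\<dots> <= (\<Sum>b\<in>(Basis :: 'a set). h)"
   using that by (intro sum_mono) (force simp: Q inner_diff_left algebra_simps abs_le_iff)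
  finally show ?thesis by simp
 qed
qed

lemma finite_cell_labels:
 assumes "bounded \<Omega>" "h > 0" shows "finite (cell_label h ` (\<Omega> :: 'a::euclidean_space set))"
proof -
 obtain R where R: "!!x. x \<in> \<Omega> ==> norm x <= R" using assms bounded_iff by blast
 define F where "F = (Basis :: 'a set) \<rightarrow>\<^sub>E {\<lfloor>- R / h\<rfloor>..\<lfloor>R / h\<rfloor>}"
 have "cell_label h ` \<Omega> \<subseteq> (%k. \<Sum>b\<in>(Basis :: 'a set). of_int (k b) *\<^sub>R b) ` F"
 proof (intro image_subsetI rev_image_eqI)
  fix x assume x: "x \<in> \<Omega>"
  have "\<bar>x \<bullet> b\<bar> <= R" if "b \<in> Basis" for b using Basis_le_norm[OF that, of x] R[OF x] by linarith
  then have "- R / h <= x \<bullet> b / h \<and> x \<bullet> b / h <= R / h" if "b \<in> Basis" for b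
   using that assms(2) by (metis abs_le_iff divide_right_mono less_imp_le minus_le_iff)
  then show "restrict (%b. \<lfloor>x \<bullet> b / h\<rfloor>) Basis \<in> F"
   unfolding F_def by (auto intro!: floor_mono)
  show "cell_label h x = (\<Sum>b\<in>Basis. of_int (restrict (%b. \<lfloor>x \<bullet> b / h\<rfloor>) Basis b) *\<^sub>R b)"
   unfolding cell_label_def by (intro sum.cong) auto
 qed
 moreover have "finite F" unfolding F_def by (intro finite_PiE) auto
 ultimately show ?thesis using finite_surj by blast
qed

text \<open>This is the mechanism of compactness: up to an error proportional to the mesh
  \<open>h\<close> times the gradient norm, the \<open>L2\<close> norm is controlled by finitely
  many linear functionals, the integrals over the cubes meeting \<Omega>.\<close>

lemma cell_decomposition:
 fixes \<phi> :: "'a::euclidean_space \<Rightarrow> real"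
 assumes \<phi>: "\<phi> \<in> test_functions \<Omega>" and \<Omega>: "bounded \<Omega>" and h: "h > 0"
 shows "(n2 lborel \<phi>)^2 <= (\<Sum>l\<in>cell_label h ` \<Omega>. (LBINT x. indicator (cell h l) x * \<phi> x)^2 / measure lborel (cell h l))
  + (real DIM('a) * h)^2 * 2 ^ DIM('a) * (n2 lborel (grad \<phi>))^2"
proof -
 define L where "L = cell_label h ` \<Omega>"
 have fin: "finite L" unfolding L_def by (rule finite_cell_labels[OF \<Omega> h])
 note P = cell_props[OF h, where 'a = 'a]
 have range: "l \<in> range (cell_label h)" if "l \<in> L" for l using that by (auto simp: L_def)
 note [measurable] = tf_measurable[OF \<phi>] tf_measurable_grad[OF \<phi>]
 have one: "(\<Sum>l\<in>L. indicator (cell h l) x * c) = c" if "x \<notin> \<Omega> ==> c = 0" for x :: 'a and c :: real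
 proof (cases "x \<in> \<Omega>")
  case True
  have "(\<Sum>l\<in>L. indicator (cell h l) x * c) = (\<Sum>l\<in>{cell_label h x}. indicator (cell h l) x * c)"
   using True by (intro sum.mono_neutral_right fin) (auto simp: L_def cell_def indicator_def)
  then show ?thesis by (simp add: cell_def)
 qed (use that in simp)
 have split: "(LBINT x. f x) = (\<Sum>l\<in>L. LBINT x. indicator (cell h l) x * f x)"
  if f: "integrable lborel f" "!!x. x \<notin> \<Omega> ==> f x = 0" for f :: "'a \<Rightarrow> real"
 proof -
  have "integrable lborel (%x. indicator (cell h l) x * f x)" if "l \<in> L" for l
   using P(1)[OF range[OF that]] f(1)
   by (intro integrable_bound'[OF f(1)]) (auto simp: indicator_def)
  then have "(\<Sum>l\<in>L. LBINT x. indicator (cell h l) x * f x) = (LBINT x. (\<Sum>l\<in>L. indicator (cell h l) x * f x))"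
   by (rule integral_sum'[symmetric])
  then show ?thesis using one f(2) by simp
 qed
 have "(n2 lborel \<phi>)^2 = (\<Sum>l\<in>L. LBINT x. indicator (cell h l) x * (\<phi> x)^2)"
  unfolding n2_sq_real using L2_integrable_real[OF tf_L2[OF \<phi>]] tf_outside[OF \<phi>] by (intro split) auto
 also have "\<dots> <= (\<Sum>l\<in>L. (LBINT x. indicator (cell h l) x * \<phi> x)^2 / measure lborel (cell h l)
  + (real DIM('a) * h)^2 * 2 ^ DIM('a) * (LBINT x. indicator (cell h l) x * (norm (grad \<phi> x))^2))"
  by (rule sum_mono, rule convex_Poincare[OF \<phi> P(1,2,5,3,4)[OF range]])
 also have "\<dots> = (\<Sum>l\<in>L. (LBINT x. indicator (cell h l) x * \<phi> x)^2 / measure lborel (cell h l))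
  + (real DIM('a) * h)^2 * 2 ^ DIM('a) * (\<Sum>l\<in>L. LBINT x. indicator (cell h l) x * (norm (grad \<phi> x))^2)"
  by (simp add: sum.distrib sum_distrib_left)
 also have "(\<Sum>l\<in>L. LBINT x. indicator (cell h l) x * (norm (grad \<phi> x))^2) = (n2 lborel (grad \<phi>))^2"
  unfolding n2_sq using L2_integrable[OF tf_grad_L2[OF \<phi>]] tf_grad_outside[OF \<phi>] by (intro split[symmetric]) auto
 finally show ?thesis by (simp add: L_def)
qed

text \<open>The integrals over all cubes of sides \<open>1 / (k + 1)\<close> form a countable
  family, bounded in \<open>n\<close>, so a diagonal subsequence makes all of them converge. For
  given \<open>e\<close> a fine mesh makes the gradient term small, and only finitely many integrals
  remain.\<close>

lemma Rellich_test_functions: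
 fixes \<phi> :: "nat \<Rightarrow> 'a::euclidean_space \<Rightarrow> real"
 assumes \<phi>: "!!n. \<phi> n \<in> test_functions \<Omega>" and \<Omega>: "bounded \<Omega>" "open \<Omega>" and C: "!!n. n2 lborel (grad (\<phi> n)) <= C"
 obtains r where "strict_mono (r :: nat \<Rightarrow> nat)"
  "!!e. e > 0 ==> \<exists>N. \<forall>i\<ge>N. \<forall>j\<ge>N. n2 lborel (%x. \<phi> (r i) x - \<phi> (r j) x) < e"
proof -
 define S where "S = (SIGMA k:UNIV. cell_label (1 / real (Suc k)) ` \<Omega>)"
 define a where "a n s = (LBINT x. indicator (cell (1 / real (Suc (fst s))) (snd s)) x * \<phi> n x)" for n and s :: "nat \<times> 'a"
 have fin: "finite (cell_label (1 / real (Suc k)) ` \<Omega>)" for k by (rule finite_cell_labels[OF \<Omega>(1)]) simp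
 have count: "countable S" unfolding S_def by (rule countable_SIGMA[OF _ countable_finite[OF fin]]) simp
 obtain D where D: "D > 0" "!!x. x \<in> \<Omega> ==> norm x <= D" using \<Omega>(1) unfolding bounded_pos by blast
 then have sub: "\<Omega> \<subseteq> cball 0 D" by auto
 note [measurable] = tf_measurable[OF \<phi>] borel_open[OF \<Omega>(2)]
 have efin: "emeasure lborel \<Omega> < \<infinity>" using \<Omega>(1) by (rule emeasure_bounded_finite)
 have i2: "(indicator \<Omega> x :: real)^2 = indicator \<Omega> x" for x by (auto simp: indicator_def)
 have L\<Omega>: "L2 lborel (indicator \<Omega> :: 'a \<Rightarrow> real)" using efin by (auto simp: L2_def i2)
 have bd: "norm (a n s) <= n2 lborel (indicator \<Omega> :: 'a \<Rightarrow> real) * ((2 * D + 1) * C)" if s: "s \<in> S" for n s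
 proof -
  have [measurable]: "cell (1 / real (Suc (fst s))) (snd s) \<in> sets borel"
   using s by (intro cell_props(1)) (auto simp: S_def)
  define i where "i x = (indicator (cell (1 / real (Suc (fst s))) (snd s)) x * indicator \<Omega> x :: real)" for x
  have [measurable]: "i \<in> borel_measurable borel" unfolding i_def by measurable
  have ae: "AE x in lborel. norm (i x) <= norm (indicator \<Omega> x :: real)" by (auto simp: i_def indicator_def)
  have i: "L2 lborel i" "n2 lborel i <= n2 lborel (indicator \<Omega> :: 'a \<Rightarrow> real)"
   using L2_bound[OF L\<Omega> _ ae] by simp_all
  have "a n s = (LBINT x. i x * \<phi> n x)"
   unfolding a_def i_def using tf_outside[OF \<phi>] by (intro integral_cong'[OF refl]) (auto simp: indicator_def)
  then have "norm (a n s) <= n2 lborel i * n2 lborel (\<phi> n)"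
   using L2_Cauchy_Schwarz_real[OF i(1) tf_L2[OF \<phi>]] by simp
  also have "\<dots> <= n2 lborel (indicator \<Omega> :: 'a \<Rightarrow> real) * ((2 * D + 1) * C)"
  proof (intro mult_mono i)
   have "(2 * D + 1) * n2 lborel (grad (\<phi> n)) <= (2 * D + 1) * C" using D C by (intro mult_left_mono) auto
   then show "n2 lborel (\<phi> n) <= (2 * D + 1) * C" using tf_Poincare[OF \<phi> sub, of n] D(1) by linarith
  qed simp_all
  finally show ?thesis .
 qed
 have "\<exists>r :: nat \<Rightarrow> nat. strict_mono r \<and> (\<forall>s\<in>S. \<exists>l. (%n. a (r n) s) \<longlonglongrightarrow> l)"
 proof (rule function_convergent_subsequence[OF count, of a, OF bd])
  fix k :: "nat \<Rightarrow> nat" assume k: "strict_mono k" "!!x. x \<in> S ==> \<exists>l. (%n. a (k n) x) \<longlonglongrightarrow> l"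
  show ?thesis by (intro exI[of _ k] conjI ballI k)
 qed
 then obtain r where r: "strict_mono (r :: nat \<Rightarrow> nat)" "!!s. s \<in> S ==> \<exists>l. (%n. a (r n) s) \<longlonglongrightarrow> l"
  by blast
 then obtain A where A: "!!s. s \<in> S ==> (%n. a (r n) s) \<longlonglongrightarrow> A s" by metis
 have "\<exists>N. \<forall>i\<ge>N. \<forall>j\<ge>N. n2 lborel (%x. \<phi> (r i) x - \<phi> (r j) x) < e" if e: "e > 0" for e
 proof -
  define c where "c = (real DIM('a))^2 * 2 ^ DIM('a) * (2 * C)^2"
  have "(%k. c * (1 / real (Suc k))^2) \<longlonglongrightarrow> c * 0^2"
   using LIMSEQ_inverse_real_of_nat by (intro tendsto_intros) (simp add: inverse_eq_divide)
  then have "\<forall>\<^sub>F k in sequentially. c * (1 / real (Suc k))^2 < e^2 / 2"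
   using e by (intro order_tendstoD(2)) auto
  then obtain k where k: "c * (1 / real (Suc k))^2 < e^2 / 2" by (auto simp: eventually_sequentially)
  define h where "h = 1 / real (Suc k)"
  define L where "L = cell_label h ` \<Omega>"
  have LS: "(k, l) \<in> S" if "l \<in> L" for l using that by (auto simp: S_def L_def h_def)
  define t where "t i = (\<Sum>l\<in>L. 2 * (a (r i) (k, l) - A (k, l))^2 / measure lborel (cell h l))" for i
  have "t \<longlonglongrightarrow> (\<Sum>l\<in>L. 2 * (A (k, l) - A (k, l))^2 / measure lborel (cell h l))"
   unfolding t_def divide_inverse by (intro tendsto_intros A LS)
  then have "\<forall>\<^sub>F i in sequentially. t i < e^2 / 4" using e by (intro order_tendstoD(2)) auto
  then obtain N where N: "!!i. i \<ge> N ==> t i < e^2 / 4" by (auto simp: eventually_sequentially)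
  have "n2 lborel (%x. \<phi> (r i) x - \<phi> (r j) x) < e" if ij: "i \<ge> N" "j \<ge> N" for i j
  proof -
   let ?\<psi> = "%x. \<phi> (r i) x - \<phi> (r j) x"
   have \<psi>: "?\<psi> \<in> test_functions \<Omega>" by (rule tf_diff[OF \<phi> \<phi>])
   have g: "n2 lborel (grad ?\<psi>) <= 2 * C"
    unfolding tf_grad_diff[OF \<phi> \<phi>]
    using n2_triangle_diff[OF tf_grad_L2[OF \<phi>] tf_grad_L2[OF \<phi>], of "r i" "r j"] C[of "r i"] C[of "r j"] by linarith
   have "(n2 lborel ?\<psi>)^2 <= (\<Sum>l\<in>L. (LBINT x. indicator (cell h l) x * ?\<psi> x)^2 / measure lborel (cell h l))
    + (real DIM('a) * h)^2 * 2 ^ DIM('a) * (n2 lborel (grad ?\<psi>))^2"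
    unfolding L_def by (rule cell_decomposition[OF \<psi> \<Omega>(1)]) (simp add: h_def)
   also have "(real DIM('a) * h)^2 * 2 ^ DIM('a) * (n2 lborel (grad ?\<psi>))^2 <= (real DIM('a) * h)^2 * 2 ^ DIM('a) * (2 * C)^2"
    using g by (intro mult_left_mono power_mono) auto
   also have "\<dots> = c * (1 / real (Suc k))^2" unfolding c_def h_def power_mult_distrib by (simp only: mult_ac)
   also have "(\<Sum>l\<in>L. (LBINT x. indicator (cell h l) x * ?\<psi> x)^2 / measure lborel (cell h l)) <= t i + t j"
    unfolding t_def sum.distrib[symmetric]
   proof (rule sum_mono)
    fix l assume l: "l \<in> L"
    have ak: "a n (k, l) = (LBINT x. indicator (cell h l) x * \<phi> n x)" for n
     unfolding a_def h_def by (simp only: fst_conv snd_conv)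
    have lr: "l \<in> range (cell_label h)" "h > 0" using l by (auto simp: L_def h_def)
    have [measurable]: "cell h l \<in> sets borel" by (rule cell_props(1)[OF lr(2,1)])
    have int: "integrable lborel (%x. indicator (cell h l) x * \<phi> n x)" for n
     by (rule integrable_bound'[OF tf_integrable[OF \<phi>[of n]]]) (auto simp: indicator_def)
    have "(LBINT x. indicator (cell h l) x * ?\<psi> x) = (a (r i) (k, l) - A (k, l)) + (A (k, l) - a (r j) (k, l))"
     using int by (simp add: ak right_diff_distrib)
    then have "(LBINT x. indicator (cell h l) x * ?\<psi> x)^2 <= 2 * (a (r i) (k, l) - A (k, l))^2 + 2 * (A (k, l) - a (r j) (k, l))^2"
     using norm_add_sq_le[of "a (r i) (k, l) - A (k, l)" "A (k, l) - a (r j) (k, l)"] by simp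
    then show "(LBINT x. indicator (cell h l) x * ?\<psi> x)^2 / measure lborel (cell h l) <=
     2 * (a (r i) (k, l) - A (k, l))^2 / measure lborel (cell h l) + 2 * (a (r j) (k, l) - A (k, l))^2 / measure lborel (cell h l)"
     unfolding add_divide_distrib[symmetric] by (intro divide_right_mono) (auto simp: power2_commute)
   qed
   finally have "(n2 lborel ?\<psi>)^2 < e^2" using N[OF ij(1)] N[OF ij(2)] k by linarith
   then show ?thesis using e by (simp add: power_less_imp_less_base)
  qed
  then show ?thesis by blast
 qed
 then show thesis using that r(1) by blast
qed

context bounded_open
begin

lemma H01_test_sequence:
 assumes "!!n. u n \<in> H01 \<Omega>"
 obtains \<phi> where "!!n. \<phi> n \<in> test_functions \<Omega>" "!!n. nrm (%x. u n x - \<phi> n x) < 1 / real (Suc n)"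
proof -
 have "\<exists>\<phi>\<in>test_functions \<Omega>. nrm (%x. u n x - \<phi> x) < 1 / real (Suc n)" for n
 proof -
  obtain \<phi> where \<phi>: "!!n. \<phi> n \<in> test_functions \<Omega>" "(%k. n2 M (%x. u n x - \<phi> k x)) \<longlonglongrightarrow> 0"
   "(%k. nrm (%x. u n x - \<phi> k x)) \<longlonglongrightarrow> 0" by (rule H01_dense[OF assms], rule that)
  have "\<forall>\<^sub>F k in sequentially. nrm (%x. u n x - \<phi> k x) < 1 / real (Suc n)"
   by (rule order_tendstoD(2)[OF \<phi>(3)]) simp
  then show ?thesis using \<phi>(1) by (auto simp: eventually_sequentially)
 qed
 then show thesis using that by metis
qed

text \<open>Stated as a Cauchy property: for critical points it is later upgraded to the Dirichlet
  norm, and the limit is taken there.\<close>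

lemma Rellich:
 assumes u: "!!n. u n \<in> H01 \<Omega>" and C: "!!n. nrm (u n) <= C"
 obtains r where "strict_mono (r :: nat \<Rightarrow> nat)"
  "!!e. e > 0 ==> \<exists>N. \<forall>i\<ge>N. \<forall>j\<ge>N. n2 M (%x. u (r i) x - u (r j) x) < e"
proof -
 obtain P where P: "P > 0" "!!u. u \<in> H01 \<Omega> ==> n2 M u <= P * nrm u" using Poincare by blast
 obtain \<phi> where \<phi>: "!!n. \<phi> n \<in> test_functions \<Omega>" "!!n. nrm (%x. u n x - \<phi> n x) < 1 / real (Suc n)"
  by (rule H01_test_sequence[of u, OF u], rule that)
 note t = test_H01(1)[OF \<phi>(1)]
 have gC: "n2 lborel (grad (\<phi> n)) <= C + 1" for n
 proof -
  have "1 / real (Suc n) <= 1" by simp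
  then show ?thesis
   using H01_norm_triangle_diff[OF u t, of n n] \<phi>(2)[of n] C[of n] unfolding H01_norm_test[OF \<phi>(1), symmetric] by linarith
 qed
 obtain r where r: "strict_mono (r :: nat \<Rightarrow> nat)"
  "!!e. e > 0 ==> \<exists>N. \<forall>i\<ge>N. \<forall>j\<ge>N. n2 lborel (%x. \<phi> (r i) x - \<phi> (r j) x) < e"
 proof (rule Rellich_test_functions[of \<phi>, OF \<phi>(1) bounded_dom open_dom gC])
  fix k :: "nat \<Rightarrow> nat" assume "strict_mono k"
   "!!e. e > 0 ==> \<exists>N. \<forall>i\<ge>N. \<forall>j\<ge>N. n2 lborel (%x. \<phi> (k i) x - \<phi> (k j) x) < e"
  then show thesis by (rule that)
 qed
 have "\<exists>N. \<forall>i\<ge>N. \<forall>j\<ge>N. n2 M (%x. u (r i) x - u (r j) x) < e" if e: "e > 0" for e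
 proof -
  obtain N1 where N1: "!!i j. i \<ge> N1 ==> j \<ge> N1 ==> n2 lborel (%x. \<phi> (r i) x - \<phi> (r j) x) < e / 3"
   using r(2)[of "e / 3"] e by auto
  obtain N2 where N2: "1 / real (Suc N2) < e / (3 * P)"
   using reals_Archimedean[of "e / (3 * P)"] e P(1) by (auto simp: inverse_eq_divide)
  have small: "n2 M (%x. u (r i) x - \<phi> (r i) x) < e / 3" if "i \<ge> N2" for i
  proof -
   have "real (Suc N2) <= real (Suc (r i))" using that seq_suble[OF r(1), of i] by simp
   then have "1 / real (Suc (r i)) <= 1 / real (Suc N2)" by (intro divide_left_mono) auto
   then have "P * nrm (%x. u (r i) x - \<phi> (r i) x) < P * (e / (3 * P))"
    using \<phi>(2)[of "r i"] N2 P(1) by (intro mult_strict_left_mono) linarith+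
   then show ?thesis using P(2)[OF H01_diff[OF u t], of "r i" "r i"] P(1) by simp
  qed
  have "n2 M (%x. u (r i) x - u (r j) x) < e" if "i \<ge> max N1 N2" "j \<ge> max N1 N2" for i j
  proof -
   have "n2 M (%x. u (r i) x - u (r j) x) <= n2 M (%x. u (r i) x - \<phi> (r i) x) + n2 M (%x. \<phi> (r i) x - u (r j) x)"
    by (intro n2_triangle3 H01_L2 u t)
   also have "n2 M (%x. \<phi> (r i) x - u (r j) x) <= n2 M (%x. \<phi> (r i) x - \<phi> (r j) x) + n2 M (%x. \<phi> (r j) x - u (r j) x)"
    by (intro n2_triangle3 H01_L2 u t)
   finally show ?thesis
    using small[of i] small[of j] N1[of i j] that n2_commute[of M "\<phi> (r j)" "u (r j)"]
     test_n2_M[OF tf_diff[OF \<phi>(1) \<phi>(1)], of "r i" "r j"] by simp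
  qed
  then show ?thesis by blast
 qed
 then show thesis using that r(1) by blast
qed

end

subsection \<open>The power nonlinearity\<close>

text \<open>With \<open>r = \<gamma> - 2\<close> this is the nonlinearity of the equation.\<close>

definition spow :: "real \<Rightarrow> real \<Rightarrow> real" where
 "spow r s = \<bar>s\<bar> powr r * s"

lemma measurable_spow[measurable]: "spow r \<in> borel_measurable borel"
 unfolding spow_def by measurable

lemma DERIV_spow:
 assumes "r > 0" shows "(spow r has_real_derivative (r + 1) * \<bar>s\<bar> powr r) (at s)"
proof -
 consider "s > 0" | "s < 0" | "s = 0" by linarith
 then show ?thesis
 proof cases
  case 1
  have "((%s. s powr (r + 1)) has_real_derivative (r + 1) * \<bar>s\<bar> powr r) (at s)"
   using has_real_derivative_powr[OF 1, of "r + 1"] 1 by simp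
  then show ?thesis
   by (rule has_field_derivative_transform_within_open[where S = "{0<..}"]) (use 1 in \<open>auto simp: spow_def powr_add\<close>)
 next
  case 2
  have "((%s. (- s) powr (r + 1)) has_real_derivative ((r + 1) * (- s) powr (r + 1 - 1)) * (- 1)) (at s)"
   by (rule DERIV_chain2[OF has_real_derivative_powr]) (use 2 in \<open>auto intro!: derivative_eq_intros\<close>)
  from DERIV_minus[OF this]
  have "((%s. - ((- s) powr (r + 1))) has_real_derivative (r + 1) * \<bar>s\<bar> powr r) (at s)" using 2 by simp
  then show ?thesis
   by (rule has_field_derivative_transform_within_open[where S = "{..<0}"]) (use 2 in \<open>auto simp: spow_def powr_add\<close>)
 next
  case 3
  have "((%y. \<bar>y\<bar> powr r) \<longlongrightarrow> 0) (at (0::real))"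
   by (rule tendsto_zero_powrI[of _ _ _ r]) (use assms in \<open>auto intro!: tendsto_eq_intros\<close>)
  then have "((%y. (spow r y - spow r 0) / (y - 0)) \<longlongrightarrow> 0) (at 0)"
   by (rule Lim_transform_eventually) (auto simp: spow_def eventually_at_filter)
  then show ?thesis using 3 assms by (simp add: has_field_derivative_iff)
 qed
qed

lemma abs_powr_eq_spow: "2 < \<gamma> ==> \<bar>s\<bar> powr \<gamma> = spow (\<gamma> - 2) s * s"
 by (cases "s = 0") (auto simp: spow_def powr_diff power2_eq_square[symmetric] field_simps)

lemma DERIV_abs_powr:
 assumes "2 < \<gamma>" shows "((%s. \<bar>s\<bar> powr \<gamma>) has_real_derivative \<gamma> * spow (\<gamma> - 2) s) (at s)"
proof -
 have "((%s. spow (\<gamma> - 2) s * s) has_real_derivative ((\<gamma> - 2 + 1) * \<bar>s\<bar> powr (\<gamma> - 2)) * s + 1 * spow (\<gamma> - 2) s) (at s)"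
  using DERIV_mult[OF DERIV_spow[of "\<gamma> - 2" s] DERIV_ident] assms by simp
 moreover have "(%s. spow (\<gamma> - 2) s * s) = (%s. \<bar>s\<bar> powr \<gamma>)" using abs_powr_eq_spow[OF assms] by auto
 ultimately show ?thesis by (simp add: spow_def algebra_simps)
qed

lemma MVT_signed:
 assumes "!!x. (f has_real_derivative f' x) (at x)"
 shows "\<exists>z. \<bar>z - s\<bar> <= \<bar>t\<bar> \<and> f (s + t) - f s = t * f' z"
proof -
 consider "t > 0" | "t < 0" | "t = 0" by linarith
 then show ?thesis
 proof cases
  case 1
  then obtain z where "s < z" "z < s + t" "f (s + t) - f s = (s + t - s) * f' z"
   using MVT2[of s "s + t" f f'] assms by auto
  then show ?thesis by (intro exI[of _ z]) auto
 next
  case 2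
  then obtain z where "s + t < z" "z < s" "f s - f (s + t) = (s - (s + t)) * f' z"
   using MVT2[of "s + t" s f f'] assms by auto
  then show ?thesis by (intro exI[of _ z]) auto
 qed auto
qed

lemma powr_le_one_plus_sq: "0 <= r ==> r <= 2 ==> \<bar>z\<bar> powr r <= 1 + (z::real)^2"
proof -
 assume r: "0 <= r" "r <= 2"
 show ?thesis
 proof (cases "\<bar>z\<bar> <= 1")
  case True
  then have "\<bar>z\<bar> powr r <= 1" using r powr_le1[of r "\<bar>z\<bar>"] by simp
  then show ?thesis using zero_le_power2[of z] by linarith
 next
  case False
  then have "\<bar>z\<bar> powr r <= \<bar>z\<bar> powr 2" using r by (intro powr_mono) auto
  then show ?thesis by simp
 qed
qed

text \<open>The mean value theorem is applied to the power and then to its derivative. The majorant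
  is a polynomial that \<open>L2\<close> and \<open>L4\<close> norms can integrate;
  \<open>12 = 4 * 3\<close> bounds \<open>\<gamma> * (\<gamma> - 1)\<close>.\<close>

lemma abs_powr_Taylor:
 assumes \<gamma>: "2 < \<gamma>" "\<gamma> < 4"
 shows "\<bar>\<bar>s + t\<bar> powr \<gamma> - \<bar>s\<bar> powr \<gamma> - \<gamma> * spow (\<gamma> - 2) s * t\<bar> <= 12 * t^2 + 24 * (s^2 * t^2) + 24 * t ^ 4"
proof -
 obtain z where z: "\<bar>z - s\<bar> <= \<bar>t\<bar>" "\<bar>s + t\<bar> powr \<gamma> - \<bar>s\<bar> powr \<gamma> = t * (\<gamma> * spow (\<gamma> - 2) z)"
  using MVT_signed[OF DERIV_abs_powr[OF \<gamma>(1)], of s t] by blast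
 have d: "!!x. (spow (\<gamma> - 2) has_real_derivative (\<gamma> - 2 + 1) * \<bar>x\<bar> powr (\<gamma> - 2)) (at x)"
  using \<gamma> by (intro DERIV_spow) auto
 obtain y where y: "\<bar>y - s\<bar> <= \<bar>z - s\<bar>" "spow (\<gamma> - 2) (s + (z - s)) - spow (\<gamma> - 2) s = (z - s) * ((\<gamma> - 2 + 1) * \<bar>y\<bar> powr (\<gamma> - 2))"
  using MVT_signed[OF d, of s "z - s"] by blast
 have "\<bar>y\<bar> <= \<bar>s\<bar> + \<bar>t\<bar>" using y(1) z(1) by linarith
 then have "\<bar>y\<bar>^2 <= (\<bar>s\<bar> + \<bar>t\<bar>)^2" by (rule power_mono) simp
 also have "\<dots> <= 2 * s^2 + 2 * t^2" using sum_squares_bound[of "\<bar>s\<bar>" "\<bar>t\<bar>"] by (simp add: power2_sum)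
 finally have y2: "y^2 <= 2 * s^2 + 2 * t^2" by simp
 have yb: "\<bar>y\<bar> powr (\<gamma> - 2) <= 1 + 2 * s^2 + 2 * t^2"
  using powr_le_one_plus_sq[of "\<gamma> - 2" y] \<gamma> y2 by simp
 have "\<bar>s + t\<bar> powr \<gamma> - \<bar>s\<bar> powr \<gamma> - \<gamma> * spow (\<gamma> - 2) s * t = t * \<gamma> * (spow (\<gamma> - 2) z - spow (\<gamma> - 2) s)"
  unfolding z(2) by (simp add: algebra_simps)
 also have "\<dots> = t * \<gamma> * ((z - s) * ((\<gamma> - 1) * \<bar>y\<bar> powr (\<gamma> - 2)))" using y(2) by simp
 also have "\<bar>\<dots>\<bar> = (\<gamma> * (\<gamma> - 1)) * (\<bar>t\<bar> * \<bar>z - s\<bar>) * \<bar>y\<bar> powr (\<gamma> - 2)"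
  using \<gamma> by (simp add: abs_mult mult_ac)
 also have "\<dots> <= (4 * 3) * (\<bar>t\<bar> * \<bar>t\<bar>) * (1 + 2 * s^2 + 2 * t^2)"
  using \<gamma> z(1) yb by (intro mult_mono) auto
 also have "\<dots> = 12 * t^2 + 24 * (s^2 * t^2) + 24 * t ^ 4"
  by (simp add: power2_eq_square power4_eq_xxxx algebra_simps)
 finally show ?thesis .
qed

lemma abs_powr_le: "2 <= q ==> q <= 6 ==> \<bar>t\<bar> powr q <= t^2 + (t::real) ^ 6"
proof -
 assume q: "2 <= q" "q <= 6"
 have e: "\<bar>t\<bar> powr 2 = t^2" "\<bar>t\<bar> powr 6 = t ^ 6"
  by (simp_all add: powr_numeral)
 show ?thesis
 proof (cases "\<bar>t\<bar> <= 1")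
  case True
  then have "\<bar>t\<bar> powr q <= \<bar>t\<bar> powr 2" using q by (intro powr_mono') auto
  moreover have "0 <= t ^ 6" by simp
  ultimately show ?thesis unfolding e by linarith
 next
  case False
  then have "\<bar>t\<bar> powr q <= \<bar>t\<bar> powr 6" using q by (intro powr_mono) auto
  then show ?thesis unfolding e using zero_le_power2[of t] by linarith
 qed
qed

context bounded_open3
begin

lemma H01_measurable[measurable_dest]: "u \<in> H01 \<Omega> ==> u \<in> borel_measurable M"
 using H01_L2(1) L2_measurable by blast

lemma L2_cube: "u \<in> H01 \<Omega> ==> L2 M (%x. u x ^ 3)"
 using Sobolev(1)[of u] H01_measurable[of u] by (auto simp: L2_def power_mult[symmetric])

lemma L2_powr:
 assumes u: "u \<in> H01 \<Omega>" and q: "1 <= q" "q <= 3"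
 shows "L2 M (%x. \<bar>u x\<bar> powr q)"
proof -
 note [measurable] = H01_measurable[OF u]
 have sq: "(\<bar>u x\<bar> powr q)^2 = \<bar>u x\<bar> powr (2 * q)" for x
  by (simp add: power2_eq_square powr_add[symmetric])
 have "integrable M (%x. (u x)^2 + u x ^ 6)"
  using L2_integrable_real[OF H01_L2(1)[OF u]] Sobolev(1)[OF u] by simp
 then have "integrable M (%x. \<bar>u x\<bar> powr (2 * q))"
  by (rule integrable_bound') (use abs_powr_le[of "2 * q"] q in auto)
 then show ?thesis by (simp add: L2_def sq)
qed

lemma integrable_powr:
 assumes u: "u \<in> H01 \<Omega>" and q: "2 <= q" "q <= 6"
 shows "integrable M (%x. \<bar>u x\<bar> powr q)"
proof -
 have "integrable M (%x. (\<bar>u x\<bar> powr (q / 2))^2)"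
  using L2_integrable[OF L2_powr[OF u, of "q / 2"]] q by simp
 then show ?thesis by (simp add: power2_eq_square powr_add[symmetric])
qed

text \<open>Interpolation between \<open>L2\<close> and \<open>L6\<close>: the fourth power is split
  as \<open>u * u ^ 3\<close> and estimated by Cauchy-Schwarz, Poincare and Sobolev.\<close>

lemma L4_bound: "\<exists>K>0. \<forall>u\<in>H01 \<Omega>. n2 M (%x. (u x)^2) <= K * (nrm u)^2"
proof -
 obtain P where P: "P > 0" "!!u. u \<in> H01 \<Omega> ==> n2 M u <= P * nrm u" using Poincare by blast
 have "n2 M (%x. (u x)^2) <= sqrt (64 * P) * (nrm u)^2" if u: "u \<in> H01 \<Omega>" for u
 proof -
  have "(n2 M (%x. u x ^ 3))^2 <= (64 * nrm u ^ 3)^2"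
   unfolding n2_sq_real using Sobolev(2)[OF u] by (simp add: power_mult_distrib power_mult[symmetric])
  then have n3: "n2 M (%x. u x ^ 3) <= 64 * nrm u ^ 3" by (rule power2_le_imp_le) simp
  have "(n2 M (%x. (u x)^2))^2 = (LINT x|M. u x * u x ^ 3)"
   unfolding n2_sq_real by (simp add: power2_eq_square power3_eq_cube mult.assoc)
  also have "\<dots> <= n2 M u * n2 M (%x. u x ^ 3)"
   using L2_Cauchy_Schwarz_real[OF H01_L2(1)[OF u] L2_cube[OF u]] by linarith
  also have "\<dots> <= (P * nrm u) * (64 * nrm u ^ 3)"
   using P(1) by (intro mult_mono P(2) u n3) auto
  also have "\<dots> = (sqrt (64 * P) * (nrm u)^2)^2"
   using P(1) by (simp add: power_mult_distrib power_mult[symmetric] power4_eq_xxxx power3_eq_cube)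
  finally show ?thesis by (rule power2_le_imp_le) (use P(1) in simp)
 qed
 moreover have "sqrt (64 * P) > 0" using P(1) by simp
 ultimately show ?thesis by blast
qed

lemma L2_square: "u \<in> H01 \<Omega> ==> L2 M (%x. (u x)^2)"
 using L2_powr[of u 2] by simp

definition NL :: "real \<Rightarrow> (real^3 \<Rightarrow> real) \<Rightarrow> real" where
 "NL \<gamma> u = (LINT x|M. \<bar>u x\<bar> powr \<gamma>)"

lemma NL_nonneg: "0 <= NL \<gamma> u"
 unfolding NL_def by (rule integral_nonneg') simp

lemma Lp_norm_powr: "\<gamma> \<noteq> 0 ==> Lp_norm \<gamma> \<Omega> u powr \<gamma> = NL \<gamma> u"
 using NL_nonneg[of \<gamma> u] by (simp add: Lp_norm_def NL_def[symmetric] powr_powr)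

lemma Phi_eq:
 "\<gamma> \<noteq> 0 ==> Phi \<Omega> a \<gamma> \<mu> u = a / 2 * (nrm u)^2 + \<mu> / 4 * nrm u ^ 4 - 1 / \<gamma> * NL \<gamma> u"
 by (simp add: Phi_def Lp_norm_powr)

lemma NL_cmult: "NL \<gamma> (%x. c * u x) = \<bar>c\<bar> powr \<gamma> * NL \<gamma> u"
 unfolding NL_def by (simp add: abs_mult powr_mult)

text \<open>Bounding the power by \<open>t^2 + t ^ 6\<close> gives a bound that is not homogeneous;
  it is used at norm 1 only, and scaling restores the exponent \<gamma>.\<close>

lemma NL_bound:
 assumes \<gamma>: "2 <= \<gamma>" "\<gamma> <= 6" shows "\<exists>S>0. \<forall>u\<in>H01 \<Omega>. NL \<gamma> u <= S * nrm u powr \<gamma>"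
proof -
 obtain P where P: "P > 0" "!!u. u \<in> H01 \<Omega> ==> n2 M u <= P * nrm u" using Poincare by blast
 have le: "NL \<gamma> u <= P^2 * (nrm u)^2 + 4096 * nrm u ^ 6" if u: "u \<in> H01 \<Omega>" for u
 proof -
  have "NL \<gamma> u <= (LINT x|M. (u x)^2 + u x ^ 6)"
   unfolding NL_def using L2_integrable_real[OF H01_L2(1)[OF u]] Sobolev(1)[OF u]
   by (intro integral_mono integrable_powr u \<gamma>) (auto intro: abs_powr_le \<gamma>)
  also have "\<dots> = (n2 M u)^2 + (LINT x|M. u x ^ 6)"
   using L2_integrable_real[OF H01_L2(1)[OF u]] Sobolev(1)[OF u] by (simp add: n2_sq_real)
  also have "(n2 M u)^2 <= (P * nrm u)^2" by (intro power_mono P u) simp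
  finally show ?thesis using Sobolev(2)[OF u] by (simp add: power_mult_distrib)
 qed
 have "NL \<gamma> u <= (P^2 + 4096) * nrm u powr \<gamma>" if u: "u \<in> H01 \<Omega>" for u
 proof (cases "nrm u = 0")
  case True
  then show ?thesis using le[OF u] by simp
 next
  case False
  define g where "g = nrm u"
  have g: "g > 0" using False by (simp add: g_def less_le)
  have "nrm (%x. (1 / g) * u x) = 1" using H01_norm_cmult[OF u, of "1 / g"] g by (simp add: g_def)
  then have "NL \<gamma> (%x. (1 / g) * u x) <= P^2 + 4096" using le[OF H01_cmult[OF u, of "1 / g"]] by simp
  then have "g powr \<gamma> * ((1 / g) powr \<gamma> * NL \<gamma> u) <= g powr \<gamma> * (P^2 + 4096)"
   using g unfolding NL_cmult by (intro mult_left_mono) auto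
  moreover have "g powr \<gamma> * (1 / g) powr \<gamma> = 1" using g by (simp add: powr_mult[symmetric])
  ultimately show ?thesis unfolding g_def[symmetric] by (simp add: mult.assoc[symmetric] mult.commute)
 qed
 moreover have "P^2 + 4096 > 0" by (simp add: add_nonneg_pos)
 ultimately show ?thesis by blast
qed

text \<open>Up to the factor \<gamma> this is the derivative of \<open>NL\<close> at
  \<open>u\<close> in direction \<open>v\<close>.\<close>

definition TL :: "real \<Rightarrow> (real^3 \<Rightarrow> real) \<Rightarrow> (real^3 \<Rightarrow> real) \<Rightarrow> real" where
 "TL \<gamma> u v = (LINT x|M. spow (\<gamma> - 2) (u x) * v x)"

lemma L2_spow:
 assumes u: "u \<in> H01 \<Omega>" and \<gamma>: "2 < \<gamma>" "\<gamma> < 4" shows "L2 M (%x. spow (\<gamma> - 2) (u x))"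
proof -
 note [measurable] = H01_measurable[OF u]
 have "norm (spow (\<gamma> - 2) s) <= norm (\<bar>s\<bar> powr (\<gamma> - 1))" for s
  using powr_add[of "\<bar>s\<bar>" "\<gamma> - 2" 1] by (simp add: spow_def abs_mult)
 then show ?thesis using \<gamma>
  by (intro L2_bound(1)[OF L2_powr[OF u, of "\<gamma> - 1"]]) auto
qed

lemma NL_eq_TL: "2 < \<gamma> ==> NL \<gamma> u = TL \<gamma> u u"
 unfolding NL_def TL_def using abs_powr_eq_spow[of \<gamma>] by simp

lemma NL_Taylor:
 assumes \<gamma>: "2 < \<gamma>" "\<gamma> < 4"
 shows "\<exists>C>0. \<forall>u\<in>H01 \<Omega>. \<forall>v\<in>H01 \<Omega>. \<bar>NL \<gamma> (%x. u x + v x) - NL \<gamma> u - \<gamma> * TL \<gamma> u v\<bar>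
   <= C * (1 + (nrm u)^2 + (nrm v)^2) * (nrm v)^2"
proof -
 obtain P where P: "P > 0" "!!u. u \<in> H01 \<Omega> ==> n2 M u <= P * nrm u" using Poincare by blast
 obtain K where K: "K > 0" "!!u. u \<in> H01 \<Omega> ==> n2 M (%x. (u x)^2) <= K * (nrm u)^2" using L4_bound by blast
 define C where "C = 12 * P^2 + 24 * K^2"
 have "\<bar>NL \<gamma> (%x. u x + v x) - NL \<gamma> u - \<gamma> * TL \<gamma> u v\<bar>
   <= C * (1 + (nrm u)^2 + (nrm v)^2) * (nrm v)^2" if u: "u \<in> H01 \<Omega>" and v: "v \<in> H01 \<Omega>" for u v
 proof -
  define U where "U = (nrm u)^2" define V where "V = (nrm v)^2"
  have UV: "U \<ge> 0" "V \<ge> 0" by (simp_all add: U_def V_def)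
  have g26: "2 <= \<gamma>" "\<gamma> <= 6" using \<gamma> by auto
  note i1 = integrable_powr[OF H01_add[OF u v] g26] and i2 = integrable_powr[OF u g26]
   and i3 = integrable_mult_L2[OF L2_spow[OF u \<gamma>] H01_L2(1)[OF v]]
   and j1 = L2_integrable_real[OF H01_L2(1)[OF v]] and j2 = integrable_mult_L2[OF L2_square[OF u] L2_square[OF v]]
   and j3 = integrable_mult_L2[OF L2_square[OF v] L2_square[OF v]]
  have eq: "NL \<gamma> (%x. u x + v x) - NL \<gamma> u - \<gamma> * TL \<gamma> u v =
   (LINT x|M. \<bar>u x + v x\<bar> powr \<gamma> - \<bar>u x\<bar> powr \<gamma> - \<gamma> * (spow (\<gamma> - 2) (u x) * v x))"
   unfolding NL_def TL_def using i1 i2 i3 by simp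
  have "\<bar>NL \<gamma> (%x. u x + v x) - NL \<gamma> u - \<gamma> * TL \<gamma> u v\<bar> <= (LINT x|M. 12 * (v x)^2 + 24 * ((u x)^2 * (v x)^2) + 24 * ((v x)^2 * (v x)^2))"
   unfolding eq
  proof (rule integral_abs_bound_integral)
   show "\<bar>\<bar>u x + v x\<bar> powr \<gamma> - \<bar>u x\<bar> powr \<gamma> - \<gamma> * (spow (\<gamma> - 2) (u x) * v x)\<bar> <= 12 * (v x)^2 + 24 * ((u x)^2 * (v x)^2) + 24 * ((v x)^2 * (v x)^2)" for x
    using abs_powr_Taylor[OF \<gamma>, of "u x" "v x"] by (simp add: mult.assoc power_add[symmetric])
  qed (intro integrable_diff' integrable_add' integrable_mult_right i1 i2 i3 j1 j2 j3)+
  also have "\<dots> = 12 * (n2 M v)^2 + 24 * (LINT x|M. (u x)^2 * (v x)^2) + 24 * (LINT x|M. (v x)^2 * (v x)^2)"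
   using j1 j2 j3 by (simp add: n2_sq_real)
  also have "\<dots> <= 12 * (P^2 * V) + 24 * ((K * U) * (K * V)) + 24 * ((K * V) * (K * V))"
  proof (intro add_mono mult_left_mono)
   have "(n2 M v)^2 <= (P * nrm v)^2" by (intro power_mono P v) simp
   then show "(n2 M v)^2 <= P^2 * V" by (simp add: V_def power_mult_distrib)
   have *: "(LINT x|M. (f x)^2 * (v x)^2) <= (K * (nrm f)^2) * (K * V)" if f: "f \<in> H01 \<Omega>" for f
   proof -
    have "(LINT x|M. (f x)^2 * (v x)^2) <= n2 M (%x. (f x)^2) * n2 M (%x. (v x)^2)"
     using L2_Cauchy_Schwarz_real[OF L2_square[OF f] L2_square[OF v]] by linarith
    also have "\<dots> <= (K * (nrm f)^2) * (K * V)"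
     unfolding V_def using K(1) by (intro mult_mono K f v) auto
    finally show ?thesis .
   qed
   show "(LINT x|M. (u x)^2 * (v x)^2) <= (K * U) * (K * V)" using *[OF u] by (simp add: U_def)
   show "(LINT x|M. (v x)^2 * (v x)^2) <= (K * V) * (K * V)" using *[OF v] by (simp add: V_def)
  qed auto
  also have "\<dots> = (12 * P^2 + 24 * K^2 * (U + V)) * V"
   by (simp add: power2_eq_square algebra_simps)
  also have "\<dots> <= (C * (1 + U + V)) * V"
   using UV by (intro mult_right_mono) (simp_all add: C_def algebra_simps)
  finally show ?thesis by (simp add: U_def V_def)
 qed
 moreover have "C > 0" using P(1) by (simp add: C_def add_pos_nonneg)
 ultimately show ?thesis by blast
qed

definition DPhi :: "real \<Rightarrow> real \<Rightarrow> real \<Rightarrow> (real^3 \<Rightarrow> real) \<Rightarrow> (real^3 \<Rightarrow> real) \<Rightarrow> real" where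
 "DPhi a \<gamma> \<mu> u v = (a + \<mu> * (nrm u)^2) * B u v - TL \<gamma> u v"

lemma TL_cmult: "TL \<gamma> u (%x. c * v x) = c * TL \<gamma> u v"
 unfolding TL_def by (subst integral_mult_right_zero[symmetric]) (simp add: mult_ac)

lemma DPhi_cmult: "u \<in> H01 \<Omega> ==> v \<in> H01 \<Omega> ==> DPhi a \<gamma> \<mu> u (%x. c * v x) = c * DPhi a \<gamma> \<mu> u v"
 unfolding DPhi_def using B_cmult_left[of v u c] by (simp add: B_commute[of u] TL_cmult algebra_simps)

lemma Phi_Taylor:
 assumes \<gamma>: "2 < \<gamma>" "\<gamma> < 4" and u: "u \<in> H01 \<Omega>"
 shows "\<exists>C>0. \<forall>v\<in>H01 \<Omega>. nrm v <= 1 \<longrightarrow>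
  \<bar>Phi \<Omega> a \<gamma> \<mu> (%x. u x + v x) - Phi \<Omega> a \<gamma> \<mu> u - DPhi a \<gamma> \<mu> u v\<bar> <= C * (nrm v)^2"
proof -
 obtain C where C: "C > 0" "!!u v. u \<in> H01 \<Omega> ==> v \<in> H01 \<Omega> ==> \<bar>NL \<gamma> (%x. u x + v x) - NL \<gamma> u - \<gamma> * TL \<gamma> u v\<bar>
   <= C * (1 + (nrm u)^2 + (nrm v)^2) * (nrm v)^2"
  using NL_Taylor[OF \<gamma>] by blast
 define g where "g = nrm u"
 define K where "K = \<bar>a\<bar> / 2 + \<bar>\<mu>\<bar> / 4 * (6 * g^2 + 4 * g + 1) + C * (2 + g^2)"
 have g: "g \<ge> 0" by (simp add: g_def)
 have "\<bar>Phi \<Omega> a \<gamma> \<mu> (%x. u x + v x) - Phi \<Omega> a \<gamma> \<mu> u - DPhi a \<gamma> \<mu> u v\<bar> <= K * (nrm v)^2"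
  if v: "v \<in> H01 \<Omega>" and v1: "nrm v <= 1" for v
 proof -
  define h where "h = nrm v" define b where "b = B u v"
  define R where "R = NL \<gamma> (%x. u x + v x) - NL \<gamma> u - \<gamma> * TL \<gamma> u v"
  have h: "0 <= h" "h <= 1" using v1 by (simp_all add: h_def)
  have b: "\<bar>b\<bar> <= g * h" using B_Cauchy_Schwarz[OF u v] by (simp add: b_def g_def h_def)
  have n: "(nrm (%x. u x + v x))^2 = g^2 + 2 * b + h^2"
   using H01_norm_add_sq[OF u v] by (simp add: b_def g_def h_def)
  have p4: "x ^ 4 = (x^2)^2" for x :: real by (simp add: power_mult[symmetric])
  have eq: "Phi \<Omega> a \<gamma> \<mu> (%x. u x + v x) - Phi \<Omega> a \<gamma> \<mu> u - DPhi a \<gamma> \<mu> u v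
   = a / 2 * h^2 + \<mu> / 4 * (2 * (g^2 * h^2) + 4 * b^2 + 4 * (b * h^2) + (h^2)^2) - 1 / \<gamma> * R"
   using \<gamma> unfolding Phi_eq[of \<gamma>, OF less_imp_neq[THEN not_sym], OF order.strict_trans[OF zero_less_numeral \<gamma>(1)]] DPhi_def p4 n R_def b_def[symmetric] g_def[symmetric]
   by (simp add: field_simps power2_eq_square)
  have "\<bar>Phi \<Omega> a \<gamma> \<mu> (%x. u x + v x) - Phi \<Omega> a \<gamma> \<mu> u - DPhi a \<gamma> \<mu> u v\<bar> <= \<bar>a\<bar> / 2 * h^2 + \<bar>\<mu>\<bar> / 4 * ((6 * g^2 + 4 * g + 1) * h^2) + 1 * (C * (1 + g^2 + h^2) * h^2)"
  proof -
   have b2: "b^2 <= g^2 * h^2" using power_mono[OF b, of 2] by (simp add: power_mult_distrib)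
   have "\<bar>b\<bar> <= g" using b mult_left_mono[OF h(2) g] by linarith
   then have b3: "\<bar>b * h^2\<bar> <= g * h^2" by (simp add: abs_mult mult_right_mono)
   have h4: "(h^2)^2 <= 1 * h^2" unfolding power2_eq_square[of "h^2"] using h by (intro mult_right_mono) (auto simp: power_le_one)
   have "\<bar>2 * (g^2 * h^2) + 4 * b^2 + 4 * (b * h^2) + (h^2)^2\<bar> <= (6 * g^2 + 4 * g + 1) * h^2"
   proof -
    have "(6 * g^2 + 4 * g + 1) * h^2 = 6 * (g^2 * h^2) + 4 * (g * h^2) + h^2" by (simp add: algebra_simps)
    then show ?thesis using b2 b3 h4 zero_le_power2[of b] zero_le_power2[of "h^2"] by linarith
   qed
   then have m: "\<bar>\<mu> / 4 * (2 * (g^2 * h^2) + 4 * b^2 + 4 * (b * h^2) + (h^2)^2)\<bar> <= \<bar>\<mu>\<bar> / 4 * ((6 * g^2 + 4 * g + 1) * h^2)"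
    unfolding abs_mult by (intro mult_mono) auto
   have r: "\<bar>1 / \<gamma> * R\<bar> <= 1 * (C * (1 + g^2 + h^2) * h^2)"
    unfolding abs_mult using C(2)[OF u v] \<gamma> by (intro mult_mono) (auto simp: R_def g_def h_def field_simps)
   have "\<bar>a / 2 * h^2\<bar> = \<bar>a\<bar> / 2 * h^2" by (simp add: abs_mult)
   then show ?thesis unfolding eq using m r by linarith
  qed
  also have "C * (1 + g^2 + h^2) * h^2 <= C * (2 + g^2) * h^2"
   using h C(1) power_le_one[of h 2] by (intro mult_right_mono mult_left_mono) auto
  finally show ?thesis by (simp add: K_def h_def[symmetric] algebra_simps)
 qed
 moreover have "K > 0"
 proof -
  have "C * (2 + g^2) > 0" using C(1) by (simp add: add_pos_nonneg)
  moreover have "\<bar>a\<bar> / 2 + \<bar>\<mu>\<bar> / 4 * (6 * g^2 + 4 * g + 1) \<ge> 0" using g by simp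
  ultimately show ?thesis unfolding K_def by linarith
 qed
 ultimately show ?thesis by blast
qed

text \<open>The remainder in \<open>Phi_Taylor\<close> is quadratic, so the Frechet derivative is
  zero exactly when the linear part \<open>DPhi\<close> vanishes. Critical points thereby become
  weak solutions.\<close>

lemma critical_point_iff:
 assumes \<gamma>: "2 < \<gamma>" "\<gamma> < 4"
 shows "critical_point \<Omega> (Phi \<Omega> a \<gamma> \<mu>) u \<longleftrightarrow> u \<in> H01 \<Omega> \<and> (\<forall>v\<in>H01 \<Omega>. DPhi a \<gamma> \<mu> u v = 0)"
proof (cases "u \<in> H01 \<Omega>")
 case u: True
 define F where "F v = Phi \<Omega> a \<gamma> \<mu> (%x. u x + v x) - Phi \<Omega> a \<gamma> \<mu> u" for v
 obtain C where C: "C > 0" "!!v. v \<in> H01 \<Omega> ==> nrm v <= 1 ==> \<bar>F v - DPhi a \<gamma> \<mu> u v\<bar> <= C * (nrm v)^2"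
  using Phi_Taylor[OF \<gamma> u, of a \<mu>] unfolding F_def by blast
 have crit: "critical_point \<Omega> (Phi \<Omega> a \<gamma> \<mu>) u \<longleftrightarrow> (\<forall>e>0. \<exists>d>0. \<forall>v\<in>H01 \<Omega>. nrm v < d \<longrightarrow> \<bar>F v\<bar> <= e * nrm v)"
  unfolding critical_point_def H01_has_derivative_def F_def using u by (auto intro: exI[of _ 0])
 show ?thesis
 proof
  assume "critical_point \<Omega> (Phi \<Omega> a \<gamma> \<mu>) u"
  then have cr: "!!e. e > 0 ==> \<exists>d>0. \<forall>v\<in>H01 \<Omega>. nrm v < d \<longrightarrow> \<bar>F v\<bar> <= e * nrm v"
   unfolding crit by blast
  have "DPhi a \<gamma> \<mu> u v = 0" if v: "v \<in> H01 \<Omega>" for v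
  proof -
   define h where "h = nrm v"
   have h: "h \<ge> 0" by (simp add: h_def)
   have "\<bar>DPhi a \<gamma> \<mu> u v\<bar> <= e" if e: "e > 0" for e
   proof -
    define e' where "e' = e / (2 * (h + 1))"
    have e': "e' > 0" using e h by (simp add: e'_def)
    obtain d where d: "d > 0" "!!v. v \<in> H01 \<Omega> ==> nrm v < d ==> \<bar>F v\<bar> <= e' * nrm v"
     using cr[OF e'] by blast
    \<comment> \<open>The bounds keep the norm of \<open>t * v\<close> below both \<open>d\<close>
      and 1 and make the quadratic remainder divided by \<open>t\<close> at most
      \<open>e / 2\<close>. The added ones exclude zero denominators.\<close>
    define t where "t = min (min (d / (2 * (h + 1))) (1 / (h + 1))) (e / (2 * (C * (h^2 + 1))))"
    have den: "C * (h^2 + 1) > 0" using C(1) by (simp add: add_nonneg_pos)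
    have t: "t > 0" using d(1) h e den unfolding t_def by simp
    have tv: "(%x. t * v x) \<in> H01 \<Omega>" by (rule H01_cmult[OF v])
    have nt: "nrm (%x. t * v x) = t * h" using H01_norm_cmult[OF v, of t] t by (simp add: h_def)
    have "t <= d / (2 * (h + 1))" "t <= 1 / (h + 1)" by (simp_all add: t_def)
    then have "t * (2 * (h + 1)) <= d" "t * (h + 1) <= 1" using h by (simp_all add: pos_le_divide_eq)
    moreover have "0 <= t * h" using t h by simp
    ultimately have th: "t * h < d" "t * h <= 1" using t by (simp_all add: algebra_simps)
    have "\<bar>DPhi a \<gamma> \<mu> u (%x. t * v x)\<bar> <= \<bar>F (%x. t * v x)\<bar> + \<bar>F (%x. t * v x) - DPhi a \<gamma> \<mu> u (%x. t * v x)\<bar>" by linarith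
    also have "\<dots> <= e' * (t * h) + C * (t * h)^2"
     using d(2)[OF tv] C(2)[OF tv] th unfolding nt by (intro add_mono) auto
    finally have "t * \<bar>DPhi a \<gamma> \<mu> u v\<bar> <= t * (e' * h + t * (C * h^2))"
     using t by (simp add: DPhi_cmult[OF u v] abs_mult power2_eq_square algebra_simps)
    then have "\<bar>DPhi a \<gamma> \<mu> u v\<bar> <= e' * h + t * (C * h^2)" using t by simp
    also have "e' * h <= e / 2" using h e by (simp add: e'_def field_simps)
    also have "t * (C * h^2) <= (e / (2 * (C * (h^2 + 1)))) * (C * (h^2 + 1))"
     using C(1) t by (intro mult_mono) (auto simp: t_def)
    also have "\<dots> = e / 2"
    proof -
     have "e / (2 * D) * D = e / 2" if "D > 0" for D :: real using that by simp
     from this[OF den] show ?thesis .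
    qed
    finally show ?thesis by simp
   qed
   then have "\<bar>DPhi a \<gamma> \<mu> u v\<bar> <= 0" by (rule field_le_epsilon[where y = 0, simplified])
   then show ?thesis by simp
  qed
  then show "u \<in> H01 \<Omega> \<and> (\<forall>v\<in>H01 \<Omega>. DPhi a \<gamma> \<mu> u v = 0)" using u by blast
 next
  assume D: "u \<in> H01 \<Omega> \<and> (\<forall>v\<in>H01 \<Omega>. DPhi a \<gamma> \<mu> u v = 0)"
  show "critical_point \<Omega> (Phi \<Omega> a \<gamma> \<mu>) u"
   unfolding crit
  proof (intro allI impI)
   fix e :: real assume e: "e > 0"
   have "\<bar>F v\<bar> <= e * nrm v" if v: "v \<in> H01 \<Omega>" "nrm v < min 1 (e / C)" for v
   proof -
    have "\<bar>F v\<bar> <= C * nrm v * nrm v" using C(2)[OF v(1)] v(2) D v(1) by (simp add: power2_eq_square)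
    also have "\<dots> <= e * nrm v"
     using v(2) C(1) by (intro mult_right_mono) (simp_all add: pos_less_divide_eq mult.commute)
    finally show ?thesis .
   qed
   then show "\<exists>d>0. \<forall>v\<in>H01 \<Omega>. nrm v < d \<longrightarrow> \<bar>F v\<bar> <= e * nrm v"
    using e C(1) by (intro exI[of _ "min 1 (e / C)"]) auto
  qed
 qed
qed (simp add: critical_point_def)

end

subsection \<open>The Kelvin transform\<close>

text \<open>Inversion in the sphere of radius \<rho> about \<open>y\<close>. At the centre the
  quotient is 0 and the value is \<open>y\<close>.\<close>

definition inv_pt :: "real^3 \<Rightarrow> real \<Rightarrow> real^3 \<Rightarrow> real^3" where
 "inv_pt y \<rho> x = y + (\<rho>^2 / (norm (x - y))^2) *\<^sub>R (x - y)"

text \<open>The Kelvin transform in dimension three, where the power of the conformal factor is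
  \<open>3 - 2 = 1\<close>. At the centre its value is 0.\<close>

definition kelvin :: "real^3 \<Rightarrow> real \<Rightarrow> (real^3 \<Rightarrow> real) \<Rightarrow> real^3 \<Rightarrow> real" where
 "kelvin y \<rho> f x = \<rho> / norm (x - y) * f (inv_pt y \<rho> x)"

text \<open>Reflection in the plane orthogonal to \<open>d\<close>. The derivative of the inversion
  at \<open>x\<close> is a positive multiple of it with \<open>d = x - y\<close>, which expresses
  conformality.\<close>

definition reflect :: "real^3 \<Rightarrow> real^3 \<Rightarrow> real^3" where
 "reflect d h = h - (2 * (d \<bullet> h) / (norm d)^2) *\<^sub>R d"

lemma linear_reflect: "linear (reflect d)"
 by (rule linearI) (simp_all add: reflect_def inner_add_right algebra_simps add_divide_distrib)

lemma reflect_inner: "d \<noteq> 0 ==> reflect d g \<bullet> reflect d h = g \<bullet> h"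
 by (simp add: reflect_def inner_diff_left inner_diff_right power2_norm_eq_inner inner_commute field_simps)

lemma reflect_inner_self: "d \<noteq> 0 ==> reflect d g \<bullet> d = - (g \<bullet> d)"
 by (simp add: reflect_def inner_diff_left power2_norm_eq_inner inner_commute[of d g])

lemma reflect_sym: "reflect d g \<bullet> h = g \<bullet> reflect d h"
 by (simp add: reflect_def inner_diff_left inner_diff_right inner_commute)

lemma norm_inv_pt: "norm (inv_pt y \<rho> x - y) = \<rho>^2 / norm (x - y)"
 by (cases "x = y") (simp_all add: inv_pt_def power2_eq_square)

lemma inv_pt_ne: "\<rho> \<noteq> 0 ==> x \<noteq> y ==> inv_pt y \<rho> x \<noteq> y"
 by (simp add: inv_pt_def)

lemma inv_pt_inv_pt: "\<rho> \<noteq> 0 ==> x \<noteq> y ==> inv_pt y \<rho> (inv_pt y \<rho> x) = x"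
proof -
 assume a: "\<rho> \<noteq> 0" "x \<noteq> y"
 have "inv_pt y \<rho> (inv_pt y \<rho> x) = y + (\<rho>^2 / (norm (inv_pt y \<rho> x - y))^2) *\<^sub>R (inv_pt y \<rho> x - y)"
  by (simp add: inv_pt_def)
 also have "\<dots> = y + (\<rho>^2 / (\<rho>^2 / norm (x - y))^2) *\<^sub>R ((\<rho>^2 / (norm (x - y))^2) *\<^sub>R (x - y))"
  unfolding norm_inv_pt by (simp add: inv_pt_def)
 also have "\<dots> = x" using a by (simp add: power2_eq_square field_simps)
 finally show ?thesis .
qed

lemma kelvin_kelvin: "\<rho> > 0 ==> x \<noteq> y ==> kelvin y \<rho> (kelvin y \<rho> f) x = f x"
 by (simp add: kelvin_def inv_pt_inv_pt norm_inv_pt power2_eq_square)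

lemma kelvin_diff: "kelvin y \<rho> (%x. f x - g x) x = kelvin y \<rho> f x - kelvin y \<rho> g x"
 by (simp add: kelvin_def right_diff_distrib)

lemma measurable_inv_pt[measurable]: "inv_pt y \<rho> \<in> borel_measurable borel"
 unfolding inv_pt_def by measurable

lemma measurable_compose_inv_pt[measurable (raw)]:
 "f \<in> borel_measurable borel ==> (%x. f (inv_pt y \<rho> x)) \<in> borel_measurable borel"
 by (rule measurable_compose[OF measurable_inv_pt])

lemma measurable_kelvin: "f \<in> borel_measurable borel ==> kelvin y \<rho> f \<in> borel_measurable borel"
 unfolding kelvin_def[abs_def] by (intro borel_measurable_times measurable_compose_inv_pt) measurable

lemma smooth_on_inv_pt: "c \<in> Basis ==> smooth_on (- {y}) (%x. inv_pt y \<rho> x \<bullet> c)"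
proof -
 have o: "open (- {y})" by (simp add: open_Compl)
 have "smooth_on (- {y}) (%x. y \<bullet> c + \<rho>^2 * inverse ((norm (x - y))^2) * (x \<bullet> c - y \<bullet> c))"
  by (intro smooth_on_add[OF o] smooth_on_mult[OF o] smooth_on_const[OF o] smooth_on_diff[OF o] smooth_on_inner[OF o]
   smooth_on_inverse[OF o] smooth_on_norm_sq[OF o]) auto
 then show ?thesis by (simp add: inv_pt_def inner_add_left inner_diff_left divide_inverse)
qed

lemma smooth_on_kelvin:
 assumes "smooth_on UNIV f" shows "smooth_on (- {y}) (kelvin y \<rho> f)"
proof -
 have o: "open (- {y})" by (simp add: open_Compl)
 have "smooth_on (- {y}) (%x. \<rho> * inverse (norm (x - y)) * f (inv_pt y \<rho> x))"
  by (intro smooth_on_mult[OF o] smooth_on_const[OF o] smooth_on_inverse[OF o] smooth_on_norm[OF o]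
   smooth_on_compose[OF o open_UNIV _ assms] smooth_on_inv_pt) auto
 then show ?thesis unfolding kelvin_def divide_inverse .
qed

lemma continuous_on_inv_pt: "continuous_on (- {y}) (inv_pt y \<rho>)"
 unfolding inv_pt_def by (intro continuous_intros) auto

lemma tf_local_mult:
 assumes \<phi>: "\<phi> \<in> test_functions U" and "U \<subseteq> S" "open S" "smooth_on S \<psi>"
 shows "(%x. \<psi> x * \<phi> x) \<in> test_functions U"
proof -
 obtain K where K: "smooth_on UNIV \<phi>" "compact K" "K \<subseteq> U" "!!x. x \<notin> K ==> \<phi> x = 0"
  by (rule test_functionsE[OF \<phi>], rule that)
 have o: "open (- K)" using K(2) by (simp add: compact_imp_closed open_Compl)
 have "smooth_on S (%x. \<psi> x * \<phi> x)"
  using assms by (intro smooth_on_mult smooth_on_subset[OF K(1)]) auto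
 moreover have "smooth_on (- K) (%x. \<psi> x * \<phi> x)"
  by (rule smooth_on_cong[OF o _ smooth_on_const[OF o, of 0]]) (use K in auto)
 ultimately have "smooth_on (S \<union> - K) (%x. \<psi> x * \<phi> x)" by (rule smooth_on_Un[OF assms(3) o])
 moreover have "S \<union> - K = UNIV" using K(3) assms(2) by auto
 ultimately show ?thesis using K by (intro test_functionsI[where K = K]) auto
qed

text \<open>The support of \<open>f\<close> lies within some distance \<open>R\<close> of
  \<open>y\<close>, so its image under inversion stays at distance at least
  \<open>\<rho>^2 / R\<close> from \<open>y\<close>. The transform vanishes near the centre and the
  singularity there disappears.\<close>

lemma tf_kelvin:
 assumes f: "f \<in> test_functions U" and y: "y \<notin> U" and \<rho>: "\<rho> > 0" and UV: "inv_pt y \<rho> ` U \<subseteq> V"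
 shows "kelvin y \<rho> f \<in> test_functions V"
proof -
 obtain K where K: "smooth_on UNIV f" "compact K" "K \<subseteq> U" "!!x. x \<notin> K ==> f x = 0"
  by (rule test_functionsE[OF f], rule that)
 have yK: "y \<notin> K" using y K by auto
 obtain R where R: "R > 0" "!!x. x \<in> K ==> norm (x - y) <= R"
  using compact_imp_bounded[OF compact_translation[OF K(2), of "- y"]] unfolding bounded_pos by auto
 have zero: "kelvin y \<rho> f x = 0" if "x \<notin> inv_pt y \<rho> ` K" for x
 proof (cases "x = y")
  case False
  then have "inv_pt y \<rho> x \<notin> K" using that inv_pt_inv_pt[of \<rho> x y] \<rho> by force
  then show ?thesis using K by (simp add: kelvin_def)
 qed (simp add: kelvin_def)
 have near: "kelvin y \<rho> f x = 0" if x: "x \<in> ball y (\<rho>^2 / R)" for x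
 proof (rule zero)
  have "\<rho>^2 / R <= norm (inv_pt y \<rho> z - y)" if "z \<in> K" for z
  proof -
   have "z \<noteq> y" using that yK by auto
   then show ?thesis unfolding norm_inv_pt using R that by (intro divide_left_mono) auto
  qed
  then show "x \<notin> inv_pt y \<rho> ` K" using x by (force simp: dist_norm norm_minus_commute)
 qed
 have "smooth_on (- {y} \<union> ball y (\<rho>^2 / R)) (kelvin y \<rho> f)"
  by (rule smooth_on_Un[OF _ _ smooth_on_kelvin[OF K(1)] smooth_on_cong[OF _ _ smooth_on_const[of _ 0]]]) (use near in auto)
 moreover have "- {y} \<union> ball y (\<rho>^2 / R) = UNIV" using \<rho> R by auto
 moreover have "compact (inv_pt y \<rho> ` K)"
  using yK by (intro compact_continuous_image[OF continuous_on_subset[OF continuous_on_inv_pt] K(2)]) auto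
 moreover have "inv_pt y \<rho> ` K \<subseteq> V" using UV K(3) by blast
 ultimately show ?thesis using zero by (intro test_functionsI[where K = "inv_pt y \<rho> ` K"]) auto
qed

lemma inv_pt_has_derivative:
 assumes "x \<noteq> y"
 shows "(inv_pt y \<rho> has_derivative (%h. (\<rho>^2 / (norm (x - y))^2) *\<^sub>R reflect (x - y) h)) (at x)"
proof -
 have d: "(x - y) \<bullet> (x - y) \<noteq> 0" using assms by simp
 have "((%x. y + (\<rho>^2 / ((x - y) \<bullet> (x - y))) *\<^sub>R (x - y)) has_derivative
  (%h. (\<rho>^2 / ((x - y) \<bullet> (x - y))) *\<^sub>R h + (- (\<rho>^2) * (2 * ((x - y) \<bullet> h)) / ((x - y) \<bullet> (x - y))^2) *\<^sub>R (x - y))) (at x)"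
  using d by (auto intro!: derivative_eq_intros simp: inner_commute power2_eq_square field_simps)
 moreover have "(%x. y + (\<rho>^2 / ((x - y) \<bullet> (x - y))) *\<^sub>R (x - y)) = inv_pt y \<rho>"
  by (auto simp: inv_pt_def power2_norm_eq_inner)
 moreover have "(r / (d \<bullet> d)) *\<^sub>R h + (- r * (2 * (d \<bullet> h)) / (d \<bullet> d)^2) *\<^sub>R d = (r / (norm d)^2) *\<^sub>R reflect d h" for r d h
  unfolding reflect_def power2_norm_eq_inner by (simp add: scaleR_diff_right power2_eq_square)
 ultimately show ?thesis by simp
qed

lemma norm_has_derivative_inverse:
 assumes "x \<noteq> (y :: real^3)"
 shows "((%x. \<rho> / norm (x - y)) has_derivative (%h. - \<rho> / norm (x - y) ^ 3 * ((x - y) \<bullet> h))) (at x)"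
proof -
 have "((%x. norm (x - y)) has_derivative (%h. h \<bullet> sgn (x - y))) (at x)"
  using has_derivative_compose[OF has_derivative_diff[OF has_derivative_ident has_derivative_const] has_derivative_norm, of "x" y UNIV] assms
  by simp
 moreover have "(%h. h \<bullet> sgn (x - y)) = (%h. (x - y) \<bullet> h / norm (x - y))"
  by (auto simp: sgn_div_norm inner_commute divide_inverse mult.commute fun_eq_iff)
 ultimately have "((%x. norm (x - y)) has_derivative (%h. (x - y) \<bullet> h / norm (x - y))) (at x)" by simp
 from has_derivative_divide[OF has_derivative_const[of \<rho>] this] show ?thesis
  using assms by (simp add: divide_inverse power3_eq_cube mult_ac)
qed

lemma grad_kelvin:
 assumes f: "smooth_on UNIV f" and x: "x \<noteq> y"
 shows "grad (kelvin y \<rho> f) x = (\<rho> / norm (x - y)) *\<^sub>R (\<rho>^2 / (norm (x - y))^2) *\<^sub>R reflect (x - y) (grad f (inv_pt y \<rho> x))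
  - (\<rho> / norm (x - y) ^ 3 * f (inv_pt y \<rho> x)) *\<^sub>R (x - y)"
proof (rule grad_eqI)
 have "((%x. f (inv_pt y \<rho> x)) has_derivative (%h. grad f (inv_pt y \<rho> x) \<bullet> ((\<rho>^2 / (norm (x - y))^2) *\<^sub>R reflect (x - y) h))) (at x)"
  by (rule has_derivative_compose[OF inv_pt_has_derivative[OF x] smooth_on_has_derivative_grad[OF f UNIV_I]])
 from has_derivative_mult[OF norm_has_derivative_inverse[OF x, of \<rho>] this]
 show "(kelvin y \<rho> f has_derivative (%h. ((\<rho> / norm (x - y)) *\<^sub>R (\<rho>^2 / (norm (x - y))^2) *\<^sub>R reflect (x - y) (grad f (inv_pt y \<rho> x))
  - (\<rho> / norm (x - y) ^ 3 * f (inv_pt y \<rho> x)) *\<^sub>R (x - y)) \<bullet> h)) (at x)"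
  unfolding kelvin_def[abs_def] by (simp add: inner_diff_left reflect_sym mult_ac)
qed

lemma det_inv_pt:
 assumes "x \<noteq> y"
 shows "\<bar>det (matrix (%h. (\<rho>^2 / (norm (x - y))^2) *\<^sub>R reflect (x - y) h))\<bar> = (\<rho> / norm (x - y)) ^ 6"
proof -
 define c where "c = \<rho>^2 / (norm (x - y))^2"
 have o: "orthogonal_transformation (reflect (x - y))"
  using assms by (simp add: orthogonal_transformation_def linear_reflect reflect_inner)
 have "matrix ((*\<^sub>R) c \<circ> reflect (x - y)) = matrix ((*\<^sub>R) c) ** matrix (reflect (x - y))"
  by (rule matrix_compose[OF linear_reflect]) (simp add: linear_iff scaleR_add_right)
 then have "\<bar>det (matrix (%h. c *\<^sub>R reflect (x - y) h))\<bar> = \<bar>c ^ 3\<bar> * \<bar>det (matrix (reflect (x - y)))\<bar>"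
  by (simp add: o_def det_mul abs_mult)
 also have "\<bar>det (matrix (reflect (x - y)))\<bar> = 1"
  using o by (rule orthogonal_transformation_det)
 finally show ?thesis by (simp add: c_def power_divide power_mult[symmetric] power_even_abs)
qed

lemma integral_kelvin:
 assumes f[measurable]: "f \<in> borel_measurable borel" "integrable lborel f" and \<rho>: "\<rho> > 0"
 shows "integrable lborel (%x. (\<rho> / norm (x - y)) ^ 6 * f (inv_pt y \<rho> x))"
  and "(LBINT x. (\<rho> / norm (x - y)) ^ 6 * f (inv_pt y \<rho> x)) = (LBINT x. f x)"
proof -
 define S where "S = - {y}"
 \<comment> \<open>The change of variables theorem concerns vector-valued functions, so
   \<open>f\<close> is read as a vector of length one.\<close>
 define F where "F x = (vec (f x) :: real^1)" for x
 define H where "H x = (\<rho> / norm (x - y)) ^ 6 * f (inv_pt y \<rho> x)" for x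
 have Hm[measurable]: "H \<in> borel_measurable borel" unfolding H_def by measurable
 have img: "inv_pt y \<rho> ` S = S"
 proof
  show "inv_pt y \<rho> ` S \<subseteq> S"
  proof (rule image_subsetI)
   fix x assume "x \<in> S"
   then show "inv_pt y \<rho> x \<in> S" using inv_pt_ne[of \<rho> x y] \<rho> by (simp add: S_def)
  qed
  show "S \<subseteq> inv_pt y \<rho> ` S"
  proof
   fix x assume "x \<in> S"
   then have "inv_pt y \<rho> (inv_pt y \<rho> x) = x" "inv_pt y \<rho> x \<in> S"
    using inv_pt_inv_pt[of \<rho> x y] inv_pt_ne[of \<rho> x y] \<rho> by (simp_all add: S_def)
   then show "x \<in> inv_pt y \<rho> ` S" by (metis imageI)
  qed
 qed
 have inj: "inj_on (inv_pt y \<rho>) S"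
  by (rule inj_on_inverseI[where g = "inv_pt y \<rho>"], rule inv_pt_inv_pt) (use \<rho> in \<open>simp_all add: S_def\<close>)
 have Sl: "S \<in> sets lebesgue" unfolding S_def by auto
 have aeS: "AE x in lebesgue. x \<in> S"
  by (rule AE_I'[of "{y}"]) (auto simp: S_def)
 have intf: "integrable lebesgue f" using f integrable_completion[of f lborel] by simp
 have si: "set_integrable lebesgue S f" unfolding set_integrable_def using Sl by (intro integrable_mult_indicator intf)
 have "integral S f = (LINT x|lebesgue. indicator S x *\<^sub>R f x)"
  using set_lebesgue_integral_eq_integral(2)[OF si] by (simp add: set_lebesgue_integral_def)
 also have "\<dots> = (LINT x|lebesgue. f x)"
 proof (rule integral_cong_AE)
  show "f \<in> borel_measurable lebesgue" using intf by simp
  then show "(%x. indicator S x *\<^sub>R f x) \<in> borel_measurable lebesgue" using Sl by measurable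
  show "AE x in lebesgue. indicator S x *\<^sub>R f x = f x" using aeS by eventually_elim simp
 qed
 also have "\<dots> = (LBINT x. f x)" by (rule integral_completion) simp
 finally have I: "integral S f = (LBINT x. f x)" .
 have F: "F absolutely_integrable_on inv_pt y \<rho> ` S \<and> integral (inv_pt y \<rho> ` S) F = vec (LBINT x. f x)"
  unfolding img integral_on_1_eq absolutely_integrable_on_1_iff using si I by (simp add: F_def)
 have der: "(inv_pt y \<rho> has_derivative (%h. (\<rho>^2 / (norm (x - y))^2) *\<^sub>R reflect (x - y) h)) (at x within S)" if "x \<in> S" for x
  using inv_pt_has_derivative[of x y \<rho>] that by (auto simp: S_def intro: has_derivative_at_withinI)
 have 1: "(%x. \<bar>det (matrix (%h. (\<rho>^2 / (norm (x - y))^2) *\<^sub>R reflect (x - y) h))\<bar> *\<^sub>R F (inv_pt y \<rho> x)) absolutely_integrable_on S \<and>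
   integral S (%x. \<bar>det (matrix (%h. (\<rho>^2 / (norm (x - y))^2) *\<^sub>R reflect (x - y) h))\<bar> *\<^sub>R F (inv_pt y \<rho> x)) = vec (LBINT x. f x)"
  using has_absolute_integral_change_of_variables[OF Sl der inj, of F] F by blast
 have eq: "(\<bar>det (matrix (%h. (\<rho>^2 / (norm (x - y))^2) *\<^sub>R reflect (x - y) h))\<bar> *\<^sub>R F (inv_pt y \<rho> x)) $ 1 = H x" if "x \<in> S" for x
  using that by (simp add: det_inv_pt S_def H_def F_def)
 have "set_integrable lebesgue S (%x. (\<bar>det (matrix (%h. (\<rho>^2 / (norm (x - y))^2) *\<^sub>R reflect (x - y) h))\<bar> *\<^sub>R F (inv_pt y \<rho> x)) $ 1)"
  using 1 unfolding absolutely_integrable_on_1_iff by blast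
 then have sH: "set_integrable lebesgue S H"
  by (rule set_integrable_cong[THEN iffD1, rotated 3]) (use eq in auto)
 have HS: "(%x. indicator S x *\<^sub>R H x) = H" by (auto simp: S_def H_def indicator_def)
 have iH: "integrable lebesgue H" using sH unfolding set_integrable_def HS .
 then show "integrable lborel (%x. (\<rho> / norm (x - y)) ^ 6 * f (inv_pt y \<rho> x))"
  using integrable_completion[of H lborel] Hm by (simp add: H_def[abs_def])
 have "integral S H = integral S (%x. (\<bar>det (matrix (%h. (\<rho>^2 / (norm (x - y))^2) *\<^sub>R reflect (x - y) h))\<bar> *\<^sub>R F (inv_pt y \<rho> x)) $ 1)"
  by (rule integral_cong) (use eq in auto)
 also have "\<dots> = (LBINT x. f x)"
 proof -
  have "(vec (integral S (%x. (\<bar>det (matrix (%h. (\<rho>^2 / (norm (x - y))^2) *\<^sub>R reflect (x - y) h))\<bar> *\<^sub>R F (inv_pt y \<rho> x)) $ 1)) :: real^1)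
    = (vec (LBINT x. f x) :: real^1)"
   using 1 unfolding integral_on_1_eq by blast
  then have "(vec (integral S (%x. (\<bar>det (matrix (%h. (\<rho>^2 / (norm (x - y))^2) *\<^sub>R reflect (x - y) h))\<bar> *\<^sub>R F (inv_pt y \<rho> x)) $ 1)) :: real^1) $ 1
    = (vec (LBINT x. f x) :: real^1) $ 1" by (rule arg_cong)
  then show ?thesis unfolding vec_component .
 qed
 finally have "(LBINT x. f x) = (LINT x|lebesgue. H x)"
  using set_lebesgue_integral_eq_integral(2)[OF sH] unfolding set_lebesgue_integral_def HS by simp
 also have "\<dots> = (LBINT x. H x)" by (rule integral_completion) simp
 finally show "(LBINT x. (\<rho> / norm (x - y)) ^ 6 * f (inv_pt y \<rho> x)) = (LBINT x. f x)"
  by (simp add: H_def[abs_def])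
qed

text \<open>Conformal invariance of the Dirichlet integral. Pointwise, the product of the
  transformed gradients equals the original product times the Jacobian of the inversion, up to the
  divergence of a compactly supported field, which integrates to zero.\<close>

lemma kelvin_Dirichlet:
 assumes f: "f \<in> test_functions U" and g: "g \<in> test_functions U" and y: "y \<notin> U" and \<rho>: "\<rho> > 0"
 shows "(LBINT x. grad (kelvin y \<rho> f) x \<bullet> grad (kelvin y \<rho> g) x) = (LBINT x. grad f x \<bullet> grad g x)"
proof -
 define Q where "Q x = f x * g x" for x
 \<comment> \<open>The components of \<open>(x - y) / norm (x - y) ^ 4\<close> times
   \<open>f * g\<close> at the inverted point. Writing the factor through the Kelvin transform of
   \<open>f * g\<close> shows that they are test functions.\<close>
 define X where "X b x = (inverse \<rho> * (inverse (norm (x - y)) ^ 3 * (x \<bullet> b - y \<bullet> b))) * kelvin y \<rho> Q x" for b x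
 define dv where "dv x = (\<Sum>b\<in>Basis. frechet_derivative (X b) (at x) b)" for x
 have o: "open (- {y})" by (simp add: open_Compl)
 have yi: "inv_pt y \<rho> ` U \<subseteq> - {y}"
 proof (intro image_subsetI ComplI)
  fix x assume "x \<in> U" "inv_pt y \<rho> x \<in> {y}"
  then show False using inv_pt_ne[of \<rho> x y] \<rho> y by auto
 qed
 have Q: "Q \<in> test_functions U" unfolding Q_def by (rule tf_mult[OF g tf_smooth[OF f]])
 have kQ: "kelvin y \<rho> Q \<in> test_functions (- {y})" by (rule tf_kelvin[OF Q y \<rho> yi])
 have kf: "kelvin y \<rho> f \<in> test_functions (- {y})" by (rule tf_kelvin[OF f y \<rho> yi])
 have kg: "kelvin y \<rho> g \<in> test_functions (- {y})" by (rule tf_kelvin[OF g y \<rho> yi])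
 have "smooth_on (- {y}) (%x. inverse \<rho> * (inverse (norm (x - y)) ^ 3 * (x \<bullet> b - y \<bullet> b)))" for b
  by (intro smooth_on_cmult[OF o] smooth_on_mult[OF o] smooth_on_power[OF o] smooth_on_inverse[OF o] smooth_on_norm[OF o]
   smooth_on_diff[OF o] smooth_on_inner[OF o] smooth_on_const[OF o]) auto
 then have X: "X b \<in> test_functions UNIV" for b
  unfolding X_def by (intro tf_UNIV[OF tf_local_mult[OF kQ _ o]]) auto
 have dX: "frechet_derivative (X b) (at x) b = (\<rho> / norm (x - y)) * (1 / \<rho>) * (1 / norm (x - y) ^ 3) * Q (inv_pt y \<rho> x) * (b \<bullet> b)
   - 4 / norm (x - y) ^ 6 * ((x - y) \<bullet> b)^2 * Q (inv_pt y \<rho> x)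
   + (\<rho>^2 / norm (x - y) ^ 6) * (reflect (x - y) (grad Q (inv_pt y \<rho> x)) \<bullet> b) * ((x - y) \<bullet> b)" if x: "x \<noteq> y" for b x
 proof -
  define n where "n = norm (x - y)"
  have n: "n > 0" using x by (simp add: n_def)
  have eqX: "X b z = (inverse ((norm (z - y))^2))^2 * ((z - y) \<bullet> b) * Q (inv_pt y \<rho> z)" for z
   using \<rho> by (simp add: X_def kelvin_def inner_diff_left divide_inverse power2_eq_square power3_eq_cube mult_ac)
  have t: "(x - y) \<bullet> (x - y) = n^2" by (simp add: n_def power2_norm_eq_inner)
  have i: "((%z. (z - y) \<bullet> (z - y)) has_derivative (%h. 2 * ((x - y) \<bullet> h))) (at x)"
   by (auto intro!: derivative_eq_intros simp: inner_commute)
  have "((%t. (inverse t)^2) has_real_derivative 2 * inverse t * - (inverse t * inverse t)) (at t)" if "t > 0" for t :: real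
   using that by (auto intro!: derivative_eq_intros simp: power2_eq_square)
  from this[of "(x - y) \<bullet> (x - y)"] have "((%t. (inverse t)^2) has_derivative (*) (2 * inverse (n^2) * - (inverse (n^2) * inverse (n^2)))) (at ((x - y) \<bullet> (x - y)))"
   unfolding has_field_derivative_def t using n by simp
  from has_derivative_compose[OF i this]
  have d1: "((%z. (inverse ((z - y) \<bullet> (z - y)))^2) has_derivative (%h. - 4 * ((x - y) \<bullet> h) / n ^ 6)) (at x)"
   using n by (simp add: field_simps eval_nat_numeral)
  have d2: "((%z. (z - y) \<bullet> b) has_derivative (%h. h \<bullet> b)) (at x)" by (auto intro!: derivative_eq_intros)
  have d3: "((%z. Q (inv_pt y \<rho> z)) has_derivative (%h. grad Q (inv_pt y \<rho> x) \<bullet> ((\<rho>^2 / n^2) *\<^sub>R reflect (x - y) h))) (at x)"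
   unfolding n_def by (rule has_derivative_compose[OF inv_pt_has_derivative[OF x] smooth_on_has_derivative_grad[OF tf_smooth[OF Q] UNIV_I]])
  have "(X b has_derivative (%h. (inverse ((x - y) \<bullet> (x - y)))^2 * ((x - y) \<bullet> b) * (grad Q (inv_pt y \<rho> x) \<bullet> ((\<rho>^2 / n^2) *\<^sub>R reflect (x - y) h))
    + ((inverse ((x - y) \<bullet> (x - y)))^2 * (h \<bullet> b) + (- 4 * ((x - y) \<bullet> h) / n ^ 6) * ((x - y) \<bullet> b)) * Q (inv_pt y \<rho> x))) (at x)"
   unfolding eqX[abs_def] power2_norm_eq_inner by (rule has_derivative_mult[OF has_derivative_mult[OF d1 d2] d3])
  then have "frechet_derivative (X b) (at x) b = (inverse ((x - y) \<bullet> (x - y)))^2 * ((x - y) \<bullet> b) * (grad Q (inv_pt y \<rho> x) \<bullet> ((\<rho>^2 / n^2) *\<^sub>R reflect (x - y) b))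
    + ((inverse ((x - y) \<bullet> (x - y)))^2 * (b \<bullet> b) + (- 4 * ((x - y) \<bullet> b) / n ^ 6) * ((x - y) \<bullet> b)) * Q (inv_pt y \<rho> x)"
   by (metis (no_types, lifting) frechet_derivative_at)
  then show ?thesis unfolding n_def[symmetric] power2_norm_eq_inner[symmetric] reflect_sym
   using n \<rho> by (simp add: n_def[symmetric] field_simps eval_nat_numeral)
 qed
 have dv_eq: "dv x = - (1 / norm (x - y) ^ 4) * Q (inv_pt y \<rho> x) - (\<rho>^2 / norm (x - y) ^ 6) * (grad Q (inv_pt y \<rho> x) \<bullet> (x - y))" if x: "x \<noteq> y" for x
 proof -
  define n where "n = norm (x - y)"
  have n: "n > 0" using x by (simp add: n_def)
  have s1: "(\<Sum>b\<in>(Basis :: (real^3) set). b \<bullet> b) = 3" by simp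
  have s2: "(\<Sum>b\<in>Basis. ((x - y) \<bullet> b)^2) = n^2"
   unfolding n_def power2_norm_eq_inner by (subst (2) euclidean_inner) (simp add: power2_eq_square)
  have s3: "(\<Sum>b\<in>Basis. (reflect (x - y) (grad Q (inv_pt y \<rho> x)) \<bullet> b) * ((x - y) \<bullet> b)) = - (grad Q (inv_pt y \<rho> x) \<bullet> (x - y))"
   using reflect_inner_self[of "x - y"] x by (subst euclidean_inner[symmetric]) simp
  have "dv x = (\<rho> / n) * (1 / \<rho>) * (1 / n ^ 3) * Q (inv_pt y \<rho> x) * (\<Sum>b\<in>(Basis :: (real^3) set). b \<bullet> b)
   - 4 / n ^ 6 * Q (inv_pt y \<rho> x) * (\<Sum>b\<in>Basis. ((x - y) \<bullet> b)^2)
   + (\<rho>^2 / n ^ 6) * (\<Sum>b\<in>Basis. (reflect (x - y) (grad Q (inv_pt y \<rho> x)) \<bullet> b) * ((x - y) \<bullet> b))"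
   unfolding dv_def sum_distrib_left sum_subtractf[symmetric] sum.distrib[symmetric]
   by (intro sum.cong refl) (subst dX[OF x], simp add: n_def mult_ac)
  then show ?thesis unfolding s1 s2 s3 n_def[symmetric] using n \<rho> by (simp add: field_simps eval_nat_numeral)
 qed
 have pt: "grad (kelvin y \<rho> f) x \<bullet> grad (kelvin y \<rho> g) x = (\<rho> / norm (x - y)) ^ 6 * (grad f (inv_pt y \<rho> x) \<bullet> grad g (inv_pt y \<rho> x)) - \<rho>^2 * dv x"
  if x: "x \<noteq> y" for x
 proof -
  define d where "d = x - y" define n where "n = norm d"
  define a where "a = grad f (inv_pt y \<rho> x)" define b where "b = grad g (inv_pt y \<rho> x)"
  define p where "p = f (inv_pt y \<rho> x)" define q where "q = g (inv_pt y \<rho> x)"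
  have d0: "d \<noteq> 0" and n: "n > 0" using x by (simp_all add: d_def n_def)
  have gQ: "grad Q (inv_pt y \<rho> x) = p *\<^sub>R b + q *\<^sub>R a"
   unfolding Q_def[abs_def] p_def q_def a_def b_def
   by (rule grad_mult[OF tf_differentiable[OF f] tf_differentiable[OF g]])
  have Qx: "Q (inv_pt y \<rho> x) = p * q" by (simp add: Q_def p_def q_def)
  have dd: "d \<bullet> d = n^2" by (simp add: n_def power2_norm_eq_inner)
  have r1: "d \<bullet> reflect d v = - (v \<bullet> d)" for v using reflect_inner_self[OF d0, of v] by (simp add: inner_commute)
  have "grad (kelvin y \<rho> f) x \<bullet> grad (kelvin y \<rho> g) x =
   ((\<rho> / n) *\<^sub>R (\<rho>^2 / n^2) *\<^sub>R reflect d a - (\<rho> / n ^ 3 * p) *\<^sub>R d) \<bullet> ((\<rho> / n) *\<^sub>R (\<rho>^2 / n^2) *\<^sub>R reflect d b - (\<rho> / n ^ 3 * q) *\<^sub>R d)"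
   unfolding grad_kelvin[OF tf_smooth[OF f] x] grad_kelvin[OF tf_smooth[OF g] x]
   by (simp add: d_def n_def a_def b_def p_def q_def)
  also have "\<dots> = (\<rho> / n * (\<rho>^2 / n^2))^2 * (a \<bullet> b) + (\<rho> / n * (\<rho>^2 / n^2)) * (\<rho> / n ^ 3 * q) * (a \<bullet> d)
   + (\<rho> / n * (\<rho>^2 / n^2)) * (\<rho> / n ^ 3 * p) * (b \<bullet> d) + (\<rho> / n ^ 3 * p) * (\<rho> / n ^ 3 * q) * n^2"
   by (simp add: inner_diff_left inner_diff_right reflect_inner[OF d0] reflect_inner_self[OF d0] r1 dd power2_eq_square algebra_simps)
  also have "\<dots> = (\<rho> / n) ^ 6 * (a \<bullet> b) - \<rho>^2 * (- (1 / n ^ 4) * (p * q) - (\<rho>^2 / n ^ 6) * ((p *\<^sub>R b + q *\<^sub>R a) \<bullet> d))"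
   using n by (simp add: inner_add_left field_simps eval_nat_numeral)
  finally show ?thesis unfolding dv_eq[OF x] gQ Qx by (simp add: a_def b_def d_def n_def)
 qed
 have ag: "integrable lborel (%x. grad f x \<bullet> grad g x)" by (rule integrable_inner_L2[OF tf_grad_L2[OF f] tf_grad_L2[OF g]])
 have [measurable]: "grad f \<in> borel_measurable borel" "grad g \<in> borel_measurable borel"
  using tf_measurable_grad[OF f] tf_measurable_grad[OF g] by auto
 have agm: "(%x. grad f x \<bullet> grad g x) \<in> borel_measurable borel" by measurable
 have dint: "integrable lborel (%x. frechet_derivative (X b) (at x) b)" if "b \<in> Basis" for b
  by (rule tf_integrable[OF tf_frechet_derivative[OF X that]])
 have di: "integrable lborel dv" unfolding dv_def by (intro integrable_sum' dint)
 have dz: "(LBINT x. dv x) = 0"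
  unfolding dv_def using dint integral_derivative_test_function[OF X] by (subst integral_sum') auto
 have ae: "AE x in lborel. x \<noteq> y" by (rule AE_I'[of "{y}"]) auto
 have "(LBINT x. grad (kelvin y \<rho> f) x \<bullet> grad (kelvin y \<rho> g) x) =
  (LBINT x. (\<rho> / norm (x - y)) ^ 6 * (grad f (inv_pt y \<rho> x) \<bullet> grad g (inv_pt y \<rho> x)) - \<rho>^2 * dv x)"
 proof (rule integral_cong_AE)
  show "AE x in lborel. grad (kelvin y \<rho> f) x \<bullet> grad (kelvin y \<rho> g) x = (\<rho> / norm (x - y)) ^ 6 * (grad f (inv_pt y \<rho> x) \<bullet> grad g (inv_pt y \<rho> x)) - \<rho>^2 * dv x"
   using ae by eventually_elim (rule pt)
  show "(%x. grad (kelvin y \<rho> f) x \<bullet> grad (kelvin y \<rho> g) x) \<in> borel_measurable lborel"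
   using tf_measurable_grad[OF kf] tf_measurable_grad[OF kg] by simp
  show "(%x. (\<rho> / norm (x - y)) ^ 6 * (grad f (inv_pt y \<rho> x) \<bullet> grad g (inv_pt y \<rho> x)) - \<rho>^2 * dv x) \<in> borel_measurable lborel"
   using borel_measurable_integrable[OF di] by measurable
 qed
 also have "\<dots> = (LBINT x. grad f x \<bullet> grad g x)"
  using integral_kelvin[OF agm ag \<rho>, of y] di dz by simp
 finally show ?thesis .
qed

subsection \<open>The method of moving spheres\<close>

context bounded_open3
begin

lemma test_L4_bound: "\<exists>K>0. \<forall>v\<in>test_functions \<Omega>. n2 lborel (%x. (v x)^2) <= K * (n2 lborel (grad v))^2"
proof -
 obtain K where K: "K > 0" "!!u. u \<in> H01 \<Omega> ==> n2 M (%x. (u x)^2) <= K * (nrm u)^2" using L4_bound by blast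
 have "n2 lborel (%x. (v x)^2) <= K * (n2 lborel (grad v))^2" if v: "v \<in> test_functions \<Omega>" for v
  using K(2)[OF test_H01(1)[OF v]] H01_norm_test[OF v] test_n2_M[OF tf_power[OF v], of 2] by simp
 then show ?thesis using K(1) by blast
qed

end

text \<open>A positive weak solution of \<open>- \<Delta> z = z powr p\<close>, given by a Borel representative \<open>Z\<close> extended by zero
 and by nonnegative test functions \<open>\<psi> n\<close> converging to it in the Dirichlet norm, with error \<open>\<epsilon> n\<close>.\<close>

locale pos_sol = bounded_open3 +
 fixes p :: real and Z :: "real^3 \<Rightarrow> real" and \<psi> :: "nat \<Rightarrow> real^3 \<Rightarrow> real" and \<epsilon> :: "nat \<Rightarrow> real" and Bd :: real
 assumes p: "1 < p" "p < 3"
  and Z_meas[measurable]: "Z \<in> borel_measurable borel" and Z_nonneg: "!!x. 0 <= Z x" and Z_out: "!!x. x \<notin> \<Omega> ==> Z x = 0"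
  and Z_pos: "AE x in lborel. x \<in> \<Omega> \<longrightarrow> 0 < Z x"
  and Z_L2: "L2 lborel Z" and Z6: "integrable lborel (%x. Z x ^ 6)"
  and psi: "!!n. \<psi> n \<in> test_functions \<Omega>" and psi_nonneg: "!!n x. 0 <= \<psi> n x"
  and psi_lim: "(%n. n2 lborel (%x. Z x - \<psi> n x)) \<longlonglongrightarrow> 0" and psi_bd: "!!n. n2 lborel (grad (\<psi> n)) <= Bd"
  and eps: "\<epsilon> \<longlonglongrightarrow> 0" and eps_nonneg: "!!n. 0 <= \<epsilon> n"
  and weak: "!!n v. v \<in> test_functions \<Omega> ==>
   \<bar>(LBINT x. grad (\<psi> n) x \<bullet> grad v x) - (LBINT x. Z x powr p * v x)\<bar> <= \<epsilon> n * n2 lborel (grad v)"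
begin

lemma Z2: "integrable lborel (%x. (Z x)^2)"
 using L2_integrable_real[OF Z_L2] .

lemma integrable_Z_powr: "2 <= q ==> q <= 6 ==> integrable lborel (%x. Z x powr q)"
proof (rule integrable_bound'[OF integrable_add'[OF Z2 Z6]], simp, rule AE_I2)
 fix x assume q: "2 <= q" "q <= 6"
 show "norm (Z x powr q) <= norm ((Z x)^2 + Z x ^ 6)"
  using abs_powr_le[OF q, of "Z x"] Z_nonneg[of x] by simp
qed

lemma L2_Z_powr: "1 <= q ==> q <= 3 ==> L2 lborel (%x. Z x powr q)"
 using integrable_Z_powr[of "2 * q"] by (simp add: L2_def power2_eq_square powr_add[symmetric])

lemma finite_dom: "emeasure lborel \<Omega> < \<infinity>" and borel_dom[measurable]: "\<Omega> \<in> sets borel"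
 using emeasure_bounded_finite[OF bounded_dom] open_dom by auto

lemma L2_indicator_dom: "L2 lborel (indicator \<Omega> :: _ \<Rightarrow> real)"
proof -
 have "(indicator \<Omega> x :: real)^2 = indicator \<Omega> x" for x by (auto simp: indicator_def)
 then show ?thesis using finite_dom by (simp add: L2_def)
qed

lemma L2_Z_powr_p1: "L2 lborel (%x. Z x powr (p - 1))"
proof (rule L2_bound(1)[OF L2_add[OF L2_indicator_dom L2_Z_powr[of 2]]])
 show "AE x in lborel. norm (Z x powr (p - 1)) <= norm (indicator \<Omega> x + Z x powr 2)"
 proof (rule AE_I2)
  fix x
  show "norm (Z x powr (p - 1)) <= norm (indicator \<Omega> x + Z x powr 2)"
   using powr_le_one_plus_sq[of "p - 1" "Z x"] p Z_nonneg[of x] Z_out[of x] by (cases "x \<in> \<Omega>") auto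
 qed
qed (use p in auto)

end

text \<open>The radii \<rho> run from \<open>R\<close>, where the sphere does not reach \<Omega>, up
  to \<open>\<rho>b\<close>. The condition \<open>inside\<close> makes the Kelvin transform of a
  test function on the part of \<Omega> inside the sphere a test function on \<Omega>, hence
  admissible in the weak equation.\<close>

locale moving_spheres = pos_sol +
 fixes y :: "real^3" and R \<rho>b :: real
 assumes R: "0 < R" "R < \<rho>b" and outside: "!!x. x \<in> \<Omega> ==> R < norm (x - y)"
  and inside: "!!\<rho> x. R < \<rho> ==> \<rho> <= \<rho>b ==> x \<in> \<Omega> ==> norm (x - y) < \<rho> ==> inv_pt y \<rho> x \<in> \<Omega>"
begin

definition Sg :: "real \<Rightarrow> (real^3) set" where "Sg \<rho> = {x\<in>\<Omega>. norm (x - y) < \<rho>}"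

definition good :: "real \<Rightarrow> bool" where
 "good \<rho> \<longleftrightarrow> (AE x in lborel. x \<in> Sg \<rho> \<longrightarrow> Z x <= kelvin y \<rho> Z x)"

definition E :: "real \<Rightarrow> (real^3) set" where "E \<rho> = {x\<in>Sg \<rho>. kelvin y \<rho> Z x < Z x}"

lemma Sg_sub: "Sg \<rho> \<subseteq> \<Omega>"
 by (auto simp: Sg_def)

lemma open_Sg: "open (Sg \<rho>)"
proof -
 have "Sg \<rho> = \<Omega> \<inter> ball y \<rho>" by (auto simp: Sg_def dist_norm norm_minus_commute)
 then show ?thesis using open_dom by auto
qed

lemma borel_Sg[measurable]: "Sg \<rho> \<in> sets borel"
 using open_Sg by auto

lemma y_out: "y \<notin> \<Omega>"
 using outside[of y] R by auto

lemma dom_sub: "\<Omega> \<subseteq> - {y}"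
 using y_out by auto

lemma kelvin_meas[measurable]: "kelvin y \<rho> Z \<in> borel_measurable borel" "kelvin y \<rho> (\<psi> n) \<in> borel_measurable borel"
 by (intro measurable_kelvin Z_meas tf_measurable[OF psi])+

lemma borel_E[measurable]: "E \<rho> \<in> sets borel"
 unfolding E_def by measurable

text \<open>Under the inversion the squared transform corresponds to \<open>f^2\<close> with the
  weight \<open>(\<rho> / norm (x - y)) ^ 4\<close>, which is bounded on \<Omega> because its points
  are farther than \<open>R\<close> from \<open>y\<close>.\<close>

lemma kelvin_L2:
 assumes f[measurable]: "f \<in> borel_measurable borel" and fL: "L2 lborel f" and out: "!!x. x \<notin> \<Omega> ==> f x = 0" and \<rho>: "R < \<rho>" "\<rho> <= \<rho>b"
 shows "L2 lborel (kelvin y \<rho> f)" "n2 lborel (kelvin y \<rho> f) <= (\<rho>b / R)^2 * n2 lborel f"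
proof -
 have \<rho>0: "\<rho> > 0" using R \<rho> by auto
 define h where "h x = (\<rho> / norm (x - y)) ^ 4 * (f x)^2" for x
 have hm: "h \<in> borel_measurable borel" unfolding h_def by measurable
 have hle: "h x <= (\<rho>b / R) ^ 4 * (f x)^2" for x
 proof (cases "x \<in> \<Omega>")
  case True
  then show ?thesis using outside[OF True] R \<rho> unfolding h_def by (intro mult_right_mono power_mono frac_le) auto
 qed (simp add: h_def out)
 have h0: "0 <= h x" for x by (simp add: h_def)
 have fi: "integrable lborel (%x. (f x)^2)" by (rule L2_integrable_real[OF fL])
 have hi: "integrable lborel h"
  by (rule integrable_bound'[OF integrable_mult_right[OF fi, of "(\<rho>b / R) ^ 4"]])
    (use hm hle h0 in \<open>auto simp: abs_mult intro: order_trans[OF _ abs_ge_self]\<close>)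
 have eq: "(\<rho> / norm (x - y)) ^ 6 * h (inv_pt y \<rho> x) = (kelvin y \<rho> f x)^2" for x
 proof (cases "x = y")
  case False
  then show ?thesis using \<rho>0 by (simp add: h_def kelvin_def norm_inv_pt power_mult_distrib power_divide field_simps eval_nat_numeral)
 qed (simp add: kelvin_def)
 have i: "integrable lborel (%x. (kelvin y \<rho> f x)^2)" using integral_kelvin(1)[OF hm hi \<rho>0, of y] by (simp add: eq)
 then show "L2 lborel (kelvin y \<rho> f)" using measurable_kelvin[OF f] by (simp add: L2_def)
 have "(n2 lborel (kelvin y \<rho> f))^2 = (LBINT x. h x)"
  unfolding n2_sq_real using integral_kelvin(2)[OF hm hi \<rho>0, of y] by (simp add: eq)
 also have "\<dots> <= (LBINT x. (\<rho>b / R) ^ 4 * (f x)^2)"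
  by (intro integral_mono hi integrable_mult_right fi hle)
 also have "\<dots> = ((\<rho>b / R)^2 * n2 lborel f)^2"
  by (simp add: power_mult_distrib n2_sq_real power_mult[symmetric])
 finally show "n2 lborel (kelvin y \<rho> f) <= (\<rho>b / R)^2 * n2 lborel f"
  by (rule power2_le_imp_le) simp
qed

lemma psi_diff_L2: "L2 lborel (%x. Z x - \<psi> n x)"
 by (intro L2_diff Z_L2 tf_L2[OF psi])

lemma psi_diff_kelvin:
 assumes \<rho>: "R < \<rho>" "\<rho> <= \<rho>b"
 shows "L2 lborel (%x. kelvin y \<rho> Z x - kelvin y \<rho> (\<psi> n) x)"
  "n2 lborel (%x. kelvin y \<rho> Z x - kelvin y \<rho> (\<psi> n) x) <= (\<rho>b / R)^2 * n2 lborel (%x. Z x - \<psi> n x)"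
proof -
 have m: "(%x. Z x - \<psi> n x) \<in> borel_measurable borel" using tf_measurable[OF psi] by measurable
 have o: "Z x - \<psi> n x = 0" if "x \<notin> \<Omega>" for x using Z_out[OF that] tf_outside[OF psi that] by simp
 have eq: "kelvin y \<rho> (%x. Z x - \<psi> n x) = (%x. kelvin y \<rho> Z x - kelvin y \<rho> (\<psi> n) x)" by (rule ext) (rule kelvin_diff)
 show "L2 lborel (%x. kelvin y \<rho> Z x - kelvin y \<rho> (\<psi> n) x)"
  "n2 lborel (%x. kelvin y \<rho> Z x - kelvin y \<rho> (\<psi> n) x) <= (\<rho>b / R)^2 * n2 lborel (%x. Z x - \<psi> n x)"
  using kelvin_L2[OF m psi_diff_L2 o \<rho>] unfolding eq by auto
qed

lemma kelvin_psi_test: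
 assumes "R < \<rho>" shows "kelvin y \<rho> (\<psi> n) \<in> test_functions (- {y})"
proof (rule tf_kelvin[OF psi y_out])
 show "inv_pt y \<rho> ` \<Omega> \<subseteq> - {y}"
 proof (rule image_subsetI)
  fix x assume "x \<in> \<Omega>"
  then show "inv_pt y \<rho> x \<in> - {y}" using inv_pt_ne[of \<rho> x y] y_out R assms by auto
 qed
qed (use R assms in auto)

lemma kelvin_psi_nonneg: "R < \<rho> ==> 0 <= kelvin y \<rho> (\<psi> n) x"
 using psi_nonneg R by (simp add: kelvin_def)

definition D :: "real \<Rightarrow> nat \<Rightarrow> real^3 \<Rightarrow> real" where "D \<rho> n x = \<psi> n x - kelvin y \<rho> (\<psi> n) x"

lemma D_test: "R < \<rho> ==> D \<rho> n \<in> test_functions (- {y})"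
 unfolding D_def[abs_def] by (intro tf_diff tf_mono[OF psi dom_sub] kelvin_psi_test)

lemma grad_D: "R < \<rho> ==> grad (D \<rho> n) = (%x. grad (\<psi> n) x - grad (kelvin y \<rho> (\<psi> n)) x)"
 unfolding D_def[abs_def] by (rule tf_grad_diff[OF psi kelvin_psi_test])

lemma n2_grad_D:
 assumes "R < \<rho>" shows "n2 lborel (grad (D \<rho> n)) <= 2 * Bd"
proof -
 have "(n2 lborel (grad (kelvin y \<rho> (\<psi> n))))^2 = (n2 lborel (grad (\<psi> n)))^2"
  using kelvin_Dirichlet[OF psi psi y_out, of \<rho> n n] R assms by (simp add: n2_sq power2_norm_eq_inner)
 then have "n2 lborel (grad (kelvin y \<rho> (\<psi> n))) = n2 lborel (grad (\<psi> n))" by (simp add: power2_eq_iff_nonneg)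
 then show ?thesis
  using n2_triangle_diff[OF tf_grad_L2[OF psi] tf_grad_L2[OF kelvin_psi_test[OF assms]], of n n] psi_bd[of n]
  unfolding grad_D[OF assms] by linarith
qed

text \<open>The equation is tested with \<open>v\<close> and with its Kelvin transform; by
  \<open>kelvin_Dirichlet\<close> the second test is an equation for the transform of
  \<open>Z\<close> tested with \<open>v\<close>. The weight collects the Jacobian and the Kelvin
  factors and would be 1 for \<open>p = 5\<close>. Both tests cost the same error, hence the factor
  2.\<close>

lemma weak_difference:
 assumes \<rho>: "R < \<rho>" "\<rho> <= \<rho>b" and v: "v \<in> test_functions (Sg \<rho>)"
 shows "integrable lborel (%x. Z x powr p * v x)"
  "integrable lborel (%x. (\<rho> / norm (x - y)) powr (5 - p) * kelvin y \<rho> Z x powr p * v x)"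
  "\<bar>(LBINT x. grad (D \<rho> n) x \<bullet> grad v x) - (LBINT x. Z x powr p * v x)
   + (LBINT x. (\<rho> / norm (x - y)) powr (5 - p) * kelvin y \<rho> Z x powr p * v x)\<bar> <= 2 * \<epsilon> n * n2 lborel (grad v)"
proof -
 have \<rho>0: "\<rho> > 0" using R \<rho> by auto
 have vO: "v \<in> test_functions \<Omega>" by (rule tf_mono[OF v Sg_sub])
 have vy: "v \<in> test_functions (- {y})" by (rule tf_mono[OF vO dom_sub])
 have vm[measurable]: "v \<in> borel_measurable borel" by (rule tf_measurable[OF vO])
 have ySg: "y \<notin> Sg \<rho>" using y_out Sg_sub by auto
 have kv: "kelvin y \<rho> v \<in> test_functions \<Omega>"
 proof (rule tf_kelvin[OF v ySg \<rho>0])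
  show "inv_pt y \<rho> ` Sg \<rho> \<subseteq> \<Omega>" using inside[OF \<rho>] by (auto simp: Sg_def)
 qed
 have pL: "L2 lborel (%x. Z x powr p)" using p by (intro L2_Z_powr) auto
 show i1: "integrable lborel (%x. Z x powr p * v x)" by (rule integrable_mult_L2[OF pL tf_L2[OF vO]])
 have i2: "integrable lborel (%x. Z x powr p * kelvin y \<rho> v x)" by (rule integrable_mult_L2[OF pL tf_L2[OF kv]])
 have m2: "(%x. Z x powr p * kelvin y \<rho> v x) \<in> borel_measurable borel" using measurable_kelvin[OF vm] by measurable
 have eq: "(\<rho> / norm (x - y)) ^ 6 * (Z (inv_pt y \<rho> x) powr p * kelvin y \<rho> v (inv_pt y \<rho> x))
  = (\<rho> / norm (x - y)) powr (5 - p) * kelvin y \<rho> Z x powr p * v x" for x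
 proof (cases "x = y")
  case True
  then show ?thesis using tf_outside[OF v ySg] by simp
 next
  case False
  define t where "t = \<rho> / norm (x - y)"
  have t: "t > 0" using False \<rho>0 by (simp add: t_def)
  have "kelvin y \<rho> v (inv_pt y \<rho> x) = inverse t * v x"
   using False \<rho>0 by (simp add: kelvin_def norm_inv_pt inv_pt_inv_pt t_def power2_eq_square field_simps)
  note 1 = this
  have 2: "kelvin y \<rho> Z x powr p = t powr p * Z (inv_pt y \<rho> x) powr p"
   unfolding kelvin_def t_def[symmetric] by (rule powr_mult)
  have 3: "t ^ 6 * inverse t = t powr (5 - p) * t powr p"
  proof -
   have "t powr (5 - p) * t powr p = t powr 5" by (simp add: powr_add[symmetric])
   also have "\<dots> = t ^ 5" using t by (simp add: powr_numeral)
   also have "\<dots> = t ^ 6 * inverse t" using t by (simp add: eval_nat_numeral)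
   finally show ?thesis ..
  qed
  have "t ^ 6 * (Z (inv_pt y \<rho> x) powr p * kelvin y \<rho> v (inv_pt y \<rho> x)) = (t ^ 6 * inverse t) * Z (inv_pt y \<rho> x) powr p * v x"
   unfolding 1 by (simp only: mult_ac)
  also have "\<dots> = t powr (5 - p) * kelvin y \<rho> Z x powr p * v x" unfolding 2 3 by (simp only: mult_ac)
  finally show ?thesis unfolding t_def .
 qed
 show i3: "integrable lborel (%x. (\<rho> / norm (x - y)) powr (5 - p) * kelvin y \<rho> Z x powr p * v x)"
  using integral_kelvin(1)[OF m2 i2 \<rho>0, of y] unfolding eq .
 have I3: "(LBINT x. (\<rho> / norm (x - y)) powr (5 - p) * kelvin y \<rho> Z x powr p * v x) = (LBINT x. Z x powr p * kelvin y \<rho> v x)"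
  using integral_kelvin(2)[OF m2 i2 \<rho>0, of y] unfolding eq .
 have ny: "y \<notin> - {y}" by simp
 have kk: "kelvin y \<rho> (kelvin y \<rho> (\<psi> n)) = \<psi> n"
 proof
  fix x show "kelvin y \<rho> (kelvin y \<rho> (\<psi> n)) x = \<psi> n x"
   using kelvin_kelvin[OF \<rho>0, of x y "\<psi> n"] tf_outside[OF psi y_out, of n] by (cases "x = y") (simp_all add: kelvin_def)
 qed
 have d1: "(LBINT x. grad (\<psi> n) x \<bullet> grad (kelvin y \<rho> v) x) = (LBINT x. grad (kelvin y \<rho> (\<psi> n)) x \<bullet> grad v x)"
  using kelvin_Dirichlet[OF kelvin_psi_test[OF \<rho>(1)] vy ny \<rho>0, of n] unfolding kk .
 have "(n2 lborel (grad (kelvin y \<rho> v)))^2 = (n2 lborel (grad v))^2"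
  using kelvin_Dirichlet[OF v v ySg \<rho>0] by (simp add: n2_sq power2_norm_eq_inner)
 then have nv: "n2 lborel (grad (kelvin y \<rho> v)) = n2 lborel (grad v)" by (simp add: power2_eq_iff_nonneg)
 have gD: "(LBINT x. grad (D \<rho> n) x \<bullet> grad v x) = (LBINT x. grad (\<psi> n) x \<bullet> grad v x) - (LBINT x. grad (kelvin y \<rho> (\<psi> n)) x \<bullet> grad v x)"
  unfolding grad_D[OF \<rho>(1)] inner_diff_left
  by (rule integral_diff'[OF integrable_inner_L2[OF tf_grad_L2[OF psi] tf_grad_L2[OF vO]]
   integrable_inner_L2[OF tf_grad_L2[OF kelvin_psi_test[OF \<rho>(1)]] tf_grad_L2[OF vO]]])
 show "\<bar>(LBINT x. grad (D \<rho> n) x \<bullet> grad v x) - (LBINT x. Z x powr p * v x)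
   + (LBINT x. (\<rho> / norm (x - y)) powr (5 - p) * kelvin y \<rho> Z x powr p * v x)\<bar> <= 2 * \<epsilon> n * n2 lborel (grad v)"
  using weak[OF vO, of n] weak[OF kv, of n] unfolding gD I3 d1 nv by linarith
qed

text \<open>Subcriticality enters here: the exponent \<open>5 - p\<close> is positive, and inside
  the sphere the base exceeds 1.\<close>

lemma weight_ge_1: "R < \<rho> ==> x \<in> Sg \<rho> ==> 1 < (\<rho> / norm (x - y)) powr (5 - p)"
proof -
 assume "R < \<rho>" "x \<in> Sg \<rho>"
 then have "0 < norm (x - y)" "norm (x - y) < \<rho>" using outside[of x] R(1) unfolding Sg_def by auto
 then have "1 < \<rho> / norm (x - y)" by (simp add: less_divide_eq_1_pos)
 then show ?thesis using p by (intro gr_one_powr) auto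
qed

lemma kelvin_Z_nonneg: "R < \<rho> ==> 0 <= kelvin y \<rho> Z x"
 using Z_nonneg R by (simp add: kelvin_def)

lemma powr_tangent:
 assumes "0 <= b" "b <= c" shows "c powr p - b powr p <= p * c powr (p - 1) * (c - b)"
proof (cases "b = c")
 case False
 then have bc: "b < c" using assms by simp
 have s: "spow (p - 1) t = t powr p" if "t \<ge> 0" for t
  using that p by (cases "t = 0") (simp_all add: spow_def powr_diff)
 obtain z where z: "b < z" "z < c" "spow (p - 1) c - spow (p - 1) b = (c - b) * ((p - 1 + 1) * \<bar>z\<bar> powr (p - 1))"
  using MVT2[OF bc, of "spow (p - 1)" "%s. (p - 1 + 1) * \<bar>s\<bar> powr (p - 1)"] DERIV_spow[of "p - 1"] p by auto
 have "c powr p - b powr p = (c - b) * (p * z powr (p - 1))" using z s assms by simp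
 also have "\<dots> <= (c - b) * (p * c powr (p - 1))" using z assms p by (intro mult_left_mono powr_mono2) auto
 finally show ?thesis by (simp add: mult_ac)
qed simp

definition cut :: "real \<Rightarrow> nat \<Rightarrow> real^3 \<Rightarrow> real" where
 "cut \<rho> n x = (if norm (x - y) < \<rho> then spos (1 / real (Suc n)) (D \<rho> n x) else 0)"

text \<open>Where the truncation is positive, \<open>\<psi> n\<close> is positive too, so the
  support is a compact subset of \<Omega>. The slope of \<open>spos\<close> lies between 0 and 1, so
  its square is at most itself, which gives the energy inequality.\<close>

lemma cut_props:
 assumes \<rho>: "R < \<rho>"
 shows "cut \<rho> n \<in> test_functions (Sg \<rho>)" "(n2 lborel (grad (cut \<rho> n)))^2 <= (LBINT x. grad (D \<rho> n) x \<bullet> grad (cut \<rho> n) x)"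
proof -
 define e where "e = 1 / real (Suc n)"
 have e: "e > 0" by (simp add: e_def)
 have Ds: "smooth_on UNIV (D \<rho> n)" by (rule tf_smooth[OF D_test[OF \<rho>]])
 obtain K\<psi> where K\<psi>: "compact K\<psi>" "K\<psi> \<subseteq> \<Omega>" "!!x. x \<notin> K\<psi> ==> \<psi> n x = 0" by (metis test_functionsE[OF psi])
 define K where "K = K\<psi> \<inter> {x. norm (x - y) <= \<rho> \<and> e <= D \<rho> n x}"
 have "closed {x. norm (x - y) <= \<rho> \<and> e <= D \<rho> n x}"
  by (intro closed_Collect_conj closed_Collect_le continuous_intros smooth_on_continuous[OF Ds])
 then have K: "compact K" unfolding K_def by (intro compact_Int_closed K\<psi>)
 have oK: "open (- K)" using K by (simp add: compact_imp_closed open_Compl)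
 have zero: "cut \<rho> n x = 0" if "x \<notin> K" for x
 proof (cases "norm (x - y) < \<rho> \<and> e < D \<rho> n x")
  case True
  then have "0 < \<psi> n x" using kelvin_psi_nonneg[OF \<rho>, of n x] e by (simp add: D_def)
  then show ?thesis using that True K\<psi>(3)[of x] by (auto simp: K_def)
 qed (auto simp: cut_def spos_eq e_def)
 \<comment> \<open>On the sphere the inversion is the identity, so \<open>D\<close> vanishes there
   and lies below the threshold \<open>e\<close>. Hence the support stays strictly inside, and
   cutting off at the sphere preserves smoothness.\<close>
 have KS: "norm (x - y) < \<rho>" if "x \<in> K" for x
 proof (rule ccontr)
  assume "\<not> norm (x - y) < \<rho>"
  then have n: "norm (x - y) = \<rho>" using that by (auto simp: K_def)
  then have "inv_pt y \<rho> x = x" using R \<rho> by (simp add: inv_pt_def)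
  then have "D \<rho> n x = 0" using n R \<rho> by (simp add: D_def kelvin_def)
  then show False using that e by (auto simp: K_def)
 qed
 define ba where "ba = ball y \<rho>"
 have ba: "open ba" "x \<in> ba \<longleftrightarrow> norm (x - y) < \<rho>" for x by (auto simp: ba_def dist_norm norm_minus_commute)
 have "smooth_on ba (%x. spos e (D \<rho> n x))" by (intro smooth_on_spos ba smooth_on_subset[OF Ds]) auto
 then have "smooth_on ba (cut \<rho> n)" by (rule smooth_on_cong[OF ba(1), rotated]) (simp add: cut_def ba e_def)
 moreover have "smooth_on (- K) (cut \<rho> n)" by (rule smooth_on_cong[OF oK _ smooth_on_const[OF oK, of 0]]) (use zero in auto)
 ultimately have "smooth_on (ba \<union> - K) (cut \<rho> n)" by (rule smooth_on_Un[OF ba(1) oK])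
 moreover have "ba \<union> - K = UNIV" using KS ba(2) by auto
 moreover have "K \<subseteq> Sg \<rho>" using KS K\<psi>(2) by (auto simp: Sg_def K_def)
 ultimately show t: "cut \<rho> n \<in> test_functions (Sg \<rho>)" using K zero by (intro test_functionsI[where K = K]) auto
 have g: "grad (cut \<rho> n) x = (if norm (x - y) < \<rho> then spos' e (D \<rho> n x) else 0) *\<^sub>R grad (D \<rho> n) x" for x
 proof (cases "norm (x - y) < \<rho>")
  case True
  have "frechet_derivative (cut \<rho> n) (at x) = frechet_derivative (%x. spos e (D \<rho> n x)) (at x)"
   by (rule frechet_derivative_eq_on(2)[OF ba(1)]) (use True in \<open>auto simp: ba cut_def e_def\<close>)
  then have "grad (cut \<rho> n) x = grad (%x. spos e (D \<rho> n x)) x" by (simp add: grad_def)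
  also have "\<dots> = spos' e (D \<rho> n x) *\<^sub>R grad (D \<rho> n) x"
   by (rule grad_compose[OF smooth_on_differentiable[OF Ds UNIV_I] DERIV_spos[OF e]])
  finally show ?thesis using True by simp
 next
  case False
  then have "x \<notin> Sg \<rho>" by (simp add: Sg_def)
  then show ?thesis using tf_grad_outside[OF t] False by simp
 qed
 show "(n2 lborel (grad (cut \<rho> n)))^2 <= (LBINT x. grad (D \<rho> n) x \<bullet> grad (cut \<rho> n) x)"
  unfolding n2_sq
 proof (rule integral_mono)
  show "integrable lborel (%x. (norm (grad (cut \<rho> n) x))^2)" by (rule L2_integrable[OF tf_grad_L2[OF t]])
  show "integrable lborel (%x. grad (D \<rho> n) x \<bullet> grad (cut \<rho> n) x)"
   by (rule integrable_inner_L2[OF tf_grad_L2[OF D_test[OF \<rho>]] tf_grad_L2[OF t]])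
  fix x
  have *: "(c * m)^2 <= c * m^2" if "0 <= c" "c <= 1" for c m :: real
   unfolding power_mult_distrib using that by (intro mult_right_mono) (auto simp: power2_eq_square mult_left_le)
  show "(norm (grad (cut \<rho> n) x))^2 <= grad (D \<rho> n) x \<bullet> grad (cut \<rho> n) x"
   unfolding g using spos'_bounds[OF e, of "D \<rho> n x"] *[of "spos' e (D \<rho> n x)" "norm (grad (D \<rho> n) x)"]
   by (simp add: power2_norm_eq_inner)
 qed
qed

definition V :: "real \<Rightarrow> real^3 \<Rightarrow> real" where
 "V \<rho> x = (if x \<in> Sg \<rho> then max (Z x - kelvin y \<rho> Z x) 0 else 0)"

lemma V_bounds: "R < \<rho> ==> 0 <= V \<rho> x \<and> V \<rho> x <= Z x"
 using kelvin_Z_nonneg[of \<rho> x] Z_nonneg[of x] by (auto simp: V_def)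

lemma V_meas[measurable]: "V \<rho> \<in> borel_measurable borel"
 unfolding V_def by measurable

lemma cut_tendsto:
 assumes \<rho>: "R < \<rho>" "\<rho> <= \<rho>b"
 shows "(%n. n2 lborel (%x. cut \<rho> n x - V \<rho> x)) \<longlonglongrightarrow> 0"
proof -
 define c where "c = n2 lborel (indicator \<Omega> :: real^3 \<Rightarrow> real)"
 have main: "n2 lborel (%x. cut \<rho> n x - V \<rho> x) <= 2 * (1 / real (Suc n)) * c + (1 + (\<rho>b / R)^2) * n2 lborel (%x. Z x - \<psi> n x)" for n
 proof -
  define e where "e = 1 / real (Suc n)"
  have e: "e > 0" by (simp add: e_def)
  define b1 where "b1 x = (2 * e) * (indicator \<Omega> x :: real)" for x
  define b2 where "b2 x = \<bar>Z x - \<psi> n x\<bar>" for x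
  define b3 where "b3 x = \<bar>kelvin y \<rho> Z x - kelvin y \<rho> (\<psi> n) x\<bar>" for x
  have L1: "L2 lborel b1" unfolding b1_def by (rule L2_cmult[OF L2_indicator_dom])
  have L2': "L2 lborel b2" unfolding b2_def using psi_diff_L2[of n] by (auto simp: L2_def)
  have L3: "L2 lborel b3" unfolding b3_def using psi_diff_kelvin(1)[OF \<rho>, of n] by (auto simp: L2_def)
  have L: "L2 lborel (%x. b1 x + (b2 x + b3 x))" by (intro L2_add L1 L2' L3)
  have [measurable]: "cut \<rho> n \<in> borel_measurable borel" by (rule tf_measurable[OF cut_props(1)[OF \<rho>(1)]])
  have le: "\<bar>cut \<rho> n x - V \<rho> x\<bar> <= b1 x + (b2 x + b3 x)" for x
  proof (cases "x \<in> Sg \<rho>")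
   case True
   have s: "\<bar>spos e (D \<rho> n x) - max (D \<rho> n x) 0\<bar> <= 2 * e" by (rule spos_bounds(3)[OF e])
   have c: "cut \<rho> n x = spos e (D \<rho> n x)" unfolding cut_def e_def using True by (simp add: Sg_def)
   have "indicator \<Omega> x = (1 :: real)" using True Sg_sub[of \<rho>] by auto
   then show ?thesis using s True unfolding c V_def b1_def b2_def b3_def D_def by auto
  next
   case False
   then show ?thesis using tf_outside[OF cut_props(1)[OF \<rho>(1)] False, of n] e
    by (simp add: V_def b1_def b2_def b3_def)
  qed
  have "n2 lborel (%x. cut \<rho> n x - V \<rho> x) <= n2 lborel (%x. b1 x + (b2 x + b3 x))"
   by (rule L2_bound(2)[OF L]) (use le in \<open>auto intro: order_trans[OF _ abs_ge_self]\<close>)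
  also have "\<dots> <= n2 lborel b1 + (n2 lborel b2 + n2 lborel b3)"
   using n2_triangle[OF L1 L2_add[OF L2' L3]] n2_triangle[OF L2' L3] by linarith
  also have "n2 lborel b1 = 2 * e * c" unfolding b1_def c_def n2_cmult using e by simp
  also have "n2 lborel b2 = n2 lborel (%x. Z x - \<psi> n x)" by (simp add: n2_def b2_def)
  also have "n2 lborel b3 <= (\<rho>b / R)^2 * n2 lborel (%x. Z x - \<psi> n x)"
   using psi_diff_kelvin(2)[OF \<rho>, of n] by (simp add: n2_def b3_def)
  finally show ?thesis by (simp add: e_def algebra_simps)
 qed
 have zero: "(%n. 2 * (1 / real (Suc n)) * c + (1 + (\<rho>b / R)^2) * n2 lborel (%x. Z x - \<psi> n x)) \<longlonglongrightarrow> 0"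
  using tendsto_add[OF tendsto_mult_right[OF tendsto_mult_left[OF LIMSEQ_Suc[OF lim_1_over_n], of 2], of c] tendsto_mult_left[OF psi_lim, of "1 + (\<rho>b / R)^2"]] by simp
 show ?thesis
  by (rule tendsto_sandwich[OF always_eventually always_eventually tendsto_const zero]) (use main in auto)
qed

lemma V_L4: "R < \<rho> ==> L2 lborel (%x. (V \<rho> x)^2)"
 by (rule L2_bound(1)[OF L2_Z_powr[of 2]])
   (use V_bounds[of \<rho>] Z_nonneg in \<open>auto intro!: power_mono\<close>)

lemma n2_product_le:
 fixes f g :: "real^3 \<Rightarrow> real"
 assumes [measurable]: "f \<in> borel_measurable borel" "g \<in> borel_measurable borel"
  and "L2 lborel (%x. (f x)^2)" "L2 lborel (%x. (g x)^2)"
 shows "L2 lborel (%x. f x * g x)" "(n2 lborel (%x. f x * g x))^2 <= n2 lborel (%x. (f x)^2) * n2 lborel (%x. (g x)^2)"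
proof -
 have i: "integrable lborel (%x. (f x)^2 * (g x)^2)" by (rule integrable_mult_L2[OF assms(3,4)])
 then show "L2 lborel (%x. f x * g x)" by (simp add: L2_def power_mult_distrib)
 show "(n2 lborel (%x. f x * g x))^2 <= n2 lborel (%x. (f x)^2) * n2 lborel (%x. (g x)^2)"
  unfolding n2_sq_real power_mult_distrib using L2_Cauchy_Schwarz_real[OF assms(3,4)] by linarith
qed

text \<open>The maximum principle for small sets: \<open>V\<close>, the positive part of \<open>Z - kelvin y \<rho> Z\<close>, is a test function up to
 the approximation by \<open>cut\<close>, and is absorbed by the Sobolev inequality.\<close>

lemma good_if_small:
 "\<exists>c>0. \<forall>\<rho>. R < \<rho> \<longrightarrow> \<rho> <= \<rho>b \<longrightarrow> n2 lborel (%x. indicator (E \<rho>) x * Z x powr (p - 1)) < c \<longrightarrow> good \<rho>"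
proof -
 obtain K where K: "K > 0" "!!v. v \<in> test_functions \<Omega> ==> n2 lborel (%x. (v x)^2) <= K * (n2 lborel (grad v))^2"
  using test_L4_bound by blast
 \<comment> \<open>The threshold \<open>1 / (K * p)\<close> is what turns the final estimate
   \<open>W <= (K * p * H)^2 * W\<close> into \<open>W = 0\<close>.\<close>
 have "good \<rho>" if \<rho>: "R < \<rho>" "\<rho> <= \<rho>b" and small: "n2 lborel (%x. indicator (E \<rho>) x * Z x powr (p - 1)) < 1 / (K * p)" for \<rho>
 proof -
  define q where "q x = indicator (E \<rho>) x * Z x powr (p - 1)" for x
  define H where "H = n2 lborel q"
  define W where "W = n2 lborel (%x. (V \<rho> x)^2)"
  define T where "T n = n2 lborel (grad (cut \<rho> n))" for n
  have qL: "L2 lborel q" unfolding q_def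
   by (rule L2_bound(1)[OF L2_Z_powr_p1]) (auto simp: indicator_def)
  \<comment> \<open>The energy of the cut function is compared with the difference of the right-hand
    sides. Only points of \<open>E\<close> contribute positively, and there the tangent inequality
    produces the factor \<open>p * Z powr (p - 1)\<close>.\<close>
  have tb: "T n <= p * H * sqrt (W * K) + 2 * \<epsilon> n" for n
  proof -
   let ?v = "cut \<rho> n"
   have vt: "?v \<in> test_functions (Sg \<rho>)" by (rule cut_props(1)[OF \<rho>(1)])
   have vO: "?v \<in> test_functions \<Omega>" by (rule tf_mono[OF vt Sg_sub])
   have vm[measurable]: "?v \<in> borel_measurable borel" by (rule tf_measurable[OF vt])
   have v4: "L2 lborel (%x. (?v x)^2)" by (rule tf_L2[OF tf_power[OF vO]]) simp
   have v0: "0 <= ?v x" for x unfolding cut_def using spos_bounds(1)[of "1 / real (Suc n)"] by simp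
   note Vv = n2_product_le[OF V_meas vm V_L4[OF \<rho>(1)] v4]
   note wd = weak_difference[OF \<rho> vt]
   have pt: "Z x powr p * ?v x - (\<rho> / norm (x - y)) powr (5 - p) * kelvin y \<rho> Z x powr p * ?v x <= p * (q x * (V \<rho> x * ?v x))" for x
   proof (cases "x \<in> Sg \<rho>")
    case True
    let ?k = "(\<rho> / norm (x - y)) powr (5 - p)" and ?b = "kelvin y \<rho> Z x"
    have "1 * ?b powr p <= ?k * ?b powr p" using weight_ge_1[OF \<rho>(1) True] by (intro mult_right_mono) auto
    then have 1: "(Z x powr p - ?k * ?b powr p) * ?v x <= (Z x powr p - ?b powr p) * ?v x" using v0 by (intro mult_right_mono) auto
    have "(Z x powr p - ?b powr p) * ?v x <= p * (q x * (V \<rho> x * ?v x))"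
    proof (cases "?b < Z x")
     case b: True
     have "(Z x powr p - ?b powr p) * ?v x <= (p * Z x powr (p - 1) * (Z x - ?b)) * ?v x"
      using powr_tangent[of ?b "Z x"] b v0[of x] kelvin_Z_nonneg[OF \<rho>(1), of x] by (intro mult_right_mono) auto
     then show ?thesis using b True by (simp add: q_def E_def V_def mult_ac)
    next
     case False
     then have "Z x powr p <= ?b powr p" using Z_nonneg[of x] p by (intro powr_mono2) auto
     then have "(Z x powr p - ?b powr p) * ?v x <= 0" using v0[of x] by (simp add: mult_nonpos_nonneg)
     also have "0 <= p * (q x * (V \<rho> x * ?v x))" using p v0[of x] V_bounds[OF \<rho>(1), of x] by (auto simp: q_def)
     finally show ?thesis .
    qed
    then show ?thesis using 1 by (simp add: left_diff_distrib)
   next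
    case False
    then show ?thesis using tf_outside[OF vt False] by simp
   qed
   have "(T n)^2 <= (LBINT x. grad (D \<rho> n) x \<bullet> grad ?v x)" unfolding T_def by (rule cut_props(2)[OF \<rho>(1)])
   also have "\<dots> <= (LBINT x. Z x powr p * ?v x) - (LBINT x. (\<rho> / norm (x - y)) powr (5 - p) * kelvin y \<rho> Z x powr p * ?v x) + 2 * \<epsilon> n * T n"
    using wd(3)[of n] unfolding T_def by linarith
   also have "(LBINT x. Z x powr p * ?v x) - (LBINT x. (\<rho> / norm (x - y)) powr (5 - p) * kelvin y \<rho> Z x powr p * ?v x)
    <= p * (LBINT x. q x * (V \<rho> x * ?v x))"
   proof -
    have "(LBINT x. Z x powr p * ?v x - (\<rho> / norm (x - y)) powr (5 - p) * kelvin y \<rho> Z x powr p * ?v x) <= (LBINT x. p * (q x * (V \<rho> x * ?v x)))"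
     by (intro integral_mono pt integrable_diff' wd integrable_mult_right integrable_mult_L2[OF qL Vv(1)])
    then show ?thesis using wd(1,2) by simp
   qed
   also have "(LBINT x. q x * (V \<rho> x * ?v x)) <= H * sqrt (W * K) * T n"
   proof -
    have "(n2 lborel (%x. V \<rho> x * ?v x))^2 <= W * (K * (T n)^2)"
     using Vv(2) mult_left_mono[OF K(2)[OF vO], of W] unfolding W_def T_def by simp
    also have "\<dots> = (sqrt (W * K) * T n)^2" using K(1) by (simp add: power_mult_distrib W_def)
    finally have "n2 lborel (%x. V \<rho> x * ?v x) <= sqrt (W * K) * T n"
     by (rule power2_le_imp_le) (use K(1) in \<open>simp add: W_def T_def\<close>)
    then have "H * n2 lborel (%x. V \<rho> x * ?v x) <= H * (sqrt (W * K) * T n)" by (rule mult_left_mono) (simp add: H_def)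
    then show ?thesis using L2_Cauchy_Schwarz_real[OF qL Vv(1)] unfolding H_def by (simp add: mult.assoc)
   qed
   finally have "T n * T n <= (p * H * sqrt (W * K) + 2 * \<epsilon> n) * T n"
    using p by (simp add: power2_eq_square algebra_simps)
   moreover have "T n \<ge> 0" by (simp add: T_def)
   moreover have "0 <= p * H * sqrt (W * K) + 2 * \<epsilon> n" if "T n = 0"
    using p K(1) eps_nonneg[of n] by (simp add: H_def W_def)
   ultimately show ?thesis by (cases "T n = 0") (auto simp: mult_le_cancel_right)
  qed
  have W0: "W \<ge> 0" and H0: "H \<ge> 0" by (simp_all add: W_def H_def)
  have cL: "L2 lborel (cut \<rho> n)" for n by (rule tf_L2[OF cut_props(1)[OF \<rho>(1)]])
  have VL: "L2 lborel (V \<rho>)"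
   by (rule L2_bound(1)[OF Z_L2]) (use V_bounds[OF \<rho>(1)] Z_nonneg in auto)
  obtain r where r: "strict_mono (r :: nat \<Rightarrow> nat)" "AE x in lborel. (%n. cut \<rho> (r n) x) \<longlonglongrightarrow> V \<rho> x"
   by (rule L2_convergence_AE_subseq[OF cL VL cut_tendsto[OF \<rho>]])
  define A where "A = p * H * sqrt (W * K)"
  have A0: "A \<ge> 0" using p H0 by (simp add: A_def W0 K(1) less_imp_le)
  have er: "(%k. \<epsilon> (r k)) \<longlonglongrightarrow> 0" using LIMSEQ_subseq_LIMSEQ[OF eps r(1)] by (simp add: comp_def)
  have v4: "L2 lborel (%x. (cut \<rho> n x)^2)" for n
   by (rule tf_L2[OF tf_power[OF cut_props(1)[OF \<rho>(1)]]]) simp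
  have lim: "(%k. (K * (A + 2 * \<epsilon> (r k))^2)^2) \<longlonglongrightarrow> (K * (A + 2 * 0)^2)^2"
   by (intro tendsto_intros er)
  have le4: "(LBINT x. ((cut \<rho> (r k) x)^2)^2) <= (K * (A + 2 * \<epsilon> (r k))^2)^2" for k
  proof -
   have "(T (r k))^2 <= (A + 2 * \<epsilon> (r k))^2" using tb[of "r k"] unfolding A_def by (intro power_mono) (simp_all add: T_def)
   then have "n2 lborel (%x. (cut \<rho> (r k) x)^2) <= K * (A + 2 * \<epsilon> (r k))^2"
    using K(2)[OF tf_mono[OF cut_props(1)[OF \<rho>(1)] Sg_sub], of "r k"] K(1) unfolding T_def
    by (meson mult_left_mono less_imp_le order_trans)
   then have "(n2 lborel (%x. (cut \<rho> (r k) x)^2))^2 <= (K * (A + 2 * \<epsilon> (r k))^2)^2"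
    by (rule power_mono) simp
   then show ?thesis unfolding n2_sq_real .
  qed
  have ae: "AE x in lborel. (%k. ((cut \<rho> (r k) x)^2)^2) \<longlonglongrightarrow> ((V \<rho> x)^2)^2"
   using r(2) by eventually_elim (intro tendsto_intros)
  have "(LBINT x. ((V \<rho> x)^2)^2) <= (K * (A + 2 * 0)^2)^2"
   by (rule Fatou_bound(2)[OF L2_integrable_real[OF v4] _ _ ae le4 lim]) simp_all
  then have "W^2 <= (K * A^2)^2" unfolding W_def n2_sq_real by simp
  then have "W <= K * A^2" by (rule power2_le_imp_le) (use K(1) in simp)
  also have "\<dots> = (K * p * H)^2 * W" using W0 K(1) by (simp add: A_def power_mult_distrib) (simp add: power2_eq_square)
  finally have Wle: "W <= (K * p * H)^2 * W" .
  have "K * p * H < 1" using small K(1) p unfolding H_def q_def by (simp add: field_simps)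
  then have "(K * p * H)^2 < 1^2" by (rule power_strict_mono) (use K(1) p H0 in auto)
  then have "W = 0" using Wle W0 mult_strict_right_mono[of "(K * p * H)^2" 1 W] by (cases "W = 0") auto
  then have "(LBINT x. ((V \<rho> x)^2)^2) = 0" unfolding W_def n2_sq_real[symmetric] by simp
  then have "AE x in lborel. ((V \<rho> x)^2)^2 = 0"
   using integral_nonneg_eq_0_iff_AE[OF L2_integrable_real[OF V_L4[OF \<rho>(1)]]] by simp
  then show ?thesis unfolding good_def by eventually_elim (auto simp: V_def)
 qed
 then show ?thesis using K(1) p by (intro exI[of _ "1 / (K * p)"]) auto
qed

end

section \<open>Concave test functions for the strong maximum principle\<close>

lemma tf_bounded:
 assumes "f \<in> test_functions U" obtains S where "0 <= S" "!!x. \<bar>f x\<bar> <= S"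
proof -
 have "compact (f ` closure {x. f x \<noteq> 0})"
  using assms by (intro compact_continuous_image continuous_on_subset[OF tf_continuous[OF assms]]) (auto simp: test_functions_def)
 then obtain S where S: "!!t. t \<in> f ` closure {x. f x \<noteq> 0} ==> norm t <= S"
  using compact_imp_bounded bounded_iff by metis
 have "\<bar>f x\<bar> <= \<bar>S\<bar>" for x
 proof (cases "f x = 0")
  case False
  then have "x \<in> closure {x. f x \<noteq> 0}" by (intro subsetD[OF closure_subset]) simp
  then show ?thesis using S[of "f x"] by auto
 qed simp
 then show thesis by (intro that[of "\<bar>S\<bar>"]) auto
qed

text \<open>The function \<open>t + 1 - sqrt (1 + t^2)\<close>: concave, nondecreasing, Lipschitz,
  with slope 1 at 0 and bounded on the half line. Writing the root as a real power makes smoothness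
  an instance of \<open>smooth_on_powr\<close>.\<close>

definition cav :: "real \<Rightarrow> real" where "cav t = t - (1 + t^2) powr (1 / 2) + 1"
definition cav' :: "real \<Rightarrow> real" where "cav' t = 1 - t * (1 + t^2) powr (- 1 / 2)"
definition cav'' :: "real \<Rightarrow> real" where "cav'' t = - ((1 + t^2) powr (- 3 / 2))"

lemma one_plus_sq_pos: "0 < 1 + (t :: real)^2"
 by (simp add: add_pos_nonneg)

lemma DERIV_cav: "(cav has_real_derivative cav' t) (at t)"
proof -
 have "(cav has_real_derivative 1 - (1 / 2 * (1 + t^2) powr (1 / 2 - 1) * (2 * t)) + 0) (at t)"
  unfolding cav_def[abs_def] using one_plus_sq_pos[of t] by (auto intro!: derivative_eq_intros)
 then show ?thesis by (simp add: cav'_def mult.commute)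
qed

lemma DERIV_cav': "(cav' has_real_derivative cav'' t) (at t)"
proof -
 let ?s = "1 + t^2"
 have "(cav' has_real_derivative - (1 * ?s powr (- 1 / 2) + (- 1 / 2 * ?s powr (- 1 / 2 - 1) * (2 * t)) * t)) (at t)"
  unfolding cav'_def[abs_def] using one_plus_sq_pos[of t] by (auto intro!: derivative_eq_intros)
 moreover have "?s powr (- 1 / 2) = ?s * ?s powr (- 3 / 2)"
  using powr_add[of ?s 1 "- 3 / 2"] one_plus_sq_pos[of t] by simp
 ultimately show ?thesis by (simp add: cav''_def power2_eq_square algebra_simps)
qed

lemma powr_half_bounds: "\<bar>t\<bar> <= (1 + t^2) powr (1 / 2)" "(1 + t^2) powr (1 / 2) <= 1 + \<bar>t :: real\<bar>"
proof -
 have eq: "(1 + t^2) powr (1 / 2) = sqrt (1 + t^2)" using one_plus_sq_pos[of t] by (simp add: powr_half_sqrt)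
 show "\<bar>t\<bar> <= (1 + t^2) powr (1 / 2)" unfolding eq by (rule real_le_rsqrt) simp
 show "(1 + t^2) powr (1 / 2) <= 1 + \<bar>t\<bar>" unfolding eq by (rule real_le_lsqrt) (auto simp: power2_eq_square algebra_simps)
qed

lemma cav_0: "cav' 0 = 1"
 by (simp add: cav'_def)

lemma cav_bounds: "0 <= t ==> \<bar>cav t\<bar> <= 1"
 using powr_half_bounds[of t] by (simp add: cav_def)

lemma cav'_bounds: "0 <= cav' t" "cav' t <= 2"
proof -
 have "(1 + t^2) powr (- 1 / 2) * \<bar>t\<bar> <= (1 + t^2) powr (- 1 / 2) * (1 + t^2) powr (1 / 2)"
  by (intro mult_left_mono powr_half_bounds) simp
 also have "\<dots> = 1" using one_plus_sq_pos[of t] by (simp add: powr_add[symmetric])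
 finally have "\<bar>t * (1 + t^2) powr (- 1 / 2)\<bar> <= 1" by (simp add: abs_mult mult.commute)
 then show "0 <= cav' t" "cav' t <= 2" unfolding cav'_def by linarith+
qed

lemma cav''_bounds: "cav'' t <= 0" "\<bar>cav'' t\<bar> <= 1"
proof -
 have "(1 + t^2) powr (- 3 / 2) <= (1 + t^2) powr 0" by (intro powr_mono) auto
 then show "cav'' t <= 0" "\<bar>cav'' t\<bar> <= 1" using one_plus_sq_pos[of t] by (simp_all add: cav''_def)
qed

lemma cav_Lipschitz: "\<bar>cav s - cav t\<bar> <= 2 * \<bar>s - t\<bar>"
 using field_differentiable_bound[of UNIV cav cav' 2 s t] DERIV_cav cav'_bounds by auto

lemma cav'_Lipschitz: "\<bar>cav' s - cav' t\<bar> <= \<bar>s - t\<bar>"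
 using field_differentiable_bound[of UNIV cav' cav'' 1 s t] DERIV_cav' cav''_bounds by auto

lemma smooth_on_cav:
 assumes "open S" "smooth_on S f" shows "smooth_on S (%x. cav (f x))" "smooth_on S (%x. cav' (f x))"
 unfolding cav_def cav'_def using one_plus_sq_pos
 by (intro smooth_on_add smooth_on_diff smooth_on_mult smooth_on_const smooth_on_powr smooth_on_power assms; simp)+

lemma borel_cav[measurable]: "cav \<in> borel_measurable borel" "cav' \<in> borel_measurable borel"
 unfolding cav_def[abs_def] cav'_def[abs_def] by measurable

definition laplacian :: "('a::euclidean_space \<Rightarrow> real) \<Rightarrow> 'a \<Rightarrow> real" where
 "laplacian f x = (\<Sum>b\<in>Basis. frechet_derivative (%y. frechet_derivative f (at y) b) (at x) b)"

lemma tf_laplacian: "\<eta> \<in> test_functions U ==> laplacian \<eta> \<in> test_functions U"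
 unfolding laplacian_def[abs_def] by (intro tf_sum tf_frechet_derivative finite_Basis) auto

lemma integral_grad_laplacian:
 assumes \<eta>: "\<eta> \<in> test_functions U" and g: "smooth_on UNIV g"
 shows "(LBINT x. grad g x \<bullet> grad \<eta> x) = - (LBINT x. g x * laplacian \<eta> x)"
proof -
 have t: "(%x. frechet_derivative \<eta> (at x) b) \<in> test_functions UNIV" if "b \<in> Basis" for b
  by (rule tf_frechet_derivative[OF tf_UNIV[OF \<eta>] that])
 have i1: "integrable lborel (%x. frechet_derivative g (at x) b * frechet_derivative \<eta> (at x) b)" if "b \<in> Basis" for b
  by (rule tf_integrable[OF tf_mult[OF t[OF that] smooth_on_frechet_derivative[OF g]]]) (use that in auto)
 have i2: "integrable lborel (%x. g x * frechet_derivative (%y. frechet_derivative \<eta> (at y) b) (at x) b)" if "b \<in> Basis" for b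
  by (rule tf_integrable[OF tf_mult[OF tf_frechet_derivative[OF t[OF that] that] g]])
 have ip: "grad g x \<bullet> grad \<eta> x = (\<Sum>b\<in>Basis. frechet_derivative g (at x) b * frechet_derivative \<eta> (at x) b)" for x
  by (subst euclidean_inner) (simp add: grad_inner_Basis)
 have "(LBINT x. grad g x \<bullet> grad \<eta> x) = (\<Sum>b\<in>Basis. LBINT x. frechet_derivative g (at x) b * frechet_derivative \<eta> (at x) b)"
  unfolding ip by (rule integral_sum') (rule i1)
 also have "\<dots> = (\<Sum>b\<in>Basis. - (LBINT x. g x * frechet_derivative (%y. frechet_derivative \<eta> (at y) b) (at x) b))"
  by (rule sum.cong[OF refl]) (simp add: tf_by_parts[OF t g])
 also have "\<dots> = - (LBINT x. g x * laplacian \<eta> x)"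
  unfolding laplacian_def sum_distrib_left by (subst integral_sum'[OF i2]) (simp_all add: sum_negf)
 finally show ?thesis .
qed

text \<open>The product rule for \<open>v\<close> yields the gradient of
  \<open>\<delta> * cav (W / \<delta>)\<close> paired with that of \<eta>, plus a multiple of the
  squared gradient of \<open>W\<close> with the sign of \<open>cav''\<close>, which is dropped. A
  second integration by parts moves all derivatives to \<eta>.\<close>

lemma concave_test_function:
 assumes \<eta>: "\<eta> \<in> test_functions U" "!!x. 0 <= \<eta> x" "!!x. \<eta> x <= S" and W: "W \<in> test_functions UNIV" and \<delta>: "\<delta> > 0"
 defines "v \<equiv> %x. cav' (W x / \<delta>) * \<eta> x"
 shows "v \<in> test_functions U"
  "(LBINT x. grad W x \<bullet> grad v x) <= - (LBINT x. \<delta> * cav (W x / \<delta>) * laplacian \<eta> x)"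
  "n2 lborel (grad v) <= 2 * n2 lborel (grad \<eta>) + S / \<delta> * n2 lborel (grad W)"
proof -
 have Ws: "smooth_on UNIV (%x. W x / \<delta>)"
  using smooth_on_cmult[OF open_UNIV tf_smooth[OF W], of "inverse \<delta>"] by (simp add: divide_inverse mult.commute)
 define g where "g x = \<delta> * cav (W x / \<delta>)" for x
 have gs: "smooth_on UNIV g" unfolding g_def[abs_def] by (intro smooth_on_cmult smooth_on_cav open_UNIV Ws)
 have hs: "smooth_on UNIV (%x. cav' (W x / \<delta>))" by (intro smooth_on_cav open_UNIV Ws)
 show vt: "v \<in> test_functions U" unfolding v_def by (rule tf_mult[OF \<eta>(1) hs])
 have dW: "W differentiable at x" for x by (rule tf_differentiable[OF W])
 have gg: "grad g x = cav' (W x / \<delta>) *\<^sub>R grad W x" for x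
 proof -
  have "((%t. \<delta> * cav (t / \<delta>)) has_real_derivative \<delta> * (cav' (W x / \<delta>) * (1 / \<delta>))) (at (W x))"
   by (intro DERIV_cmult DERIV_chain2[OF DERIV_cav]) (use \<delta> in \<open>auto intro!: derivative_eq_intros\<close>)
  from grad_compose[OF dW this] show ?thesis using \<delta> by (simp add: g_def[abs_def])
 qed
 have gh: "grad (%x. cav' (W x / \<delta>)) x = (cav'' (W x / \<delta>) / \<delta>) *\<^sub>R grad W x" for x
 proof -
  have "((%t. cav' (t / \<delta>)) has_real_derivative (cav'' (W x / \<delta>) * (1 / \<delta>))) (at (W x))"
   by (intro DERIV_chain2[OF DERIV_cav']) (use \<delta> in \<open>auto intro!: derivative_eq_intros\<close>)
  from grad_compose[OF dW this] show ?thesis by simp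
 qed
 have gv: "grad v x = cav' (W x / \<delta>) *\<^sub>R grad \<eta> x + (\<eta> x * (cav'' (W x / \<delta>) / \<delta>)) *\<^sub>R grad W x" for x
  unfolding v_def
  by (subst grad_mult) (use smooth_on_differentiable[OF hs UNIV_I] tf_differentiable[OF \<eta>(1)] in \<open>auto simp: gh\<close>)
 have gL: "L2 lborel (grad W)" "L2 lborel (grad v)" "L2 lborel (grad \<eta>)"
  by (rule tf_grad_L2[OF W] tf_grad_L2[OF vt] tf_grad_L2[OF \<eta>(1)])+
 have ghL: "L2 lborel (grad g)"
 proof (rule L2_bound(1)[OF L2_scaleR[OF gL(1), of 2]])
  show "grad g \<in> borel_measurable lborel" using borel_measurable_continuous_onI[OF smooth_on_continuous_grad[OF gs]] by simp
  show "AE x in lborel. norm (grad g x) <= norm (2 *\<^sub>R grad W x)"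
   by (rule AE_I2) (use cav'_bounds in \<open>auto simp: gg intro!: mult_right_mono\<close>)
 qed
 have "(LBINT x. grad W x \<bullet> grad v x) <= (LBINT x. grad g x \<bullet> grad \<eta> x)"
 proof (rule integral_mono[OF integrable_inner_L2[OF gL(1,2)] integrable_inner_L2[OF ghL gL(3)]])
  fix x
  have "(\<eta> x * (cav'' (W x / \<delta>) / \<delta>)) * (grad W x \<bullet> grad W x) <= 0"
   using \<eta>(2)[of x] cav''_bounds(1)[of "W x / \<delta>"] \<delta> by (intro mult_nonpos_nonneg mult_nonneg_nonpos divide_nonpos_pos) auto
  then show "grad W x \<bullet> grad v x <= grad g x \<bullet> grad \<eta> x" by (simp add: gv gg inner_add_right)
 qed
 then show "(LBINT x. grad W x \<bullet> grad v x) <= - (LBINT x. \<delta> * cav (W x / \<delta>) * laplacian \<eta> x)"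
  unfolding integral_grad_laplacian[OF \<eta>(1) gs] g_def .
 have S: "0 <= S" using \<eta>(2,3)[of 0] by linarith
 define f1 where "f1 x = cav' (W x / \<delta>) *\<^sub>R grad \<eta> x" for x
 define f2 where "f2 x = (\<eta> x * (cav'' (W x / \<delta>) / \<delta>)) *\<^sub>R grad W x" for x
 have m1[measurable]: "grad \<eta> \<in> borel_measurable borel" "grad W \<in> borel_measurable borel" "\<eta> \<in> borel_measurable borel" "W \<in> borel_measurable borel"
  by (rule tf_measurable_grad[OF \<eta>(1)] tf_measurable_grad[OF W] tf_measurable[OF \<eta>(1)] tf_measurable[OF W])+
 have f1m: "f1 \<in> borel_measurable lborel" unfolding f1_def by measurable
 have "norm (f1 x) <= norm (2 *\<^sub>R grad \<eta> x)" for x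
  using cav'_bounds[of "W x / \<delta>"] by (simp add: f1_def mult_right_mono)
 then have f1b: "AE x in lborel. norm (f1 x) <= norm (2 *\<^sub>R grad \<eta> x)" by simp
 note f1 = L2_bound[OF L2_scaleR[OF gL(3)] f1m f1b]
 have b: "\<bar>\<eta> x * (cav'' (W x / \<delta>) / \<delta>)\<bar> <= S / \<delta>" for x
 proof -
  have "\<bar>\<eta> x * cav'' (W x / \<delta>)\<bar> <= S * 1" unfolding abs_mult using \<eta>(2,3)[of x] S cav''_bounds(2) by (intro mult_mono) auto
  then show ?thesis using \<delta> by (simp add: abs_mult divide_right_mono)
 qed
 have [measurable]: "cav'' \<in> borel_measurable borel" unfolding cav''_def[abs_def] by measurable
 have f2m: "f2 \<in> borel_measurable lborel" unfolding f2_def by measurable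
 have "norm (f2 x) <= norm ((S / \<delta>) *\<^sub>R grad W x)" for x
  unfolding f2_def norm_scaleR using order_trans[OF b[of x] abs_ge_self] by (rule mult_right_mono) simp
 then have f2b: "AE x in lborel. norm (f2 x) <= norm ((S / \<delta>) *\<^sub>R grad W x)" by simp
 note f2 = L2_bound[OF L2_scaleR[OF gL(1)] f2m f2b]
 show "n2 lborel (grad v) <= 2 * n2 lborel (grad \<eta>) + S / \<delta> * n2 lborel (grad W)"
  using n2_triangle[OF f1(1) f2(1)] f1(2) f2(2) S \<delta> unfolding n2_scaleR f1_def f2_def gv[symmetric] by simp
qed

context moving_spheres
begin

text \<open>The strong maximum principle, in integrated form: where \<open>Z\<close> touches its Kelvin transform the right-hand sides still
 differ by \<open>f > 0\<close>. Testing with \<open>cav' (W / \<delta>) * \<eta>\<close>, \<open>W = kelvin y \<rho> Z - Z\<close>, the gradient terms have a sign up to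
 \<open>\<delta> * cav (W / \<delta>)\<close>, which vanishes with \<open>\<delta>\<close> as \<open>cav\<close> is bounded on the half line.\<close>

lemma strict_positivity:
 assumes \<rho>: "R < \<rho>" "\<rho> <= \<rho>b" and g: "good \<rho>"
 shows "AE x in lborel. x \<in> Sg \<rho> \<longrightarrow> Z x < kelvin y \<rho> Z x"
proof -
 define F where "F = {x\<in>Sg \<rho>. 0 < Z x \<and> Z x = kelvin y \<rho> Z x}"
 have [measurable]: "F \<in> sets borel" unfolding F_def by measurable
 define k where "k x = (\<rho> / norm (x - y)) powr (5 - p)" for x
 have k1: "1 < k x" if "x \<in> Sg \<rho>" for x unfolding k_def by (rule weight_ge_1[OF \<rho>(1) that])
 have kb: "k x <= (\<rho>b / R) powr (5 - p)" if "x \<in> Sg \<rho>" for x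
  unfolding k_def using outside[of x] that R \<rho> p by (intro powr_mono2 frac_le) (auto simp: Sg_def)
 define f where "f x = (if x \<in> Sg \<rho> then (k x - 1) * Z x powr p else 0)" for x
 have [measurable]: "f \<in> borel_measurable borel" unfolding f_def k_def by measurable
 have f0: "0 <= f x" for x using k1[of x] by (auto simp: f_def)
 define Wl where "Wl x = kelvin y \<rho> Z x - Z x" for x
 define Wn where "Wn n x = kelvin y \<rho> (\<psi> n) x - \<psi> n x" for n x
 have WnD: "Wn n = (%x. - D \<rho> n x)" for n by (simp add: Wn_def D_def fun_eq_iff)
 have Wt: "Wn n \<in> test_functions UNIV" for n unfolding WnD by (rule tf_minus[OF tf_UNIV[OF D_test[OF \<rho>(1)]]])
 have gW: "grad (Wn n) x = - grad (D \<rho> n) x" for n x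
  using tf_grad_cmult[OF D_test[OF \<rho>(1), of n], of "- 1"] unfolding WnD by (simp add: fun_eq_iff)
 have ngW: "n2 lborel (grad (Wn n)) <= 2 * Bd" for n
  using n2_grad_D[OF \<rho>(1), of n] unfolding n2_minus[of lborel "grad (D \<rho> n)", symmetric] gW[symmetric] .
 define d where "d n = n2 lborel (%x. Wn n x - Wl x)" for n
 have dL: "L2 lborel (%x. Wn n x - Wl x)" and dle: "d n <= ((\<rho>b / R)^2 + 1) * n2 lborel (%x. Z x - \<psi> n x)" for n
 proof -
  have eq: "(%x. Wn n x - Wl x) = (%x. (Z x - \<psi> n x) - (kelvin y \<rho> Z x - kelvin y \<rho> (\<psi> n) x))"
   by (auto simp: Wn_def Wl_def fun_eq_iff)
  show "L2 lborel (%x. Wn n x - Wl x)" unfolding eq by (intro L2_diff[OF psi_diff_L2 psi_diff_kelvin(1)] \<rho>)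
  show "d n <= ((\<rho>b / R)^2 + 1) * n2 lborel (%x. Z x - \<psi> n x)"
   unfolding d_def eq using n2_triangle_diff[OF psi_diff_L2 psi_diff_kelvin(1)[OF \<rho>], of n n] psi_diff_kelvin(2)[OF \<rho>, of n]
   by (simp add: distrib_right)
 qed
 have d0: "d \<longlonglongrightarrow> 0"
  by (rule tendsto_sandwich[OF always_eventually always_eventually tendsto_const tendsto_mult_right_zero[OF psi_lim, of "(\<rho>b / R)^2 + 1"]])
    (use dle in \<open>auto simp: d_def\<close>)
 have null: "AE x in lborel. x \<in> F \<longrightarrow> \<eta> x = 0" if \<eta>: "\<eta> \<in> test_functions (Sg \<rho>)" "!!x. 0 <= \<eta> x" for \<eta>
 proof -
  obtain S where S': "!!x. \<bar>\<eta> x\<bar> <= S" by (rule tf_bounded[OF \<eta>(1)], rule that)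
  have S: "\<eta> x <= S" for x using S'[of x] by linarith
  have [measurable]: "\<eta> \<in> borel_measurable borel" by (rule tf_measurable[OF \<eta>(1)])
  have S0: "0 <= S" using \<eta>(2)[of 0] S[of 0] by linarith
  let ?l = "laplacian \<eta>"
  have lt: "?l \<in> test_functions (Sg \<rho>)" by (rule tf_laplacian[OF \<eta>(1)])
  have lL: "L2 lborel ?l" by (rule tf_L2[OF lt])
  have laL: "L2 lborel (%x. \<bar>?l x\<bar>)" using lL by (auto simp: L2_def)
  have li: "integrable lborel (%x. \<bar>?l x\<bar>)" by (intro integrable_abs tf_integrable[OF lt])
  have fbound: "norm (f x * \<eta> x) <= norm (((\<rho>b / R) powr (5 - p) * S) * Z x powr p)" for x
  proof (cases "x \<in> Sg \<rho>")
   case True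
   have "(k x - 1) * \<eta> x <= (\<rho>b / R) powr (5 - p) * S"
    using k1[OF True] kb[OF True] S[of x] \<eta>(2)[of x] by (intro mult_mono) auto
   then have "((k x - 1) * \<eta> x) * Z x powr p <= ((\<rho>b / R) powr (5 - p) * S) * Z x powr p" by (rule mult_right_mono) simp
   then show ?thesis using True f0[of x] \<eta>(2)[of x] S0 by (simp add: f_def mult_ac)
  qed (simp add: f_def)
  have fL: "L2 lborel (%x. f x * \<eta> x)"
   by (rule L2_bound(1)[OF L2_cmult[OF L2_Z_powr[of p]], of _ "(\<rho>b / R) powr (5 - p) * S"]) (use p fbound in auto)
  have fi: "integrable lborel (%x. f x * \<eta> x)"
  proof -
   have eq: "f x * \<eta> x = f x * \<eta> x * (indicator \<Omega> x)" for x
    using tf_outside[OF \<eta>(1), of x] Sg_sub[of \<rho>] by (cases "x \<in> \<Omega>") auto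
   show ?thesis by (subst eq) (rule integrable_mult_L2[OF fL L2_indicator_dom])
  qed
  define J where "J = (LBINT x. indicator F x * (f x * \<eta> x))"
  have Ji: "integrable lborel (%x. indicator F x * (f x * \<eta> x))"
   by (rule integrable_bound'[OF fi]) (auto simp: indicator_def)
  define C where "C = (LBINT x. \<bar>?l x\<bar>)"
  \<comment> \<open>The order of limits matters: the errors carry factors
    \<open>1 / \<delta>\<close>, so \<open>n\<close> tends to infinity with \<delta> fixed, and only
    afterwards does \<delta> tend to 0.\<close>
  have key: "J <= \<delta> * C" if \<delta>: "\<delta> > 0" for \<delta>
  proof -
   define v where "v n x = cav' (Wn n x / \<delta>) * \<eta> x" for n x
   note ct = concave_test_function[OF \<eta> S Wt \<delta>, folded v_def]
   have step: "J <= \<delta> * C + (2 * n2 lborel (%x. \<bar>?l x\<bar>) * d n + 1 / \<delta> * n2 lborel (%x. f x * \<eta> x) * d n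
    + 2 * \<epsilon> n * (2 * n2 lborel (grad \<eta>) + S / \<delta> * (2 * Bd)))" for n
   proof -
    have vt: "v n \<in> test_functions (Sg \<rho>)" using ct(1)[of n] unfolding v_def .
    have vm[measurable]: "v n \<in> borel_measurable borel" by (rule tf_measurable[OF vt])
    have v0: "0 <= v n x" for x using cav'_bounds(1) \<eta>(2) by (simp add: v_def)
    have v2: "v n x <= 2 * \<eta> x" for x unfolding v_def using cav'_bounds(2) \<eta>(2) by (rule mult_right_mono)
    note wd = weak_difference[OF \<rho> vt]
    have fvi: "integrable lborel (%x. f x * v n x)"
     by (rule integrable_bound'[OF integrable_mult_right[OF fi, of 2]])
       (use f0 v0 v2 \<eta>(2) in \<open>auto simp: abs_mult mult_left_mono mult.left_commute\<close>)
    \<comment> \<open>On \<open>F\<close> the limit \<open>Wl\<close> is 0, where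
      \<open>cav'\<close> has value 1; by the Lipschitz bound the test function misses \<eta> there
      by at most \<open>\<eta>\<close> times the distance of \<open>Wn n\<close> and
      \<open>Wl\<close> divided by \<delta>.\<close>
    have 1: "J <= (LBINT x. f x * v n x) + 1 / \<delta> * n2 lborel (%x. f x * \<eta> x) * d n"
    proof -
     have adL: "L2 lborel (%x. \<bar>Wn n x - Wl x\<bar>)" using dL[of n] by (auto simp: L2_def)
     have adn: "n2 lborel (%x. \<bar>Wn n x - Wl x\<bar>) = d n" by (simp add: d_def n2_def)
     have i2: "integrable lborel (%x. 1 / \<delta> * (f x * \<eta> x * \<bar>Wn n x - Wl x\<bar>))"
      by (intro integrable_mult_right integrable_mult_L2[OF fL adL])
     have "J <= (LBINT x. f x * v n x + 1 / \<delta> * (f x * \<eta> x * \<bar>Wn n x - Wl x\<bar>))"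
      unfolding J_def
     proof (rule integral_mono[OF Ji integrable_add'[OF fvi i2]])
      fix x
      have fe: "0 <= f x * \<eta> x" using f0 \<eta>(2) by simp
      show "indicator F x * (f x * \<eta> x) <= f x * v n x + 1 / \<delta> * (f x * \<eta> x * \<bar>Wn n x - Wl x\<bar>)"
      proof (cases "x \<in> F")
       case True
       then have "Wl x = 0" by (simp add: F_def Wl_def)
       then have "\<bar>Wn n x / \<delta> - 0\<bar> = 1 / \<delta> * \<bar>Wn n x - Wl x\<bar>" using \<delta> by simp
       then have "1 <= cav' (Wn n x / \<delta>) + 1 / \<delta> * \<bar>Wn n x - Wl x\<bar>"
        using cav'_Lipschitz[of "Wn n x / \<delta>" 0] unfolding cav_0 by linarith
       from mult_left_mono[OF this fe] show ?thesis using True by (simp add: v_def distrib_left mult_ac)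
      next
       case False
       then show ?thesis using fe f0[of x] v0[of x] \<delta> by simp
      qed
     qed
     also have "\<dots> = (LBINT x. f x * v n x) + 1 / \<delta> * (LBINT x. f x * \<eta> x * \<bar>Wn n x - Wl x\<bar>)"
      using fvi i2 by (subst integral_add') auto
     also have "\<dots> <= (LBINT x. f x * v n x) + 1 / \<delta> * (n2 lborel (%x. f x * \<eta> x) * d n)"
      using L2_Cauchy_Schwarz_real[OF fL adL] \<delta> unfolding adn by (intro add_left_mono mult_left_mono) auto
     finally show ?thesis by (simp add: mult.assoc)
    qed
    have 2: "(LBINT x. f x * v n x) <= (LBINT x. k x * kelvin y \<rho> Z x powr p * v n x) - (LBINT x. Z x powr p * v n x)"
    proof -
     have ae: "AE x in lborel. f x * v n x <= k x * kelvin y \<rho> Z x powr p * v n x - Z x powr p * v n x"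
      using g unfolding good_def
     proof eventually_elim
      case (elim x)
      show ?case
      proof (cases "x \<in> Sg \<rho>")
       case True
       have "Z x powr p <= kelvin y \<rho> Z x powr p" using elim True Z_nonneg[of x] p by (intro powr_mono2) auto
       then have "k x * Z x powr p <= k x * kelvin y \<rho> Z x powr p" using k1[OF True] by (intro mult_left_mono) auto
       then have "f x <= k x * kelvin y \<rho> Z x powr p - Z x powr p" using True by (simp add: f_def left_diff_distrib)
       from mult_right_mono[OF this v0[of x]] show ?thesis by (simp add: left_diff_distrib)
      next
       case False
       then show ?thesis using tf_outside[OF vt False] by simp
      qed
     qed
     have "(LBINT x. f x * v n x) <= (LBINT x. k x * kelvin y \<rho> Z x powr p * v n x - Z x powr p * v n x)"
      by (rule integral_mono_AE[OF fvi integrable_diff'[OF wd(2,1)[folded k_def]] ae])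
     then show ?thesis using wd(1,2)[folded k_def] by simp
    qed
    have 3: "(LBINT x. k x * kelvin y \<rho> Z x powr p * v n x) - (LBINT x. Z x powr p * v n x)
     <= (LBINT x. grad (Wn n) x \<bullet> grad (v n) x) + 2 * \<epsilon> n * n2 lborel (grad (v n))"
     using wd(3)[of n, folded k_def] unfolding gW inner_minus_left by simp
    have 4: "(LBINT x. grad (Wn n) x \<bullet> grad (v n) x) <= - (LBINT x. \<delta> * cav (Wn n x / \<delta>) * ?l x)"
     using ct(2)[of n] unfolding v_def .
    have 5: "2 * \<epsilon> n * n2 lborel (grad (v n)) <= 2 * \<epsilon> n * (2 * n2 lborel (grad \<eta>) + S / \<delta> * (2 * Bd))"
    proof -
     have "S / \<delta> * n2 lborel (grad (Wn n)) <= S / \<delta> * (2 * Bd)" using ngW[of n] S0 \<delta> by (intro mult_left_mono) auto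
     then have "n2 lborel (grad (v n)) <= 2 * n2 lborel (grad \<eta>) + S / \<delta> * (2 * Bd)" using ct(3)[of n] unfolding v_def by linarith
     then show ?thesis using eps_nonneg[of n] by (intro mult_left_mono) auto
    qed
    \<comment> \<open>Since \<rho> is good, \<open>Wl\<close> is nonnegative on the support, so
      \<open>cav (Wl / \<delta>)\<close> is at most 1 in absolute value; passing to
      \<open>Wn n\<close> is a Lipschitz error whose factor \<open>1 / \<delta>\<close> cancels
      against \<delta>.\<close>
    have 6: "- (LBINT x. \<delta> * cav (Wn n x / \<delta>) * ?l x) <= \<delta> * C + 2 * n2 lborel (%x. \<bar>?l x\<bar>) * d n"
    proof -
     have adL: "L2 lborel (%x. \<bar>Wn n x - Wl x\<bar>)" using dL[of n] by (auto simp: L2_def)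
     have adn: "n2 lborel (%x. \<bar>Wn n x - Wl x\<bar>) = d n" by (simp add: d_def n2_def)
     have i2: "integrable lborel (%x. 2 * (\<bar>?l x\<bar> * \<bar>Wn n x - Wl x\<bar>))"
      by (intro integrable_mult_right integrable_mult_L2[OF laL adL])
     have ii: "integrable lborel (%x. \<delta> * \<bar>?l x\<bar> + 2 * (\<bar>?l x\<bar> * \<bar>Wn n x - Wl x\<bar>))"
      by (intro integrable_add' integrable_mult_right li i2)
     have [measurable]: "Wn n \<in> borel_measurable borel" "?l \<in> borel_measurable borel"
      by (rule tf_measurable[OF Wt] tf_measurable[OF lt])+
     have ae: "AE x in lborel. \<bar>\<delta> * cav (Wn n x / \<delta>) * ?l x\<bar> <= \<delta> * \<bar>?l x\<bar> + 2 * (\<bar>?l x\<bar> * \<bar>Wn n x - Wl x\<bar>)"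
      using g unfolding good_def
     proof eventually_elim
      case (elim x)
      show ?case
      proof (cases "x \<in> Sg \<rho>")
       case True
       have "\<bar>cav (Wl x / \<delta>)\<bar> <= 1" using elim True \<delta> by (intro cav_bounds) (auto simp: Wl_def)
       moreover have "\<bar>cav (Wn n x / \<delta>) - cav (Wl x / \<delta>)\<bar> <= 2 * \<bar>Wn n x / \<delta> - Wl x / \<delta>\<bar>" by (rule cav_Lipschitz)
       ultimately have "\<bar>cav (Wn n x / \<delta>)\<bar> <= 1 + 2 * (\<bar>Wn n x - Wl x\<bar> / \<delta>)"
        using \<delta> by (simp add: diff_divide_distrib[symmetric])
       then have "\<delta> * \<bar>cav (Wn n x / \<delta>)\<bar> <= \<delta> * (1 + 2 * (\<bar>Wn n x - Wl x\<bar> / \<delta>))" using \<delta> by (intro mult_left_mono) auto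
       also have "\<dots> = \<delta> + 2 * \<bar>Wn n x - Wl x\<bar>" using \<delta> by (simp add: distrib_left)
       finally have "(\<delta> * \<bar>cav (Wn n x / \<delta>)\<bar>) * \<bar>?l x\<bar> <= (\<delta> + 2 * \<bar>Wn n x - Wl x\<bar>) * \<bar>?l x\<bar>" by (rule mult_right_mono) simp
       then show ?thesis using \<delta> by (simp add: abs_mult algebra_simps)
      next
       case False
       then show ?thesis using tf_outside[OF lt False] by simp
      qed
     qed
     have "- (LBINT x. \<delta> * cav (Wn n x / \<delta>) * ?l x) <= \<bar>LBINT x. \<delta> * cav (Wn n x / \<delta>) * ?l x\<bar>" by simp
     also have "\<dots> <= (LBINT x. \<bar>\<delta> * cav (Wn n x / \<delta>) * ?l x\<bar>)" by (rule integral_abs_bound)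
     also have "\<dots> <= (LBINT x. \<delta> * \<bar>?l x\<bar> + 2 * (\<bar>?l x\<bar> * \<bar>Wn n x - Wl x\<bar>))"
      by (rule integral_mono_AE[OF _ ii ae], rule integrable_abs, rule integrable_bound'[OF ii])
        (use ae in \<open>auto elim!: eventually_mono\<close>)
     also have "\<dots> = \<delta> * C + 2 * (LBINT x. \<bar>?l x\<bar> * \<bar>Wn n x - Wl x\<bar>)"
      unfolding C_def by (subst integral_add'[OF integrable_mult_right[OF li] i2]) auto
     also have "\<dots> <= \<delta> * C + 2 * (n2 lborel (%x. \<bar>?l x\<bar>) * d n)"
      using L2_Cauchy_Schwarz_real[OF laL adL] unfolding adn by auto
     finally show ?thesis by (simp add: mult.assoc)
    qed
    show ?thesis using 1 2 3 4 5 6 by linarith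
   qed
   have "(%n. \<delta> * C + (2 * n2 lborel (%x. \<bar>?l x\<bar>) * d n + 1 / \<delta> * n2 lborel (%x. f x * \<eta> x) * d n
    + 2 * \<epsilon> n * (2 * n2 lborel (grad \<eta>) + S / \<delta> * (2 * Bd)))) \<longlonglongrightarrow> \<delta> * C + (2 * n2 lborel (%x. \<bar>?l x\<bar>) * 0
    + 1 / \<delta> * n2 lborel (%x. f x * \<eta> x) * 0 + 2 * 0 * (2 * n2 lborel (grad \<eta>) + S / \<delta> * (2 * Bd)))"
    by (intro tendsto_add tendsto_mult tendsto_const d0 eps)
   then have "J <= \<delta> * C + (2 * n2 lborel (%x. \<bar>?l x\<bar>) * 0
    + 1 / \<delta> * n2 lborel (%x. f x * \<eta> x) * 0 + 2 * 0 * (2 * n2 lborel (grad \<eta>) + S / \<delta> * (2 * Bd)))"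
    by (rule LIMSEQ_le_const) (use step in auto)
   then show ?thesis by simp
  qed
  have "((%\<delta>. \<delta> * C) \<longlongrightarrow> 0 * C) (at_right 0)" by (intro tendsto_mult tendsto_const tendsto_ident_at)
  then have "J <= 0 * C" by (rule tendsto_lowerbound) (use key in \<open>auto simp: eventually_at_right_less intro: eventually_mono[OF eventually_at_right_less]\<close>)
  moreover have fe: "0 <= indicator F x * (f x * \<eta> x)" for x using f0 \<eta>(2) by (simp add: indicator_def)
  moreover have "0 <= J" unfolding J_def by (rule integral_nonneg') (rule fe)
  ultimately have "J = 0" by simp
  then have "AE x in lborel. indicator F x * (f x * \<eta> x) = 0"
   unfolding J_def using integral_nonneg_eq_0_iff_AE[OF Ji] fe by auto
  then show ?thesis
  proof eventually_elim
   case (elim x)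
   have "f x > 0" if "x \<in> F" using that k1[of x] by (auto simp: F_def f_def)
   then show ?case using elim by auto
  qed
 qed
 obtain K where K: "!!n. compact (K n)" "!!n. K n \<subseteq> Sg \<rho>" "!!n. K n \<subseteq> interior (K (Suc n))" "(\<Union>(range K)) = Sg \<rho>"
  using open_Union_compact_subsets[OF open_Sg] by metis
 have "AE x in lborel. x \<in> F \<longrightarrow> x \<notin> K n" for n
 proof -
  obtain \<eta> where \<eta>: "\<eta> \<in> test_functions (Sg \<rho>)" "!!x. 0 <= \<eta> x" "!!x. x \<in> K n ==> 0 < \<eta> x"
   by (rule tf_positive_on_compact[OF K(1)[of n] K(2)[of n] open_Sg], rule that)
  from null[OF \<eta>(1,2)] show ?thesis by eventually_elim (use \<eta>(3) in force)
 qed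
 then have "AE x in lborel. \<forall>n. x \<in> F \<longrightarrow> x \<notin> K n" by (subst AE_all_countable) (rule allI)
 with g[unfolded good_def] Z_pos show ?thesis
 proof eventually_elim
  case (elim x)
  show ?case
  proof
   assume x: "x \<in> Sg \<rho>"
   then obtain n where "x \<in> K n" using K(4) by blast
   then have "x \<notin> F" using elim by blast
   then show "Z x < kelvin y \<rho> Z x" using x elim Sg_sub[of \<rho>] by (auto simp: F_def)
  qed
 qed
qed

end

section \<open>Continuity in the radius and the continuation argument\<close>

context pos_sol
begin

lemma integrable_Z_powr_p: "integrable lborel (%x. Z x powr p)"
proof -
 have eq: "(%x. Z x powr p * indicator \<Omega> x) = (%x. Z x powr p)"
 proof
  fix x show "Z x powr p * indicator \<Omega> x = Z x powr p" using Z_out[of x] p by (cases "x \<in> \<Omega>") auto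
 qed
 show ?thesis using integrable_mult_L2[OF L2_Z_powr[of p] L2_indicator_dom] p unfolding eq by simp
qed

lemma integrable_indicator_Z_powr_p:
 assumes [measurable]: "A \<in> sets borel" shows "integrable lborel (%x. indicator A x * Z x powr p)"
 by (rule integrable_bound'[OF integrable_Z_powr_p]) (auto simp: indicator_def)

end

context moving_spheres
begin

text \<open>Dominated convergence. The transform at radius \<open>r\<close> vanishes unless the
  inverted point lies in \<Omega>, that is unless \<open>norm (x - y)\<close> lies between
  \<open>r^2 / m\<close> and \<open>r^2 / R\<close>. The lower limit bounds the Kelvin factor and
  the upper one the support, uniformly in \<open>r\<close>.\<close>

lemma kelvin_psi_continuous:
 assumes \<rho>: "!!j. R < \<rho> j" "!!j. \<rho> j <= \<rho>b" and lim: "\<rho> \<longlonglongrightarrow> \<rho>0" and \<rho>0: "R < \<rho>0" "\<rho>0 <= \<rho>b"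
 shows "(%j. n2 lborel (%x. kelvin y (\<rho> j) (\<psi> n) x - kelvin y \<rho>0 (\<psi> n) x)) \<longlonglongrightarrow> 0"
proof -
 obtain S where S: "0 <= S" "!!x. \<bar>\<psi> n x\<bar> <= S" by (rule tf_bounded[OF psi], rule that)
 obtain m where m: "0 < m" "!!x. x \<in> \<Omega> ==> norm (x - y) <= m"
 proof -
  have "bounded ((%x. x - y) ` \<Omega>)" using bounded_dom by (rule bounded_translation_minus)
  then obtain m where "\<forall>x\<in>(%x. x - y) ` \<Omega>. norm x <= m" unfolding bounded_iff by blast
  then show thesis by (intro that[of "\<bar>m\<bar> + 1"]) force+
 qed
 define w where "w x = (\<rho>b * m / R^2 * S) * indicator (cball y (\<rho>b^2 / R)) x" for x :: "real^3"
 have w: "\<bar>kelvin y r (\<psi> n) x\<bar> <= w x" if r: "R < r" "r <= \<rho>b" for r x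
 proof (cases "kelvin y r (\<psi> n) x = 0")
  case True
  then show ?thesis using R m S by (simp add: w_def)
 next
  case False
  then have xy: "x \<noteq> y" and ne: "\<psi> n (inv_pt y r x) \<noteq> 0" by (auto simp: kelvin_def)
  define s where "s = norm (x - y)"
  have s: "s > 0" using xy by (simp add: s_def)
  have "inv_pt y r x \<in> \<Omega>" using tf_outside[OF psi] ne by blast
  then have b: "R < r^2 / s" "r^2 / s <= m" using outside m(2) norm_inv_pt[of y r x] unfolding s_def by fastforce+
  have "s <= r^2 / R" using b(1) s R by (simp add: field_simps)
  also have "\<dots> <= \<rho>b^2 / R" using r R by (intro divide_right_mono power_mono) auto
  finally have in_ball: "x \<in> cball y (\<rho>b^2 / R)" by (simp add: s_def dist_norm norm_minus_commute)
  have "R^2 <= r^2" using r R by (intro power_mono) auto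
  also have "\<dots> <= m * s" using b(2) s by (simp add: field_simps)
  finally have "r * R^2 <= \<rho>b * (m * s)" using r R s m by (intro mult_mono) auto
  then have "r / s <= \<rho>b * m / R^2" using s R by (simp add: field_simps)
  then have "r / s * \<bar>\<psi> n (inv_pt y r x)\<bar> <= \<rho>b * m / R^2 * S" using S(2) s r R m by (intro mult_mono) auto
  then show ?thesis using in_ball r R s by (simp add: kelvin_def w_def abs_mult s_def[symmetric])
 qed
 have "(%j. LBINT x. (kelvin y (\<rho> j) (\<psi> n) x - kelvin y \<rho>0 (\<psi> n) x)^2) \<longlonglongrightarrow> (LINT x|(lborel :: (real^3) measure). (0 :: real))"
 proof (rule integral_dominated_convergence[where w = "%x. (2 * w x)^2" and f = "%x. 0"
   and s = "%j x. (kelvin y (\<rho> j) (\<psi> n) x - kelvin y \<rho>0 (\<psi> n) x)^2" and M = lborel])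
  have "integrable lborel (%x. (2 * (\<rho>b * m / R^2 * S))^2 * indicator (cball y (\<rho>b^2 / R)) x)"
   using emeasure_bounded_finite[OF bounded_cball[of y "\<rho>b^2 / R"]] by (intro integrable_mult_right) auto
  moreover have "(2 * w x)^2 = (2 * (\<rho>b * m / R^2 * S))^2 * indicator (cball y (\<rho>b^2 / R)) x" for x
   by (auto simp: w_def indicator_def)
  ultimately show "integrable lborel (%x. (2 * w x)^2)" by simp
  show "AE x in lborel. norm ((kelvin y (\<rho> j) (\<psi> n) x - kelvin y \<rho>0 (\<psi> n) x)^2) <= (2 * w x)^2" for j
  proof (rule AE_I2)
   fix x
   have "\<bar>kelvin y (\<rho> j) (\<psi> n) x - kelvin y \<rho>0 (\<psi> n) x\<bar> <= 2 * w x"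
    using w[OF \<rho>, of j x] w[OF \<rho>0, of x] by linarith
   then have "\<bar>kelvin y (\<rho> j) (\<psi> n) x - kelvin y \<rho>0 (\<psi> n) x\<bar>^2 <= (2 * w x)^2" by (rule power_mono) simp
   then show "norm ((kelvin y (\<rho> j) (\<psi> n) x - kelvin y \<rho>0 (\<psi> n) x)^2) <= (2 * w x)^2" by simp
  qed
  show "AE x in lborel. (%j. (kelvin y (\<rho> j) (\<psi> n) x - kelvin y \<rho>0 (\<psi> n) x)^2) \<longlonglongrightarrow> 0"
  proof (rule AE_I2)
   fix x
   have "(%j. kelvin y (\<rho> j) (\<psi> n) x) \<longlonglongrightarrow> kelvin y \<rho>0 (\<psi> n) x"
   proof (cases "x = y")
    case False
    have "(%j. inv_pt y (\<rho> j) x) \<longlonglongrightarrow> inv_pt y \<rho>0 x" unfolding inv_pt_def using False by (intro tendsto_intros lim) auto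
    then have "(%j. \<psi> n (inv_pt y (\<rho> j) x)) \<longlonglongrightarrow> \<psi> n (inv_pt y \<rho>0 x)"
     by (rule continuous_on_tendsto_compose[OF tf_continuous[OF psi]]) auto
    then show ?thesis unfolding kelvin_def using False by (intro tendsto_intros lim) auto
   qed (simp add: kelvin_def)
   from tendsto_power[OF tendsto_diff[OF this tendsto_const], of "kelvin y \<rho>0 (\<psi> n) x" 2]
   show "(%j. (kelvin y (\<rho> j) (\<psi> n) x - kelvin y \<rho>0 (\<psi> n) x)^2) \<longlonglongrightarrow> 0" by simp
  qed
 qed (use kelvin_meas in measurable)
 then have "(%j. sqrt (LBINT x. (kelvin y (\<rho> j) (\<psi> n) x - kelvin y \<rho>0 (\<psi> n) x)^2)) \<longlonglongrightarrow> sqrt 0"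
  by (intro tendsto_real_sqrt) simp
 then show ?thesis by (simp add: n2_def)
qed

text \<open>\<open>Z\<close> need not be continuous, so it is replaced by a fixed
  \<open>\<psi> n\<close>; by \<open>psi_diff_kelvin\<close> the error is small uniformly in the
  radius.\<close>

lemma kelvin_continuous:
 assumes \<rho>: "!!j. R < \<rho> j" "!!j. \<rho> j <= \<rho>b" and lim: "\<rho> \<longlonglongrightarrow> \<rho>0" and \<rho>0: "R < \<rho>0" "\<rho>0 <= \<rho>b"
 obtains r where "strict_mono (r :: nat \<Rightarrow> nat)" "AE x in lborel. (%j. kelvin y (\<rho> (r j)) Z x) \<longlonglongrightarrow> kelvin y \<rho>0 Z x"
proof -
 have KL: "L2 lborel (kelvin y r Z)" if "R < r" "r <= \<rho>b" for r by (rule kelvin_L2(1)[OF Z_meas Z_L2 Z_out that])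
 have PL: "L2 lborel (kelvin y r (\<psi> n))" if "R < r" "r <= \<rho>b" for r n
  by (rule kelvin_L2(1)[OF tf_measurable[OF psi] tf_L2[OF psi] tf_outside[OF psi] that])
 define c where "c = (\<rho>b / R)^2"
 have "(%j. n2 lborel (%x. kelvin y (\<rho> j) Z x - kelvin y \<rho>0 Z x)) \<longlonglongrightarrow> 0"
 proof (rule LIMSEQ_I)
  fix e :: real assume e: "0 < e"
  have "(%n. c * n2 lborel (%x. Z x - \<psi> n x)) \<longlonglongrightarrow> 0" by (rule tendsto_mult_right_zero[OF psi_lim])
  then have "\<forall>\<^sub>F n in sequentially. c * n2 lborel (%x. Z x - \<psi> n x) < e / 4" by (rule order_tendstoD) (use e in simp)
  then obtain n where n: "c * n2 lborel (%x. Z x - \<psi> n x) < e / 4" by (auto simp: eventually_sequentially)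
  have "\<forall>\<^sub>F j in sequentially. n2 lborel (%x. kelvin y (\<rho> j) (\<psi> n) x - kelvin y \<rho>0 (\<psi> n) x) < e / 4"
   by (rule order_tendstoD[OF kelvin_psi_continuous[OF assms]]) (use e in simp)
  then obtain N where N: "!!j. j \<ge> N ==> n2 lborel (%x. kelvin y (\<rho> j) (\<psi> n) x - kelvin y \<rho>0 (\<psi> n) x) < e / 4"
   by (auto simp: eventually_sequentially)
  have "n2 lborel (%x. kelvin y (\<rho> j) Z x - kelvin y \<rho>0 Z x) < e" if j: "j \<ge> N" for j
  proof -
   note t1 = n2_triangle3[OF KL[OF \<rho>] PL[OF \<rho>] KL[OF \<rho>0], of j j n]
   note t2 = n2_triangle3[OF PL[OF \<rho>] PL[OF \<rho>0] KL[OF \<rho>0], of j n n]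
   note d1 = psi_diff_kelvin(2)[OF \<rho>, of j n, folded c_def]
   note d2 = psi_diff_kelvin(2)[OF \<rho>0, of n, folded c_def, unfolded n2_commute[of lborel "kelvin y \<rho>0 Z" "kelvin y \<rho>0 (\<psi> n)"]]
   show ?thesis using t1 t2 d1 d2 n N[OF j] e by linarith
  qed
  then show "\<exists>no. \<forall>n\<ge>no. norm (n2 lborel (%x. kelvin y (\<rho> n) Z x - kelvin y \<rho>0 Z x) - 0) < e" by auto
 qed
 then show thesis by (rule L2_convergence_AE_subseq[OF KL[OF \<rho>] KL[OF \<rho>0]]) (rule that)
qed

lemma good_limit:
 assumes \<rho>: "!!j. R < \<rho> j" "!!j. \<rho> j <= \<rho>b" and lim: "\<rho> \<longlonglongrightarrow> \<rho>0" and \<rho>0: "R < \<rho>0" "\<rho>0 <= \<rho>b" and g: "!!j. good (\<rho> j)"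
 shows "good \<rho>0"
proof -
 obtain r where r: "strict_mono (r :: nat \<Rightarrow> nat)" "AE x in lborel. (%j. kelvin y (\<rho> (r j)) Z x) \<longlonglongrightarrow> kelvin y \<rho>0 Z x"
  by (rule kelvin_continuous[OF \<rho> lim \<rho>0])
 have rlim: "(%j. \<rho> (r j)) \<longlonglongrightarrow> \<rho>0" using LIMSEQ_subseq_LIMSEQ[OF lim r(1)] by (simp add: comp_def)
 have "AE x in lborel. \<forall>j. x \<in> Sg (\<rho> j) \<longrightarrow> Z x <= kelvin y (\<rho> j) Z x" using g by (simp add: good_def AE_all_countable)
 with r(2) show ?thesis unfolding good_def
 proof eventually_elim
  case (elim x)
  show ?case
  proof
   assume x: "x \<in> Sg \<rho>0"
   then have "\<forall>\<^sub>F j in sequentially. norm (x - y) < \<rho> (r j)" by (intro order_tendstoD(1)[OF rlim]) (simp add: Sg_def)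
   then have "\<forall>\<^sub>F j in sequentially. Z x <= kelvin y (\<rho> (r j)) Z x"
    by eventually_elim (use elim(2) x in \<open>auto simp: Sg_def\<close>)
   then show "Z x <= kelvin y \<rho>0 Z x" by (intro tendsto_lowerbound[OF elim(1)]) auto
  qed
 qed
qed

text \<open>If almost every point eventually leaves \<open>E\<close>, dominated convergence drives
  the weighted size of \<open>E\<close> to 0, and the maximum principle for small sets takes
  over.\<close>

lemma good_eventually:
 assumes \<rho>: "!!j. R < \<rho> j" "!!j. \<rho> j <= \<rho>b" and ae: "AE x in lborel. \<forall>\<^sub>F j in sequentially. x \<notin> E (\<rho> j)"
 shows "\<exists>j. good (\<rho> j)"
proof -
 obtain c where c: "c > 0" "!!r. R < r ==> r <= \<rho>b ==> n2 lborel (%x. indicator (E r) x * Z x powr (p - 1)) < c ==> good r"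
  using good_if_small by blast
 have "(%j. LBINT x. (indicator (E (\<rho> j)) x * Z x powr (p - 1))^2) \<longlonglongrightarrow> (LINT x|(lborel :: (real^3) measure). (0 :: real))"
 proof (rule integral_dominated_convergence[where w = "%x. (Z x powr (p - 1))^2" and f = "%x. 0"
   and s = "%j x. (indicator (E (\<rho> j)) x * Z x powr (p - 1))^2" and M = lborel])
  show "integrable lborel (%x. (Z x powr (p - 1))^2)" by (rule L2_integrable_real[OF L2_Z_powr_p1])
  show "AE x in lborel. (%j. (indicator (E (\<rho> j)) x * Z x powr (p - 1))^2) \<longlonglongrightarrow> 0"
   using ae
  proof eventually_elim
   case (elim x)
   then have "\<forall>\<^sub>F j in sequentially. (indicator (E (\<rho> j)) x * Z x powr (p - 1))^2 = 0" by eventually_elim simp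
   then show ?case by (rule tendsto_eventually)
  qed
  show "AE x in lborel. norm ((indicator (E (\<rho> j)) x * Z x powr (p - 1))^2) <= (Z x powr (p - 1))^2" for j
   by (rule AE_I2) (simp add: indicator_def)
 qed measurable
 then have "(%j. sqrt (LBINT x. (indicator (E (\<rho> j)) x * Z x powr (p - 1))^2)) \<longlonglongrightarrow> sqrt 0"
  by (intro tendsto_real_sqrt) simp
 then have "(%j. n2 lborel (%x. indicator (E (\<rho> j)) x * Z x powr (p - 1))) \<longlonglongrightarrow> 0" by (simp add: n2_def)
 then have "\<forall>\<^sub>F j in sequentially. n2 lborel (%x. indicator (E (\<rho> j)) x * Z x powr (p - 1)) < c" by (rule order_tendstoD) (rule c(1))
 then obtain j where "n2 lborel (%x. indicator (E (\<rho> j)) x * Z x powr (p - 1)) < c" by (auto simp: eventually_sequentially)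
 then show ?thesis using c(2)[OF \<rho>] by blast
qed

lemma decreasing_radii:
 assumes "R <= \<rho>0" "\<rho>0 < \<rho>b"
 defines "r \<equiv> %j. \<rho>0 + (\<rho>b - \<rho>0) * (1 / real (Suc j))"
 shows "\<rho>0 < r j" "r j <= \<rho>b" "r \<longlonglongrightarrow> \<rho>0"
proof -
 show "\<rho>0 < r j" using assms by (simp add: r_def)
 have "(\<rho>b - \<rho>0) * (1 / real (Suc j)) <= (\<rho>b - \<rho>0) * 1" using assms by (intro mult_left_mono) auto
 then show "r j <= \<rho>b" by (simp add: r_def)
 have "r \<longlonglongrightarrow> \<rho>0 + (\<rho>b - \<rho>0) * 0" unfolding r_def
  by (intro tendsto_add tendsto_mult tendsto_const LIMSEQ_Suc[OF lim_1_over_n])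
 then show "r \<longlonglongrightarrow> \<rho>0" by simp
qed

text \<open>A continuity argument on the set of good radii. It is nonempty, because each point of
  \<Omega> is farther than \<open>R\<close> from \<open>y\<close> and so drops out as the radii
  decrease to \<open>R\<close>. It contains its supremum \<open>s\<close> by
  \<open>good_limit\<close>. If \<open>s < \<rho>b\<close>, the strict inequality at
  \<open>s\<close> and continuity in the radius make almost every point leave \<open>E\<close> as
  the radii decrease to \<open>s\<close>, which produces a good radius above
  \<open>s\<close>.\<close>

lemma good_all: "good \<rho>b"
proof (rule ccontr)
 assume bad: "\<not> good \<rho>b"
 define G where "G = {\<rho>. R < \<rho> \<and> \<rho> <= \<rho>b \<and> good \<rho>}"
 have "\<exists>\<rho>. \<rho> \<in> G"
 proof -
  define r where "r j = R + (\<rho>b - R) * (1 / real (Suc j))" for j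
  note r = decreasing_radii[OF order_refl R(2), folded r_def]
  have "\<exists>j. good (r j)"
  proof (rule good_eventually[OF r(1,2)], rule AE_I2)
   fix x
   show "\<forall>\<^sub>F j in sequentially. x \<notin> E (r j)"
   proof (cases "x \<in> \<Omega>")
    case True
    have "\<forall>\<^sub>F j in sequentially. r j < norm (x - y)" by (rule order_tendstoD(2)[OF r(3) outside[OF True]])
    then show ?thesis by eventually_elim (simp add: E_def Sg_def)
   qed (simp add: E_def Sg_def)
  qed
  then show ?thesis using r unfolding G_def by blast
 qed
 then have ne: "G \<noteq> {}" by auto
 have bdd: "bdd_above G" by (auto simp: G_def bdd_above_def)
 define s where "s = Sup G"
 have sR: "R < s" using ne cSup_upper[OF _ bdd] unfolding s_def G_def by fastforce
 have sb: "s <= \<rho>b" unfolding s_def by (rule cSup_least[OF ne]) (simp add: G_def)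
 have gs: "good s"
 proof -
  have "\<exists>t\<in>G. s - 1 / real (Suc j) < t" for j using less_cSup_iff[OF ne bdd, of "s - 1 / real (Suc j)"] by (simp add: s_def)
  then obtain t where t: "!!j. t j \<in> G" "!!j. s - 1 / real (Suc j) < t j" by metis
  have ts: "t j <= s" for j unfolding s_def by (rule cSup_upper[OF t(1) bdd])
  have l: "(%j. s - 1 / real (Suc j)) \<longlonglongrightarrow> s" using tendsto_diff[OF tendsto_const LIMSEQ_Suc[OF lim_1_over_n], of s] by simp
  have "t \<longlonglongrightarrow> s"
   by (rule tendsto_sandwich[OF always_eventually always_eventually l tendsto_const]) (use t(2) ts in \<open>auto intro: less_imp_le\<close>)
  then show ?thesis using good_limit[of t s] t(1) sR sb by (auto simp: G_def)
 qed
 then have sb': "s < \<rho>b" using bad sb by (cases "s = \<rho>b") auto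
 define r where "r j = s + (\<rho>b - s) * (1 / real (Suc j))" for j
 note r = decreasing_radii[OF less_imp_le[OF sR] sb', folded r_def]
 have rR: "R < r j" for j using r(1)[of j] sR by linarith
 obtain q where q: "strict_mono (q :: nat \<Rightarrow> nat)" "AE x in lborel. (%j. kelvin y (r (q j)) Z x) \<longlonglongrightarrow> kelvin y s Z x"
  by (rule kelvin_continuous[OF rR r(2) r(3) sR sb])
 have qlim: "(%j. r (q j)) \<longlonglongrightarrow> s" using LIMSEQ_subseq_LIMSEQ[OF r(3) q(1)] by (simp add: comp_def)
 \<comment> \<open>Points on the sphere itself satisfy equality and escape the strict inequality,
   but they form a null set.\<close>
 have sph: "AE x in lborel. norm (x - y) \<noteq> s"
 proof -
  have "negligible (sphere y s)" by (rule negligible_sphere)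
  then have "sphere y s \<in> null_sets lborel" using borel_closed[of "sphere y s"] by (simp add: negligible_iff_null_sets null_sets_completion_iff)
  from AE_not_in[OF this] show ?thesis by eventually_elim (simp add: dist_norm norm_minus_commute)
 qed
 have "\<exists>j. good (r (q j))"
 proof (rule good_eventually[of "%j. r (q j)", OF rR r(2)])
  show "AE x in lborel. \<forall>\<^sub>F j in sequentially. x \<notin> E (r (q j))"
   using q(2) sph strict_positivity[OF sR sb gs]
  proof eventually_elim
   case (elim x)
   show ?case
   proof (cases "norm (x - y) < s")
    case True
    show ?thesis
    proof (cases "x \<in> \<Omega>")
     case x: True
     have "\<forall>\<^sub>F j in sequentially. Z x < kelvin y (r (q j)) Z x"
      by (rule order_tendstoD(1)[OF elim(1)]) (use elim(3) x True in \<open>simp add: Sg_def\<close>)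
     then show ?thesis by eventually_elim (simp add: E_def)
    qed (simp add: E_def Sg_def)
   next
    case False
    then have "s < norm (x - y)" using elim(2) by simp
    then have "\<forall>\<^sub>F j in sequentially. r (q j) < norm (x - y)" by (rule order_tendstoD(2)[OF qlim])
    then show ?thesis by eventually_elim (simp add: E_def Sg_def)
   qed
  qed
 qed
 then obtain j where "r (q j) \<in> G" using rR r(2) unfolding G_def by blast
 then have "r (q j) <= s" unfolding s_def by (rule cSup_upper[OF _ bdd])
 then show False using r(1)[of "q j"] by simp
qed

text \<open>Comparison at radius \<open>\<rho>b\<close> bounds \<open>Z\<close> at a point of
  \<open>U\<close> by a multiple of its value at the inverted point in \<open>K\<close>. Inside the
  sphere the Jacobian of the inversion is at least 1, so it may be inserted before changing
  variables.\<close>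

lemma integral_near_boundary:
 assumes [measurable]: "U \<in> sets borel" "K \<in> sets borel"
  and U: "!!x. x \<in> U ==> x \<in> \<Omega> ==> norm (x - y) < \<rho>b \<and> inv_pt y \<rho>b x \<in> K"
 shows "(LBINT x. indicator U x * Z x powr p) <= (\<rho>b / R) powr p * (LBINT x. indicator K x * Z x powr p)"
proof -
 define h where "h x = indicator K x * Z x powr p" for x
 have hm: "h \<in> borel_measurable borel" unfolding h_def[abs_def] by measurable
 have hi: "integrable lborel h" unfolding h_def[abs_def] by (rule integrable_indicator_Z_powr_p) measurable
 have \<rho>b0: "0 < \<rho>b" using R by simp
 note ik = integral_kelvin[OF hm hi \<rho>b0, of y]
 have "(LBINT x. indicator U x * Z x powr p) <= (LBINT x. (\<rho>b / R) powr p * ((\<rho>b / norm (x - y)) ^ 6 * h (inv_pt y \<rho>b x)))"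
 proof (rule integral_mono_AE[OF integrable_indicator_Z_powr_p[OF assms(1)] integrable_mult_right[OF ik(1)]])
  show "AE x in lborel. indicator U x * Z x powr p <= (\<rho>b / R) powr p * ((\<rho>b / norm (x - y)) ^ 6 * h (inv_pt y \<rho>b x))"
   using good_all unfolding good_def
  proof eventually_elim
   case (elim x)
   have h0: "0 <= h z" for z by (simp add: h_def)
   show ?case
   proof (cases "x \<in> U \<and> x \<in> \<Omega>")
    case True
    then have x: "norm (x - y) < \<rho>b" "inv_pt y \<rho>b x \<in> K" "R < norm (x - y)" using U outside by auto
    define z where "z = inv_pt y \<rho>b x"
    have "Z x <= \<rho>b / norm (x - y) * Z z" using elim x True by (simp add: Sg_def kelvin_def z_def)
    also have "\<dots> <= \<rho>b / R * Z z" using x R Z_nonneg by (intro mult_right_mono frac_le) auto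
    finally have "Z x powr p <= (\<rho>b / R * Z z) powr p" using Z_nonneg p by (intro powr_mono2) auto
    also have "\<dots> = (\<rho>b / R) powr p * Z z powr p" by (rule powr_mult)
    finally have 1: "Z x powr p <= (\<rho>b / R) powr p * h z" using x by (simp add: h_def z_def)
    have "0 < norm (x - y)" using x R by linarith
    then have "1 ^ 6 <= (\<rho>b / norm (x - y)) ^ 6" using x by (intro power_mono) (auto simp: le_divide_eq_1)
    then have "1 * h z <= (\<rho>b / norm (x - y)) ^ 6 * h z" by (intro mult_right_mono h0) simp
    then have "(\<rho>b / R) powr p * h z <= (\<rho>b / R) powr p * ((\<rho>b / norm (x - y)) ^ 6 * h z)" by (intro mult_left_mono) auto
    then show ?thesis using 1 True unfolding z_def by simp
   next
    case False
    then have eq: "indicator U x * Z x powr p = 0" using Z_out[of x] p by auto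
    show ?thesis unfolding eq using h0[of "inv_pt y \<rho>b x"] by (intro mult_nonneg_nonneg) auto
   qed
  qed
 qed
 also have "\<dots> = (\<rho>b / R) powr p * (LBINT x. h x)" using ik by simp
 finally show ?thesis unfolding h_def .
qed

end

subsection \<open>Spheres touching the boundary from outside\<close>

lemma mvt_gradient:
 fixes G :: "'a::euclidean_space \<Rightarrow> real"
 assumes G: "!!x. (G has_derivative (%h. g x \<bullet> h)) (at x)"
 obtains t where "0 < t" "t < 1" "G (x + v) = G x + g (x + t *\<^sub>R v) \<bullet> v"
proof -
 have D: "((%t. G (x + t *\<^sub>R v)) has_real_derivative g (x + t *\<^sub>R v) \<bullet> v) (at t)" for t
 proof -
  have "((%t. x + t *\<^sub>R v) has_derivative (%s. s *\<^sub>R v)) (at t)" by (auto intro!: derivative_eq_intros)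
  from has_derivative_compose[OF this G] show ?thesis by (simp add: has_field_derivative_def inner_scaleR_right mult_commute_abs)
 qed
 from MVT2[OF zero_less_one D] obtain t where t: "0 < t" "t < 1" "G (x + 1 *\<^sub>R v) - G (x + 0 *\<^sub>R v) = (1 - 0) * (g (x + t *\<^sub>R v) \<bullet> v)" by blast
 then show thesis by (intro that[of t]) auto
qed

lemma differentiable_locally_Lipschitz:
 fixes f :: "'a::real_normed_vector \<Rightarrow> 'b::real_normed_vector"
 assumes "f differentiable at q"
 obtains M r where "0 < M" "0 < r" "!!x. norm (x - q) < r ==> norm (f x - f q) <= M * norm (x - q)"
proof -
 obtain D where D: "(f has_derivative D) (at q)" using assms by (auto simp: differentiable_def)
 then have bl: "bounded_linear D" and e: "!!e. e > 0 ==> \<exists>d>0. \<forall>x. norm (x - q) < d \<longrightarrow> norm (f x - f q - D (x - q)) <= e * norm (x - q)"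
  by (auto simp: has_derivative_at_alt)
 obtain B where B: "B > 0" "!!h. norm (D h) <= norm h * B" using bounded_linear.pos_bounded[OF bl] by blast
 obtain d where d: "d > 0" "!!x. norm (x - q) < d ==> norm (f x - f q - D (x - q)) <= 1 * norm (x - q)" using e[of 1] by auto
 show thesis
 proof (rule that[of "1 + B" d])
  fix x assume "norm (x - q) < d"
  then have "norm (f x - f q - D (x - q)) + norm (D (x - q)) <= 1 * norm (x - q) + norm (x - q) * B" by (intro add_mono d B)
  moreover have "norm (f x - f q) <= norm (f x - f q - D (x - q)) + norm (D (x - q))"
   using norm_triangle_ineq[of "f x - f q - D (x - q)" "D (x - q)"] by simp
  ultimately show "norm (f x - f q) <= (1 + B) * norm (x - q)" by (simp add: distrib_right mult.commute)
 qed (use B d in auto)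
qed

text \<open>The sphere of radius \<open>R\<close> about \<open>y = q - R \<nu>\<close>, where \<nu>
  is the inner unit normal, passes through \<open>q\<close>. Smallness of \<open>M * r\<close> means
  that the boundary bends little at this scale, so the ball stays outside \<Omega>. For slightly
  larger radii the part of \<Omega> inside the sphere is close to \<open>q\<close>, where moving
  away from \<open>y\<close> increases \<open>G\<close>; inversion moves points in just this
  direction and so does not leave \<Omega>.\<close>

lemma touching_sphere:
 fixes G :: "real^3 \<Rightarrow> real"
 assumes op: "open \<Omega>" and G: "!!x. (G has_derivative (%h. g x \<bullet> h)) (at x)" and q: "G q = 0" "g q \<noteq> 0"
  and M: "0 < M" and r: "0 < r" "!!x. norm (x - q) < r ==> norm (g x - g q) <= M * norm (x - q)" "M * r <= norm (g q) / 4"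
  and dom: "\<Omega> \<inter> ball q r = {x \<in> ball q r. G x > 0}"
 obtains y R \<rho>b \<delta> K where "0 < R" "R < \<rho>b" "!!x. x \<in> \<Omega> ==> R < norm (x - y)"
  "!!\<rho> x. R < \<rho> ==> \<rho> <= \<rho>b ==> x \<in> \<Omega> ==> norm (x - y) < \<rho> ==> inv_pt y \<rho> x \<in> \<Omega>"
  "0 < \<delta>" "compact K" "K \<subseteq> \<Omega>" "!!x. norm (x - q) < \<delta> ==> norm (x - y) < \<rho>b \<and> inv_pt y \<rho>b x \<in> K"
proof -
 define N where "N = norm (g q)"
 define \<nu> where "\<nu> = (1 / N) *\<^sub>R g q"
 define R where "R = r / 4"
 define y where "y = q - R *\<^sub>R \<nu>"
 \<comment> \<open>The constant \<open>9 / 8\<close> is fitted to \<open>near\<close>: a point of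
   \<Omega> at distance at most \<open>\<rho>b\<close> from \<open>y\<close> has
   \<open>(norm (x - q))^2 / 2 < R^2 / 8\<close>, hence lies within \<open>R / 2\<close> of
   \<open>q\<close>.\<close>
 define \<rho>b where "\<rho>b = R * sqrt (9 / 8)"
 have N: "N > 0" using q by (simp add: N_def)
 have \<nu>: "norm \<nu> = 1" "g q = N *\<^sub>R \<nu>" using N by (simp_all add: \<nu>_def N_def)
 have \<nu>\<nu>: "\<nu> \<bullet> \<nu> = 1" using \<nu>(1) by (simp add: dot_square_norm)
 have R: "R > 0" using r by (simp add: R_def)
 have b2: "\<rho>b^2 = 9 / 8 * R^2" by (simp add: \<rho>b_def power_mult_distrib)
 have b0: "\<rho>b > 0" using R by (simp add: \<rho>b_def)
 have MR: "M * R <= N / 16" using r(3) by (simp add: R_def N_def)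
 have "0 < R^2" using R by simp
 then have "R^2 < \<rho>b^2" unfolding b2 by linarith
 then have Rb: "R < \<rho>b" by (rule power2_less_imp_less) (use b0 in simp)
 have xy: "x - y = (x - q) + R *\<^sub>R \<nu>" for x by (simp add: y_def)
 have xy2: "(norm (x - y))^2 = (norm (x - q))^2 + 2 * R * (\<nu> \<bullet> (x - q)) + R^2" for x
  unfolding xy power2_norm_eq_inner by (simp add: inner_add_left inner_add_right \<nu>\<nu> inner_commute power2_eq_square)
 have in_dom: "x \<in> \<Omega> \<longleftrightarrow> G x > 0" if "norm (x - q) < r" for x
 proof -
  have "x \<in> ball q r" using that by (simp add: dist_norm norm_minus_commute)
  then show ?thesis using dom by blast
 qed
 \<comment> \<open>By the mean value theorem \<open>0 < G x\<close> bounds the normal component of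
   \<open>x - q\<close> from below up to a quadratic error. Since \<open>M * R <= N / 16\<close>,
   this error consumes at most half of the squared distance.\<close>
 have near: "R^2 + (norm (x - q))^2 / 2 < (norm (x - y))^2" if x: "x \<in> \<Omega>" "norm (x - q) < r" for x
 proof -
  have "0 < G x" using x in_dom by simp
  obtain t where t: "0 < t" "t < 1" "G (q + (x - q)) = G q + g (q + t *\<^sub>R (x - q)) \<bullet> (x - q)" by (rule mvt_gradient[OF G])
  define z where "z = q + t *\<^sub>R (x - q)"
  have zq: "norm (z - q) <= norm (x - q)" using t by (simp add: z_def mult_left_le_one_le)
  have "\<bar>(g z - g q) \<bullet> (x - q)\<bar> <= norm (g z - g q) * norm (x - q)" by (rule Cauchy_Schwarz_ineq2)
  also have "\<dots> <= (M * norm (x - q)) * norm (x - q)"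
   using r(2)[of z] zq x(2) M by (intro mult_right_mono) (auto intro: order_trans[OF _ mult_left_mono[OF zq]])
  finally have "\<bar>(g z - g q) \<bullet> (x - q)\<bar> <= M * (norm (x - q))^2" by (simp add: power2_eq_square)
  moreover have "g z \<bullet> (x - q) = N * (\<nu> \<bullet> (x - q)) + (g z - g q) \<bullet> (x - q)" unfolding \<nu>(2) by (simp add: inner_diff_left)
  ultimately have "0 < N * (\<nu> \<bullet> (x - q)) + M * (norm (x - q))^2" using \<open>0 < G x\<close> t(3) q(1) unfolding z_def by simp
  then have "0 < 2 * R / N * (N * (\<nu> \<bullet> (x - q)) + M * (norm (x - q))^2)" using R N by simp
  also have "\<dots> = 2 * R * (\<nu> \<bullet> (x - q)) + 2 * (M * R) / N * (norm (x - q))^2" using N by (simp add: field_simps)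
  also have "2 * (M * R) / N * (norm (x - q))^2 <= 1 / 2 * (norm (x - q))^2"
   using MR N by (intro mult_right_mono) (auto simp: field_simps)
  finally show ?thesis unfolding xy2 by simp
 qed
 have ynorm: "norm (q - y) = R" using R by (simp add: y_def \<nu>)
 have far: "3 * R <= norm (x - y)" if "r <= norm (x - q)" for x
  using norm_triangle_ineq4[of "x - y" "q - y"] that ynorm by (simp add: R_def)
 have outside: "R < norm (x - y)" if x: "x \<in> \<Omega>" for x
 proof (cases "norm (x - q) < r")
  case True
  then have "R^2 < (norm (x - y))^2" using near[OF x True] zero_le_power2[of "norm (x - q)"] by linarith
  then show ?thesis by (rule power2_less_imp_less) simp
 qed (use far[of x] R in auto)
 have b3: "\<rho>b < 3 * R" by (rule power2_less_imp_less) (use \<open>0 < R^2\<close> R in \<open>auto simp: power_mult_distrib b2\<close>)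
 \<comment> \<open>The normal part contributes \<open>15 / 16\<close>, as the gradient varies by at
   most \<open>N / 16\<close>; the part along \<open>x - q\<close> costs at most
   \<open>17 / 16 * 1 / 2 = 17 / 32\<close>, which leaves \<open>13 / 32\<close>.\<close>
 have gz: "13 / 32 * R * N <= g z \<bullet> (x - y)" if x: "norm (x - q) <= R / 2" and z: "norm (z - q) <= R" for x z
 proof -
  have "norm (g z - g q) <= M * norm (z - q)" using z R by (intro r(2)) (auto simp: R_def)
  also have "\<dots> <= M * R" using z M by (intro mult_left_mono) auto
  finally have d: "norm (g z - g q) <= N / 16" using MR by linarith
  have "norm (g z) <= norm (g q) + norm (g z - g q)" using norm_triangle_ineq[of "g q" "g z - g q"] by simp
  then have nz: "norm (g z) <= 17 / 16 * N" using d by (simp add: N_def)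
  have "\<bar>g z \<bullet> (x - q)\<bar> <= norm (g z) * norm (x - q)" by (rule Cauchy_Schwarz_ineq2)
  also have "\<dots> <= (17 / 16 * N) * (R / 2)" using nz x N by (intro mult_mono) auto
  finally have 1: "- (17 / 32 * R * N) <= g z \<bullet> (x - q)" by (simp add: mult_ac)
  have "\<bar>(g z - g q) \<bullet> \<nu>\<bar> <= N / 16" using Cauchy_Schwarz_ineq2[of "g z - g q" \<nu>] d \<nu> by simp
  moreover have "g z \<bullet> \<nu> = N + (g z - g q) \<bullet> \<nu>" unfolding \<nu>(2) by (simp add: inner_diff_left \<nu>\<nu>)
  ultimately have "15 / 16 * N <= g z \<bullet> \<nu>" by linarith
  then have "R * (15 / 16 * N) <= R * (g z \<bullet> \<nu>)" using R by (intro mult_left_mono) auto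
  then have "R * (15 / 16 * N) <= g z \<bullet> (R *\<^sub>R \<nu>)" by simp
  then show ?thesis using 1 unfolding xy inner_add_right by (simp add: mult_ac)
 qed
 have inv_eq: "inv_pt y \<rho> x = x + c *\<^sub>R (x - y)" if "c = \<rho>^2 / (norm (x - y))^2 - 1" for \<rho> x c
  unfolding that inv_pt_def by (simp add: algebra_simps)
 \<comment> \<open>Inversion shifts \<open>x\<close> along \<open>x - y\<close> by at most
   \<open>R / 8\<close>, because \<open>\<rho>^2 - m^2 <= \<rho>b^2 - R^2 = R^2 / 8\<close> and
   \<open>m >= R\<close>. The whole segment stays within \<open>R\<close> of \<open>q\<close>, where
   \<open>gz\<close> applies.\<close>
 have move: "G x < G (inv_pt y \<rho> x) \<and> norm (inv_pt y \<rho> x - q) < r"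
  if x: "norm (x - q) <= R / 2" "R <= norm (x - y)" "norm (x - y) < \<rho>" and \<rho>: "\<rho> <= \<rho>b" for x \<rho>
 proof -
  define m where "m = norm (x - y)"
  define c where "c = \<rho>^2 / m^2 - 1"
  have m: "0 < m" "R <= m" "m < \<rho>" using x R by (auto simp: m_def)
  have "m^2 < \<rho>^2" using m by (intro power_strict_mono) auto
  then have c0: "0 < c" using m by (simp add: c_def)
  have "\<rho>^2 <= \<rho>b^2" using m \<rho> by (intro power_mono) auto
  moreover have "R^2 <= m^2" using m R by (intro power_mono) auto
  ultimately have "\<rho>^2 - m^2 <= R^2 / 8" unfolding b2 by linarith
  also have "\<dots> <= R / 8 * m" using m R by (simp add: power2_eq_square)
  finally have "(\<rho>^2 - m^2) / m <= R / 8" using m by (simp add: pos_divide_le_eq)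
  moreover have "c * m = (\<rho>^2 - m^2) / m" using m by (simp add: c_def field_simps power2_eq_square)
  ultimately have "c * m <= R / 8" by simp
  then have cm: "norm (c *\<^sub>R (x - y)) <= R / 8" using c0 by (simp add: m_def)
  have eq: "inv_pt y \<rho> x = x + c *\<^sub>R (x - y)" by (rule inv_eq) (simp add: c_def m_def)
  obtain t where t: "0 < t" "t < 1" "G (x + c *\<^sub>R (x - y)) = G x + g (x + t *\<^sub>R (c *\<^sub>R (x - y))) \<bullet> (c *\<^sub>R (x - y))"
   by (rule mvt_gradient[OF G])
  have "norm (t *\<^sub>R (c *\<^sub>R (x - y))) <= norm (c *\<^sub>R (x - y))" using t c0 by (simp add: mult_left_le_one_le)
  then have "norm (x + t *\<^sub>R (c *\<^sub>R (x - y)) - q) <= R / 2 + R / 8"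
   using norm_triangle_ineq[of "x - q" "t *\<^sub>R (c *\<^sub>R (x - y))"] x(1) cm by (simp add: algebra_simps)
  then have "13 / 32 * R * N <= g (x + t *\<^sub>R (c *\<^sub>R (x - y))) \<bullet> (x - y)" using R by (intro gz x(1)) auto
  moreover have "0 < 13 / 32 * R * N" using R N by simp
  ultimately have "0 < g (x + t *\<^sub>R (c *\<^sub>R (x - y))) \<bullet> (x - y)" by linarith
  then have "0 < g (x + t *\<^sub>R (c *\<^sub>R (x - y))) \<bullet> (c *\<^sub>R (x - y))" using c0 by (simp only: inner_scaleR_right mult_pos_pos)
  moreover have "norm (x + c *\<^sub>R (x - y) - q) < r"
   using norm_triangle_ineq[of "x - q" "c *\<^sub>R (x - y)"] x(1) cm R by (simp add: algebra_simps R_def)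
  ultimately show ?thesis unfolding eq using t(3) by simp
 qed
 have inside: "inv_pt y \<rho> x \<in> \<Omega>" if \<rho>: "R < \<rho>" "\<rho> <= \<rho>b" and x: "x \<in> \<Omega>" "norm (x - y) < \<rho>" for \<rho> x
 proof -
  have n: "norm (x - q) < r" using far[of x] x \<rho> b3 by linarith
  have "(norm (x - y))^2 <= \<rho>b^2" using x \<rho> by (intro power_mono) auto
  then have "(norm (x - q))^2 <= (R / 2)^2" using near[OF x(1) n] unfolding b2 by (simp add: power_divide)
  then have h: "norm (x - q) <= R / 2" by (rule power2_le_imp_le) (use R in simp)
  have "G x < G (inv_pt y \<rho> x) \<and> norm (inv_pt y \<rho> x - q) < r"
   using move[OF h _ x(2) \<rho>(2)] outside[OF x(1)] by simp
  then show ?thesis using in_dom[OF n] x(1) in_dom[of "inv_pt y \<rho> x"] by auto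
 qed
 have "G q < G (inv_pt y \<rho>b q) \<and> norm (inv_pt y \<rho>b q - q) < r" using R Rb ynorm by (intro move) auto
 then have "inv_pt y \<rho>b q \<in> \<Omega>" using in_dom q(1) by simp
 then obtain e where e: "e > 0" "cball (inv_pt y \<rho>b q) e \<subseteq> \<Omega>" using op open_contains_cball by blast
 have qy: "q \<in> - {y}" using ynorm R by auto
 have "isCont (inv_pt y \<rho>b) q"
  using continuous_on_inv_pt[of y \<rho>b] qy continuous_on_eq_continuous_at[of "- {y}" "inv_pt y \<rho>b"] by (simp add: open_Compl)
 then obtain d where d: "d > 0" "!!x. dist x q < d ==> dist (inv_pt y \<rho>b x) (inv_pt y \<rho>b q) < e"
  using e(1) unfolding continuous_at_eps_delta by blast
 show thesis
 proof (rule that[of R \<rho>b y "min d (\<rho>b - R)" "cball (inv_pt y \<rho>b q) e"])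
  fix x assume x: "norm (x - q) < min d (\<rho>b - R)"
  have "norm (x - y) <= norm (x - q) + norm (q - y)" using norm_triangle_ineq[of "x - q" "q - y"] by simp
  moreover have "inv_pt y \<rho>b x \<in> cball (inv_pt y \<rho>b q) e" using d(2)[of x] x by (simp add: dist_norm norm_minus_commute less_imp_le)
  ultimately show "norm (x - y) < \<rho>b \<and> inv_pt y \<rho>b x \<in> cball (inv_pt y \<rho>b q) e" using x ynorm by simp
 qed (use R Rb outside inside e d in auto)
qed

lemma Ck_on_linear:
 assumes "open S" "linear (f :: 'a::euclidean_space \<Rightarrow> real)" shows "Ck_on k S f"
proof -
 have "f = (%x. x \<bullet> adjoint f 1)" using adjoint_works[OF assms(2), of _ 1] by auto
 then show ?thesis using Ck_on_inner[OF assms(1), of k "adjoint f 1"] by simp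
qed

text \<open>In the rotated coordinates the boundary is the zero set of \<open>G\<close>, the height
  above the graph. The second derivatives of the graph function enter through the differentiability
  of the gradient of \<open>G\<close>, which supplies the Lipschitz constant \<open>M\<close> at
  \<open>q\<close>.\<close>

lemma regular_domain_touching_sphere:
 assumes \<Omega>: "bounded_regular_domain \<Omega>" and q: "q \<in> frontier \<Omega>"
 obtains y R \<rho>b \<delta> K where "0 < R" "R < \<rho>b" "!!x. x \<in> \<Omega> ==> R < norm (x - y)"
  "!!\<rho> x. R < \<rho> ==> \<rho> <= \<rho>b ==> x \<in> \<Omega> ==> norm (x - y) < \<rho> ==> inv_pt y \<rho> x \<in> \<Omega>"
  "0 < \<delta>" "compact K" "K \<subseteq> \<Omega>" "!!x. norm (x - q) < \<delta> ==> norm (x - y) < \<rho>b \<and> inv_pt y \<rho>b x \<in> K"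
proof -
 have op: "open \<Omega>" using \<Omega> by (simp add: bounded_regular_domain_def)
 obtain r h and T :: "real^3 \<Rightarrow> real^3" where r: "r > 0" and T: "orthogonal_transformation T" and h: "Ck 2 h"
  and dom: "\<Omega> \<inter> ball q r = {x \<in> ball q r. T x $ 3 > h (T x $ 1, T x $ 2)}"
  using \<Omega> q unfolding bounded_regular_domain_def Ck_boundary_def by blast
 have lT: "linear T" by (rule orthogonal_transformation_linear[OF T])
 have lTi: "linear (%x. T x $ i)" for i using lT by (simp add: linear_iff)
 define G where "G x = T x $ 3 - h (T x $ 1, T x $ 2)" for x
 have "Ck_on 2 UNIV (%x. h (T x $ 1, T x $ 2))"
 proof (rule Ck_on_compose[where T = UNIV and \<phi> = h and \<kappa> = "%x. (T x $ 1, T x $ 2)"])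
  show "Ck_on 2 UNIV (%x. (T x $ 1, T x $ 2) \<bullet> c)" for c
   by (rule Ck_on_linear) (use lTi in \<open>auto simp: linear_iff inner_prod_def algebra_simps\<close>)
 qed (use h in \<open>auto simp: Ck_iff_on[symmetric]\<close>)
 then have "Ck_on 2 UNIV (%x. - 1 * h (T x $ 1, T x $ 2))" by (intro Ck_on_mult Ck_on_const) auto
 from Ck_on_add[OF open_UNIV Ck_on_linear[OF open_UNIV lTi[of 3]] this] have CG: "Ck_on 2 UNIV G" by (simp add: G_def[abs_def])
 then have dG: "G differentiable at x" for x by (simp add: numeral_2_eq_2)
 have dg: "(%x. frechet_derivative G (at x) b) differentiable at x" if "b \<in> Basis" for b x
  using CG that by (simp add: numeral_2_eq_2)
 have "(%x. frechet_derivative G (at x) b *\<^sub>R b) differentiable at q" if "b \<in> Basis" for b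
  using dg[OF that, of q] has_derivative_scaleR_left unfolding differentiable_def by blast
 then have "grad G differentiable at q" unfolding grad_def[abs_def] by (intro differentiable_sum) auto
 then obtain M s where M: "0 < M" "0 < s" "!!x. norm (x - q) < s ==> norm (grad G x - grad G q) <= M * norm (x - q)"
  by (rule differentiable_locally_Lipschitz) blast
 have D: "(G has_derivative (%h. grad G x \<bullet> h)) (at x)" for x by (rule has_derivative_grad[OF dG])
 have cont: "isCont G x" for x by (rule has_derivative_continuous[OF D])
 have Gdom: "\<Omega> \<inter> ball q r = {x \<in> ball q r. G x > 0}" unfolding dom G_def by auto
 have "q \<notin> \<Omega>" using q op by (simp add: frontier_def interior_open)
 then have "G q <= 0" using Gdom r by (metis (mono_tags, lifting) Int_iff centre_in_ball mem_Collect_eq not_le)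
 moreover have "0 <= G q"
 proof (rule ccontr)
  assume "\<not> 0 <= G q"
  then have "\<forall>\<^sub>F x in at q. G x < 0" using cont[of q] by (intro order_tendstoD(2)[of G "G q"]) (auto simp: isCont_def)
  then obtain d where d: "d > 0" "!!x. x \<noteq> q ==> dist x q < d ==> G x < 0" unfolding eventually_at by auto
  have "q \<in> closure \<Omega>" using q by (simp add: frontier_def)
  then obtain x where x: "x \<in> \<Omega>" "dist x q < min d r" unfolding closure_approachable using d(1) r by (metis min_less_iff_conj)
  then have "x \<in> \<Omega> \<inter> ball q r" by (simp add: dist_commute)
  then have "G x > 0" unfolding Gdom by simp
  moreover have "x \<noteq> q" using x \<open>q \<notin> \<Omega>\<close> by auto
  ultimately show False using d(2)[of x] x by simp
 qed
 ultimately have Gq: "G q = 0" by simp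
 have gq: "grad G q \<noteq> 0"
 proof
  assume 0: "grad G q = 0"
  \<comment> \<open>Along the direction that \<open>T\<close> sends to the third axis
    \<open>G\<close> grows with slope 1, so its gradient cannot vanish.\<close>
  obtain e where e: "T e = axis 3 1" using orthogonal_transformation_surj[OF T] by (metis surjD)
  have "G (q + t *\<^sub>R e) = G q + t" for t
  proof -
   have "T (q + t *\<^sub>R e) = T q + t *\<^sub>R axis 3 1" using lT e by (simp add: linear_add linear_scale)
   then show ?thesis by (simp add: G_def axis_def)
  qed
  moreover have "((%t. G (q + t *\<^sub>R e)) has_derivative (%s. grad G (q + 0 *\<^sub>R e) \<bullet> (s *\<^sub>R e))) (at 0)"
   by (rule has_derivative_compose[OF _ D]) (auto intro!: derivative_eq_intros)
  ultimately have "((%t. G q + t) has_real_derivative 0) (at 0)" by (simp add: 0 has_field_derivative_def lambda_zero)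
  moreover have "((%t. G q + t) has_real_derivative 1) (at 0)" by (auto intro!: derivative_eq_intros)
  ultimately show False using DERIV_unique by fastforce
 qed
 define r' where "r' = min r (min s (norm (grad G q) / (4 * M)))"
 have r': "0 < r'" "r' <= r" "r' <= s" "r' <= norm (grad G q) / (4 * M)" using r M gq by (auto simp: r'_def)
 have "M * r' <= M * (norm (grad G q) / (4 * M))" using r'(4) M by (intro mult_left_mono) auto
 then have Mr: "M * r' <= norm (grad G q) / 4" using M by simp
 have "\<Omega> \<inter> ball q r' = \<Omega> \<inter> ball q r \<inter> ball q r'" using r' by auto
 also have "\<dots> = {x \<in> ball q r'. G x > 0}" unfolding Gdom using r' by auto
 finally have dom': "\<Omega> \<inter> ball q r' = {x \<in> ball q r'. G x > 0}" .
 show thesis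
  by (rule touching_sphere[OF op D Gq gq M(1) r'(1) _ Mr dom'], rule M(3), use r' in linarith, rule that)
qed

subsection \<open>Uniform bounds for positive solutions\<close>

lemma laplacian_power:
 assumes \<eta>: "\<eta> \<in> test_functions U"
 shows "laplacian (%x. \<eta> x ^ Suc (Suc k)) x
  = real (Suc (Suc k)) * real (Suc k) * \<eta> x ^ k * (grad \<eta> x \<bullet> grad \<eta> x) + real (Suc (Suc k)) * \<eta> x ^ Suc k * laplacian \<eta> x"
proof -
 have g: "grad (%x. \<eta> x ^ Suc j) x = (real (Suc j) * \<eta> x ^ j) *\<^sub>R grad \<eta> x" for j x
 proof -
  have "((%t. t ^ Suc j) has_real_derivative real (Suc j) * \<eta> x ^ j) (at (\<eta> x))" using DERIV_pow[of "Suc j" "\<eta> x"] by simp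
  from grad_compose[OF tf_differentiable[OF \<eta>] this] show ?thesis .
 qed
 have d: "(%x. \<eta> x ^ Suc j) differentiable at x" for j x
  using tf_differentiable[OF tf_power[OF \<eta>, of "Suc j"]] by simp
 have "frechet_derivative (%y. frechet_derivative (%x. \<eta> x ^ Suc (Suc k)) (at y) b) (at x) b
  = real (Suc (Suc k)) * real (Suc k) * \<eta> x ^ k * (grad \<eta> x \<bullet> b * (grad \<eta> x \<bullet> b))
   + real (Suc (Suc k)) * \<eta> x ^ Suc k * frechet_derivative (%y. frechet_derivative \<eta> (at y) b) (at x) b" if b: "b \<in> Basis" for b
 proof -
  have 1: "(%y. frechet_derivative (%x. \<eta> x ^ Suc (Suc k)) (at y) b) = (%y. real (Suc (Suc k)) * \<eta> y ^ Suc k * frechet_derivative \<eta> (at y) b)"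
   unfolding grad_inner_Basis[OF b, symmetric] g by simp
  have db: "(%y. frechet_derivative \<eta> (at y) b) differentiable at x"
   by (rule tf_differentiable[OF tf_frechet_derivative[OF \<eta> b]])
  have dc: "(%y. real (Suc (Suc k)) * \<eta> y ^ Suc k) differentiable at x" by (intro differentiable_mult d) auto
  have "grad (%y. real (Suc (Suc k)) * \<eta> y ^ Suc k * frechet_derivative \<eta> (at y) b) x
   = (real (Suc (Suc k)) * \<eta> x ^ Suc k) *\<^sub>R grad (%y. frechet_derivative \<eta> (at y) b) x
    + frechet_derivative \<eta> (at x) b *\<^sub>R (real (Suc (Suc k)) *\<^sub>R ((real (Suc k) * \<eta> x ^ k) *\<^sub>R grad \<eta> x))"
   unfolding grad_mult[OF dc db] grad_cmult[OF d] g ..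
  then have "grad (%y. real (Suc (Suc k)) * \<eta> y ^ Suc k * frechet_derivative \<eta> (at y) b) x \<bullet> b
   = real (Suc (Suc k)) * \<eta> x ^ Suc k * (grad (%y. frechet_derivative \<eta> (at y) b) x \<bullet> b)
    + frechet_derivative \<eta> (at x) b * (real (Suc (Suc k)) * ((real (Suc k) * \<eta> x ^ k) * (grad \<eta> x \<bullet> b)))"
   by (simp add: inner_add_left del: power_Suc of_nat_Suc)
  then show ?thesis unfolding 1 by (simp add: grad_inner_Basis[OF b] mult_ac del: power_Suc of_nat_Suc)
 qed
 then have "laplacian (%x. \<eta> x ^ Suc (Suc k)) x = (\<Sum>b\<in>Basis. real (Suc (Suc k)) * real (Suc k) * \<eta> x ^ k * (grad \<eta> x \<bullet> b * (grad \<eta> x \<bullet> b))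
   + real (Suc (Suc k)) * \<eta> x ^ Suc k * frechet_derivative (%y. frechet_derivative \<eta> (at y) b) (at x) b)"
  unfolding laplacian_def by (intro sum.cong) auto
 also have "\<dots> = real (Suc (Suc k)) * real (Suc k) * \<eta> x ^ k * (\<Sum>b\<in>Basis. grad \<eta> x \<bullet> b * (grad \<eta> x \<bullet> b)) + real (Suc (Suc k)) * \<eta> x ^ Suc k * laplacian \<eta> x"
  unfolding laplacian_def sum.distrib sum_distrib_left[symmetric] ..
 finally show ?thesis unfolding euclidean_inner[of "grad \<eta> x" "grad \<eta> x"] .
qed

text \<open>Young's inequality in elementary form: above the threshold
  \<open>t powr (p - 1) = 2 * C\<close> the power absorbs the linear term, below it the linear term
  is bounded.\<close>

lemma linear_le_powr:
 fixes C p :: real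
 assumes "1 < p" "0 <= C"
 obtains C' where "0 <= C'" "!!t. 0 <= t ==> C * t <= t powr p / 2 + C'"
proof (rule that[of "C * (2 * C) powr (1 / (p - 1))"])
 fix t :: real assume t: "0 <= t"
 show "C * t <= t powr p / 2 + C * (2 * C) powr (1 / (p - 1))"
 proof (cases "2 * C <= t powr (p - 1)")
  case True
  have "t powr p = t * t powr (p - 1)" using t assms by (cases "t = 0") (auto simp: powr_diff)
  then have "C * t <= t powr p / 2" using mult_right_mono[OF True t] by (simp add: mult_ac)
  then show ?thesis using assms by (simp add: add_increasing2)
 next
  case False
  then have "(t powr (p - 1)) powr (1 / (p - 1)) <= (2 * C) powr (1 / (p - 1))" using assms by (intro powr_mono2) auto
  then have "t <= (2 * C) powr (1 / (p - 1))" using t assms by (simp add: powr_powr)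
  then have "C * t <= C * (2 * C) powr (1 / (p - 1))" using assms by (intro mult_left_mono)
  then show ?thesis by (simp add: add_increasing)
 qed
qed (use assms in simp)

context pos_sol
begin

text \<open>With both derivatives on the test function, \<open>L2\<close> convergence of \<psi> is
  enough and no gradient of \<open>Z\<close> is involved.\<close>

lemma weak_laplacian:
 assumes v: "v \<in> test_functions \<Omega>"
 shows "(LBINT x. Z x powr p * v x) = - (LBINT x. Z x * laplacian v x)"
proof -
 have lL: "L2 lborel (laplacian v)" by (rule tf_L2[OF tf_laplacian[OF v]])
 have le: "\<bar>(LBINT x. Z x powr p * v x) + (LBINT x. Z x * laplacian v x)\<bar>
  <= \<epsilon> n * n2 lborel (grad v) + n2 lborel (%x. Z x - \<psi> n x) * n2 lborel (laplacian v)" for n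
 proof -
  have dL: "L2 lborel (%x. Z x - \<psi> n x)" by (intro L2_diff Z_L2 tf_L2[OF psi])
  have "(LBINT x. (Z x - \<psi> n x) * laplacian v x) = (LBINT x. Z x * laplacian v x) - (LBINT x. \<psi> n x * laplacian v x)"
   unfolding left_diff_distrib
   by (rule integral_diff'[OF integrable_mult_L2[OF Z_L2 lL] integrable_mult_L2[OF tf_L2[OF psi] lL]])
  then show ?thesis
   using weak[OF v, of n] L2_Cauchy_Schwarz_real[OF dL lL] unfolding integral_grad_laplacian[OF v tf_smooth[OF psi]] by linarith
 qed
 have "(%n. \<epsilon> n * n2 lborel (grad v) + n2 lborel (%x. Z x - \<psi> n x) * n2 lborel (laplacian v)) \<longlonglongrightarrow> 0 * n2 lborel (grad v) + 0 * n2 lborel (laplacian v)"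
  by (intro tendsto_add tendsto_mult tendsto_const eps psi_lim)
 then have "\<bar>(LBINT x. Z x powr p * v x) + (LBINT x. Z x * laplacian v x)\<bar> <= 0 * n2 lborel (grad v) + 0 * n2 lborel (laplacian v)"
  by (rule LIMSEQ_le_const) (use le in auto)
 then show ?thesis by simp
qed

end

context bounded_open3
begin

text \<open>Testing with the power \<open>k + 2\<close> of a cutoff \<eta> leaves a Laplacian
  bounded by a multiple of \<open>\<eta> ^ k\<close>. By \<open>linear_le_powr\<close> the term
  \<open>Z * \<eta> ^ k\<close> is at most half of its power \<open>p\<close>, which the left-hand
  side absorbs, plus a constant. All constants depend on the cutoff and \<open>p\<close> alone, so
  the bound is uniform over solutions.\<close>

lemma interior_bound:
 assumes p: "1 < p" "p < 3" and K: "compact K" "K \<subseteq> \<Omega>"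
 shows "\<exists>C. \<forall>Z \<psi> \<epsilon> Bd. pos_sol \<Omega> p Z \<psi> \<epsilon> Bd \<longrightarrow> (LBINT x. indicator K x * Z x powr p) <= C"
proof -
 obtain \<eta>0 where \<eta>0: "\<eta>0 \<in> test_functions \<Omega>" "!!x. 0 <= \<eta>0 x" "!!x. x \<in> K ==> 0 < \<eta>0 x"
  by (rule tf_positive_on_compact[OF K open_dom], rule that)
 obtain S where S: "0 <= S" "!!x. \<bar>\<eta>0 x\<bar> <= S" by (rule tf_bounded[OF \<eta>0(1)], rule that)
 define \<eta> where "\<eta> x = inverse (S + 1) * \<eta>0 x" for x
 have \<eta>: "\<eta> \<in> test_functions \<Omega>" unfolding \<eta>_def[abs_def] by (rule tf_cmult[OF \<eta>0(1)])
 have \<eta>01: "0 <= \<eta> x" "\<eta> x <= 1" for x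
 proof -
  show "0 <= \<eta> x" using \<eta>0(2) S by (simp add: \<eta>_def)
  have "inverse (S + 1) * \<eta>0 x <= inverse (S + 1) * (S + 1)" using S(1) S(2)[of x] by (intro mult_left_mono) auto
  then show "\<eta> x <= 1" using S by (simp add: \<eta>_def)
 qed
 have \<eta>K: "\<exists>c>0. \<forall>x\<in>K. c <= \<eta> x"
 proof (cases "K = {}")
  case False
  from continuous_attains_inf[OF K(1) False continuous_on_subset[OF tf_continuous[OF \<eta>]]]
  obtain z where z: "z \<in> K" "!!x. x \<in> K ==> \<eta> z <= \<eta> x" by auto
  have "0 < \<eta> z" using \<eta>0(3)[OF z(1)] S by (simp add: \<eta>_def)
  then show ?thesis using z by blast
 qed (auto intro: exI[of _ 1])
 then obtain c where c: "0 < c" "!!x. x \<in> K ==> c <= \<eta> x" by blast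
 \<comment> \<open>Large enough for \<open>real k + 2 <= real k * p\<close>, so that
   \<open>(\<eta> ^ k) powr p <= \<eta> ^ Suc (Suc k)\<close> as \<eta> is at most 1.\<close>
 define k where "k = nat \<lceil>2 / (p - 1)\<rceil>"
 have k: "real k + 2 <= real k * p"
 proof -
  have "2 / (p - 1) <= real k" unfolding k_def by linarith
  then show ?thesis using p by (simp add: field_simps)
 qed
 obtain L1 where L1: "0 <= L1" "!!x. \<bar>laplacian \<eta> x\<bar> <= L1" by (rule tf_bounded[OF tf_laplacian[OF \<eta>]], rule that)
 obtain L2 where L2: "0 <= L2" "!!x. \<bar>grad \<eta> x \<bullet> grad \<eta> x\<bar> <= L2"
 proof -
  have ft: "(%x. frechet_derivative \<eta> (at x) b) \<in> test_functions \<Omega>" if "b \<in> Basis" for b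
   by (rule tf_frechet_derivative[OF \<eta> that])
  have "(%x. \<Sum>b\<in>Basis. frechet_derivative \<eta> (at x) b * frechet_derivative \<eta> (at x) b) \<in> test_functions \<Omega>"
   by (intro tf_sum tf_mult ft tf_smooth[OF ft]) auto
  moreover have "(%x. \<Sum>b\<in>Basis. frechet_derivative \<eta> (at x) b * frechet_derivative \<eta> (at x) b) = (%x. grad \<eta> x \<bullet> grad \<eta> x)"
   by (rule ext, subst euclidean_inner) (simp add: grad_inner_Basis)
  ultimately have t: "(%x. grad \<eta> x \<bullet> grad \<eta> x) \<in> test_functions \<Omega>" by simp
  show thesis by (rule tf_bounded[OF t], rule that)
 qed
 define C1 where "C1 = real (Suc (Suc k)) * real (Suc k) * L2 + real (Suc (Suc k)) * L1"
 have C1: "0 <= C1" using L1(1) L2(1) by (simp add: C1_def)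
 obtain C' where C': "0 <= C'" "!!t. 0 <= t ==> C1 * t <= t powr p / 2 + C'"
  by (rule linear_le_powr[OF p(1) C1], rule that)
 let ?v = "%x. \<eta> x ^ Suc (Suc k)"
 have vt: "?v \<in> test_functions \<Omega>" by (rule tf_power[OF \<eta>]) simp
 have lap: "\<bar>laplacian ?v x\<bar> <= C1 * \<eta> x ^ k" for x
 proof -
  have e: "0 <= \<eta> x ^ k" using \<eta>01 by simp
  have es: "\<eta> x ^ Suc k <= \<eta> x ^ k" using \<eta>01 by (simp add: mult_left_le_one_le)
  have "\<bar>real (Suc (Suc k)) * real (Suc k) * \<eta> x ^ k * (grad \<eta> x \<bullet> grad \<eta> x)\<bar> <= real (Suc (Suc k)) * real (Suc k) * \<eta> x ^ k * L2"
   using L2(2)[of x] e unfolding abs_mult by (simp add: mult_left_mono)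
  moreover have "\<bar>real (Suc (Suc k)) * \<eta> x ^ Suc k * laplacian \<eta> x\<bar> <= real (Suc (Suc k)) * \<eta> x ^ k * L1"
  proof -
   have "\<bar>real (Suc (Suc k)) * \<eta> x ^ Suc k * laplacian \<eta> x\<bar> = real (Suc (Suc k)) * \<eta> x ^ Suc k * \<bar>laplacian \<eta> x\<bar>"
    using \<eta>01(1)[of x] by (simp only: abs_mult abs_of_nat power_abs abs_of_nonneg)
   also have "\<dots> <= real (Suc (Suc k)) * \<eta> x ^ k * L1" using L1(2)[of x] es e \<eta>01(1)[of x] by (intro mult_mono) auto
   finally show ?thesis .
  qed
  moreover have "C1 * \<eta> x ^ k = real (Suc (Suc k)) * real (Suc k) * \<eta> x ^ k * L2 + real (Suc (Suc k)) * \<eta> x ^ k * L1"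
   unfolding C1_def by (simp add: algebra_simps del: of_nat_Suc)
  ultimately show ?thesis unfolding laplacian_power[OF \<eta>] by linarith
 qed
 have bound: "(LBINT x. indicator K x * Z x powr p) <= inverse (c ^ Suc (Suc k)) * (2 * (C' * measure lborel \<Omega>))"
  if ps: "pos_sol \<Omega> p Z \<psi> \<epsilon> Bd" for Z \<psi> \<epsilon> Bd
 proof -
  interpret ps: pos_sol \<Omega> p Z \<psi> \<epsilon> Bd by (rule ps)
  note [measurable] = ps.Z_meas ps.borel_dom
  have zvi: "integrable lborel (%x. Z x powr p * ?v x)"
   by (rule integrable_mult_L2[OF ps.L2_Z_powr tf_L2[OF vt]]) (use p in auto)
  have ii: "integrable lborel (%x. C' * indicator \<Omega> x)" using ps.finite_dom by (intro integrable_mult_right) auto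
  have pt: "- (Z x * laplacian ?v x) <= Z x powr p * ?v x / 2 + C' * indicator \<Omega> x" for x
  proof (cases "x \<in> \<Omega>")
   case True
   have "- (Z x * laplacian ?v x) <= \<bar>Z x * laplacian ?v x\<bar>" by simp
   also have "\<dots> <= Z x * (C1 * \<eta> x ^ k)" unfolding abs_mult using ps.Z_nonneg[of x] lap[of x] by (intro mult_mono) auto
   also have "\<dots> = C1 * (Z x * \<eta> x ^ k)" by simp
   also have "\<dots> <= (Z x * \<eta> x ^ k) powr p / 2 + C'" using ps.Z_nonneg \<eta>01 by (intro C') auto
   also have "(Z x * \<eta> x ^ k) powr p <= Z x powr p * ?v x"
   proof -
    have "(\<eta> x ^ k) powr p <= ?v x"
    proof (cases "\<eta> x = 0")
     case True
     have "k \<noteq> 0" using k by (intro notI) simp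
     then show ?thesis using True by simp
    next
     case False
     then have e: "0 < \<eta> x" using \<eta>01(1)[of x] by simp
     have "(\<eta> x ^ k) powr p = \<eta> x powr (real k * p)" using e by (simp add: powr_realpow[symmetric] powr_powr)
     also have "\<dots> <= \<eta> x powr (real (Suc (Suc k)))" using k e \<eta>01 by (intro powr_mono') auto
     also have "\<dots> = ?v x" by (rule powr_realpow[OF e])
     finally show ?thesis .
    qed
    then show ?thesis unfolding powr_mult by (intro mult_left_mono) auto
   qed
   finally show ?thesis using True by simp
  next
   case False
   then show ?thesis using ps.Z_out p by simp
  qed
  have "(LBINT x. Z x powr p * ?v x) = (LBINT x. - (Z x * laplacian ?v x))" using ps.weak_laplacian[OF vt] by simp
  also have "\<dots> <= (LBINT x. Z x powr p * ?v x / 2 + C' * indicator \<Omega> x)"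
   by (intro integral_mono pt integrable_minus' integrable_mult_L2[OF ps.Z_L2 tf_L2[OF tf_laplacian[OF vt]]]
    integrable_add' integrable_divide zvi ii)
  also have "\<dots> = (LBINT x. Z x powr p * ?v x) / 2 + C' * measure lborel \<Omega>"
   using zvi ii by (subst integral_add') auto
  finally have b: "(LBINT x. Z x powr p * ?v x) <= 2 * (C' * measure lborel \<Omega>)" by simp
  have Kb[measurable]: "K \<in> sets borel" using K by (simp add: borel_compact)
  have "(LBINT x. indicator K x * Z x powr p) <= (LBINT x. inverse (c ^ Suc (Suc k)) * (Z x powr p * ?v x))"
  proof (rule integral_mono[OF ps.integrable_indicator_Z_powr_p[OF Kb] integrable_mult_right[OF zvi]])
   fix x
   have nn: "0 <= Z x powr p * ?v x" using \<eta>01 by simp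
   show "indicator K x * Z x powr p <= inverse (c ^ Suc (Suc k)) * (Z x powr p * ?v x)"
   proof (cases "x \<in> K")
    case True
    have "c ^ Suc (Suc k) <= ?v x" using c True by (intro power_mono) auto
    then have "c ^ Suc (Suc k) * Z x powr p <= ?v x * Z x powr p" by (intro mult_right_mono) auto
    then have "inverse (c ^ Suc (Suc k)) * (c ^ Suc (Suc k) * Z x powr p) <= inverse (c ^ Suc (Suc k)) * (?v x * Z x powr p)"
     using c by (intro mult_left_mono) auto
    then show ?thesis using True c by (simp add: mult_ac field_simps)
   next
    case False
    then show ?thesis using nn c(1) by simp
   qed
  qed
  also have "\<dots> <= inverse (c ^ Suc (Suc k)) * (2 * (C' * measure lborel \<Omega>))"
   using b c(1) by (simp del: power_Suc)
  finally show ?thesis .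
 qed
 then show ?thesis by blast
qed

text \<open>The touching sphere, the radius \<delta> and the compact set at a boundary point depend
  on \<Omega> only. Hence one finite cover of the frontier serves all solutions, and what it leaves
  of the closure is a compact subset of \<Omega>.\<close>

lemma total_bound:
 assumes \<Omega>: "bounded_regular_domain \<Omega>" and p: "1 < p" "p < 3"
 shows "\<exists>C. \<forall>Z \<psi> \<epsilon> Bd. pos_sol \<Omega> p Z \<psi> \<epsilon> Bd \<longrightarrow> (LBINT x. Z x powr p) <= C"
proof -
 have "\<exists>\<delta> C. 0 < \<delta> \<and> (\<forall>Z \<psi> \<epsilon> Bd. pos_sol \<Omega> p Z \<psi> \<epsilon> Bd \<longrightarrow> (LBINT x. indicator (ball q \<delta>) x * Z x powr p) <= C)"
  if q: "q \<in> frontier \<Omega>" for q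
 proof -
  obtain y R \<rho>b \<delta> K where s: "0 < R" "R < \<rho>b" "!!x. x \<in> \<Omega> ==> R < norm (x - y)"
   "!!\<rho> x. R < \<rho> ==> \<rho> <= \<rho>b ==> x \<in> \<Omega> ==> norm (x - y) < \<rho> ==> inv_pt y \<rho> x \<in> \<Omega>"
   "0 < \<delta>" "compact K" "K \<subseteq> \<Omega>" "!!x. norm (x - q) < \<delta> ==> norm (x - y) < \<rho>b \<and> inv_pt y \<rho>b x \<in> K"
   by (rule regular_domain_touching_sphere[OF \<Omega> q], rule that)
  obtain C where C: "!!Z \<psi> \<epsilon> Bd. pos_sol \<Omega> p Z \<psi> \<epsilon> Bd ==> (LBINT x. indicator K x * Z x powr p) <= C"
   using interior_bound[OF p s(6,7)] by blast
  have "(LBINT x. indicator (ball q \<delta>) x * Z x powr p) <= (\<rho>b / R) powr p * C" if ps: "pos_sol \<Omega> p Z \<psi> \<epsilon> Bd" for Z \<psi> \<epsilon> Bd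
  proof -
   interpret ps: pos_sol \<Omega> p Z \<psi> \<epsilon> Bd by (rule ps)
   interpret ms: moving_spheres \<Omega> p Z \<psi> \<epsilon> Bd y R \<rho>b
    by unfold_locales (use s in auto)
   have "(LBINT x. indicator (ball q \<delta>) x * Z x powr p) <= (\<rho>b / R) powr p * (LBINT x. indicator K x * Z x powr p)"
    by (rule ms.integral_near_boundary) (use s(6,8) in \<open>auto simp: dist_norm norm_minus_commute borel_compact\<close>)
   also have "\<dots> <= (\<rho>b / R) powr p * C" by (intro mult_left_mono C[OF ps]) simp
   finally show ?thesis .
  qed
  then show ?thesis using s(5) by blast
 qed
 then obtain \<delta> C where \<delta>: "!!q. q \<in> frontier \<Omega> ==> 0 < \<delta> q"
  and C: "!!q Z \<psi> \<epsilon> Bd. q \<in> frontier \<Omega> ==> pos_sol \<Omega> p Z \<psi> \<epsilon> Bd ==> (LBINT x. indicator (ball q (\<delta> q)) x * Z x powr p) <= C q"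
  by metis
 have cf: "compact (frontier \<Omega>)" using bounded_dom by (simp add: compact_frontier_bounded)
 have fs: "frontier \<Omega> \<subseteq> (\<Union>q\<in>frontier \<Omega>. ball q (\<delta> q))" using \<delta> by force
 obtain F where F: "F \<subseteq> frontier \<Omega>" "finite F" "frontier \<Omega> \<subseteq> (\<Union>q\<in>F. ball q (\<delta> q))"
  by (rule compactE_image[OF cf _ fs]) auto
 define K where "K = closure \<Omega> - (\<Union>q\<in>F. ball q (\<delta> q))"
 have K: "compact K" unfolding K_def using bounded_dom by (intro compact_diff open_UN) auto
 have KO: "K \<subseteq> \<Omega>" using F(3) open_dom unfolding K_def frontier_def by (auto simp: interior_open)
 obtain C0 where C0: "!!Z \<psi> \<epsilon> Bd. pos_sol \<Omega> p Z \<psi> \<epsilon> Bd ==> (LBINT x. indicator K x * Z x powr p) <= C0"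
  using interior_bound[OF p K KO] by blast
 have "(LBINT x. Z x powr p) <= C0 + (\<Sum>q\<in>F. C q)" if ps: "pos_sol \<Omega> p Z \<psi> \<epsilon> Bd" for Z \<psi> \<epsilon> Bd
 proof -
  interpret ps: pos_sol \<Omega> p Z \<psi> \<epsilon> Bd by (rule ps)
  have Kb: "K \<in> sets borel" using K by (simp add: borel_compact)
  have ib: "integrable lborel (%x. indicator (ball q (\<delta> q)) x * Z x powr p)" for q by (rule ps.integrable_indicator_Z_powr_p) simp
  have ik: "integrable lborel (%x. indicator K x * Z x powr p)" by (rule ps.integrable_indicator_Z_powr_p[OF Kb])
  have "(LBINT x. Z x powr p) <= (LBINT x. indicator K x * Z x powr p + (\<Sum>q\<in>F. indicator (ball q (\<delta> q)) x * Z x powr p))"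
  proof (rule integral_mono[OF ps.integrable_Z_powr_p])
   show "integrable lborel (%x. indicator K x * Z x powr p + (\<Sum>q\<in>F. indicator (ball q (\<delta> q)) x * Z x powr p))"
    by (intro integrable_add' ik integrable_sum' ib)
   fix x
   have s0: "0 <= (\<Sum>q\<in>F. indicator (ball q (\<delta> q)) x * Z x powr p)" by (intro sum_nonneg) simp
   show "Z x powr p <= indicator K x * Z x powr p + (\<Sum>q\<in>F. indicator (ball q (\<delta> q)) x * Z x powr p)"
   proof (cases "x \<in> \<Omega> \<and> x \<notin> K")
    case True
    then obtain q where q: "q \<in> F" "x \<in> ball q (\<delta> q)" using closure_subset[of \<Omega>] unfolding K_def by auto
    have "indicator (ball q (\<delta> q)) x * Z x powr p <= (\<Sum>q\<in>F. indicator (ball q (\<delta> q)) x * Z x powr p)"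
     by (rule member_le_sum[OF q(1)]) (use F in auto)
    then show ?thesis using q True by simp
   next
    case False
    then show ?thesis using s0 ps.Z_out[of x] p by auto
   qed
  qed
  also have "\<dots> = (LBINT x. indicator K x * Z x powr p) + (\<Sum>q\<in>F. LBINT x. indicator (ball q (\<delta> q)) x * Z x powr p)"
   using ik ib by (subst integral_add') (auto intro!: integrable_sum' integral_sum')
  also have "\<dots> <= C0 + (\<Sum>q\<in>F. C q)" using C0[OF ps] C[OF _ ps] F(1) by (intro add_mono sum_mono) auto
  finally show ?thesis .
 qed
 then show ?thesis by blast
qed

end

section \<open>From weak solutions in \<open>H01\<close> to the setting of
  \<open>pos_sol\<close>\<close>

context bounded_open
begin

text \<open>Truncating approximations by \<open>spos\<close> does not increase their Dirichlet
  norms, but convergence of the gradients is not immediate. Instead the truncations converge weakly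
  to \<open>z\<close> with norms asymptotically at most that of \<open>z\<close>, and in a Hilbert
  space this forces strong convergence.\<close>

lemma H01_nonneg_approx:
 assumes z: "z \<in> H01 \<Omega>" and z0: "AE x in M. 0 <= z x"
 obtains \<psi> where "!!n. \<psi> n \<in> test_functions \<Omega>" "!!n x. 0 <= \<psi> n x"
  "(%n. nrm (%x. z x - \<psi> n x)) \<longlonglongrightarrow> 0"
proof -
 obtain \<phi> where \<phi>: "!!n. \<phi> n \<in> test_functions \<Omega>" "(%n. n2 M (%x. z x - \<phi> n x)) \<longlonglongrightarrow> 0"
  "(%n. nrm (%x. z x - \<phi> n x)) \<longlonglongrightarrow> 0" by (rule H01_dense[OF z], rule that)
 define e where "e n = 1 / real (Suc n)" for n
 have e: "0 < e n" for n by (simp add: e_def)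
 have e0: "e \<longlonglongrightarrow> 0" unfolding e_def[abs_def] by (rule LIMSEQ_Suc[OF lim_1_over_n])
 define \<psi> where "\<psi> n x = spos (e n) (\<phi> n x)" for n x
 have \<psi>t: "\<psi> n \<in> test_functions \<Omega>" for n unfolding \<psi>_def[abs_def] by (rule tf_spos[OF \<phi>(1) e])
 have \<psi>0: "0 <= \<psi> n x" for n x unfolding \<psi>_def by (rule spos_bounds(1)[OF e])
 have \<phi>H: "\<phi> n \<in> H01 \<Omega>" and \<psi>H: "\<psi> n \<in> H01 \<Omega>" for n by (rule test_H01(1)[OF \<phi>(1)] test_H01(1)[OF \<psi>t])+
 have \<psi>le: "nrm (\<psi> n) <= nrm (\<phi> n)" for n
  unfolding H01_norm_test[OF \<phi>(1)] H01_norm_test[OF \<psi>t]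
 proof (rule L2_bound(2)[OF tf_grad_L2[OF \<phi>(1)]])
  have g: "grad (\<psi> n) x = spos' (e n) (\<phi> n x) *\<^sub>R grad (\<phi> n) x" for x
   unfolding \<psi>_def by (rule grad_compose[OF tf_differentiable[OF \<phi>(1)] DERIV_spos[OF e]])
  show "AE x in lborel. norm (grad (\<psi> n) x) <= norm (grad (\<phi> n) x)"
   by (rule AE_I2) (use spos'_bounds[OF e] in \<open>simp add: g mult_left_le_one_le\<close>)
 qed (use tf_measurable_grad[OF \<psi>t] in simp)
 have nlim: "(%n. nrm (\<phi> n)) \<longlonglongrightarrow> nrm z" by (rule H01_norm_tendsto[OF \<phi>H z \<phi>(3)])
 then obtain C where C: "0 < C" "!!n. nrm (\<phi> n) <= C"
  using convergent_imp_Bseq[OF convergentI[OF nlim]] unfolding Bseq_def by auto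
 interpret fm: finite_measure M by (rule finite_measure_M)
 have L1: "L2 M (%x. 1 :: real)" by (simp add: L2_def)
 have dle: "n2 M (%x. \<psi> n x - \<phi> n x) <= 2 * e n * n2 M (%x. 1 :: real) + n2 M (%x. z x - \<phi> n x)" for n
 proof -
  have La: "L2 M (%x. 2 * e n * 1)" by (rule L2_cmult[OF L1])
  have L: "L2 M (%x. z x - \<phi> n x)" by (intro L2_diff H01_L2(1)[OF z] test_L2_M \<phi>(1))
  then have Lb: "L2 M (%x. \<bar>z x - \<phi> n x\<bar>)" by (auto simp: L2_def)
  have "n2 M (%x. \<psi> n x - \<phi> n x) <= n2 M (%x. 2 * e n * 1 + \<bar>z x - \<phi> n x\<bar>)"
  proof (rule L2_bound(2)[OF L2_add[OF La Lb]])
   show "(%x. \<psi> n x - \<phi> n x) \<in> borel_measurable M"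
    using L2_measurable[OF test_L2_M[OF \<phi>(1)]] L2_measurable[OF test_L2_M[OF \<psi>t]] by measurable
   show "AE x in M. norm (\<psi> n x - \<phi> n x) <= norm (2 * e n * 1 + \<bar>z x - \<phi> n x\<bar>)"
    using z0
   proof eventually_elim
    case (elim x)
    have "\<bar>\<psi> n x - max (\<phi> n x) 0\<bar> <= 2 * e n" unfolding \<psi>_def by (rule spos_bounds(3)[OF e])
    then show ?case using elim e[of n] by (auto simp: max_def split: if_splits)
   qed
  qed
  also have "\<dots> <= n2 M (%x. 2 * e n * 1 :: real) + n2 M (%x. \<bar>z x - \<phi> n x\<bar>)" by (rule n2_triangle[OF La Lb])
  also have "n2 M (%x. 2 * e n * 1 :: real) = 2 * e n * n2 M (%x. 1 :: real)" unfolding n2_cmult using e[of n] by simp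
  also have "n2 M (%x. \<bar>z x - \<phi> n x\<bar>) = n2 M (%x. z x - \<phi> n x)" by (simp add: n2_def)
  finally show ?thesis .
 qed
 have "(%n. 2 * e n * n2 M (%x. 1 :: real) + n2 M (%x. z x - \<phi> n x)) \<longlonglongrightarrow> 2 * 0 * n2 M (%x. 1 :: real) + 0"
  by (intro tendsto_add tendsto_mult tendsto_const e0 \<phi>)
 then have l0: "(%n. 2 * e n * n2 M (%x. 1 :: real) + n2 M (%x. z x - \<phi> n x)) \<longlonglongrightarrow> 0" by simp
 have d0: "(%n. n2 M (%x. \<psi> n x - \<phi> n x)) \<longlonglongrightarrow> 0"
  by (rule tendsto_sandwich[OF always_eventually always_eventually tendsto_const l0]) (use dle in auto)
 \<comment> \<open>Weak convergence: up to a small error \<open>z\<close> is replaced by a fixed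
   test function, and integrating by parts against its Laplacian leaves only the \<open>L2\<close>
   distance of \<open>\<psi> n\<close> and \<open>\<phi> n\<close>.\<close>
 have wk: "(%n. B z (\<psi> n) - B z (\<phi> n)) \<longlonglongrightarrow> 0"
 proof (rule LIMSEQ_I)
  fix r :: real assume r: "0 < r"
  have "\<forall>\<^sub>F n in sequentially. nrm (%x. z x - \<phi> n x) < r / (4 * C)"
   by (rule order_tendstoD(2)[OF \<phi>(3)]) (use r C in simp)
  then obtain N where N: "nrm (%x. z x - \<phi> N x) < r / (4 * C)" by (auto simp: eventually_sequentially)
  let ?l = "laplacian (\<phi> N)"
  have lt: "?l \<in> test_functions \<Omega>" by (rule tf_laplacian[OF \<phi>(1)])
  have "(%n. n2 M (%x. \<psi> n x - \<phi> n x) * n2 lborel ?l) \<longlonglongrightarrow> 0" by (rule tendsto_mult_left_zero[OF d0])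
  then have "\<forall>\<^sub>F n in sequentially. n2 M (%x. \<psi> n x - \<phi> n x) * n2 lborel ?l < r / 2"
   by (rule order_tendstoD(2)) (use r in simp)
  then obtain n0 where n0: "!!n. n \<ge> n0 ==> n2 M (%x. \<psi> n x - \<phi> n x) * n2 lborel ?l < r / 2" by (auto simp: eventually_sequentially)
  have "norm (B z (\<psi> n) - B z (\<phi> n) - 0) < r" if n: "n \<ge> n0" for n
  proof -
   have dt: "(%x. \<psi> n x - \<phi> n x) \<in> test_functions \<Omega>" by (rule tf_diff[OF \<psi>t \<phi>(1)])
   have dH: "(%x. \<psi> n x - \<phi> n x) \<in> H01 \<Omega>" by (rule test_H01(1)[OF dt])
   have zH: "(%x. z x - \<phi> N x) \<in> H01 \<Omega>" by (rule H01_diff[OF z \<phi>H])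
   have eq: "B z (\<psi> n) - B z (\<phi> n) = B (%x. z x - \<phi> N x) (%x. \<psi> n x - \<phi> n x) + B (\<phi> N) (%x. \<psi> n x - \<phi> n x)"
    using B_diff_left[OF z \<phi>H dH, of N] B_diff_left[OF \<psi>H \<phi>H z, of n n] by (simp add: B_commute[of z])
   have "\<bar>B (%x. z x - \<phi> N x) (%x. \<psi> n x - \<phi> n x)\<bar> <= nrm (%x. z x - \<phi> N x) * nrm (%x. \<psi> n x - \<phi> n x)"
    by (rule B_Cauchy_Schwarz[OF zH dH])
   also have "nrm (%x. \<psi> n x - \<phi> n x) <= 2 * C"
    using n2_triangle_diff[OF tf_grad_L2[OF \<psi>t] tf_grad_L2[OF \<phi>(1)], of n n] \<psi>le[of n] C(2)[of n]
    unfolding H01_norm_test[OF dt] tf_grad_diff[OF \<psi>t \<phi>(1)] H01_norm_test[OF \<phi>(1)] H01_norm_test[OF \<psi>t] by linarith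
   then have "nrm (%x. z x - \<phi> N x) * nrm (%x. \<psi> n x - \<phi> n x) <= r / (4 * C) * (2 * C)"
    using N r C(1) by (intro mult_mono) auto
   also have "\<dots> = r / 2" using C(1) by simp
   finally have 1: "\<bar>B (%x. z x - \<phi> N x) (%x. \<psi> n x - \<phi> n x)\<bar> <= r / 2" .
   have "B (\<phi> N) (%x. \<psi> n x - \<phi> n x) = - (LBINT x. (\<psi> n x - \<phi> n x) * ?l x)"
    unfolding B_test_test[OF \<phi>(1) dt] using integral_grad_laplacian[OF \<phi>(1) tf_smooth[OF dt], of N]
    by (simp add: inner_commute)
   then have "\<bar>B (\<phi> N) (%x. \<psi> n x - \<phi> n x)\<bar> <= n2 M (%x. \<psi> n x - \<phi> n x) * n2 lborel ?l"
    using L2_Cauchy_Schwarz_real[OF tf_L2[OF dt] tf_L2[OF lt]] unfolding test_n2_M[OF dt] by simp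
   then show ?thesis using 1 n0[OF n] unfolding eq by simp
  qed
  then show "\<exists>no. \<forall>n\<ge>no. norm (B z (\<psi> n) - B z (\<phi> n) - 0) < r" by blast
 qed
 have Bl: "(%n. B z (\<phi> n)) \<longlonglongrightarrow> B z z" using B_tendsto[OF \<phi>H z z \<phi>(3)] by (simp add: B_commute[of z "\<phi> _"])
 \<comment> \<open>The square is expanded and the norm of \<open>\<psi> n\<close> replaced by the
   larger norm of \<open>\<phi> n\<close>; the right-hand side then tends to
   \<open>B z z - 2 * B z z + (nrm z)^2 = 0\<close>.\<close>
 have sqle: "(nrm (%x. z x - \<psi> n x))^2 <= B z z - 2 * (B z (\<psi> n) - B z (\<phi> n)) - 2 * B z (\<phi> n) + (nrm (\<phi> n))^2" for n
 proof -
  have "(nrm (\<psi> n))^2 <= (nrm (\<phi> n))^2" by (intro power_mono \<psi>le) simp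
  moreover have "(nrm (%x. z x - \<psi> n x))^2 = B z z - 2 * B z (\<psi> n) + (nrm (\<psi> n))^2"
   using H01_norm_add_sq[OF z H01_cmult[OF \<psi>H[of n], of "-1"]] H01_norm_cmult[OF \<psi>H[of n], of "-1"] B_cmult_left[OF \<psi>H[of n] z, of "-1"]
   by (simp add: B_commute[of z "\<psi> n"] B_commute[of z "%x. - \<psi> n x"] H01_norm_sq[of z])
  ultimately show ?thesis by (simp add: algebra_simps)
 qed
 have "(%n. B z z - 2 * (B z (\<psi> n) - B z (\<phi> n)) - 2 * B z (\<phi> n) + (nrm (\<phi> n))^2) \<longlonglongrightarrow> B z z - 2 * 0 - 2 * B z z + (nrm z)^2"
  by (intro tendsto_add tendsto_diff tendsto_mult tendsto_const tendsto_power wk Bl nlim)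
 then have l: "(%n. B z z - 2 * (B z (\<psi> n) - B z (\<phi> n)) - 2 * B z (\<phi> n) + (nrm (\<phi> n))^2) \<longlonglongrightarrow> 0"
  by (simp add: H01_norm_sq)
 have "(%n. (nrm (%x. z x - \<psi> n x))^2) \<longlonglongrightarrow> 0"
  by (rule tendsto_sandwich[OF always_eventually always_eventually tendsto_const l]) (use sqle in auto)
 then have "(%n. sqrt ((nrm (%x. z x - \<psi> n x))^2)) \<longlonglongrightarrow> sqrt 0" by (rule tendsto_real_sqrt)
 then show thesis using that[of \<psi>] \<psi>t \<psi>0 by simp
qed

text \<open>Composition with the inversion is immediate for Borel functions on the whole space.
  Changing \<open>z\<close> on a null set and extending it by zero leaves all integrals over
  \<Omega> as they are.\<close>

lemma borel_representative:
 assumes "z \<in> borel_measurable M" "ae_positive \<Omega> z"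
 obtains Z :: "'a \<Rightarrow> real" where "Z \<in> borel_measurable borel" "!!x. 0 <= Z x" "!!x. x \<notin> \<Omega> ==> Z x = 0"
  "AE x in lborel. x \<in> \<Omega> \<longrightarrow> 0 < Z x" "AE x in M. z x = Z x"
proof -
 have "(%x. if x \<in> \<Omega> then z x else 0) \<in> borel_measurable lebesgue"
  using assms(1) by (subst (asm) borel_measurable_if[OF sets_dom, symmetric])
 then obtain f where f: "f \<in> borel_measurable lborel" "AE x in lborel. (if x \<in> \<Omega> then z x else 0) = f x"
  using completion_ex_borel_measurable_real by blast
 have [measurable]: "\<Omega> \<in> sets borel" "f \<in> borel_measurable borel" using open_dom f(1) by auto
 define Z where "Z x = (if x \<in> \<Omega> then max (f x) 0 else 0)" for x
 have pos: "AE x in lborel. x \<in> \<Omega> \<longrightarrow> 0 < z x"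
  using assms(2) unfolding ae_positive_def
  by (subst (asm) AE_restrict_space_iff) (auto simp: AE_completion_iff)
 have eq: "AE x in lborel. x \<in> \<Omega> \<longrightarrow> z x = Z x \<and> 0 < Z x"
  using f(2) pos by eventually_elim (auto simp: Z_def)
 show thesis
 proof (rule that[of Z])
  show "Z \<in> borel_measurable borel" unfolding Z_def by measurable
  show "AE x in lborel. x \<in> \<Omega> \<longrightarrow> 0 < Z x" using eq by eventually_elim auto
  have "AE x in lborel. x \<in> \<Omega> \<longrightarrow> z x = Z x" using eq by eventually_elim auto
  then show "AE x in M. z x = Z x"
   by (subst AE_restrict_space_iff) (auto simp: AE_completion_iff)
 qed (auto simp: Z_def)
qed

end

context bounded_open3
begin

text \<open>The error \<open>\<epsilon> n\<close> is the Dirichlet distance of \<open>z\<close> and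
  \<open>\<psi> n\<close>: by Cauchy-Schwarz this is the price of replacing \<open>z\<close> by
  \<open>\<psi> n\<close> in the weak equation.\<close>

lemma pos_solI:
 assumes \<gamma>: "2 < \<gamma>" "\<gamma> < 4" and z: "z \<in> H01 \<Omega>" "ae_positive \<Omega> z" and weak: "!!v. v \<in> H01 \<Omega> ==> B z v = TL \<gamma> z v"
 obtains Z \<psi> \<epsilon> Bd where "pos_sol \<Omega> (\<gamma> - 1) Z \<psi> \<epsilon> Bd" "AE x in M. z x = Z x"
proof -
 obtain Z where Z: "Z \<in> borel_measurable borel" "!!x. 0 <= Z x" "!!x. x \<notin> \<Omega> ==> Z x = 0"
  "AE x in lborel. x \<in> \<Omega> \<longrightarrow> 0 < Z x" "AE x in M. z x = Z x"
  by (rule borel_representative[OF H01_measurable[OF z(1)] z(2)], rule that)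
 have ZM: "Z \<in> borel_measurable M" by (rule borel_measurable_M[OF Z(1)])
 have "AE x in M. 0 <= z x" using z(2) unfolding ae_positive_def by eventually_elim simp
 then obtain \<psi> where \<psi>: "!!n. \<psi> n \<in> test_functions \<Omega>" "!!n x. 0 <= \<psi> n x" "(%n. nrm (%x. z x - \<psi> n x)) \<longlonglongrightarrow> 0"
  by (rule H01_nonneg_approx[OF z(1)]) blast
 have \<psi>H: "\<psi> n \<in> H01 \<Omega>" for n by (rule test_H01(1)[OF \<psi>(1)])
 obtain Bd where Bd: "!!n. nrm (\<psi> n) <= Bd"
  using convergent_imp_Bseq[OF convergentI[OF H01_norm_tendsto[OF \<psi>H z(1) \<psi>(3)]]] unfolding Bseq_def by auto
 have ZL: "L2 M Z" using L2_cong_AE(1)[OF Z(5) H01_measurable[OF z(1)] ZM] H01_L2(1)[OF z(1)] by simp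
 define \<epsilon> where "\<epsilon> n = nrm (%x. z x - \<psi> n x)" for n
 have "pos_sol \<Omega> (\<gamma> - 1) Z \<psi> \<epsilon> Bd"
 proof unfold_locales
  show "1 < \<gamma> - 1" "\<gamma> - 1 < 3" using \<gamma> by auto
  show "L2 lborel Z" using ZL L2_M[OF Z(1,3)] by simp
  have "integrable M (%x. Z x ^ 6) \<longleftrightarrow> integrable M (%x. z x ^ 6)"
   by (rule integrable_cong_AE) (use Z(5) H01_measurable[OF z(1)] ZM in \<open>auto elim!: eventually_mono\<close>)
  then have "integrable M (%x. Z x ^ 6)" using Sobolev(1)[OF z(1)] by simp
  then show "integrable lborel (%x. Z x ^ 6)" using integrable_M[of "%x. Z x ^ 6"] Z(1,3) by simp
  show "(%n. n2 lborel (%x. Z x - \<psi> n x)) \<longlonglongrightarrow> 0"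
  proof -
   have "n2 M (%x. z x - \<psi> n x) = n2 lborel (%x. Z x - \<psi> n x)" for n
   proof -
    note [measurable] = tf_measurable[OF \<psi>(1)[of n]] Z(1) ZM H01_measurable[OF z(1)]
     borel_measurable_M[OF tf_measurable[OF \<psi>(1)[of n]]]
    have "n2 M (%x. z x - \<psi> n x) = n2 M (%x. Z x - \<psi> n x)"
     by (rule L2_cong_AE(2)) (use Z(5) in \<open>auto elim!: eventually_mono\<close>)
    also have "\<dots> = n2 lborel (%x. Z x - \<psi> n x)"
     by (rule n2_M) (use Z(3) tf_outside[OF \<psi>(1)[of n]] in auto)
    finally show ?thesis .
   qed
   then show ?thesis using H01_norm_tendsto_n2[OF \<psi>H z(1) \<psi>(3)] by simp
  qed
  show "n2 lborel (grad (\<psi> n)) <= Bd" for n using Bd[of n] unfolding H01_norm_test[OF \<psi>(1)] .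
  show "\<epsilon> \<longlonglongrightarrow> 0" unfolding \<epsilon>_def[abs_def] by (rule \<psi>(3))
  show "0 <= \<epsilon> n" for n by (simp add: \<epsilon>_def)
  fix n v assume v: "v \<in> test_functions \<Omega>"
  have vH: "v \<in> H01 \<Omega>" by (rule test_H01(1)[OF v])
  note [measurable] = tf_measurable[OF v] Z(1) ZM H01_measurable[OF z(1)] borel_measurable_M[OF tf_measurable[OF v]]
  have "TL \<gamma> z v = (LINT x|M. Z x powr (\<gamma> - 1) * v x)"
   unfolding TL_def
  proof (rule integral_cong_AE)
   show "AE x in M. spow (\<gamma> - 2) (z x) * v x = Z x powr (\<gamma> - 1) * v x"
    using Z(5)
   proof eventually_elim
    case (elim x)
    have "spow (\<gamma> - 2) (Z x) = Z x powr (\<gamma> - 1)"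
    proof (cases "Z x = 0")
     case False
     then have "0 < Z x" using Z(2)[of x] by simp
     then show ?thesis using powr_add[of "Z x" "\<gamma> - 2" 1] by (simp add: spow_def)
    qed (simp add: spow_def)
    then show ?case using elim by simp
   qed
  qed measurable
  also have "\<dots> = (LBINT x. Z x powr (\<gamma> - 1) * v x)"
   by (rule integral_M) (use tf_outside[OF v] in auto)
  finally have eq: "(LBINT x. Z x powr (\<gamma> - 1) * v x) = B z v" using weak[OF vH] by simp
  have "\<bar>B (\<psi> n) v - B z v\<bar> = \<bar>B (%x. z x - \<psi> n x) v\<bar>" unfolding B_diff_left[OF z(1) \<psi>H vH] by simp
  also have "\<dots> <= \<epsilon> n * nrm v" unfolding \<epsilon>_def by (rule B_Cauchy_Schwarz[OF H01_diff[OF z(1) \<psi>H] vH])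
  finally show "\<bar>(LBINT x. grad (\<psi> n) x \<bullet> grad v x) - (LBINT x. Z x powr (\<gamma> - 1) * v x)\<bar> <= \<epsilon> n * n2 lborel (grad v)"
   unfolding eq B_test_test[OF \<psi>(1) v, symmetric] H01_norm_test[OF v] .
 qed (use Z \<psi> in auto)
 then show thesis using Z(5) by (rule that)
qed

text \<open>Testing with \<open>z\<close> itself identifies the squared norm \<open>g^2\<close> with
  \<open>NL \<gamma> z\<close>. Once the \<open>L6\<close> part is absorbed,
  \<open>g^2 <= 2 * \<bar>C\<bar> * K\<close> remains with \<open>K\<close> of order
  \<open>g powr (4 * s)\<close>, and \<open>4 * s < 2\<close> is equivalent to
  \<open>p < 3\<close>.\<close>

lemma H1_bound:
 assumes \<Omega>: "bounded_regular_domain \<Omega>" and \<gamma>: "2 < \<gamma>" "\<gamma> < 4"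
 shows "\<exists>C. \<forall>z\<in>H01 \<Omega>. ae_positive \<Omega> z \<longrightarrow> (\<forall>v\<in>H01 \<Omega>. B z v = TL \<gamma> z v) \<longrightarrow> nrm z <= C"
proof -
 define p where "p = \<gamma> - 1"
 have p: "1 < p" "p < 3" using \<gamma> by (auto simp: p_def)
 obtain C where C: "!!Z \<psi> \<epsilon> Bd. pos_sol \<Omega> p Z \<psi> \<epsilon> Bd ==> (LBINT x. Z x powr p) <= C" using total_bound[OF \<Omega> p] by blast
 define s where "s = 1 / (5 - p)"
 define D where "D = 2 * \<bar>C\<bar> * 8192 powr s"
 have s: "0 < 2 - 4 * s" "0 < s" using p by (auto simp: s_def field_simps)
 have "nrm z <= D powr (1 / (2 - 4 * s))" if z: "z \<in> H01 \<Omega>" "ae_positive \<Omega> z" and w: "!!v. v \<in> H01 \<Omega> ==> B z v = TL \<gamma> z v" for z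
 proof (cases "nrm z = 0")
  case False
  obtain Z \<psi> \<epsilon> Bd where "pos_sol \<Omega> (\<gamma> - 1) Z \<psi> \<epsilon> Bd" and Z: "AE x in M. z x = Z x" by (rule pos_solI[OF \<gamma> z w])
  then have ps: "pos_sol \<Omega> p Z \<psi> \<epsilon> Bd" by (simp add: p_def)
  interpret ps: pos_sol \<Omega> p Z \<psi> \<epsilon> Bd by (rule ps)
  note [measurable] = ps.Z_meas H01_measurable[OF z(1)]
  have ZM[measurable]: "Z \<in> borel_measurable M" by (rule borel_measurable_M[OF ps.Z_meas])
  define g where "g = nrm z"
  have g: "0 < g" using False by (simp add: g_def less_le)
  \<comment> \<open>Here \<open>8192 = 2 * 4096\<close> with the Sobolev constant 4096, and
    \<open>s * (p - 5) = - 1\<close>; this height makes the \<open>L6\<close> term exactly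
    \<open>g^2 / 2\<close>.\<close>
  define K where "K = (8192 * g powr 4) powr s"
  have K: "0 < K" using g by (simp add: K_def)
  have "g^2 = NL \<gamma> z" unfolding g_def H01_norm_sq w[OF z(1)] NL_eq_TL[OF \<gamma>(1)] ..
  also have "\<dots> = (LINT x|M. Z x powr \<gamma>)"
   unfolding NL_def by (rule integral_cong_AE) (use Z ps.Z_nonneg in \<open>auto elim!: eventually_mono\<close>)
  also have "\<dots> = (LBINT x. Z x powr \<gamma>)" by (rule integral_M) (use ps.Z_out \<gamma> in auto)
  also have "\<dots> <= (LBINT x. K * Z x powr p + K powr (p - 5) * Z x ^ 6)"
  proof (rule integral_mono)
   show "integrable lborel (%x. Z x powr \<gamma>)" by (rule ps.integrable_Z_powr) (use \<gamma> in auto)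
   show "integrable lborel (%x. K * Z x powr p + K powr (p - 5) * Z x ^ 6)"
    by (intro integrable_add' integrable_mult_right ps.integrable_Z_powr_p ps.Z6)
   fix x
   show "Z x powr \<gamma> <= K * Z x powr p + K powr (p - 5) * Z x ^ 6"
   proof (cases "Z x = 0")
    case False
    then have z0: "0 < Z x" using ps.Z_nonneg[of x] by simp
    have e1: "Z x powr \<gamma> = Z x * Z x powr p" using z0 powr_add[of "Z x" 1 p] by (simp add: p_def)
    have e2: "Z x powr \<gamma> = Z x powr (p - 5) * Z x ^ 6"
     using z0 powr_add[of "Z x" "p - 5" 6] by (simp add: p_def powr_numeral)
    show ?thesis
    proof (cases "Z x <= K")
     case True
     then have "Z x * Z x powr p <= K * Z x powr p" by (intro mult_right_mono) auto
     then show ?thesis unfolding e1 using z0 by (simp add: add_increasing2)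
    next
     case False
     then have "Z x powr (p - 5) <= K powr (p - 5)" using K p by (intro powr_mono2') auto
     then have "Z x powr (p - 5) * Z x ^ 6 <= K powr (p - 5) * Z x ^ 6" by (intro mult_right_mono) auto
     then show ?thesis unfolding e2 using K by (simp add: add_increasing)
    qed
   qed (use \<gamma> K in simp)
  qed
  also have "\<dots> = K * (LBINT x. Z x powr p) + K powr (p - 5) * (LBINT x. Z x ^ 6)"
   using ps.integrable_Z_powr_p ps.Z6 by (subst integral_add') auto
  also have "\<dots> <= K * \<bar>C\<bar> + K powr (p - 5) * (4096 * g ^ 6)"
  proof (intro add_mono mult_left_mono)
   show "(LBINT x. Z x powr p) <= \<bar>C\<bar>" using C[OF ps] by linarith
   have "(LBINT x. Z x ^ 6) = (LINT x|M. Z x ^ 6)" by (rule integral_M[symmetric]) (use ps.Z_out in auto)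
   also have "\<dots> = (LINT x|M. z x ^ 6)" by (rule integral_cong_AE) (use Z in \<open>auto elim!: eventually_mono\<close>)
   finally show "(LBINT x. Z x ^ 6) <= 4096 * g ^ 6" using Sobolev(2)[OF z(1)] unfolding g_def by simp
  qed (use K in auto)
  also have "K powr (p - 5) * (4096 * g ^ 6) = g^2 / 2"
  proof -
   have "s * (p - 5) = - 1" using p by (simp add: s_def field_simps)
   then have "K powr (p - 5) = inverse (8192 * g powr 4)" using g by (simp add: K_def powr_powr powr_minus)
   then show ?thesis using g by (simp add: powr_numeral field_simps eval_nat_numeral)
  qed
  finally have "g^2 <= 2 * \<bar>C\<bar> * K" by (simp add: mult.commute)
  also have "\<dots> = D * g powr (4 * s)" by (simp only: D_def K_def powr_mult powr_powr mult_ac)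
  finally have "g powr (- (4 * s)) * g powr 2 <= g powr (- (4 * s)) * (D * g powr (4 * s))"
   using g by (intro mult_left_mono) (auto simp: powr_numeral)
  also have "\<dots> = D" using g by (simp add: powr_minus)
  also have "g powr (- (4 * s)) * g powr 2 = g powr (2 - 4 * s)" by (simp only: powr_add[symmetric] uminus_add_conv_diff)
  finally have "(g powr (2 - 4 * s)) powr (1 / (2 - 4 * s)) <= D powr (1 / (2 - 4 * s))" using s by (intro powr_mono2) auto
  then show ?thesis using g s by (simp add: powr_powr g_def)
 qed simp
 then show ?thesis by blast
qed

end

subsection \<open>The Kirchhoff problem\<close>

context bounded_open3
begin

text \<open>The square of the nonlinearity has exponent \<open>2 * (\<gamma> - 1)\<close>, which
  stays below the Sobolev exponent 6 because \<open>\<gamma> < 4\<close>.\<close>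

lemma n2_spow_bound:
 assumes \<gamma>: "2 < \<gamma>" "\<gamma> < 4"
 obtains Q where "0 <= Q" "!!u. u \<in> H01 \<Omega> ==> nrm u <= C ==> n2 M (%x. spow (\<gamma> - 2) (u x)) <= Q"
proof -
 obtain S where S: "0 < S" "!!u. u \<in> H01 \<Omega> ==> NL (2 * (\<gamma> - 1)) u <= S * nrm u powr (2 * (\<gamma> - 1))"
  using NL_bound[of "2 * (\<gamma> - 1)"] \<gamma> by auto
 have sq: "(spow (\<gamma> - 2) s)^2 = \<bar>s\<bar> powr (2 * (\<gamma> - 1))" for s
 proof (cases "s = 0")
  case False
  have "(spow (\<gamma> - 2) s)^2 = (\<bar>s\<bar> powr (\<gamma> - 2))^2 * \<bar>s\<bar>^2" by (simp add: spow_def power_mult_distrib)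
  also have "\<dots> = \<bar>s\<bar> powr (\<gamma> - 2) * \<bar>s\<bar> powr (\<gamma> - 2) * \<bar>s\<bar> powr 2" using False by (simp add: power2_eq_square powr_numeral)
  also have "\<dots> = \<bar>s\<bar> powr (2 * (\<gamma> - 1))" unfolding powr_add[symmetric] by (simp add: algebra_simps)
  finally show ?thesis .
 qed (simp add: spow_def)
 show thesis
 proof (rule that[of "sqrt (S * \<bar>C\<bar> powr (2 * (\<gamma> - 1)))"])
  fix u assume u: "u \<in> H01 \<Omega>" "nrm u <= C"
  have "nrm u powr (2 * (\<gamma> - 1)) <= \<bar>C\<bar> powr (2 * (\<gamma> - 1))" using u(2) \<gamma> by (intro powr_mono2) auto
  then have "NL (2 * (\<gamma> - 1)) u <= S * \<bar>C\<bar> powr (2 * (\<gamma> - 1))" using S(2)[OF u(1)] S(1) by (meson mult_left_mono less_imp_le order_trans)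
  moreover have "(n2 M (%x. spow (\<gamma> - 2) (u x)))^2 = NL (2 * (\<gamma> - 1)) u" unfolding n2_sq_real sq NL_def ..
  ultimately show "n2 M (%x. spow (\<gamma> - 2) (u x)) <= sqrt (S * \<bar>C\<bar> powr (2 * (\<gamma> - 1)))" by (intro real_le_rsqrt) simp
 qed (use S in simp)
qed

text \<open>Needed to pass to the limit in the nonlinear term. The mean value theorem yields a
  quadratic weight, which is integrated by Cauchy-Schwarz with \<open>L4\<close> norms.\<close>

lemma TL_Lipschitz:
 assumes \<gamma>: "2 < \<gamma>" "\<gamma> < 4"
 shows "\<exists>C. \<forall>u\<in>H01 \<Omega>. \<forall>w\<in>H01 \<Omega>. \<forall>v\<in>H01 \<Omega>. \<bar>TL \<gamma> u v - TL \<gamma> w v\<bar>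
  <= C * (1 + (nrm u)^2 + (nrm w)^2) * nrm (%x. u x - w x) * nrm v"
proof -
 obtain P where P: "P > 0" "!!u. u \<in> H01 \<Omega> ==> n2 M u <= P * nrm u" using Poincare by blast
 obtain K where K: "K > 0" "!!u. u \<in> H01 \<Omega> ==> n2 M (%x. (u x)^2) <= K * (nrm u)^2" using L4_bound by blast
 define C where "C = 24 * (P^2 + K^2)"
 have pt: "\<bar>spow (\<gamma> - 2) s - spow (\<gamma> - 2) t\<bar> <= 24 * ((1 + s^2 + t^2) * \<bar>s - t\<bar>)" for s t
 proof -
  obtain z where z: "\<bar>z - t\<bar> <= \<bar>s - t\<bar>" "spow (\<gamma> - 2) s - spow (\<gamma> - 2) t = (s - t) * ((\<gamma> - 2 + 1) * \<bar>z\<bar> powr (\<gamma> - 2))"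
   using MVT_signed[of "spow (\<gamma> - 2)" "%s. (\<gamma> - 2 + 1) * \<bar>s\<bar> powr (\<gamma> - 2)" t "s - t"] DERIV_spow[of "\<gamma> - 2"] \<gamma> by auto
  have "\<bar>z\<bar> <= \<bar>s\<bar> + 2 * \<bar>t\<bar>" using z(1) by linarith
  then have "\<bar>z\<bar>^2 <= (\<bar>s\<bar> + 2 * \<bar>t\<bar>)^2" by (rule power_mono) simp
  also have "\<dots> <= 2 * s^2 + 8 * t^2" using sum_squares_bound[of "\<bar>s\<bar>" "2 * \<bar>t\<bar>"] by (simp add: power2_sum power_mult_distrib)
  also have "\<dots> <= 8 * s^2 + 8 * t^2" by simp
  finally have zp: "\<bar>z\<bar> powr (\<gamma> - 2) <= 8 * (1 + s^2 + t^2)" using powr_le_one_plus_sq[of "\<gamma> - 2" z] \<gamma> by simp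
  have "(\<gamma> - 2 + 1) * \<bar>z\<bar> powr (\<gamma> - 2) <= 24 * (1 + s^2 + t^2)" using mult_mono[of "\<gamma> - 2 + 1" 3, OF _ zp] \<gamma> by simp
  then have "\<bar>s - t\<bar> * ((\<gamma> - 2 + 1) * \<bar>z\<bar> powr (\<gamma> - 2)) <= \<bar>s - t\<bar> * (24 * (1 + s^2 + t^2))" by (intro mult_left_mono) auto
  then show ?thesis unfolding z(2) using \<gamma> by (simp add: abs_mult mult_ac)
 qed
 have "\<bar>TL \<gamma> u v - TL \<gamma> w v\<bar> <= C * (1 + (nrm u)^2 + (nrm w)^2) * nrm (%x. u x - w x) * nrm v"
  if u: "u \<in> H01 \<Omega>" and w: "w \<in> H01 \<Omega>" and v: "v \<in> H01 \<Omega>" for u w v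
 proof -
  define d where "d x = u x - w x" for x
  have d: "d \<in> H01 \<Omega>" unfolding d_def[abs_def] by (rule H01_diff[OF u w])
  note [measurable] = H01_measurable[OF u] H01_measurable[OF w] H01_measurable[OF v] H01_measurable[OF d]
  let ?N = "nrm"
  have ab: "L2 M (%x. \<bar>f x\<bar>)" "n2 M (%x. \<bar>f x\<bar>) = n2 M f" if "L2 M f" for f :: "real^3 \<Rightarrow> real"
   using that by (auto simp: L2_def n2_def)
  have i1: "integrable M (%x. \<bar>d x\<bar> * \<bar>v x\<bar>)" "(LINT x|M. \<bar>d x\<bar> * \<bar>v x\<bar>) <= P^2 * (?N d * ?N v)"
  proof -
   note L = ab[OF H01_L2(1)[OF d]] ab[OF H01_L2(1)[OF v]]
   show "integrable M (%x. \<bar>d x\<bar> * \<bar>v x\<bar>)" by (rule integrable_mult_L2[OF L(1,3)])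
   have "(LINT x|M. \<bar>d x\<bar> * \<bar>v x\<bar>) <= n2 M d * n2 M v" using L2_Cauchy_Schwarz_real[OF L(1,3)] unfolding L(2,4) by linarith
   also have "\<dots> <= (P * ?N d) * (P * ?N v)" using P by (intro mult_mono P(2) d v) auto
   finally show "(LINT x|M. \<bar>d x\<bar> * \<bar>v x\<bar>) <= P^2 * (?N d * ?N v)" by (simp add: power2_eq_square mult_ac)
  qed
  have i2: "integrable M (%x. (f x)^2 * (\<bar>d x\<bar> * \<bar>v x\<bar>)) \<and> (LINT x|M. (f x)^2 * (\<bar>d x\<bar> * \<bar>v x\<bar>)) <= K^2 * ((?N f)^2 * (?N d * ?N v))"
   if f: "f \<in> H01 \<Omega>" for f
  proof -
   have i: "integrable M (%x. (d x)^2 * (v x)^2)" by (rule integrable_mult_L2[OF L2_square[OF d] L2_square[OF v]])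
   then have L: "L2 M (%x. \<bar>d x\<bar> * \<bar>v x\<bar>)" by (simp add: L2_def power_mult_distrib)
   have "(n2 M (%x. \<bar>d x\<bar> * \<bar>v x\<bar>))^2 <= n2 M (%x. (d x)^2) * n2 M (%x. (v x)^2)"
    unfolding n2_sq_real power_mult_distrib power2_abs using L2_Cauchy_Schwarz_real[OF L2_square[OF d] L2_square[OF v]] by linarith
   also have "\<dots> <= (K * (?N d)^2) * (K * (?N v)^2)" using K(1) by (intro mult_mono K(2) d v) auto
   also have "\<dots> = (K * (?N d * ?N v))^2" by (simp add: power2_eq_square)
   finally have n: "n2 M (%x. \<bar>d x\<bar> * \<bar>v x\<bar>) <= K * (?N d * ?N v)" by (rule power2_le_imp_le) (use K(1) in simp)
   have "(LINT x|M. (f x)^2 * (\<bar>d x\<bar> * \<bar>v x\<bar>)) <= n2 M (%x. (f x)^2) * n2 M (%x. \<bar>d x\<bar> * \<bar>v x\<bar>)"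
    using L2_Cauchy_Schwarz_real[OF L2_square[OF f] L] by linarith
   also have "\<dots> <= (K * (?N f)^2) * (K * (?N d * ?N v))" using K(1) by (intro mult_mono K(2) f n) auto
   finally show ?thesis using integrable_mult_L2[OF L2_square[OF f] L] by (simp add: power2_eq_square mult_ac)
  qed
  have I: "integrable M (%x. spow (\<gamma> - 2) (f x) * v x)" if "f \<in> H01 \<Omega>" for f
   by (rule integrable_mult_L2[OF L2_spow[OF that \<gamma>] H01_L2(1)[OF v]])
  let ?b = "%x. 24 * (\<bar>d x\<bar> * \<bar>v x\<bar> + (u x)^2 * (\<bar>d x\<bar> * \<bar>v x\<bar>) + (w x)^2 * (\<bar>d x\<bar> * \<bar>v x\<bar>))"
  have eq: "TL \<gamma> u v - TL \<gamma> w v = (LINT x|M. spow (\<gamma> - 2) (u x) * v x - spow (\<gamma> - 2) (w x) * v x)"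
   unfolding TL_def using I[OF u] I[OF w] by simp
  have bi: "integrable M ?b" using i1 i2[OF u] i2[OF w] by simp
  have "\<bar>TL \<gamma> u v - TL \<gamma> w v\<bar> <= (LINT x|M. ?b x)"
   unfolding eq
  proof (rule integral_abs_bound_integral[OF integrable_diff'[OF I[OF u] I[OF w]] bi])
   fix x
   have "\<bar>spow (\<gamma> - 2) (u x) - spow (\<gamma> - 2) (w x)\<bar> * \<bar>v x\<bar> <= 24 * ((1 + (u x)^2 + (w x)^2) * \<bar>d x\<bar>) * \<bar>v x\<bar>"
    unfolding d_def by (intro mult_right_mono pt) simp
   then show "\<bar>spow (\<gamma> - 2) (u x) * v x - spow (\<gamma> - 2) (w x) * v x\<bar> <= ?b x"
    unfolding left_diff_distrib[symmetric] abs_mult by (simp add: distrib_left distrib_right mult_ac)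
  qed
  also have "\<dots> = 24 * ((LINT x|M. \<bar>d x\<bar> * \<bar>v x\<bar>) + (LINT x|M. (u x)^2 * (\<bar>d x\<bar> * \<bar>v x\<bar>)) + (LINT x|M. (w x)^2 * (\<bar>d x\<bar> * \<bar>v x\<bar>)))"
   using i1 i2[OF u] i2[OF w] by simp
  also have "\<dots> <= 24 * (P^2 * (?N d * ?N v) + K^2 * ((?N u)^2 * (?N d * ?N v)) + K^2 * ((?N w)^2 * (?N d * ?N v)))"
   using i1 i2[OF u] i2[OF w] by (intro mult_left_mono add_mono) auto
  also have "\<dots> = 24 * (P^2 + K^2 * ((?N u)^2 + (?N w)^2)) * (?N d * ?N v)" by (simp add: algebra_simps)
  also have "\<dots> <= C * (1 + (?N u)^2 + (?N w)^2) * (?N d * ?N v)"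
  proof (rule mult_right_mono)
   have "0 <= P^2 * ((?N u)^2 + (?N w)^2)" "0 <= K^2" by simp_all
   then show "24 * (P^2 + K^2 * ((?N u)^2 + (?N w)^2)) <= C * (1 + (?N u)^2 + (?N w)^2)" by (simp add: C_def algebra_simps)
  qed simp
  finally show ?thesis unfolding d_def[abs_def] by (simp add: mult.assoc)
 qed
 then show ?thesis by blast
qed

lemma nonzero_H01:
 assumes \<gamma>: "2 <= \<gamma>" "\<gamma> <= 6" and u: "u \<in> H01 \<Omega>" "\<not> ae_eq \<Omega> u (%_. 0)"
 shows "0 < NL \<gamma> u" "0 < nrm u"
proof -
 have "NL \<gamma> u \<noteq> 0"
 proof
  assume "NL \<gamma> u = 0"
  then have "AE x in M. \<bar>u x\<bar> powr \<gamma> = 0"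
   unfolding NL_def using integral_nonneg_eq_0_iff_AE[OF integrable_powr[OF u(1) \<gamma>]] by simp
  then show False using u(2) unfolding ae_eq_def by simp
 qed
 then show N: "0 < NL \<gamma> u" using NL_nonneg[of \<gamma> u] by simp
 obtain S where S: "NL \<gamma> u <= S * nrm u powr \<gamma>" using NL_bound[OF \<gamma>] u(1) by blast
 show "0 < nrm u"
 proof (rule ccontr)
  assume "\<not> 0 < nrm u"
  then have "nrm u = 0" using H01_norm_nonneg[of u] by linarith
  then show False using S N by simp
 qed
qed

lemma exists_nonzero_H01:
 assumes "\<Omega> \<noteq> {}" obtains u where "u \<in> H01 \<Omega>" "\<not> ae_eq \<Omega> u (%_. 0)"
proof -
 obtain x0 where x0: "x0 \<in> \<Omega>" using assms by blast
 obtain \<eta> where \<eta>: "\<eta> \<in> test_functions \<Omega>" "!!x. 0 <= \<eta> x" "!!x. x \<in> {x0} ==> 0 < \<eta> x"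
  by (rule tf_positive_on_compact[of "{x0}" \<Omega>]) (use x0 open_dom in auto)
 have "\<not> ae_eq \<Omega> \<eta> (%_. 0)"
 proof
  assume "ae_eq \<Omega> \<eta> (%_. 0)"
  then have ae: "AE x in lebesgue. x \<in> \<Omega> \<longrightarrow> \<eta> x = 0" unfolding ae_eq_def by (subst (asm) AE_restrict_space_iff) auto
  have "open (\<eta> -` {0<..})" using tf_continuous[OF \<eta>(1)] by (intro open_vimage) auto
  moreover have "\<eta> -` {0<..} \<noteq> {}" using \<eta>(3) by auto
  ultimately have "\<not> negligible (\<eta> -` {0<..})" by (rule open_not_negligible)
  moreover have "AE x in lebesgue. x \<notin> \<eta> -` {0<..}"
   using ae by eventually_elim (use tf_outside[OF \<eta>(1)] in force)
  then have "negligible (\<eta> -` {0<..})"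
   unfolding negligible_iff_null_sets by (subst AE_iff_null_sets) (use \<open>open (\<eta> -` {0<..})\<close> in auto)
  ultimately show False by simp
 qed
 then show thesis using test_H01(1)[OF \<eta>(1)] by (rule that[rotated])
qed

text \<open>Ensures that the admissible parameters fill a right neighbourhood of 0. The supremum is
  real-valued, so boundedness has to come first; it follows from \<open>NL_bound\<close>, as the
  quotient of norms is invariant under scaling.\<close>

lemma lam0_star_pos:
 assumes ne: "\<Omega> \<noteq> {}" and a: "0 < a" and \<gamma>: "2 < \<gamma>" "\<gamma> < 4"
 shows "0 < lam0_star \<Omega> a \<gamma>"
proof -
 obtain S where S: "0 < S" "!!u. u \<in> H01 \<Omega> ==> NL \<gamma> u <= S * nrm u powr \<gamma>" using NL_bound[of \<gamma>] \<gamma> by auto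
 define c where "c = 2 * (2 / \<gamma>) powr (2 / (\<gamma> - 2)) * (a * ((\<gamma> - 2) / (4 - \<gamma>)) * ((4 - \<gamma>) / (2 * a)) powr (2 / (\<gamma> - 2)))"
 have c: "0 < c" using a \<gamma> by (simp add: c_def)
 have l: "lam0 \<Omega> a \<gamma> u = c * (Lp_norm \<gamma> \<Omega> u / nrm u) powr (2 * \<gamma> / (\<gamma> - 2))" for u
  by (simp add: lam0_def lam_def c_def)
 have Lp: "Lp_norm \<gamma> \<Omega> u = NL \<gamma> u powr (1 / \<gamma>)" for u by (simp add: Lp_norm_def NL_def)
 let ?A = "{u \<in> H01 \<Omega>. \<not> ae_eq \<Omega> u (%_. 0)}"
 have "lam0 \<Omega> a \<gamma> u <= c * (S powr (1 / \<gamma>)) powr (2 * \<gamma> / (\<gamma> - 2))" if u: "u \<in> ?A" for u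
 proof -
  have n: "0 < nrm u" using nonzero_H01(2)[of \<gamma> u] \<gamma> u by auto
  have "NL \<gamma> u powr (1 / \<gamma>) <= (S * nrm u powr \<gamma>) powr (1 / \<gamma>)" using S(2) u NL_nonneg \<gamma> by (intro powr_mono2) auto
  also have "\<dots> = S powr (1 / \<gamma>) * nrm u" using n \<gamma> by (simp add: powr_mult powr_powr)
  finally have "Lp_norm \<gamma> \<Omega> u / nrm u <= S powr (1 / \<gamma>)" unfolding Lp using n by (simp add: pos_divide_le_eq)
  then show ?thesis unfolding l using c \<gamma> n by (intro mult_left_mono powr_mono2) (auto simp: Lp)
 qed
 then have bdd: "bdd_above (lam0 \<Omega> a \<gamma> ` ?A)" by (intro bdd_aboveI2)
 obtain u where u: "u \<in> ?A" using exists_nonzero_H01[OF ne] by blast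
 have "0 < lam0 \<Omega> a \<gamma> u" unfolding l Lp using nonzero_H01[of \<gamma> u] \<gamma> u c by auto
 also have "\<dots> <= lam0_star \<Omega> a \<gamma>" unfolding lam0_star_def by (rule cSUP_upper[OF u bdd])
 finally show ?thesis .
qed

section \<open>Mountain pass levels as the parameter tends to 0\<close>

lemma Phi_ae_zero:
 assumes "u \<in> H01 \<Omega>" "ae_eq \<Omega> u (%_. 0)" "\<gamma> \<noteq> 0" shows "Phi \<Omega> a \<gamma> \<mu> u = 0"
proof -
 have z: "(%x. 0) \<in> H01 \<Omega>" by (rule test_H01(1)[OF tf_0])
 have "nrm u = nrm (%x. 0)"
  by (rule H01_cong_norm[OF z H01_measurable[OF assms(1)]]) (use assms(2) in \<open>auto simp: ae_eq_def elim!: eventually_mono\<close>)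
 also have "\<dots> = 0" using H01_norm_cmult[OF z, of 0] by simp
 finally have 1: "nrm u = 0" .
 have "NL \<gamma> u = (LINT x|M. 0)" unfolding NL_def
  using assms H01_measurable[OF assms(1)] by (intro integral_cong_AE) (auto simp: ae_eq_def elim!: eventually_mono)
 then show ?thesis using 1 assms by (simp add: Phi_eq)
qed

lemma path_norm_bounded:
 assumes \<phi>: "\<phi> \<in> paths \<Omega> e"
 obtains C where "0 <= C" "!!t. t \<in> {0..1} ==> nrm (\<phi> t) <= C"
proof -
 have H: "\<phi> t \<in> H01 \<Omega>" if "t \<in> {0..1}" for t using \<phi> that by (simp add: paths_def)
 have "continuous_on {0..1} (%t. nrm (\<phi> t))"
  unfolding continuous_on_def
 proof
  fix t :: real assume t: "t \<in> {0..1}"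
  have "((%s. nrm (%x. \<phi> s x - \<phi> t x)) \<longlongrightarrow> 0) (at t within {0..1})" using \<phi> t by (simp add: paths_def)
  then have "((%s. nrm (\<phi> s) - nrm (\<phi> t)) \<longlongrightarrow> 0) (at t within {0..1})"
  proof (rule Lim_null_comparison[rotated])
   show "\<forall>\<^sub>F s in at t within {0..1}. norm (nrm (\<phi> s) - nrm (\<phi> t)) <= nrm (%x. \<phi> s x - \<phi> t x)"
    unfolding eventually_at_filter
    by (rule always_eventually) (use H01_norm_triangle_diff H t in auto)
  qed
  then show "((%t. nrm (\<phi> t)) \<longlongrightarrow> nrm (\<phi> t)) (at t within {0..1})" by (rule LIM_zero_cancel)
 qed
 then have "compact ((%t. nrm (\<phi> t)) ` {0..1})" by (rule compact_continuous_image) simp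
 then obtain C where C: "!!s. s \<in> (%t. nrm (\<phi> t)) ` {0..1} ==> norm s <= C"
  using compact_imp_bounded bounded_iff by metis
 show thesis by (rule that[of "\<bar>C\<bar>"]) (use C in force)+
qed

text \<open>The energy increases with \<mu>, which gives the lower bound. For the upper bound one
  path, nearly optimal at parameter 0, is kept for all \<mu>: it is bounded in norm, so the quartic
  term adds at most a multiple of \<mu>. The constant \<open>C\<close> depends on \<epsilon> through
  the path, but not on \<mu>.\<close>

lemma mp_level_near_0:
 assumes e: "e \<in> H01 \<Omega>" and a: "0 < a" and \<gamma>: "2 < \<gamma>" and \<epsilon>: "0 < \<epsilon>"
 obtains C where "!!\<mu>. 0 <= \<mu> ==> mp_level \<Omega> a \<gamma> e 0 <= mp_level \<Omega> a \<gamma> e \<mu>"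
  "!!\<mu>. 0 <= \<mu> ==> mp_level \<Omega> a \<gamma> e \<mu> <= mp_level \<Omega> a \<gamma> e 0 + \<epsilon> + \<mu> * C"
proof -
 define F where "F \<mu> \<phi> = (SUP t \<in> {0..1}. Phi \<Omega> a \<gamma> \<mu> (\<phi> t))" for \<mu> and \<phi> :: "real \<Rightarrow> real^3 \<Rightarrow> real"
 have lev: "mp_level \<Omega> a \<gamma> e \<mu> = (INF \<phi> \<in> paths \<Omega> e. F \<mu> \<phi>)" for \<mu> by (simp add: mp_level_def F_def)
 have H: "\<phi> t \<in> H01 \<Omega>" if "\<phi> \<in> paths \<Omega> e" "t \<in> {0..1}" for \<phi> t using that by (simp add: paths_def)
 have g0: "\<gamma> \<noteq> 0" using \<gamma> by simp
 have bdd: "bdd_above ((%t. Phi \<Omega> a \<gamma> \<mu> (\<phi> t)) ` {0..1})" if \<phi>: "\<phi> \<in> paths \<Omega> e" and \<mu>: "0 <= \<mu>" for \<phi> \<mu>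
 proof -
  obtain C where C: "0 <= C" "!!t. t \<in> {0..1} ==> nrm (\<phi> t) <= C" by (rule path_norm_bounded[OF \<phi>], rule that)
  show ?thesis
  proof (rule bdd_aboveI2)
   fix t :: real assume t: "t \<in> {0..1}"
   have "a / 2 * (nrm (\<phi> t))^2 + \<mu> / 4 * nrm (\<phi> t) ^ 4 <= a / 2 * C^2 + \<mu> / 4 * C ^ 4"
    using a \<mu> C(2)[OF t] by (intro add_mono mult_left_mono power_mono) auto
   moreover have "0 <= 1 / \<gamma> * NL \<gamma> (\<phi> t)" using \<gamma> NL_nonneg by simp
   ultimately show "Phi \<Omega> a \<gamma> \<mu> (\<phi> t) <= a / 2 * C^2 + \<mu> / 4 * C ^ 4" unfolding Phi_eq[OF g0] by linarith
  qed
 qed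
 have F0: "0 <= F \<mu> \<phi>" if \<phi>: "\<phi> \<in> paths \<Omega> e" and \<mu>: "0 <= \<mu>" for \<phi> \<mu>
 proof -
  have "Phi \<Omega> a \<gamma> \<mu> (\<phi> 0) <= F \<mu> \<phi>" unfolding F_def by (rule cSUP_upper[OF _ bdd[OF that]]) simp
  moreover have "Phi \<Omega> a \<gamma> \<mu> (\<phi> 0) = 0" using \<phi> g0 by (intro Phi_ae_zero) (auto simp: paths_def)
  ultimately show ?thesis by simp
 qed
 have Fmono: "F 0 \<phi> <= F \<mu> \<phi>" if \<phi>: "\<phi> \<in> paths \<Omega> e" and \<mu>: "0 <= \<mu>" for \<phi> \<mu>
  unfolding F_def by (rule cSUP_mono[OF _ bdd[OF that]]) (use \<mu> in \<open>auto simp: Phi_eq[OF g0] intro!: bexI\<close>)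
 have bi: "bdd_below (F \<mu> ` paths \<Omega> e)" if "0 <= \<mu>" for \<mu> using F0[OF _ that] by (intro bdd_belowI2)
 have "(%t x. t * e x) \<in> paths \<Omega> e"
 proof -
  have "((%s. nrm (%x. s * e x - t * e x)) \<longlongrightarrow> 0) (at t within {0..1})" for t
  proof -
   have "((%s. \<bar>s - t\<bar> * nrm e) \<longlongrightarrow> \<bar>t - t\<bar> * nrm e) (at t within {0..1})" by (intro tendsto_intros)
   then show ?thesis using H01_norm_cmult[OF e] by (simp add: left_diff_distrib[symmetric])
  qed
  then show ?thesis using H01_cmult[OF e] by (auto simp: paths_def ae_eq_def)
 qed
 then have ne: "paths \<Omega> e \<noteq> {}" by blast
 have 1: "mp_level \<Omega> a \<gamma> e 0 <= mp_level \<Omega> a \<gamma> e \<mu>" if "0 <= \<mu>" for \<mu>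
  unfolding lev by (rule cINF_mono[OF ne bi]) (use Fmono that in auto)
 have "(INF \<phi> \<in> paths \<Omega> e. F 0 \<phi>) < mp_level \<Omega> a \<gamma> e 0 + \<epsilon>" using \<epsilon> by (simp add: lev)
 then obtain \<phi> where \<phi>: "\<phi> \<in> paths \<Omega> e" "F 0 \<phi> < mp_level \<Omega> a \<gamma> e 0 + \<epsilon>"
  unfolding cINF_less_iff[OF ne bi[OF order_refl]] by blast
 obtain C where C: "0 <= C" "!!t. t \<in> {0..1} ==> nrm (\<phi> t) <= C" by (rule path_norm_bounded[OF \<phi>(1)], rule that)
 have "mp_level \<Omega> a \<gamma> e \<mu> <= mp_level \<Omega> a \<gamma> e 0 + \<epsilon> + \<mu> * (C ^ 4 / 4)" if \<mu>: "0 <= \<mu>" for \<mu>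
 proof -
  have "mp_level \<Omega> a \<gamma> e \<mu> <= F \<mu> \<phi>" unfolding lev by (rule cINF_lower[OF bi[OF \<mu>] \<phi>(1)])
  also have "\<dots> <= F 0 \<phi> + \<mu> * (C ^ 4 / 4)"
   unfolding F_def[of \<mu>]
  proof (rule cSUP_least)
   fix t :: real assume t: "t \<in> {0..1}"
   have "Phi \<Omega> a \<gamma> \<mu> (\<phi> t) = Phi \<Omega> a \<gamma> 0 (\<phi> t) + \<mu> / 4 * nrm (\<phi> t) ^ 4" by (simp add: Phi_eq[OF g0])
   also have "\<dots> <= F 0 \<phi> + \<mu> / 4 * C ^ 4"
    unfolding F_def using \<mu> C(2)[OF t] by (intro add_mono cSUP_upper[OF t bdd[OF \<phi>(1) order_refl]] mult_left_mono power_mono) auto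
   finally show "Phi \<Omega> a \<gamma> \<mu> (\<phi> t) <= F 0 \<phi> + \<mu> * (C ^ 4 / 4)" by simp
  qed simp
  finally show ?thesis using \<phi>(2) by linarith
 qed
 with 1 show thesis by (rule that)
qed

lemma mp_level_tendsto:
 assumes e: "e \<in> H01 \<Omega>" and a: "0 < a" and \<gamma>: "2 < \<gamma>" and s: "s \<longlonglongrightarrow> 0" "!!n. 0 < s n"
 shows "(%n. mp_level \<Omega> a \<gamma> e (s n)) \<longlonglongrightarrow> mp_level \<Omega> a \<gamma> e 0"
proof (rule LIMSEQ_I)
 fix r :: real assume r: "0 < r"
 obtain C where C: "!!\<mu>. 0 <= \<mu> ==> mp_level \<Omega> a \<gamma> e 0 <= mp_level \<Omega> a \<gamma> e \<mu>"
  "!!\<mu>. 0 <= \<mu> ==> mp_level \<Omega> a \<gamma> e \<mu> <= mp_level \<Omega> a \<gamma> e 0 + r / 2 + \<mu> * C"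
  by (rule mp_level_near_0[OF e a \<gamma>, of "r / 2"]) (use r in auto)
 have "(%n. s n * C) \<longlonglongrightarrow> 0 * C" by (intro tendsto_mult s tendsto_const)
 then have "\<forall>\<^sub>F n in sequentially. s n * C < r / 2" by (rule order_tendstoD) (use r in simp)
 then obtain N where N: "!!n. n \<ge> N ==> s n * C < r / 2" by (auto simp: eventually_sequentially)
 have "norm (mp_level \<Omega> a \<gamma> e (s n) - mp_level \<Omega> a \<gamma> e 0) < r" if "n \<ge> N" for n
  using C(1)[of "s n"] C(2)[of "s n"] s(2)[of n] N[OF that] by simp
 then show "\<exists>no. \<forall>n\<ge>no. norm (mp_level \<Omega> a \<gamma> e (s n) - mp_level \<Omega> a \<gamma> e 0) < r" by blast
qed

end

section \<open>Critical points, their limits and the blow-up of minimizers\<close>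

context bounded_open3
begin

text \<open>Testing with \<open>w\<close> eliminates \<open>NL\<close> from the energy. The level
  then depends on the norm of \<open>w\<close> alone and converges together with it.\<close>

lemma critical_pointD:
 assumes \<gamma>: "2 < \<gamma>" "\<gamma> < 4" and cp: "critical_point \<Omega> (Phi \<Omega> a \<gamma> \<mu>) w"
 shows "w \<in> H01 \<Omega>" "!!v. v \<in> H01 \<Omega> ==> (a + \<mu> * (nrm w)^2) * B w v = TL \<gamma> w v"
  "Phi \<Omega> a \<gamma> \<mu> w = a / 2 * (nrm w)^2 + \<mu> / 4 * nrm w ^ 4
   - 1 / \<gamma> * ((a + \<mu> * (nrm w)^2) * (nrm w)^2)"
proof -
 note c = cp[unfolded critical_point_iff[OF \<gamma>] DPhi_def]
 show w: "w \<in> H01 \<Omega>" using c by simp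
 show eq: "(a + \<mu> * (nrm w)^2) * B w v = TL \<gamma> w v" if "v \<in> H01 \<Omega>" for v using c that by simp
 show "Phi \<Omega> a \<gamma> \<mu> w = a / 2 * (nrm w)^2 + \<mu> / 4 * nrm w ^ 4
   - 1 / \<gamma> * ((a + \<mu> * (nrm w)^2) * (nrm w)^2)"
  using eq[OF w] \<gamma> by (simp add: Phi_eq NL_eq_TL H01_norm_sq[symmetric])
qed

text \<open>Dividing the energy by the squared norm \<open>A\<close> shows that a positive level
  forces \<open>\<mu> * A <= m\<close>, so the coefficient \<open>\<kappa> = a + \<mu> * A\<close>
  lies between \<open>a\<close> and \<open>a + m\<close>. Rescaling removes this coefficient and
  leads to the equation covered by \<open>H1_bound\<close>.\<close>

lemma critical_norm_bound:
 assumes \<Omega>: "bounded_regular_domain \<Omega>" and \<gamma>: "2 < \<gamma>" "\<gamma> < 4" and a: "0 < a"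
 shows "\<exists>C. \<forall>\<mu> w. 0 <= \<mu> \<longrightarrow> critical_point \<Omega> (Phi \<Omega> a \<gamma> \<mu>) w \<longrightarrow> ae_positive \<Omega> w \<longrightarrow> 0 < Phi \<Omega> a \<gamma> \<mu> w \<longrightarrow> nrm w <= C"
proof -
 obtain C where C: "!!z. z \<in> H01 \<Omega> ==> ae_positive \<Omega> z ==> (!!v. v \<in> H01 \<Omega> ==> B z v = TL \<gamma> z v) ==> nrm z <= C"
  using H1_bound[OF \<Omega> \<gamma>] by blast
 define m where "m = a * (1 / 2 - 1 / \<gamma>) / (1 / \<gamma> - 1 / 4)"
 have \<gamma>': "0 < 1 / \<gamma> - 1 / 4" using \<gamma> by (simp add: field_simps)
 have "nrm w <= (a + m) powr (1 / (\<gamma> - 2)) * \<bar>C\<bar>"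
  if \<mu>: "0 <= \<mu>" and cp: "critical_point \<Omega> (Phi \<Omega> a \<gamma> \<mu>) w" and pos: "ae_positive \<Omega> w" and lev: "0 < Phi \<Omega> a \<gamma> \<mu> w" for \<mu> w
 proof -
  note c = critical_pointD[OF \<gamma> cp]
  define A where "A = (nrm w)^2"
  define \<kappa> where "\<kappa> = a + \<mu> * A"
  have A: "0 <= A" by (simp add: A_def)
  have \<kappa>: "0 < \<kappa>" using a \<mu> A by (simp add: \<kappa>_def add_pos_nonneg)
  have "nrm w ^ 4 = A * A" by (simp add: A_def power4_eq_xxxx power2_eq_square)
  then have "0 < A * (a * (1 / 2 - 1 / \<gamma>) - \<mu> * A * (1 / \<gamma> - 1 / 4))"
   using lev unfolding c(3) A_def[symmetric] by (simp add: algebra_simps)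
  then have "\<mu> * A * (1 / \<gamma> - 1 / 4) < a * (1 / 2 - 1 / \<gamma>)" using A by (simp add: zero_less_mult_iff)
  then have "\<mu> * A <= m" unfolding m_def using \<gamma>' by (simp only: pos_le_divide_eq less_imp_le)
  then have \<kappa>m: "\<kappa> <= a + m" by (simp add: \<kappa>_def)
  \<comment> \<open>Chosen so that \<open>k powr (\<gamma> - 2) * \<kappa> = 1\<close>, which is the
    condition for \<open>k * w\<close> to solve the equation with coefficient 1.\<close>
  define k where "k = \<kappa> powr (- 1 / (\<gamma> - 2))"
  have k: "0 < k" using \<kappa> by (simp add: k_def)
  have "- 1 / (\<gamma> - 2) * (\<gamma> - 2) = - 1" using \<gamma> by simp
  then have "k powr (\<gamma> - 2) = \<kappa> powr - 1" unfolding k_def powr_powr by simp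
  then have k1: "k powr (\<gamma> - 2) * \<kappa> = 1" using \<kappa> by (simp add: powr_minus)
  have kH: "(%x. k * w x) \<in> H01 \<Omega>" by (rule H01_cmult[OF c(1)])
  have "B (%x. k * w x) v = TL \<gamma> (%x. k * w x) v" if v: "v \<in> H01 \<Omega>" for v
  proof -
   have "spow (\<gamma> - 2) (k * s) = (k powr (\<gamma> - 2) * k) * spow (\<gamma> - 2) s" for s
    using k by (simp add: spow_def abs_mult powr_mult)
   then have "TL \<gamma> (%x. k * w x) v = (LINT x|M. (k powr (\<gamma> - 2) * k) * (spow (\<gamma> - 2) (w x) * v x))"
    unfolding TL_def by (simp add: mult.assoc)
   also have "\<dots> = (k powr (\<gamma> - 2) * k) * TL \<gamma> w v" unfolding TL_def by (rule integral_mult_right_zero)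
   also have "\<dots> = (k powr (\<gamma> - 2) * k) * (\<kappa> * B w v)" using c(2)[OF v] by (simp add: \<kappa>_def A_def)
   also have "\<dots> = (k powr (\<gamma> - 2) * \<kappa>) * (k * B w v)" by (simp only: mult_ac)
   also have "\<dots> = B (%x. k * w x) v" unfolding k1 B_cmult_left[OF c(1) v] by simp
   finally show ?thesis ..
  qed
  moreover have "ae_positive \<Omega> (%x. k * w x)" using pos unfolding ae_positive_def by eventually_elim (use k in simp)
  ultimately have "nrm (%x. k * w x) <= C" using C[OF kH] by blast
  then have kC: "k * nrm w <= \<bar>C\<bar>" using H01_norm_cmult[OF c(1), of k] k by simp
  have ik: "\<kappa> powr (1 / (\<gamma> - 2)) * k = 1" using \<kappa> by (simp add: k_def powr_add[symmetric] add_divide_distrib[symmetric])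
  have "nrm w = \<kappa> powr (1 / (\<gamma> - 2)) * (k * nrm w)" using ik by (simp add: mult.assoc[symmetric])
  also have "\<dots> <= (a + m) powr (1 / (\<gamma> - 2)) * \<bar>C\<bar>"
   using \<kappa> \<kappa>m \<gamma> k kC by (intro mult_mono powr_mono2) auto
  finally show ?thesis .
 qed
 then show ?thesis by blast
qed

text \<open>The equation bounds \<open>B (w n) v\<close> by a fixed multiple of the
  \<open>L2\<close> norm of \<open>v\<close>. With \<open>v\<close> a difference of two members, the
  \<open>L2\<close> Cauchy property from \<open>Rellich\<close> becomes a Cauchy property in the
  Dirichlet norm, and strong convergence passes to the equation and to the energy.\<close>

lemma critical_point_compactness:
 assumes \<Omega>: "bounded_regular_domain \<Omega>" and \<gamma>: "2 < \<gamma>" "\<gamma> < 4" and a: "0 < a"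
  and \<mu>: "!!n. 0 <= \<mu> n" "\<mu> \<longlonglongrightarrow> 0" and cp: "!!n. critical_point \<Omega> (Phi \<Omega> a \<gamma> (\<mu> n)) (w n)"
  and pos: "!!n. ae_positive \<Omega> (w n)" "!!n. 0 < Phi \<Omega> a \<gamma> (\<mu> n) (w n)" and lev: "(%n. Phi \<Omega> a \<gamma> (\<mu> n) (w n)) \<longlonglongrightarrow> c"
 obtains r w0 where "strict_mono (r :: nat \<Rightarrow> nat)" "critical_point \<Omega> (Phi \<Omega> a \<gamma> 0) w0" "Phi \<Omega> a \<gamma> 0 w0 = c"
  "(%n. nrm (%x. w (r n) x - w0 x)) \<longlonglongrightarrow> 0"
proof -
 let ?N = "nrm"
 note wH = critical_pointD(1)[OF \<gamma> cp] and weq = critical_pointD(2)[OF \<gamma> cp] and wPhi = critical_pointD(3)[OF \<gamma> cp]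
 obtain C where C: "!!n. ?N (w n) <= C" using critical_norm_bound[OF \<Omega> \<gamma> a] \<mu>(1) cp pos by blast
 obtain r where r: "strict_mono (r :: nat \<Rightarrow> nat)" and Cau: "!!e. e > 0 ==> \<exists>N. \<forall>i\<ge>N. \<forall>j\<ge>N. n2 M (%x. w (r i) x - w (r j) x) < e"
  by (rule Rellich[of w, OF wH C], rule that)
 obtain Q where Q: "0 <= Q" "!!u. u \<in> H01 \<Omega> ==> ?N u <= C ==> n2 M (%x. spow (\<gamma> - 2) (u x)) <= Q"
  by (rule n2_spow_bound[OF \<gamma>], rule that)
 \<comment> \<open>The Kirchhoff coefficient is at least \<open>a\<close>, so dividing by it costs
   at most \<open>1 / a\<close> whatever the parameter.\<close>
 have Bb: "\<bar>B (w n) v\<bar> <= Q / a * n2 M v" if v: "v \<in> H01 \<Omega>" for n v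
 proof -
  have "\<bar>TL \<gamma> (w n) v\<bar> <= n2 M (%x. spow (\<gamma> - 2) (w n x)) * n2 M v"
   unfolding TL_def by (rule L2_Cauchy_Schwarz_real[OF L2_spow[OF wH \<gamma>] H01_L2(1)[OF v]])
  also have "\<dots> <= Q * n2 M v" by (intro mult_right_mono Q(2) wH C) simp
  finally have t: "\<bar>TL \<gamma> (w n) v\<bar> <= Q * n2 M v" .
  have "a * \<bar>B (w n) v\<bar> <= (a + \<mu> n * (?N (w n))^2) * \<bar>B (w n) v\<bar>" using \<mu>(1)[of n] by (intro mult_right_mono) auto
  also have "\<dots> = \<bar>TL \<gamma> (w n) v\<bar>"
  proof -
   have "0 <= a + \<mu> n * (?N (w n))^2" using a \<mu>(1)[of n] by (intro add_nonneg_nonneg) auto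
   then show ?thesis unfolding weq[OF v, symmetric] abs_mult by simp
  qed
  finally show ?thesis using t a by (simp add: field_simps)
 qed
 have sq: "(?N (%x. w i x - w j x))^2 <= 2 * Q / a * n2 M (%x. w i x - w j x)" for i j
 proof -
  have d: "(%x. w i x - w j x) \<in> H01 \<Omega>" by (rule H01_diff[OF wH wH])
  show ?thesis unfolding H01_norm_sq B_diff_left[OF wH wH d] using Bb[OF d, of i] Bb[OF d, of j] by simp
 qed
 have "\<exists>N. \<forall>i\<ge>N. \<forall>j\<ge>N. ?N (%x. w (r i) x - w (r j) x) < e" if e: "e > 0" for e
 proof -
  have "0 < e^2 / (2 * Q / a + 1)" using e Q(1) a by (intro divide_pos_pos) (auto intro: add_nonneg_pos)
  from Cau[OF this] obtain N where N: "!!i j. i \<ge> N ==> j \<ge> N ==> n2 M (%x. w (r i) x - w (r j) x) < e^2 / (2 * Q / a + 1)" by blast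
  have "?N (%x. w (r i) x - w (r j) x) < e" if ij: "i \<ge> N" "j \<ge> N" for i j
  proof -
   have q: "0 < 2 * Q / a + 1" using Q(1) a by (intro add_nonneg_pos) auto
   have "(?N (%x. w (r i) x - w (r j) x))^2 <= (2 * Q / a + 1) * n2 M (%x. w (r i) x - w (r j) x)"
    using sq[of "r i" "r j"] n2_nonneg[of M "%x. w (r i) x - w (r j) x"] unfolding distrib_right by linarith
   also have "\<dots> < e^2" using N[OF ij] q by (simp add: pos_less_divide_eq mult.commute)
   finally show ?thesis by (rule power2_less_imp_less) (use e in simp)
  qed
  then show ?thesis by blast
 qed
 then obtain w0 where w0: "w0 \<in> H01 \<Omega>" and lim: "(%n. ?N (%x. w (r n) x - w0 x)) \<longlonglongrightarrow> 0"
  by (rule H01_complete[of "%n. w (r n)", OF wH]) blast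
 have lim': "(%n. ?N (%x. w0 x - w (r n) x)) \<longlonglongrightarrow> 0" using lim by (simp add: H01_norm_commute[OF w0 wH])
 have Nl: "(%n. ?N (w (r n))) \<longlonglongrightarrow> ?N w0" by (rule H01_norm_tendsto[OF wH w0 lim'])
 have \<mu>r: "(%n. \<mu> (r n)) \<longlonglongrightarrow> 0" using LIMSEQ_subseq_LIMSEQ[OF \<mu>(2) r] by (simp add: comp_def)
 have crit: "a * B w0 v = TL \<gamma> w0 v" if v: "v \<in> H01 \<Omega>" for v
 proof -
  obtain K where K: "!!u w. u \<in> H01 \<Omega> ==> w \<in> H01 \<Omega> ==>
    \<bar>TL \<gamma> u v - TL \<gamma> w v\<bar> <= K * (1 + (?N u)^2 + (?N w)^2) * ?N (%x. u x - w x) * ?N v"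
   using TL_Lipschitz[OF \<gamma>] v by blast
  have "(%n. K * (1 + (?N (w (r n)))^2 + (?N w0)^2) * ?N (%x. w (r n) x - w0 x) * ?N v)
    \<longlonglongrightarrow> K * (1 + (?N w0)^2 + (?N w0)^2) * 0 * ?N v"
   by (intro tendsto_mult tendsto_add tendsto_const tendsto_power Nl lim)
  then have K0: "(%n. K * (1 + (?N (w (r n)))^2 + (?N w0)^2) * ?N (%x. w (r n) x - w0 x) * ?N v) \<longlonglongrightarrow> 0" by simp
  have "(%n. TL \<gamma> (w (r n)) v - TL \<gamma> w0 v) \<longlonglongrightarrow> 0"
   by (rule Lim_null_comparison[OF always_eventually K0]) (use K[OF wH w0] in simp)
  then have "(%n. TL \<gamma> (w (r n)) v) \<longlonglongrightarrow> TL \<gamma> w0 v" by (rule LIM_zero_cancel)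
  moreover have "(%n. (a + \<mu> (r n) * (?N (w (r n)))^2) * B (w (r n)) v) \<longlonglongrightarrow> (a + 0 * (?N w0)^2) * B w0 v"
   by (intro tendsto_mult tendsto_add tendsto_const tendsto_power Nl \<mu>r B_tendsto[OF wH w0 v lim'])
  ultimately show ?thesis using LIMSEQ_unique unfolding weq[OF v] by fastforce
 qed
 have cp0: "critical_point \<Omega> (Phi \<Omega> a \<gamma> 0) w0" unfolding critical_point_iff[OF \<gamma>] DPhi_def using w0 crit by simp
 have "(%n. Phi \<Omega> a \<gamma> (\<mu> (r n)) (w (r n))) \<longlonglongrightarrow> a / 2 * (?N w0)^2 + 0 / 4 * ?N w0 ^ 4 - 1 / \<gamma> * ((a + 0 * (?N w0)^2) * (?N w0)^2)"
  unfolding wPhi by (intro tendsto_intros Nl \<mu>r) simp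
 then have "(%n. Phi \<Omega> a \<gamma> (\<mu> (r n)) (w (r n))) \<longlonglongrightarrow> Phi \<Omega> a \<gamma> 0 w0" unfolding critical_pointD(3)[OF \<gamma> cp0] .
 moreover have "(%n. Phi \<Omega> a \<gamma> (\<mu> (r n)) (w (r n))) \<longlonglongrightarrow> c" using LIMSEQ_subseq_LIMSEQ[OF lev r] by (simp add: comp_def)
 ultimately have "Phi \<Omega> a \<gamma> 0 w0 = c" by (rule LIMSEQ_unique)
 then show thesis using that[OF r cp0 _ lim] by simp
qed

lemma minimizer_blow_up:
 assumes \<gamma>: "2 < \<gamma>" "\<gamma> < 4" and a: "0 < a" and L: "0 < L" and e: "e \<in> H01 \<Omega>" "\<not> ae_eq \<Omega> e (%_. 0)"
  and u: "!!\<mu>. \<mu> \<in> {0<..L} ==> positive_global_minimizer \<Omega> (Phi \<Omega> a \<gamma> \<mu>) (u \<mu>)"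
 shows "filterlim (%\<mu>. Phi \<Omega> a \<gamma> \<mu> (u \<mu>)) at_bot (at_right 0)" "filterlim (%\<mu>. nrm (u \<mu>)) at_top (at_right 0)"
proof -
 have g0: "\<gamma> \<noteq> 0" using \<gamma> by simp
 have uH: "u \<mu> \<in> H01 \<Omega>" and umin: "v \<in> H01 \<Omega> ==> Phi \<Omega> a \<gamma> \<mu> (u \<mu>) <= Phi \<Omega> a \<gamma> \<mu> v" if "\<mu> \<in> {0<..L}" for \<mu> v
  using u[OF that] by (auto simp: positive_global_minimizer_def)
 have small: "\<forall>\<^sub>F \<mu> in at_right 0. \<mu> \<in> {0<..L}"
  using eventually_at_right_less[of "0 :: real"] eventually_at_right[OF L] L by (auto simp: eventually_at_right_field intro!: exI[of _ L])
 have low: "\<forall>\<^sub>F \<mu> in at_right 0. Phi \<Omega> a \<gamma> \<mu> (u \<mu>) <= Y" for Y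
 proof -
  define A where "A = a / 2 * (nrm e)^2"
  define D where "D = NL \<gamma> e / \<gamma>"
  have A: "0 < A" "0 < D" using a \<gamma> nonzero_H01[of \<gamma> e] e by (auto simp: A_def D_def)
  have "filterlim (%t. A * t^2 - D * t powr \<gamma>) at_bot at_top" using A \<gamma> by real_asymp
  then have "\<forall>\<^sub>F t in at_top. A * t^2 - D * t powr \<gamma> <= Y - 1" by (simp add: filterlim_at_bot)
  then have "\<forall>\<^sub>F t in at_top. A * t^2 - D * t powr \<gamma> <= Y - 1 \<and> 0 <= t" using eventually_ge_at_top[of 0] by (rule eventually_conj)
  then obtain t where t: "A * t^2 - D * t powr \<gamma> <= Y - 1" "0 <= t" using eventually_happens'[OF trivial_limit_at_top_linorder] by blast
  define E where "E = (t * nrm e) ^ 4 / 4"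
  have "((%\<mu>. \<mu> * E) \<longlongrightarrow> 0 * E) (at_right 0)" by (intro tendsto_mult tendsto_const tendsto_ident_at)
  then have "\<forall>\<^sub>F \<mu> in at_right 0. \<mu> * E < 1" by (rule order_tendstoD) simp
  with small show ?thesis
  proof eventually_elim
   case (elim \<mu>)
   have "Phi \<Omega> a \<gamma> \<mu> (u \<mu>) <= Phi \<Omega> a \<gamma> \<mu> (%x. t * e x)" by (rule umin[OF elim(1) H01_cmult[OF e(1)]])
   also have "\<dots> = (A * t^2 - D * t powr \<gamma>) + \<mu> * E"
    unfolding Phi_eq[OF g0] H01_norm_cmult[OF e(1)] NL_cmult using t(2) by (simp add: A_def D_def E_def power_mult_distrib mult_ac)
   finally show ?case using t(1) elim(2) by linarith
  qed
 qed
 then show "filterlim (%\<mu>. Phi \<Omega> a \<gamma> \<mu> (u \<mu>)) at_bot (at_right 0)" by (simp add: filterlim_at_bot)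
 obtain S where S: "0 < S" "!!u. u \<in> H01 \<Omega> ==> NL \<gamma> u <= S * nrm u powr \<gamma>" using NL_bound[of \<gamma>] \<gamma> by auto
 show "filterlim (%\<mu>. nrm (u \<mu>)) at_top (at_right 0)"
  unfolding filterlim_at_top
 proof
  fix Y :: real
  \<comment> \<open>The energy is taken below minus
    \<open>S / \<gamma> * \<bar>Y\<bar> powr \<gamma>\<close>. Dropping the nonnegative quadratic
    and quartic terms and using the Sobolev bound for \<open>NL\<close> then excludes norms smaller
    than \<open>Y\<close>.\<close>
  show "\<forall>\<^sub>F \<mu> in at_right 0. Y <= nrm (u \<mu>)"
   using small low[of "- (S / \<gamma> * \<bar>Y\<bar> powr \<gamma>) - 1"]
  proof eventually_elim
   case (elim \<mu>)
   let ?n = "nrm (u \<mu>)"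
   have "0 <= a / 2 * ?n^2 + \<mu> / 4 * ?n ^ 4" using a elim(1) by simp
   then have "- (1 / \<gamma> * NL \<gamma> (u \<mu>)) <= - (S / \<gamma> * \<bar>Y\<bar> powr \<gamma>) - 1" using elim(2) unfolding Phi_eq[OF g0] by linarith
   moreover have "1 / \<gamma> * NL \<gamma> (u \<mu>) <= 1 / \<gamma> * (S * ?n powr \<gamma>)" using S(2)[OF uH[OF elim(1)]] \<gamma> by (intro mult_left_mono) auto
   ultimately have lt: "S / \<gamma> * \<bar>Y\<bar> powr \<gamma> < S / \<gamma> * ?n powr \<gamma>" by simp
   show "Y <= ?n"
   proof (rule ccontr)
    assume "\<not> Y <= ?n"
    then have "?n powr \<gamma> <= \<bar>Y\<bar> powr \<gamma>" using \<gamma> by (intro powr_mono2) auto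
    then have "S / \<gamma> * ?n powr \<gamma> <= S / \<gamma> * \<bar>Y\<bar> powr \<gamma>" using S(1) \<gamma> by (intro mult_left_mono) auto
    then show False using lt by simp
   qed
  qed
 qed
qed

end

text \<open>Convergence in ii) is expressed through subsequences because the compactness argument
  singles out no particular limit: \<open>w0\<close> may depend on the sequence of parameters. The
  level of \<open>w0\<close> is that of the limiting functional for the same endpoint
  \<open>u L\<close>.\<close>

theorem theorem1p2:
  fixes \<Omega> :: "(real^3) set" and a \<gamma> L :: real
    and u w :: "real \<Rightarrow> real^3 \<Rightarrow> real"
  assumes "L = lam0_star \<Omega> a \<gamma>" and "bounded_regular_domain \<Omega>" and "a > 0" and "2 < \<gamma>" and "\<gamma> < 4"
    and "\<And>\<mu>. \<mu> \<in> {0<..L} \<Longrightarrow> positive_global_minimizer \<Omega> (Phi \<Omega> a \<gamma> \<mu>) (u \<mu>)"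
    and "\<And>\<mu>. \<mu> \<in> {0<..<L} \<Longrightarrow> Phi \<Omega> a \<gamma> \<mu> (u \<mu>) < 0"
    and "Phi \<Omega> a \<gamma> L (u L) = 0" and "\<not> ae_eq \<Omega> (u L) (\<lambda>_. 0)"
    and "\<And>\<mu>. \<mu> \<in> {0<..<L} \<Longrightarrow> mp_critical_point \<Omega> a \<gamma> (u L) \<mu> (w \<mu>)"
    and "\<And>\<mu>. \<mu> \<in> {0<..<L} \<Longrightarrow> ae_positive \<Omega> (w \<mu>)"
    and "\<And>\<mu>. \<mu> \<in> {0<..<L} \<Longrightarrow> mp_level \<Omega> a \<gamma> (u L) \<mu> > 0"
  shows "filterlim (\<lambda>\<mu>. Phi \<Omega> a \<gamma> \<mu> (u \<mu>)) at_bot (at_right 0) \<and>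
    filterlim (\<lambda>\<mu>. H01_norm \<Omega> (u \<mu>)) at_top (at_right 0) \<and>
    (\<forall>s. (\<forall>n. s n \<in> {0<..<L}) \<and> s \<longlonglongrightarrow> 0 \<longrightarrow>
      (\<exists>r w0. strict_mono (r :: nat \<Rightarrow> nat) \<and> mp_critical_point \<Omega> a \<gamma> (u L) 0 w0 \<and>
        (\<lambda>n. H01_norm \<Omega> (\<lambda>x. w (s (r n)) x - w0 x)) \<longlonglongrightarrow> 0))"
proof -
 interpret bounded_open3 \<Omega>
  using assms(2) by unfold_locales (auto simp: bounded_regular_domain_def)
 have L: "0 < L" unfolding assms(1) using assms(2-5) by (intro lam0_star_pos) (auto simp: bounded_regular_domain_def)
 have e: "u L \<in> H01 \<Omega>" using assms(6)[of L] L by (simp add: positive_global_minimizer_def)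
 note blow_up = minimizer_blow_up[OF assms(4,5,3) L e assms(9,6)]
 have "\<exists>r w0. strict_mono (r :: nat \<Rightarrow> nat) \<and> mp_critical_point \<Omega> a \<gamma> (u L) 0 w0 \<and>
    (%n. H01_norm \<Omega> (%x. w (s (r n)) x - w0 x)) \<longlonglongrightarrow> 0" if s: "!!n. s n \<in> {0<..<L}" "s \<longlonglongrightarrow> 0" for s
 proof -
  have s0: "0 < s n" for n using s(1)[of n] by simp
  have cp: "critical_point \<Omega> (Phi \<Omega> a \<gamma> (s n)) (w (s n))" and lv: "Phi \<Omega> a \<gamma> (s n) (w (s n)) = mp_level \<Omega> a \<gamma> (u L) (s n)" for n
   using assms(10)[OF s(1)] by (auto simp: mp_critical_point_def)
  have lim: "(%n. Phi \<Omega> a \<gamma> (s n) (w (s n))) \<longlonglongrightarrow> mp_level \<Omega> a \<gamma> (u L) 0"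
   unfolding lv by (rule mp_level_tendsto[OF e assms(3,4) s(2) s0])
  have pos: "0 < Phi \<Omega> a \<gamma> (s n) (w (s n))" for n unfolding lv by (rule assms(12)[OF s(1)])
  obtain r w0 where "strict_mono (r :: nat \<Rightarrow> nat)" "critical_point \<Omega> (Phi \<Omega> a \<gamma> 0) w0" "Phi \<Omega> a \<gamma> 0 w0 = mp_level \<Omega> a \<gamma> (u L) 0"
   "(%n. H01_norm \<Omega> (%x. w (s (r n)) x - w0 x)) \<longlonglongrightarrow> 0"
   by (rule critical_point_compactness[OF assms(2,4,5,3) less_imp_le[OF s0] s(2) cp assms(11)[OF s(1)] pos lim])
  then show ?thesis unfolding mp_critical_point_def by blast
 qed
 then show ?thesis using blow_up by blast
qed

end
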